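(* There is an absolute constant $\varepsilon_*\in(0,1/2)$ such that the following holds. Let $1<p<2$. There exists a constant $C$ depending only on $p$ such that for every $\varepsilon\in(0,\varepsilon_* )$ and every integer $L\ge 1$ for which the set $E=E_1\cup E_2\subset\mathbb{R}^2$ determined by $\varepsilon$ and $L$ (defined in the context) satisfies: $(x,0)\in E_1$ whenever $(x,\Delta)\in E_2$, there exists a linear map $T:L^{2,p}(E)\to L^{2,p}(\mathbb{R}^2)$ (which may depend on $p$, $\varepsilon$, $L$) with $(Tf)|_E=f$ for all $f\in L^{2,p}(E)$ and $$\|Tf\|_{L^{2,p}(\mathbb{R}^2)}\le C\,\|f\|_{L^{2,p}(E)}\quad\text{for all } f\in L^{2,p}(E).$$
   Context: For $1<p<2$, $L^{2,p}(\mathbb{R}^2)$ is the homogeneous Sobolev space of functions $F:\mathbb{R}^2\to\mathbb{R}$ whose distributional second-order partial derivatives belong to $L^p(\mathbb{R}^2)$, with seminorm $\|F\|_{L^{2,p}(\mathbb{R}^2)}=\|\nabla^2F\|_{L^p(\mathbb{R}^2)}$. Since $p>1$, such functions are continuous (after modification on a null set), and are always identified with their continuous representatives. For $\Omega\subset\mathbb{R}^2$ and a continuous function $f:\Omega\to\mathbb{R}$, the trace seminorm is $\|f\|_{L^{2,p}(\Omega)}=\inf\{\|F\|_{L^{2,p}(\mathbb{R}^2)}: F\in L^{2,p}(\mathbb{R}^2),\ F|_\Omega=f\}$, and the trace space $L^{2,p}(\Omega)$ is the space of continuous $f:\Omega\to\mathbb{R}$ with finite trace seminorm. This is the meaning of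 $L^{2,p}(E)$. Given $\varepsilon\in(0,1/2)$ and an integer $L\ge1$, set $\Delta=\varepsilon^L$ and $E=E_1\cup E_2$, where $$E_1=\big((\Delta\mathbb{Z})\cap[-1,1]\big)\times\{0\},\qquad E_2=\Big\{(z,\Delta): z=\sum_{\ell=1}^L s_\ell\varepsilon^\ell,\ s_\ell\in\{-1,+1\}\Big\}.$$ (The condition that $(x,0)\in E_1$ whenever $(x,\Delta)\in E_2$ holds for instance when $\varepsilon=1/N$ with $N$ a positive integer.) *)

theory Defs
  imports "HOL-Analysis.Analysis"
begin

type_synonym plane = "real \<times> real"

definition partial :: "plane \<Rightarrow> (plane \<Rightarrow> real) \<Rightarrow> plane \<Rightarrow> real" where
  "partial b f = (\<lambda>x. frechet_derivative f (at x) b)"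

(* C^infinity: all iterated partial derivatives exist and are differentiable everywhere
   (hence continuous). *)
definition smooth :: "(plane \<Rightarrow> real) \<Rightarrow> bool" where
  "smooth f \<longleftrightarrow>
     (\<forall>bs. set bs \<subseteq> Basis \<longrightarrow> (\<forall>x. foldr partial bs f differentiable (at x)))"

definition test_functions :: "(plane \<Rightarrow> real) set" where
  "test_functions = {\<phi>. smooth \<phi> \<and> compact (closure {x. \<phi> x \<noteq> 0})}"

definition locally_integrable :: "(plane \<Rightarrow> real) \<Rightarrow> bool" where
  "locally_integrable g \<longleftrightarrow>
     g \<in> borel_measurable lborel \<and> (\<forall>K. compact K \<longrightarrow> set_integrable lborel K g)"

(* g represents the distributional derivative of F in the coordinate directions i and j;
   the two integrations by parts contribute the sign (-1)^2 = 1. *)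
definition is_weak_partial2 ::
    "plane \<Rightarrow> plane \<Rightarrow> (plane \<Rightarrow> real) \<Rightarrow> (plane \<Rightarrow> real) \<Rightarrow> bool" where
  "is_weak_partial2 i j F g \<longleftrightarrow>
     locally_integrable g \<and>
     (\<forall>\<phi>\<in>test_functions.
        (\<integral>x. F x * partial i (partial j \<phi>) x \<partial>lborel) = (\<integral>x. g x * \<phi> x \<partial>lborel))"

(* Such a g is unique up to a null set, so the choice does not affect any integral below. *)
definition weak_partial2 :: "plane \<Rightarrow> plane \<Rightarrow> (plane \<Rightarrow> real) \<Rightarrow> plane \<Rightarrow> real" where
  "weak_partial2 i j F = (SOME g. is_weak_partial2 i j F g)"

definition in_Lp :: "real \<Rightarrow> (plane \<Rightarrow> real) \<Rightarrow> bool" where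
  "in_Lp p g \<longleftrightarrow> g \<in> borel_measurable lborel \<and> integrable lborel (\<lambda>x. \<bar>g x\<bar> powr p)"

definition Lp_norm :: "real \<Rightarrow> (plane \<Rightarrow> real) \<Rightarrow> real" where
  "Lp_norm p g = (\<integral>x. \<bar>g x\<bar> powr p \<partial>lborel) powr (1 / p)"

(* The homogeneous Sobolev space, each element being given by its continuous representative. *)
definition L2p :: "real \<Rightarrow> (plane \<Rightarrow> real) set" where
  "L2p p = {F. continuous_on UNIV F \<and>
     (\<forall>i\<in>Basis. \<forall>j\<in>Basis. \<exists>g. is_weak_partial2 i j F g \<and> in_Lp p g)}"

(* |nabla^2 F| is the Hilbert-Schmidt norm of the Hessian. *)
definition L2p_seminorm :: "real \<Rightarrow> (plane \<Rightarrow> real) \<Rightarrow> real" where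
  "L2p_seminorm p F =
     Lp_norm p (\<lambda>x. sqrt (\<Sum>i\<in>Basis. \<Sum>j\<in>Basis. (weak_partial2 i j F x)\<^sup>2))"

(* The infimum over the empty set is infinity. *)
definition trace_seminorm :: "real \<Rightarrow> plane set \<Rightarrow> (plane \<Rightarrow> real) \<Rightarrow> ennreal" where
  "trace_seminorm p \<Omega> f =
     (INF F\<in>{F \<in> L2p p. \<forall>x\<in>\<Omega>. F x = f x}. ennreal (L2p_seminorm p F))"

(* A function on Omega is represented by its extension by 0 to the plane, so that functions
   on Omega correspond one-to-one, and linearly, to functions vanishing off Omega. *)
definition trace_space :: "real \<Rightarrow> plane set \<Rightarrow> (plane \<Rightarrow> real) set" where
  "trace_space p \<Omega> =
     {f. (\<forall>x. x \<notin> \<Omega> \<longrightarrow> f x = 0) \<and> continuous_on \<Omega> f \<and> trace_seminorm p \<Omega> f < \<infinity>}"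

definition linear_map ::
    "(plane \<Rightarrow> real) set \<Rightarrow> (plane \<Rightarrow> real) set \<Rightarrow> ((plane \<Rightarrow> real) \<Rightarrow> plane \<Rightarrow> real) \<Rightarrow> bool" where
  "linear_map V W T \<longleftrightarrow>
     (\<forall>f\<in>V. T f \<in> W) \<and>
     (\<forall>f\<in>V. \<forall>g\<in>V. T (\<lambda>x. f x + g x) = (\<lambda>x. T f x + T g x)) \<and>
     (\<forall>c. \<forall>f\<in>V. T (\<lambda>x. c * f x) = (\<lambda>x. c * T f x))"

definition E1 :: "real \<Rightarrow> nat \<Rightarrow> plane set" where
  "E1 \<epsilon> L = {x. (\<exists>k::int. x = \<epsilon> ^ L * of_int k) \<and> -1 \<le> x \<and> x \<le> 1} \<times> {0}"

definition E2 :: "real \<Rightarrow> nat \<Rightarrow> plane set" where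
  "E2 \<epsilon> L = {(z, \<epsilon> ^ L) | z.
     \<exists>s :: nat \<Rightarrow> real. (\<forall>l\<in>{1..L}. s l \<in> {-1, 1}) \<and> z = (\<Sum>l=1..L. s l * \<epsilon> ^ l)}"

end

theory Submission
  imports Defs
begin

text \<open>
  After scaling by \<open>\<Delta>\<close>, the set \<open>E\<close> lies in the lattice \<open>\<int>\<^sup>2\<close>. Sampling an \<open>L\<^sup>2\<^sup>,\<^sup>p\<close> function on the lattice, and
  interpolating a lattice function by a smooth kernel that reproduces affine functions, both respect the \<open>p\<close>-energy
  \<open>\<Sum> \<bar>D\<^sup>2H\<bar>\<^sup>p\<close> of second differences up to the same power of \<open>\<Delta>\<close>. So it suffices to extend lattice functions linearly
  with an energy comparable to the minimal one.

  The values on the bottom row are extended by symmetric averages over a length proportional to the height; the cost is the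
  Gagliardo seminorm of the differences along the row, which the trace inequality bounds by the energy of any extension.
  Next to the bottom row, what remains to be prescribed on \<open>E\<^sub>2\<close> is a vertical slope at every leaf of a binary tree of
  clusters. If a function with small energy takes these values, then its vertical differences, averaged at the scale of each
  cluster, define slopes at the inner nodes, and the jump between a node of level \<open>l\<close> and its parent costs the power \<open>2 - p\<close>
  of the scale \<open>R\<^sub>l\<close>. Conversely slopes at the nodes are realised by cutoffs around the clusters at the same cost. The
  minimisation over the slopes at the inner nodes is a problem on a weighted tree, and it is solved up to a constant by a
  linear formula, in which each martingale difference of the leaf data is distributed over the levels below it in
  proportion to the dual weights \<open>(2 ^ l * R\<^sub>l powr (2 - p)) powr (- 1 / (p - 1))\<close>; a Schur test for the resulting kernel gives the bound.
\<close>

subsection \<open>Weighted power sums and Hardy inequalities\<close>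

text \<open>The constant may depend neither on the number of levels nor on \<epsilon>, so no
  estimate may be summed over the levels with overlap. Each scale gets a region of its own: the
  comparison of a node with its parent uses only rows between their two radii, and the Hessian of a
  cutoff lives on an annulus around its cluster. The threshold 1/100 makes these regions disjoint,
  with room for the stencils of second differences; then p-th powers simply add. Linearity is the
  other obstacle: a minimiser of a p-energy is in general not linear in the data. On the row,
  averages replace it; on the tree, the loss is the norm of a Hardy operator, bounded uniformly in
  the weights because only partial sums of the dual weights enter its kernel. Passing to the plane
  shapes two more choices. An interpolation sum is finite, so each extension is kept as an affine
  function, which costs nothing, plus a compactly supported rest. And the seminorm uses chosen weak
  derivatives, so their uniqueness almost everywhere must be known before the norm of a constructed
  function can be estimated.\<close>

lemma powr_ge_tangent:
  fixes y t p :: real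
  assumes "1 \<le> p" "0 \<le> y" "0 < t"
  shows "t powr p + p * t powr (p - 1) * (y - t) \<le> y powr p"
proof (cases "p = 1")
  case True
  then show ?thesis using assms by simp
next
  case False
  then have p: "1 < p" using assms by simp
  \<comment> \<open>Young's inequality for y and t powr (p - 1) is the tangent inequality in
    disguise; no derivative at y = 0 is involved.\<close>
  define q where "q = p / (p - 1)"
  have q: "1 < q" "1 / p + 1 / q = 1" using p by (auto simp: q_def field_simps)
  have "y * t powr (p - 1) \<le> y powr p / p + (t powr (p - 1)) powr q / q"
    using Youngs_inequality[of p q y "t powr (p - 1)"] p q assms by auto
  also have "(t powr (p - 1)) powr q = t powr p"
    using p by (simp add: powr_powr q_def)
  also have "t powr p / q = t powr p * (p - 1) / p" by (simp add: q_def)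
  finally have "p * (y * t powr (p - 1)) \<le> y powr p + t powr p * (p - 1)"
    using p by (simp add: field_simps)
  moreover have "t powr p = t powr (p - 1) * t" using assms by (simp add: powr_diff)
  ultimately show ?thesis by (simp add: algebra_simps)
qed

text \<open>Hoelder's inequality with free weights: the tangent inequalities at the common point
  \<open>t = X / S\<close> are summed with weights \<open>c k\<close>, and for this t the linear
  terms cancel. The choice of the weights is the whole content of the Schur test and of the chain
  estimate below.\<close>

lemma powr_sum_weighted:
  fixes c x :: "'a \<Rightarrow> real"
  assumes A: "finite A" and c: "\<And>k. k \<in> A \<Longrightarrow> 0 < c k" and p: "1 \<le> p"
  shows "\<bar>\<Sum>k\<in>A. x k\<bar> powr p \<le> (\<Sum>k\<in>A. c k) powr (p - 1) * (\<Sum>k\<in>A. c k powr (1 - p) * \<bar>x k\<bar> powr p)"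
proof (cases "(\<Sum>k\<in>A. \<bar>x k\<bar>) = 0")
  case True
  then have "(\<Sum>k\<in>A. x k) = 0" using A by (auto simp: sum_nonneg_eq_0_iff intro: sum.neutral)
  then show ?thesis by (simp add: sum_nonneg)
next
  case False
  define X where "X = (\<Sum>k\<in>A. \<bar>x k\<bar>)"
  have X: "0 < X" using False unfolding X_def by (simp add: order_less_le sum_nonneg)
  define S where "S = (\<Sum>k\<in>A. c k)"
  have "A \<noteq> {}" using False by auto
  then have S: "0 < S" unfolding S_def using A c by (intro sum_pos) auto
  define t where "t = X / S"
  have t: "0 < t" using X S by (simp add: t_def)
  have *: "c k * t powr p + p * t powr (p - 1) * (\<bar>x k\<bar> - c k * t) \<le> c k powr (1 - p) * \<bar>x k\<bar> powr p" if "k \<in> A" for k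
  proof -
    have ck: "0 < c k" using c that by simp
    have "c k * (t powr p + p * t powr (p - 1) * (\<bar>x k\<bar> / c k - t)) \<le> c k * (\<bar>x k\<bar> / c k) powr p"
      using powr_ge_tangent[OF p _ t, of "\<bar>x k\<bar> / c k"] ck by (intro mult_left_mono) auto
    also have "c k * (\<bar>x k\<bar> / c k) powr p = c k powr (1 - p) * \<bar>x k\<bar> powr p"
      using ck by (simp add: powr_divide powr_diff)
    finally have "c k * (t powr p + p * t powr (p - 1) * (\<bar>x k\<bar> / c k - t)) \<le> c k powr (1 - p) * \<bar>x k\<bar> powr p" .
    moreover have "c k * (t powr p + p * t powr (p - 1) * (\<bar>x k\<bar> / c k - t)) = c k * t powr p + p * t powr (p - 1) * (c k * (\<bar>x k\<bar> / c k) - c k * t)"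
      by (simp only: algebra_simps)
    moreover have "c k * (\<bar>x k\<bar> / c k) = \<bar>x k\<bar>" using ck by simp
    ultimately show ?thesis by simp
  qed
  have "S * t powr p = (\<Sum>k\<in>A. c k * t powr p + p * t powr (p - 1) * (\<bar>x k\<bar> - c k * t))"
  proof -
    have "(\<Sum>k\<in>A. c k * t powr p + p * t powr (p - 1) * (\<bar>x k\<bar> - c k * t)) = S * t powr p + p * t powr (p - 1) * (X - S * t)"
      by (simp add: sum.distrib sum_distrib_left[symmetric] sum_distrib_right[symmetric] sum_subtractf X_def S_def)
    moreover have "X - S * t = 0" using S by (simp add: t_def)
    ultimately show ?thesis by simp
  qed
  also have "\<dots> \<le> (\<Sum>k\<in>A. c k powr (1 - p) * \<bar>x k\<bar> powr p)" by (rule sum_mono) (rule *)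
  finally have "S powr (p - 1) * (S * t powr p) \<le> S powr (p - 1) * (\<Sum>k\<in>A. c k powr (1 - p) * \<bar>x k\<bar> powr p)"
    by (intro mult_left_mono) auto
  moreover have "S powr (p - 1) * (S * t powr p) = X powr p"
    using S X by (simp add: t_def powr_divide powr_diff)
  moreover have "\<bar>\<Sum>k\<in>A. x k\<bar> powr p \<le> X powr p"
    unfolding X_def using p by (intro powr_mono2 sum_abs) auto
  ultimately show ?thesis by (simp add: S_def)
qed

lemma powr_sum_le:
  fixes x :: "'a \<Rightarrow> real"
  assumes "finite A" and p: "1 \<le> p"
  shows "\<bar>\<Sum>k\<in>A. x k\<bar> powr p \<le> real (card A) powr (p - 1) * (\<Sum>k\<in>A. \<bar>x k\<bar> powr p)"
  using powr_sum_weighted[of A "\<lambda>_. 1" p x] assms by simp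

lemma powr_add_le:
  fixes a b :: real
  assumes p: "1 \<le> p" "p \<le> 2"
  shows "\<bar>a + b\<bar> powr p \<le> 2 * (\<bar>a\<bar> powr p + \<bar>b\<bar> powr p)"
proof -
  have "\<bar>a + b\<bar> powr p \<le> 2 powr (p - 1) * (\<bar>a\<bar> powr p + \<bar>b\<bar> powr p)"
    using powr_sum_le[of "{False, True}" p "\<lambda>i. if i then b else a"] p by simp
  also have "\<dots> \<le> 2 powr 1 * (\<bar>a\<bar> powr p + \<bar>b\<bar> powr p)"
    using p by (intro mult_right_mono powr_mono) auto
  finally show ?thesis by simp
qed

text \<open>Minkowski's inequality without roots: \<alpha> and \<beta> bound the two norms relative
  to a common D, and serve as the two Hoelder weights.\<close>

lemma powr_add_norm_le:
  fixes a b :: "'a \<Rightarrow> real"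
  assumes A: "finite A" and p: "1 \<le> p" and \<alpha>: "0 < \<alpha>" "0 < \<beta>"
    and a: "(\<Sum>m\<in>A. \<bar>a m\<bar> powr p) \<le> \<alpha> powr p * D" and b: "(\<Sum>m\<in>A. \<bar>b m\<bar> powr p) \<le> \<beta> powr p * D"
  shows "(\<Sum>m\<in>A. \<bar>a m + b m\<bar> powr p) \<le> (\<alpha> + \<beta>) powr p * D"
proof -
  have "\<bar>a m + b m\<bar> powr p \<le> (\<alpha> + \<beta>) powr (p - 1) * (\<alpha> powr (1 - p) * \<bar>a m\<bar> powr p + \<beta> powr (1 - p) * \<bar>b m\<bar> powr p)" for m
    using powr_sum_weighted[of "{False, True}" "\<lambda>i. if i then \<beta> else \<alpha>" p "\<lambda>i. if i then b m else a m"] p \<alpha> 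
    by (simp add: add.commute)
  then have "(\<Sum>m\<in>A. \<bar>a m + b m\<bar> powr p) \<le>
     (\<alpha> + \<beta>) powr (p - 1) * (\<alpha> powr (1 - p) * (\<Sum>m\<in>A. \<bar>a m\<bar> powr p) + \<beta> powr (1 - p) * (\<Sum>m\<in>A. \<bar>b m\<bar> powr p))"
    unfolding sum_distrib_left sum.distrib[symmetric] by (rule sum_mono)
  also have "\<dots> \<le> (\<alpha> + \<beta>) powr (p - 1) * (\<alpha> powr (1 - p) * (\<alpha> powr p * D) + \<beta> powr (1 - p) * (\<beta> powr p * D))"
    using a b by (intro mult_left_mono add_mono) auto
  also have "\<dots> = (\<alpha> + \<beta>) powr (p - 1) * ((\<alpha> powr (1 - p) * \<alpha> powr p) * D + (\<beta> powr (1 - p) * \<beta> powr p) * D)"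
    by (simp add: algebra_simps)
  also have "\<dots> = (\<alpha> + \<beta>) powr (p - 1) * ((\<alpha> + \<beta>) * D)"
    using \<alpha> by (simp add: powr_add[symmetric] algebra_simps)
  also have "\<dots> = (\<alpha> + \<beta>) powr p * D"
    using \<alpha> by (simp add: powr_diff)
  finally show ?thesis .
qed

text \<open>Bernoulli's inequality: the tangent at 1 of the convex power 1 / \<gamma>, evaluated at
  t powr \<gamma>.\<close>

lemma one_minus_powr_ge:
  fixes t \<gamma> :: real
  assumes "0 \<le> t" "t \<le> 1" "0 < \<gamma>" "\<gamma> \<le> 1"
  shows "\<gamma> * (1 - t) \<le> 1 - t powr \<gamma>"
proof -
  have "1 powr (1/\<gamma>) + (1/\<gamma>) * 1 powr (1/\<gamma> - 1) * (t powr \<gamma> - 1) \<le> (t powr \<gamma>) powr (1/\<gamma>)"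
    using assms by (intro powr_ge_tangent) auto
  also have "\<dots> = t" using assms by (cases "t = 0") (auto simp: powr_powr)
  finally show ?thesis using assms by (simp add: field_simps)
qed

lemma powr_minus_sub_one_ge:
  fixes t \<beta> :: real
  assumes "0 < t" "t \<le> 1" "0 < \<beta>"
  shows "\<beta> * (1 - t) \<le> t powr (-\<beta>) - 1"
proof -
  have "1 + (-\<beta> * ln t) \<le> exp (-\<beta> * ln t)" by (rule exp_ge_add_one_self)
  moreover have "exp (-\<beta> * ln t) = t powr (-\<beta>)" using assms by (simp add: powr_def)
  moreover have "\<beta> * ln t \<le> \<beta> * (t - 1)" using assms ln_le_minus_one[of t] by (intro mult_left_mono) auto
  ultimately show ?thesis by (simp add: algebra_simps)
qed

text \<open>A one-step Riemann sum compared with the integral of the decreasing function s powr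
  (-\<alpha>) over [a, b], written through the antiderivative so that sums telescope. The next lemma
  does the same for an exponent below -1.\<close>

lemma powr_diff_ge_low:
  fixes a b \<alpha> :: real
  assumes "0 \<le> a" "a \<le> b" "0 < b" "0 < \<alpha>" "\<alpha> < 1"
  shows "(1 - \<alpha>) * ((b - a) * b powr (-\<alpha>)) \<le> b powr (1 - \<alpha>) - a powr (1 - \<alpha>)"
proof -
  have "(1 - \<alpha>) * (1 - a / b) \<le> 1 - (a / b) powr (1 - \<alpha>)"
    using assms by (intro one_minus_powr_ge) auto
  then have "b powr (1 - \<alpha>) * ((1 - \<alpha>) * (1 - a / b)) \<le> b powr (1 - \<alpha>) * (1 - (a / b) powr (1 - \<alpha>))"
    by (rule mult_left_mono) auto
  moreover have "b powr (1 - \<alpha>) * ((1 - \<alpha>) * (1 - a / b)) = (1 - \<alpha>) * ((b - a) * b powr (-\<alpha>))"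
    using assms by (simp add: powr_diff powr_minus field_simps)
  moreover have "b powr (1 - \<alpha>) * (1 - (a / b) powr (1 - \<alpha>)) = b powr (1 - \<alpha>) - a powr (1 - \<alpha>)"
    using assms by (simp add: powr_divide right_diff_distrib)
  ultimately show ?thesis by simp
qed

lemma powr_diff_ge_high:
  fixes a b \<beta> :: real
  assumes "0 < a" "a \<le> b" "0 < \<beta>"
  shows "\<beta> * ((b - a) * b powr (-\<beta> - 1)) \<le> a powr (-\<beta>) - b powr (-\<beta>)"
proof -
  have "\<beta> * (1 - a / b) \<le> (a / b) powr (-\<beta>) - 1"
    using assms by (intro powr_minus_sub_one_ge) auto
  then have "b powr (-\<beta>) * (\<beta> * (1 - a / b)) \<le> b powr (-\<beta>) * ((a / b) powr (-\<beta>) - 1)"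
    by (rule mult_left_mono) auto
  moreover have "b powr (-\<beta>) * (\<beta> * (1 - a / b)) = \<beta> * ((b - a) * b powr (-\<beta> - 1))"
    using assms by (simp add: powr_diff field_simps)
  moreover have "b powr (-\<beta>) * ((a / b) powr (-\<beta>) - 1) = a powr (-\<beta>) - b powr (-\<beta>)"
    using assms by (simp add: powr_divide right_diff_distrib)
  ultimately show ?thesis by simp
qed

lemma sum_powr_tail_le:
  fixes \<beta> :: real and m n :: nat
  assumes "1 \<le> m" "0 < \<beta>"
  shows "(\<Sum>k=m..n. real k powr (-\<beta> - 1)) \<le> (1 + 1 / \<beta>) * real m powr (-\<beta>)"
proof (cases "m \<le> n")
  case False
  then show ?thesis using assms by simp
next
  case True
  have "real m powr (-\<beta> - 1) \<le> real m powr (-\<beta>)" using assms by (intro powr_mono) auto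
  have "\<beta> * (\<Sum>k=Suc m..n. real k powr (-\<beta> - 1)) \<le> (\<Sum>k=Suc m..n. real (k - 1) powr (-\<beta>) - real k powr (-\<beta>))"
    unfolding sum_distrib_left
  proof (rule sum_mono)
    fix k assume "k \<in> {Suc m..n}"
    then show "\<beta> * real k powr (-\<beta> - 1) \<le> real (k - 1) powr (-\<beta>) - real k powr (-\<beta>)"
      using powr_diff_ge_high[of "real (k - 1)" "real k" \<beta>] assms by (auto simp: of_nat_diff)
  qed
  also have "\<dots> = real m powr (-\<beta>) - real n powr (-\<beta>)"
    using True
  proof (induction n rule: dec_induct)
    case base then show ?case by simp
  next
    case (step n) then show ?case by simp
  qed
  also have "\<dots> \<le> real m powr (-\<beta>)" by simp
  finally have "(\<Sum>k=Suc m..n. real k powr (-\<beta> - 1)) \<le> real m powr (-\<beta>) / \<beta>"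
    using assms by (simp add: field_simps)
  moreover have "(\<Sum>k=m..n. real k powr (-\<beta> - 1)) = real m powr (-\<beta> - 1) + (\<Sum>k=Suc m..n. real k powr (-\<beta> - 1))"
    using True by (simp add: sum.atLeast_Suc_atMost)
  ultimately show ?thesis using \<open>real m powr (-\<beta> - 1) \<le> real m powr (-\<beta>)\<close> by (simp add: algebra_simps)
qed

text \<open>Split at l: up to l the kernel is the constant 1 / T l and the sum is compared with the
  integral of s powr (-\<alpha>); beyond l the kernel is 1 / T k and the integrand becomes s powr
  (-\<alpha> - 1). Both telescope in the variable T, so the increments \<theta> leave no trace in
  the constant.\<close>

lemma schur_kernel_sum_le:
  fixes T \<theta> :: "nat \<Rightarrow> real"
  assumes T0: "T 0 = 0" and T: "\<And>k. T (Suc k) = T k + \<theta> (Suc k)" and \<theta>: "\<And>k. 0 < \<theta> k"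
    and \<alpha>: "0 < \<alpha>" "\<alpha> < 1" and l: "1 \<le> l"
  shows "(\<Sum>k=1..n. \<theta> k * T k powr (-\<alpha>) / max (T l) (T k)) \<le> (1 / (1 - \<alpha>) + 1 / \<alpha>) * T l powr (-\<alpha>)"
proof -
  have "strict_mono T" using T \<theta> by (simp add: strict_mono_Suc_iff)
  then have mono: "T i \<le> T j \<longleftrightarrow> i \<le> j" for i j by (simp add: strict_mono_less_eq)
  have pos: "0 < T k" if "1 \<le> k" for k
    using \<open>strict_mono T\<close> that T0 by (metis strict_mono_less less_le_trans zero_less_one)
  have nonneg: "0 \<le> T k" for k using mono[of 0 k] T0 by simp
  have low: "(1 - \<alpha>) * (\<Sum>k=1..j. \<theta> k * T k powr (-\<alpha>)) \<le> T j powr (1 - \<alpha>)" for j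
  proof (induction j)
    case 0 then show ?case by simp
  next
    case (Suc j)
    have "(1 - \<alpha>) * ((T (Suc j) - T j) * T (Suc j) powr (-\<alpha>)) \<le> T (Suc j) powr (1 - \<alpha>) - T j powr (1 - \<alpha>)"
      using \<alpha> pos nonneg mono by (intro powr_diff_ge_low) auto
    then show ?case using Suc T[of j] by (simp add: algebra_simps)
  qed
  \<comment> \<open>\<open>max l j\<close> lets the induction start at j = 0, as long as the sum is
    still empty.\<close>
  have high: "\<alpha> * (\<Sum>k=Suc l..j. \<theta> k * T k powr (-\<alpha> - 1)) \<le> T l powr (-\<alpha>) - T (max l j) powr (-\<alpha>)" for j
  proof (induction j)
    case 0 then show ?case by simp
  next
    case (Suc j)
    show ?case
    proof (cases "l \<le> j")
      case True
      have "\<alpha> * ((T (Suc j) - T j) * T (Suc j) powr (-\<alpha> - 1)) \<le> T j powr (-\<alpha>) - T (Suc j) powr (-\<alpha>)"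
        using \<alpha> pos[of j] True l mono by (intro powr_diff_ge_high) auto
      then show ?thesis using Suc True T[of j] by (simp add: algebra_simps max_def)
    next
      case False
      then show ?thesis using mono[of l "Suc j"] by (cases "l = Suc j") (auto simp: max_def)
    qed
  qed
  have "(\<Sum>k=1..n. \<theta> k * T k powr (-\<alpha>) / max (T l) (T k)) 
     \<le> (\<Sum>k\<in>{1..l} \<union> {Suc l..n}. \<theta> k * T k powr (-\<alpha>) / max (T l) (T k))"
    using \<theta> nonneg by (intro sum_mono2) (auto simp: less_imp_le max_def)
  also have "\<dots> = (\<Sum>k=1..l. \<theta> k * T k powr (-\<alpha>) / max (T l) (T k)) + (\<Sum>k=Suc l..n. \<theta> k * T k powr (-\<alpha>) / max (T l) (T k))"
    by (rule sum.union_disjoint) auto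
  also have "(\<Sum>k=1..l. \<theta> k * T k powr (-\<alpha>) / max (T l) (T k)) = (\<Sum>k=1..l. \<theta> k * T k powr (-\<alpha>)) / T l"
    unfolding sum_divide_distrib using mono by (intro sum.cong) (auto simp: max_def)
  also have "(\<Sum>k=Suc l..n. \<theta> k * T k powr (-\<alpha>) / max (T l) (T k)) = (\<Sum>k=Suc l..n. \<theta> k * T k powr (-\<alpha> - 1))"
  proof (intro sum.cong refl)
    fix k assume "k \<in> {Suc l..n}"
    then have "max (T l) (T k) = T k" "T k > 0" using mono pos[of k] l by (auto simp: max_def)
    then show "\<theta> k * T k powr (-\<alpha>) / max (T l) (T k) = \<theta> k * T k powr (-\<alpha> - 1)" by (simp add: powr_diff)
  qed
  also have "(\<Sum>k=1..l. \<theta> k * T k powr (-\<alpha>)) / T l \<le> 1 / (1 - \<alpha>) * T l powr (-\<alpha>)"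
  proof -
    have "T l powr (1 - \<alpha>) = T l * T l powr (-\<alpha>)" using pos[OF l] by (simp add: powr_diff powr_minus field_simps)
    then show ?thesis using low[of l] pos[OF l] \<alpha> by (simp add: field_simps)
  qed
  also have "(\<Sum>k=Suc l..n. \<theta> k * T k powr (-\<alpha> - 1)) \<le> 1 / \<alpha> * T l powr (-\<alpha>)"
  proof -
    have "\<alpha> * (\<Sum>k=Suc l..n. \<theta> k * T k powr (-\<alpha> - 1)) \<le> T l powr (-\<alpha>)"
      using high[of n] by (smt (verit) powr_ge_zero)
    then show ?thesis using \<alpha> by (simp add: field_simps)
  qed
  finally show ?thesis by (simp add: algebra_simps)
qed

text \<open>The row and column sums of the Schur test: 4 is the value of 1 / (1 - \<alpha>) + 1 /
  \<alpha> at \<alpha> = 1/2, and the other factor is the same expression at \<alpha> = (p - 1) /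
  2.\<close>

definition hardy_const :: "real \<Rightarrow> real" where
  "hardy_const p = 4 powr (p - 1) * (1 / (1 - (p - 1) / 2) + 1 / ((p - 1) / 2))"

lemma hardy_const_nonneg: "1 < p \<Longrightarrow> p < 2 \<Longrightarrow> 0 < hardy_const p"
  unfolding hardy_const_def by (intro mult_pos_pos add_pos_pos) auto

text \<open>Schur's test for the kernel \<open>1 / max (T l) (T k)\<close> with the test function \<open>T powr (-1/2)\<close>.\<close>

lemma hardy_schur:
  fixes T \<theta> D :: "nat \<Rightarrow> real" and Y :: "nat \<Rightarrow> nat \<Rightarrow> 'm \<Rightarrow> real"
  assumes p: "1 < p" "p < 2"
    and T0: "T 0 = 0" and T: "\<And>k. T (Suc k) = T k + \<theta> (Suc k)" and \<theta>: "\<And>k. 0 < \<theta> k"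
    and A: "\<And>l. finite (A l)"
    and Y: "\<And>l k. l \<in> {1..n} \<Longrightarrow> k \<in> {1..n} \<Longrightarrow> \<nu> l * (\<Sum>m\<in>A l. \<bar>Y l k m\<bar> powr p) \<le> (1 / max (T l) (T k)) powr p * D k"
    and \<nu>: "\<And>l. 0 \<le> \<nu> l" and D: "\<And>k. 0 \<le> D k"
  shows "(\<Sum>l=1..n. \<theta> l * (\<nu> l * (\<Sum>m\<in>A l. \<bar>\<Sum>k=1..n. Y l k m\<bar> powr p))) \<le> hardy_const p * (\<Sum>k=1..n. \<theta> k powr (1 - p) * D k)"
proof -
  have "strict_mono T" using T \<theta> by (simp add: strict_mono_Suc_iff)
  then have mono: "T i \<le> T j \<longleftrightarrow> i \<le> j" for i j by (simp add: strict_mono_less_eq)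
  have pos: "0 < T k" if "1 \<le> k" for k
    using \<open>strict_mono T\<close> that T0 by (metis strict_mono_less less_le_trans zero_less_one)
  define \<beta> where "\<beta> = (p - 1) / 2"
  define M where "M l k = max (T l) (T k)" for l k
  have M: "0 < M l k" if "l \<in> {1..n}" for l k using pos[of l] that by (auto simp: M_def max_def)
  \<comment> \<open>Hoelder weights: kernel times \<theta> times test function. The powers of the
    kernel combine to M powr (p - 1) / M powr p, so exactly one factor 1 / M survives and the column
    sums fall under the same lemma as the row sums.\<close>
  define c where "c l k = \<theta> k * T k powr (-1/2) / M l k" for l k
  have c: "0 < c l k" if "l \<in> {1..n}" "k \<in> {1..n}" for l k
    using \<theta>[of k] pos[of k] M[of l k] that by (simp add: c_def)
  have csum: "(\<Sum>k=1..n. c l k) \<le> 4 * T l powr (-1/2)" if "l \<in> {1..n}" for l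
    using schur_kernel_sum_le[OF T0 T \<theta>, of "1/2" l n] that by (simp add: c_def M_def)
  have row: "\<nu> l * (\<Sum>m\<in>A l. \<bar>\<Sum>k=1..n. Y l k m\<bar> powr p) \<le>
      4 powr (p - 1) * T l powr (-\<beta>) * (\<Sum>k=1..n. \<theta> k powr (1 - p) * T k powr \<beta> * D k / M l k)"
    if l: "l \<in> {1..n}" for l
  proof -
    have "\<bar>\<Sum>k=1..n. Y l k m\<bar> powr p \<le> 4 powr (p - 1) * T l powr (-\<beta>) * (\<Sum>k=1..n. c l k powr (1 - p) * \<bar>Y l k m\<bar> powr p)" for m
    proof -
      have "\<bar>\<Sum>k=1..n. Y l k m\<bar> powr p \<le> (\<Sum>k=1..n. c l k) powr (p - 1) * (\<Sum>k=1..n. c l k powr (1 - p) * \<bar>Y l k m\<bar> powr p)"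
        using c l p by (intro powr_sum_weighted) auto
      also have "\<dots> \<le> (4 * T l powr (-1/2)) powr (p - 1) * (\<Sum>k=1..n. c l k powr (1 - p) * \<bar>Y l k m\<bar> powr p)"
        using csum[OF l] c l p by (intro mult_right_mono powr_mono2 sum_nonneg) (auto simp: less_imp_le)
      also have "(4 * T l powr (-1/2)) powr (p - 1) = 4 powr (p - 1) * T l powr (-\<beta>)"
        by (simp add: powr_mult powr_powr \<beta>_def algebra_simps diff_divide_distrib)
      finally show ?thesis .
    qed
    then have "\<nu> l * (\<Sum>m\<in>A l. \<bar>\<Sum>k=1..n. Y l k m\<bar> powr p) \<le>
       \<nu> l * (\<Sum>m\<in>A l. 4 powr (p - 1) * T l powr (-\<beta>) * (\<Sum>k=1..n. c l k powr (1 - p) * \<bar>Y l k m\<bar> powr p))"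
      using \<nu> by (intro mult_left_mono sum_mono) auto
    also have "\<dots> = 4 powr (p - 1) * T l powr (-\<beta>) * (\<Sum>k=1..n. c l k powr (1 - p) * (\<nu> l * (\<Sum>m\<in>A l. \<bar>Y l k m\<bar> powr p)))"
      by (subst sum_distrib_left[symmetric], subst sum.swap) (simp add: sum_distrib_left algebra_simps)
    also have "\<dots> \<le> 4 powr (p - 1) * T l powr (-\<beta>) * (\<Sum>k=1..n. c l k powr (1 - p) * ((1 / M l k) powr p * D k))"
      using Y[OF l] by (intro mult_left_mono sum_mono) (auto simp: M_def)
    also have "(\<Sum>k=1..n. c l k powr (1 - p) * ((1 / M l k) powr p * D k)) = (\<Sum>k=1..n. \<theta> k powr (1 - p) * T k powr \<beta> * D k / M l k)"
    proof (intro sum.cong refl)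
      fix k assume k: "k \<in> {1..n}"
      have "c l k powr (1 - p) = \<theta> k powr (1 - p) * (T k powr (-1/2)) powr (1 - p) / M l k powr (1 - p)"
        using \<theta>[of k] pos[of k] M[OF l, of k] k by (simp add: c_def powr_divide powr_mult)
      also have "(T k powr (-1/2)) powr (1 - p) = T k powr \<beta>"
        unfolding powr_powr by (rule arg_cong[where f="\<lambda>e. T k powr e"]) (simp add: \<beta>_def field_simps)
      finally show "c l k powr (1 - p) * ((1 / M l k) powr p * D k) = \<theta> k powr (1 - p) * T k powr \<beta> * D k / M l k"
        using M[OF l, of k] by (simp add: powr_divide powr_diff)
    qed
    finally show ?thesis .
  qed
  have "(\<Sum>l=1..n. \<theta> l * (\<nu> l * (\<Sum>m\<in>A l. \<bar>\<Sum>k=1..n. Y l k m\<bar> powr p))) \<le>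
     (\<Sum>l=1..n. \<theta> l * (4 powr (p - 1) * T l powr (-\<beta>) * (\<Sum>k=1..n. \<theta> k powr (1 - p) * T k powr \<beta> * D k / M l k)))"
    using \<theta> by (intro sum_mono mult_left_mono row) (auto simp: less_imp_le)
  \<comment> \<open>Exchanging the sums leaves column sums with test exponent \<beta>; the remaining
    factor T k powr \<beta> is cancelled by their bound.\<close>
  also have "\<dots> = (\<Sum>k=1..n. 4 powr (p - 1) * (\<theta> k powr (1 - p) * T k powr \<beta> * D k * (\<Sum>l=1..n. \<theta> l * T l powr (-\<beta>) / max (T k) (T l))))"
    unfolding sum_distrib_left by (subst sum.swap) (simp add: algebra_simps M_def max.commute)
  also have "\<dots> \<le> (\<Sum>k=1..n. 4 powr (p - 1) * (\<theta> k powr (1 - p) * T k powr \<beta> * D k * ((1 / (1 - \<beta>) + 1 / \<beta>) * T k powr (-\<beta>))))"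
    using p D by (intro sum_mono mult_left_mono schur_kernel_sum_le[OF T0 T \<theta>]) (auto simp: \<beta>_def)
  also have "\<dots> = hardy_const p * (\<Sum>k=1..n. \<theta> k powr (1 - p) * D k)"
    unfolding sum_distrib_left
  proof (intro sum.cong refl)
    fix k assume "k \<in> {1..n}"
    then have "T k powr \<beta> * T k powr (-\<beta>) = 1" using pos[of k] by (simp add: powr_add[symmetric])
    then show "4 powr (p - 1) * (\<theta> k powr (1 - p) * T k powr \<beta> * D k * ((1 / (1 - \<beta>) + 1 / \<beta>) * T k powr (-\<beta>))) =
         hardy_const p * (\<theta> k powr (1 - p) * D k)"
      unfolding hardy_const_def \<beta>_def[symmetric] by algebra
  qed
  finally show ?thesis .
qed

lemma discrete_hardy:
  fixes a :: "nat \<Rightarrow> real"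
  assumes p: "1 < p" "p < 2"
  shows "(\<Sum>k=1..n. (1 / real k * (\<Sum>s<k. \<bar>a s\<bar>)) powr p) \<le> hardy_const p * (\<Sum>s<n. \<bar>a s\<bar> powr p)"
proof -
  \<comment> \<open>All increments are 1, so T l = l, and the averaging kernel 1 / l on k \<le> l
    lies below 1 / max l k. The vectors of the general statement are scalars here, hence the
    one-point index set; k - 1 adapts a sequence starting at 0 to indices starting at 1.\<close>
  have "(\<Sum>l=1..n. 1 * (1 * (\<Sum>m\<in>{()}. \<bar>\<Sum>k=1..n. if k \<le> l then \<bar>a (k - 1)\<bar> / real l else 0\<bar> powr p)))
    \<le> hardy_const p * (\<Sum>k=1..n. 1 powr (1 - p) * \<bar>a (k - 1)\<bar> powr p)"
    by (rule hardy_schur[OF p, of real "\<lambda>_. 1"])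
       (use p in \<open>auto simp: powr_divide max_def powr_mult divide_simps\<close>)
  moreover have "(\<Sum>k=1..n. if k \<le> l then \<bar>a (k - 1)\<bar> / real l else 0) = 1 / real l * (\<Sum>s<l. \<bar>a s\<bar>)" if "l \<in> {1..n}" for l
  proof -
    have "(\<Sum>k=1..n. if k \<le> l then \<bar>a (k - 1)\<bar> / real l else 0) = (\<Sum>k\<in>{1..l}. \<bar>a (k - 1)\<bar> / real l)"
      using that by (subst sum.inter_filter[symmetric]) (auto intro!: sum.cong)
    also have "\<dots> = (\<Sum>s<l. \<bar>a s\<bar> / real l)"
      by (rule sum.reindex_bij_witness[of _ Suc "\<lambda>k. k - 1"]) auto
    finally show ?thesis by (simp add: sum_divide_distrib)
  qed
  moreover have "(\<Sum>k=1..n. 1 powr (1 - p) * \<bar>a (k - 1)\<bar> powr p) = (\<Sum>s<n. \<bar>a s\<bar> powr p)"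
    by (rule sum.reindex_bij_witness[of _ Suc "\<lambda>k. k - 1"]) auto
  ultimately show ?thesis by (simp add: sum_nonneg)
qed

subsection \<open>Linear extension from the leaves of a weighted binary tree\<close>

definition tree_avg :: "(nat \<Rightarrow> real) \<Rightarrow> nat \<Rightarrow> real" where
  "tree_avg a = (\<lambda>m. (a (2 * m) + a (2 * m + 1)) / 2)"

definition tree_lift :: "(nat \<Rightarrow> real) \<Rightarrow> nat \<Rightarrow> real" where
  "tree_lift a = (\<lambda>m. a (m div 2))"

text \<open>Normalised by the number of nodes of the level, so that copying to the children is an
  isometry and averaging over them a contraction.\<close>

definition level_norm :: "real \<Rightarrow> nat \<Rightarrow> (nat \<Rightarrow> real) \<Rightarrow> real" where
  "level_norm p l a = (\<Sum>m<2 ^ l. \<bar>a m\<bar> powr p) / 2 ^ l"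

lemma tree_avg_lift [simp]: "tree_avg (tree_lift a) = a"
  by (simp add: tree_avg_def tree_lift_def)

lemma tree_avg_lift_pow [simp]: "(tree_avg ^^ n) ((tree_lift ^^ n) a) = a"
proof (induction n)
  case (Suc n)
  have "(tree_avg ^^ Suc n) ((tree_lift ^^ Suc n) a) = (tree_avg ^^ n) (tree_avg (tree_lift ((tree_lift ^^ n) a)))"
    by (simp add: funpow_swap1)
  then show ?case using Suc by simp
qed simp

lemma sum_lessThan_double: "(\<Sum>m<2 * n. f m) = (\<Sum>m<n. f (2 * m) + f (2 * m + 1))" for f :: "nat \<Rightarrow> real"
  by (induction n) auto

lemma level_norm_nonneg [simp]: "0 \<le> level_norm p l a"
  by (simp add: level_norm_def sum_nonneg)

lemma level_norm_lift: "level_norm p (Suc l) (tree_lift a) = level_norm p l a"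
  unfolding level_norm_def power_Suc sum_lessThan_double by (simp add: tree_lift_def sum_distrib_left[symmetric])

lemma level_norm_avg:
  assumes p: "1 \<le> p"
  shows "level_norm p l (tree_avg a) \<le> level_norm p (Suc l) a"
proof -
  have "\<bar>tree_avg a m\<bar> powr p \<le> (\<bar>a (2 * m)\<bar> powr p + \<bar>a (2 * m + 1)\<bar> powr p) / 2" for m
  proof -
    have "\<bar>\<Sum>k\<in>{0,1::nat}. a (2 * m + k)\<bar> powr p \<le> 2 powr (p - 1) * (\<Sum>k\<in>{0,1::nat}. \<bar>a (2 * m + k)\<bar> powr p)"
      using powr_sum_le[of "{0,1::nat}" p "\<lambda>k. a (2 * m + k)"] p by simp
    then have "\<bar>a (2 * m) + a (2 * m + 1)\<bar> powr p \<le> 2 powr p / 2 * (\<bar>a (2 * m)\<bar> powr p + \<bar>a (2 * m + 1)\<bar> powr p)"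
      by (simp add: powr_diff)
    then show ?thesis by (simp add: tree_avg_def powr_divide field_simps)
  qed
  then have "(\<Sum>m<2 ^ l. \<bar>tree_avg a m\<bar> powr p) \<le> (\<Sum>m<2 ^ l. (\<bar>a (2 * m)\<bar> powr p + \<bar>a (2 * m + 1)\<bar> powr p) / 2)"
    by (intro sum_mono)
  then show ?thesis
    unfolding level_norm_def power_Suc sum_lessThan_double by (simp add: sum_divide_distrib[symmetric] field_simps)
qed

lemma level_norm_avg_pow:
  assumes "1 \<le> p"
  shows "level_norm p l ((tree_avg ^^ n) a) \<le> level_norm p (l + n) a"
proof (induction n arbitrary: a)
  case (Suc n)
  have "level_norm p l ((tree_avg ^^ Suc n) a) \<le> level_norm p (l + n) (tree_avg a)"
    using Suc[of "tree_avg a"] by (simp add: funpow_swap1)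
  also have "\<dots> \<le> level_norm p (l + Suc n) a" using level_norm_avg[OF assms] by simp
  finally show ?case .
qed simp

lemma level_norm_add:
  assumes p: "1 \<le> p" and \<alpha>: "0 < \<alpha>" "0 < \<beta>"
    and a: "level_norm p l a \<le> \<alpha> powr p * D" and b: "level_norm p l b \<le> \<beta> powr p * D"
  shows "level_norm p l (\<lambda>m. a m + b m) \<le> (\<alpha> + \<beta>) powr p * D"
proof -
  have "(\<Sum>m<2 ^ l. \<bar>a m + b m\<bar> powr p) \<le> (\<alpha> + \<beta>) powr p * (2 ^ l * D)"
    using a b by (intro powr_add_norm_le p \<alpha>) (auto simp: level_norm_def field_simps)
  then show ?thesis by (simp add: level_norm_def field_simps)
qed

lemma level_norm_cmult: "level_norm p l (\<lambda>m. c * a m) = \<bar>c\<bar> powr p * level_norm p l a"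
  by (simp add: level_norm_def abs_mult powr_mult sum_distrib_left)

text \<open>A function on the leaves of the binary tree of depth \<open>L\<close> is written as the telescoping sum of
  its martingale differences; the difference created at level \<open>j\<close> is spread over the levels
  \<open>j, \<dots>, L\<close> proportionally to \<open>\<theta>\<close>, which is the cheapest way to interpolate it.\<close>

definition tree_tail :: "nat \<Rightarrow> (nat \<Rightarrow> real) \<Rightarrow> nat \<Rightarrow> real" where
  "tree_tail L \<theta> l = (\<Sum>i=l..L. \<theta> i)"

definition tree_mean :: "nat \<Rightarrow> (nat \<Rightarrow> real) \<Rightarrow> nat \<Rightarrow> nat \<Rightarrow> real" where
  "tree_mean L g j = (tree_avg ^^ (L - j)) g"

text \<open>A running rate: a difference that arises at level j is divided by the remaining weight
  \<open>tree_tail\<close> of the levels j to L and then charged at each of them. The rate at the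
  root is 0, since \<open>tree_ext\<close> starts there from the exact mean.\<close>

fun tree_slope :: "nat \<Rightarrow> (nat \<Rightarrow> real) \<Rightarrow> (nat \<Rightarrow> real) \<Rightarrow> nat \<Rightarrow> nat \<Rightarrow> real" where
  "tree_slope L \<theta> g 0 = (\<lambda>m. 0)"
| "tree_slope L \<theta> g (Suc l) = (\<lambda>m. tree_lift (tree_slope L \<theta> g l) m +
     (tree_mean L g (Suc l) m - tree_lift (tree_mean L g l) m) / tree_tail L \<theta> (Suc l))"

fun tree_ext :: "nat \<Rightarrow> (nat \<Rightarrow> real) \<Rightarrow> (nat \<Rightarrow> real) \<Rightarrow> nat \<Rightarrow> nat \<Rightarrow> real" where
  "tree_ext L \<theta> g 0 = tree_mean L g 0"
| "tree_ext L \<theta> g (Suc l) = (\<lambda>m. tree_lift (tree_ext L \<theta> g l) m + \<theta> (Suc l) * tree_slope L \<theta> g (Suc l) m)"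

lemma tree_tail_step: "l \<le> L \<Longrightarrow> tree_tail L \<theta> l = \<theta> l + tree_tail L \<theta> (Suc l)"
  by (simp add: tree_tail_def sum.atLeast_Suc_atMost)

lemma tree_tail_pos: "(\<And>i. 0 < \<theta> i) \<Longrightarrow> l \<le> L \<Longrightarrow> 0 < tree_tail L \<theta> l"
  unfolding tree_tail_def by (intro sum_pos) auto

text \<open>The invariant of the recursion: what is not yet distributed at level l is the present
  rate times the weight of the levels still to come. At level L that weight is an empty sum, which
  is why the leaves are met exactly.\<close>

lemma tree_ext_eq:
  assumes \<theta>: "\<And>i. 0 < \<theta> i" and "l \<le> L"
  shows "tree_mean L g l m - tree_ext L \<theta> g l m = tree_tail L \<theta> (Suc l) * tree_slope L \<theta> g l m"
  using assms(2)
proof (induction l arbitrary: m)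
  case (Suc l)
  have pos: "0 < tree_tail L \<theta> (Suc l)" using Suc.prems \<theta> by (intro tree_tail_pos) auto
  have IH: "tree_mean L g l (m div 2) - tree_ext L \<theta> g l (m div 2) = tree_tail L \<theta> (Suc l) * tree_slope L \<theta> g l (m div 2)"
    using Suc by simp
  have step: "tree_tail L \<theta> (Suc l) = \<theta> (Suc l) + tree_tail L \<theta> (Suc (Suc l))"
    using Suc.prems by (intro tree_tail_step)
  have "tree_tail L \<theta> (Suc l) * tree_slope L \<theta> g (Suc l) m
     = tree_tail L \<theta> (Suc l) * tree_slope L \<theta> g l (m div 2) + (tree_mean L g (Suc l) m - tree_mean L g l (m div 2))"
    using pos by (simp add: tree_lift_def distrib_left)
  also have "\<dots> = tree_mean L g (Suc l) m - tree_ext L \<theta> g l (m div 2)" using IH by simp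
  finally show ?case using step by (simp add: tree_lift_def algebra_simps del: tree_slope.simps)
qed simp

lemma tree_ext_leaf:
  assumes "\<And>i. 0 < \<theta> i"
  shows "tree_ext L \<theta> g L m = g m"
  using tree_ext_eq[OF assms order_refl, where g=g and m=m and L=L] by (simp add: tree_tail_def tree_mean_def)

lemma tree_avg_pow_add: "(tree_avg ^^ n) (\<lambda>m. a m + b m) = (\<lambda>m. (tree_avg ^^ n) a m + (tree_avg ^^ n) b m)"
  by (induction n) (auto simp: tree_avg_def field_simps fun_eq_iff)

lemma tree_avg_pow_cmult: "(tree_avg ^^ n) (\<lambda>m. c * a m) = (\<lambda>m. c * (tree_avg ^^ n) a m)"
  by (induction n) (auto simp: tree_avg_def field_simps fun_eq_iff)

lemma tree_slope_add: "tree_slope L \<theta> (\<lambda>m. a m + b m) l m = tree_slope L \<theta> a l m + tree_slope L \<theta> b l m"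
  by (induction l arbitrary: m)
     (auto simp: tree_mean_def tree_avg_pow_add tree_lift_def add_divide_distrib diff_divide_distrib)

lemma tree_slope_cmult: "tree_slope L \<theta> (\<lambda>m. c * a m) l m = c * tree_slope L \<theta> a l m"
  by (induction l arbitrary: m)
     (auto simp: tree_mean_def tree_avg_pow_cmult tree_lift_def right_diff_distrib distrib_left diff_divide_distrib)

lemma tree_ext_add: "tree_ext L \<theta> (\<lambda>m. a m + b m) l m = tree_ext L \<theta> a l m + tree_ext L \<theta> b l m"
  by (induction l arbitrary: m)
     (auto simp: tree_mean_def tree_avg_pow_add tree_lift_def tree_slope_add distrib_left simp del: tree_slope.simps)

lemma tree_ext_cmult: "tree_ext L \<theta> (\<lambda>m. c * a m) l m = c * tree_ext L \<theta> a l m"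
  by (induction l arbitrary: m)
     (auto simp: tree_mean_def tree_avg_pow_cmult tree_lift_def tree_slope_cmult distrib_left simp del: tree_slope.simps)

lemma tree_slope_sum:
  assumes "finite A"
  shows "tree_slope L \<theta> (\<lambda>m. \<Sum>k\<in>A. a k m) l m = (\<Sum>k\<in>A. tree_slope L \<theta> (a k) l m)"
  using assms
proof (induction A)
  case empty
  show ?case using tree_slope_cmult[of L \<theta> 0 "\<lambda>_. 0" l m] by simp
next
  case (insert k A)
  then show ?case by (simp add: tree_slope_add)
qed

text \<open>Summation by parts: the increments of \<open>1 / tree_tail\<close> are positive and telescope.\<close>

lemma level_norm_tree_slope:
  assumes p: "1 \<le> p" and \<theta>: "\<And>i. 0 < \<theta> i" and k: "k \<le> L" and l: "l \<le> L"
  shows "level_norm p l (tree_slope L \<theta> ((tree_lift ^^ (L - k)) d) l)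
    \<le> (2 / tree_tail L \<theta> (min l k)) powr p * level_norm p k d"
proof -
  define g where "g = (tree_lift ^^ (L - k)) d"
  define M where "M = tree_mean L g"
  define S where "S = tree_slope L \<theta> g"
  define T where "T = tree_tail L \<theta>"
  define D where "D = level_norm p k d"
  have T: "0 < T i" if "i \<le> L" for i using tree_tail_pos[OF \<theta> that] by (simp add: T_def)
  have Mlow: "M j = (tree_avg ^^ (k - j)) d" if "j \<le> k" for j
  proof -
    have "L - j = (k - j) + (L - k)" using that k by simp
    then show ?thesis by (simp add: M_def tree_mean_def g_def funpow_add)
  qed
  have Mhigh: "M j = (tree_lift ^^ (j - k)) d" if "k \<le> j" "j \<le> L" for j
  proof -
    have "L - k = (L - j) + (j - k)" using that k by simp
    then show ?thesis by (simp add: M_def tree_mean_def g_def funpow_add)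
  qed
  have Mnorm: "level_norm p j (M j) \<le> D" if "j \<le> k" for j
    using level_norm_avg_pow[OF p, of j "k - j" d] that by (simp add: Mlow D_def)
  \<comment> \<open>Once M / T is split off, S (j+1) - M (j+1) / T (j+1) is the lift of S j - M j /
    T j - (1 / T (j+1) - 1 / T j) M j. No mean exceeds d in norm, so the bounds 1 / T j + (1 / T
    (j+1) - 1 / T j) telescope to 1 / T (j+1).\<close>
  have base: "level_norm p j (\<lambda>m. S j m - M j m / T j) \<le> (1 / T j) powr p * D" if "j \<le> k" for j
    using that
  proof (induction j)
    case 0
    have "level_norm p 0 (\<lambda>m. S 0 m - M 0 m / T 0) = (1 / T 0) powr p * level_norm p 0 (M 0)"
      using level_norm_cmult[of p 0 "-1 / T 0" "M 0"] T[of 0] by (simp add: S_def)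
    also have "\<dots> \<le> (1 / T 0) powr p * D" using Mnorm[of 0] by (intro mult_left_mono) auto
    finally show ?case .
  next
    case (Suc j)
    have pos: "0 < T j" "0 < T (Suc j)" using T Suc.prems k by auto
    have "T j = \<theta> j + T (Suc j)" unfolding T_def using Suc.prems k by (intro tree_tail_step) auto
    then have "T (Suc j) < T j" using \<theta>[of j] by simp
    then have b: "0 < 1 / T (Suc j) - 1 / T j" using pos by (simp add: field_simps)
    have eq: "(\<lambda>m. S (Suc j) m - M (Suc j) m / T (Suc j)) =
      tree_lift (\<lambda>m. (S j m - M j m / T j) + (-(1 / T (Suc j) - 1 / T j)) * M j m)"
      by (simp add: S_def T_def[symmetric] M_def[symmetric] tree_lift_def fun_eq_iff field_simps add_divide_distrib diff_divide_distrib)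
    have "level_norm p j (\<lambda>m. (S j m - M j m / T j) + (-(1 / T (Suc j) - 1 / T j)) * M j m) \<le> (1 / T j + (1 / T (Suc j) - 1 / T j)) powr p * D"
    proof (rule level_norm_add[OF p])
      show "level_norm p j (\<lambda>m. (-(1 / T (Suc j) - 1 / T j)) * M j m) \<le> (1 / T (Suc j) - 1 / T j) powr p * D"
        unfolding level_norm_cmult abs_minus_cancel using Mnorm[of j] Suc.prems b by (simp add: mult_left_mono)
    qed (use b Suc pos in auto)
    then show ?case unfolding eq level_norm_lift by simp
  qed
  have low: "level_norm p j (S j) \<le> (2 / T j) powr p * D" if "j \<le> k" for j
  proof -
    have pos: "0 < T j" using T that k by auto
    have "level_norm p j (\<lambda>m. (S j m - M j m / T j) + (1 / T j) * M j m) \<le> (1 / T j + 1 / T j) powr p * D"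
    proof (rule level_norm_add[OF p])
      show "level_norm p j (\<lambda>m. (1 / T j) * M j m) \<le> (1 / T j) powr p * D"
        unfolding level_norm_cmult using Mnorm[of j] that pos by (simp add: mult_left_mono)
    qed (use base that pos in auto)
    then show ?thesis by simp
  qed
  \<comment> \<open>Beyond level k the data are constant on subtrees; no new differences arise and
    the slope is merely copied to the children.\<close>
  have high: "level_norm p (k + i) (S (k + i)) = level_norm p k (S k)" if "k + i \<le> L" for i
    using that
  proof (induction i)
    case (Suc i)
    have "M (Suc (k + i)) = tree_lift (M (k + i))"
      using Suc.prems by (simp add: Mhigh)
    then have "S (k + Suc i) = tree_lift (S (k + i))"
      by (simp add: S_def M_def fun_eq_iff)
    then show ?case using Suc by (simp add: level_norm_lift)
  qed simp
  show ?thesis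
  proof (cases "l \<le> k")
    case True
    then show ?thesis using low[of l] by (simp add: S_def T_def D_def g_def min_def)
  next
    case False
    then show ?thesis using low[of k] high[of "l - k"] l by (simp add: S_def T_def D_def g_def min_def)
  qed
qed

section \<open>Weighted energy on the tree and its near-minimisation\<close>

definition tree_weight :: "real \<Rightarrow> (nat \<Rightarrow> real) \<Rightarrow> nat \<Rightarrow> real" where
  "tree_weight p w l = (2 ^ l * w l) powr (-1 / (p - 1))"

definition tree_energy :: "real \<Rightarrow> nat \<Rightarrow> (nat \<Rightarrow> real) \<Rightarrow> (nat \<Rightarrow> nat \<Rightarrow> real) \<Rightarrow> real" where
  "tree_energy p L w V = (\<Sum>l=1..L. w l * (\<Sum>m<2 ^ l. \<bar>V l m - V (l - 1) (m div 2)\<bar> powr p))"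

lemma tree_telescope:
  "V l = (\<lambda>m. (tree_lift ^^ l) (V 0) m + (\<Sum>k=1..l. (tree_lift ^^ (l - k)) (\<lambda>m. V k m - V (k - 1) (m div 2)) m))"
    (is "_ = (\<lambda>m. _ + (\<Sum>k=1..l. (tree_lift ^^ (l - k)) (?d k) m))")
proof (induction l)
  case (Suc l)
  show ?case
  proof
    fix m
    have "V (Suc l) m = tree_lift (V l) m + ?d (Suc l) m" by (simp add: tree_lift_def)
    also have "tree_lift (V l) m = (tree_lift ^^ Suc l) (V 0) m + (\<Sum>k=1..l. (tree_lift ^^ (l - k)) (?d k) (m div 2))"
      by (subst Suc) (simp add: tree_lift_def)
    also have "(\<Sum>k=1..l. (tree_lift ^^ (l - k)) (?d k) (m div 2)) = (\<Sum>k=1..l. (tree_lift ^^ (Suc l - k)) (?d k) m)"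
      by (intro sum.cong refl) (auto simp: Suc_diff_le tree_lift_def)
    finally show "V (Suc l) m = (tree_lift ^^ Suc l) (V 0) m + (\<Sum>k=1..Suc l. (tree_lift ^^ (Suc l - k)) (?d k) m)"
      by simp
  qed
qed simp

text \<open>V is an arbitrary competitor, entering the extension through its leaf values only. Its
  increments are the sources whose slopes add up to those of the extension, and the energy of the
  extension is the \<theta>-weighted sum of its slope norms; so the claim is the Hardy inequality
  for the kernel found in \<open>level_norm_tree_slope\<close>.\<close>

theorem tree_energy_ext_le:
  fixes w :: "nat \<Rightarrow> real" and V :: "nat \<Rightarrow> nat \<Rightarrow> real"
  assumes p: "1 < p" "p < 2" and w: "\<And>l. 0 < w l"
  shows "tree_energy p L w (tree_ext L (tree_weight p w) (V L)) \<le> 2 powr p * hardy_const p * tree_energy p L w V"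
proof -
  define \<theta> where "\<theta> = tree_weight p w"
  have \<theta>: "0 < \<theta> i" for i using w[of i] by (simp add: \<theta>_def tree_weight_def)
  have w\<theta>: "2 ^ l * w l = \<theta> l powr (1 - p)" for l
  proof -
    have "\<theta> l powr (1 - p) = (2 ^ l * w l) powr ((-1 / (p - 1)) * (1 - p))"
      unfolding \<theta>_def tree_weight_def powr_powr ..
    also have "(-1 / (p - 1)) * (1 - p) = 1" using p by (simp add: field_simps)
    finally show ?thesis using w[of l] by simp
  qed
  define g where "g = V L"
  define d where "d k = (\<lambda>m. V k m - V (k - 1) (m div 2))" for k
  define s where "s k l = tree_slope L \<theta> ((tree_lift ^^ (L - k)) (d k)) l" for k l
  have slope: "tree_slope L \<theta> g l m = (\<Sum>k=1..L. s k l m)" if "l \<le> L" for l m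
  proof -
    \<comment> \<open>The root value, copied down, has no martingale differences and so produces no
      slope.\<close>
    have zero: "tree_slope L \<theta> ((tree_lift ^^ L) (V 0)) l m = 0" for m
    proof -
      show ?thesis using that
      proof (induction l arbitrary: m)
        case (Suc l)
        have "(tree_lift ^^ L) (V 0) = (tree_lift ^^ (L - Suc l)) ((tree_lift ^^ Suc l) (V 0))"
          using Suc.prems by (metis comp_apply funpow_add le_add_diff_inverse2)
        then have 1: "tree_mean L ((tree_lift ^^ L) (V 0)) (Suc l) = (tree_lift ^^ Suc l) (V 0)"
          by (simp add: tree_mean_def del: funpow.simps)
        have "(tree_lift ^^ L) (V 0) = (tree_lift ^^ (L - l)) ((tree_lift ^^ l) (V 0))"
          using Suc.prems by (metis comp_apply funpow_add le_add_diff_inverse2 Suc_leD)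
        then have "tree_mean L ((tree_lift ^^ L) (V 0)) l = (tree_lift ^^ l) (V 0)"
          by (simp add: tree_mean_def del: funpow.simps)
        moreover have "tree_lift (tree_slope L \<theta> ((tree_lift ^^ L) (V 0)) l) m = 0"
          using Suc by (simp add: tree_lift_def[of "tree_slope L _ _ _"])
        ultimately show ?case using 1 by simp
      qed simp
    qed
    have "g = (\<lambda>m. (tree_lift ^^ L) (V 0) m + (\<Sum>k=1..L. (tree_lift ^^ (L - k)) (d k) m))"
      unfolding g_def d_def by (rule tree_telescope)
    then have "tree_slope L \<theta> g l m = tree_slope L \<theta> ((tree_lift ^^ L) (V 0)) l m
        + tree_slope L \<theta> (\<lambda>m. \<Sum>k=1..L. (tree_lift ^^ (L - k)) (d k) m) l m"
      by (simp only: tree_slope_add)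
    also have "\<dots> = (\<Sum>k=1..L. s k l m)" unfolding zero s_def by (subst tree_slope_sum) auto
    finally show ?thesis .
  qed
  \<comment> \<open>The tails run from l up to L, whereas the Hardy inequality expects partial sums
    starting at 1; hence the levels are numbered backwards. The value 1 beyond L just keeps all
    increments positive.\<close>
  define \<theta>' where "\<theta>' i = (if i \<le> L then \<theta> (Suc L - i) else 1)" for i
  define T where "T i = (\<Sum>j=1..i. \<theta>' j)" for i
  have T: "T i = tree_tail L \<theta> (Suc L - i)" if "i \<le> L" for i
    unfolding T_def tree_tail_def using that
    by (intro sum.reindex_bij_witness[of _ "\<lambda>j. Suc L - j" "\<lambda>j. Suc L - j"]) (auto simp: \<theta>'_def)
  have tail_mono: "tree_tail L \<theta> j \<le> tree_tail L \<theta> i" if "i \<le> j" for i j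
    unfolding tree_tail_def using that \<theta> by (intro sum_mono2) (auto simp: less_imp_le)
  have main: "(\<Sum>l=1..L. \<theta>' l * (1 / 2 ^ (Suc L - l) * (\<Sum>m<2 ^ (Suc L - l). \<bar>\<Sum>k=1..L. s (Suc L - k) (Suc L - l) m\<bar> powr p)))
     \<le> hardy_const p * (\<Sum>k=1..L. \<theta>' k powr (1 - p) * (2 powr p * level_norm p (Suc L - k) (d (Suc L - k))))"
  proof (rule hardy_schur[OF p, of T \<theta>'])
    fix l k assume lk: "l \<in> {1..L}" "k \<in> {1..L}"
    let ?l = "Suc L - l" and ?k = "Suc L - k"
    have "level_norm p ?l (s ?k ?l) \<le> (2 / tree_tail L \<theta> (min ?l ?k)) powr p * level_norm p ?k (d ?k)"
      unfolding s_def using p \<theta> lk by (intro level_norm_tree_slope) auto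
    also have "tree_tail L \<theta> (min ?l ?k) = max (T l) (T k)"
      using lk tail_mono[of ?l ?k] tail_mono[of ?k ?l] by (auto simp: T min_def max_def)
    finally have "level_norm p ?l (s ?k ?l) \<le> (2 / max (T l) (T k)) powr p * level_norm p ?k (d ?k)" .
    also have "2 / max (T l) (T k) = 1 / max (T l) (T k) * 2" by simp
    finally show "1 / 2 ^ ?l * (\<Sum>m<2 ^ ?l. \<bar>s ?k ?l m\<bar> powr p) \<le> (1 / max (T l) (T k)) powr p * (2 powr p * level_norm p ?k (d ?k))"
      unfolding powr_mult by (simp add: level_norm_def mult.assoc)
  qed (use \<theta> in \<open>auto simp: T_def \<theta>'_def\<close>)
  have lhs: "(\<Sum>l=1..L. \<theta>' l * (1 / 2 ^ (Suc L - l) * (\<Sum>m<2 ^ (Suc L - l). \<bar>\<Sum>k=1..L. s (Suc L - k) (Suc L - l) m\<bar> powr p)))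
      = (\<Sum>l=1..L. \<theta> l * level_norm p l (tree_slope L \<theta> g l))"
  proof (rule sum.reindex_bij_witness[of _ "\<lambda>l. Suc L - l" "\<lambda>l. Suc L - l"])
    fix l assume l: "l \<in> {1..L}"
    have "(\<Sum>k=1..L. s (Suc L - k) (Suc L - l) m) = (\<Sum>k=1..L. s k (Suc L - l) m)" for m
      by (rule sum.reindex_bij_witness[of _ "\<lambda>l. Suc L - l" "\<lambda>l. Suc L - l"]) auto
    moreover have "tree_slope L \<theta> g (Suc L - l) m = (\<Sum>k=1..L. s k (Suc L - l) m)" for m
      using l by (intro slope) auto
    ultimately show "\<theta> (Suc L - l) * level_norm p (Suc L - l) (tree_slope L \<theta> g (Suc L - l)) =
       \<theta>' l * (1 / 2 ^ (Suc L - l) * (\<Sum>m<2 ^ (Suc L - l). \<bar>\<Sum>k=1..L. s (Suc L - k) (Suc L - l) m\<bar> powr p))"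
      using l by (simp add: \<theta>'_def level_norm_def)
  qed auto
  have rhs: "(\<Sum>k=1..L. \<theta>' k powr (1 - p) * (2 powr p * level_norm p (Suc L - k) (d (Suc L - k))))
      = 2 powr p * tree_energy p L w V"
    unfolding tree_energy_def
  proof (subst sum_distrib_left, rule sum.reindex_bij_witness[of _ "\<lambda>l. Suc L - l" "\<lambda>l. Suc L - l"])
    fix k assume k: "k \<in> {1..L}"
    show "2 powr p * (w (Suc L - k) * (\<Sum>m<2 ^ (Suc L - k). \<bar>V (Suc L - k) m - V (Suc L - k - 1) (m div 2)\<bar> powr p)) =
         \<theta>' k powr (1 - p) * (2 powr p * level_norm p (Suc L - k) (d (Suc L - k)))"
      using k w\<theta>[of "Suc L - k", symmetric] by (simp add: \<theta>'_def level_norm_def d_def)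
  qed auto
  \<comment> \<open>An increment is \<theta> l times the slope and 2 ^ l * w l equals \<theta> l
    powr (1 - p), so the powers of \<theta> combine to the single factor \<theta> l.\<close>
  have "tree_energy p L w (tree_ext L \<theta> g) = (\<Sum>l=1..L. \<theta> l * level_norm p l (tree_slope L \<theta> g l))"
    unfolding tree_energy_def
  proof (intro sum.cong refl)
    fix l assume "l \<in> {1..L}"
    then obtain l' where l': "l = Suc l'" by (cases l) auto
    have "tree_ext L \<theta> g l m - tree_ext L \<theta> g (l - 1) (m div 2) = \<theta> l * tree_slope L \<theta> g l m" for m
      by (simp add: l' tree_lift_def)
    then have "w l * (\<Sum>m<2 ^ l. \<bar>tree_ext L \<theta> g l m - tree_ext L \<theta> g (l - 1) (m div 2)\<bar> powr p)
       = (2 ^ l * w l) * level_norm p l (\<lambda>m. \<theta> l * tree_slope L \<theta> g l m)"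
      by (simp add: level_norm_def)
    also have "\<dots> = \<theta> l powr (1 - p) * (\<theta> l powr p * level_norm p l (tree_slope L \<theta> g l))"
      unfolding w\<theta> level_norm_cmult using \<theta>[of l] by simp
    also have "\<dots> = \<theta> l * level_norm p l (tree_slope L \<theta> g l)"
      using \<theta>[of l] by (simp add: mult.assoc[symmetric] powr_add[symmetric])
    finally show "w l * (\<Sum>m<2 ^ l. \<bar>tree_ext L \<theta> g l m - tree_ext L \<theta> g (l - 1) (m div 2)\<bar> powr p) =
      \<theta> l * level_norm p l (tree_slope L \<theta> g l)" .
  qed
  then show ?thesis using main unfolding lhs rhs by (simp add: \<theta>_def g_def algebra_simps)
qed

subsection \<open>Second differences of lattice functions\<close>

lemma powr_add3_le:
  fixes a b c :: real
  assumes p: "1 \<le> p" "p \<le> 2"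
  shows "\<bar>a + b + c\<bar> powr p \<le> 4 * (\<bar>a\<bar> powr p + \<bar>b\<bar> powr p + \<bar>c\<bar> powr p)"
proof -
  have "\<bar>a + b + c\<bar> powr p \<le> 2 * (\<bar>a + b\<bar> powr p + \<bar>c\<bar> powr p)" by (rule powr_add_le[OF p])
  also have "\<dots> \<le> 2 * (2 * (\<bar>a\<bar> powr p + \<bar>b\<bar> powr p) + \<bar>c\<bar> powr p)"
    by (intro mult_left_mono add_mono powr_add_le[OF p]) auto
  also have "\<dots> \<le> 4 * (\<bar>a\<bar> powr p + \<bar>b\<bar> powr p + \<bar>c\<bar> powr p)" by simp
  finally show ?thesis .
qed

type_synonym lattice_fun = "int \<Rightarrow> int \<Rightarrow> real"

definition dx :: "lattice_fun \<Rightarrow> lattice_fun" where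
  "dx H = (\<lambda>x y. H (x + 1) y - H x y)"

definition dy :: "lattice_fun \<Rightarrow> lattice_fun" where
  "dy H = (\<lambda>x y. H x (y + 1) - H x y)"

definition hess :: "real \<Rightarrow> lattice_fun \<Rightarrow> int \<times> int \<Rightarrow> real" where
  "hess p H q = \<bar>dx (dx H) (fst q) (snd q)\<bar> powr p + \<bar>dx (dy H) (fst q) (snd q)\<bar> powr p
     + \<bar>dy (dy H) (fst q) (snd q)\<bar> powr p"

definition lbox :: "int \<Rightarrow> (int \<times> int) set" where
  "lbox M = {-M..M} \<times> {-M..M}"

lemma finite_lbox [simp]: "finite (lbox M)"
  by (simp add: lbox_def)

definition energy :: "real \<Rightarrow> int \<Rightarrow> lattice_fun \<Rightarrow> real" where
  "energy p M H = (\<Sum>q\<in>lbox M. hess p H q)"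

lemma hess_nonneg [simp]: "0 \<le> hess p H q"
  by (simp add: hess_def)

lemma energy_nonneg [simp]: "0 \<le> energy p M H"
  by (simp add: energy_def sum_nonneg)

lemma dx_add: "dx (\<lambda>x y. H x y + K x y) = (\<lambda>x y. dx H x y + dx K x y)"
  and dy_add: "dy (\<lambda>x y. H x y + K x y) = (\<lambda>x y. dy H x y + dy K x y)"
  by (auto simp: dx_def dy_def fun_eq_iff)

lemma hess_add:
  assumes "1 \<le> p" "p \<le> 2"
  shows "hess p (\<lambda>x y. H x y + K x y) q \<le> 2 * (hess p H q + hess p K q)"
  unfolding hess_def dx_add dy_add
  using add_mono[OF add_mono[OF powr_add_le[OF assms, of "dx (dx H) (fst q) (snd q)" "dx (dx K) (fst q) (snd q)"]
    powr_add_le[OF assms, of "dx (dy H) (fst q) (snd q)" "dx (dy K) (fst q) (snd q)"]]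
    powr_add_le[OF assms, of "dy (dy H) (fst q) (snd q)" "dy (dy K) (fst q) (snd q)"]]
  by (simp add: algebra_simps)

lemma energy_add:
  assumes "1 \<le> p" "p \<le> 2"
  shows "energy p M (\<lambda>x y. H x y + K x y) \<le> 2 * (energy p M H + energy p M K)"
  unfolding energy_def sum.distrib[symmetric] sum_distrib_left by (intro sum_mono hess_add assms)

lemma hess_minus: "hess p (\<lambda>x y. - H x y) q = hess p H q"
proof -
  have "dx (\<lambda>x y. - K x y) = (\<lambda>x y. - dx K x y)" "dy (\<lambda>x y. - K x y) = (\<lambda>x y. - dy K x y)" for K
    by (auto simp: dx_def dy_def)
  then show ?thesis by (simp add: hess_def)
qed

lemma energy_diff:
  assumes "1 \<le> p" "p \<le> 2"
  shows "energy p M (\<lambda>x y. H x y - K x y) \<le> 2 * (energy p M H + energy p M K)"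
  using energy_add[OF assms, of M H "\<lambda>x y. - K x y"] by (simp add: energy_def hess_minus)

subsection \<open>The trace on a line\<close>

text \<open>The fractional seminorm of order s = 1 - 1/p, the regularity of traces of gradients: the
  exponent 1 + s p of the distance equals p. The diagonal contributes 0 / 0 = 0.\<close>

definition gagliardo :: "real \<Rightarrow> int set \<Rightarrow> (int \<Rightarrow> real) \<Rightarrow> real" where
  "gagliardo p I v = (\<Sum>a\<in>I. \<Sum>b\<in>I. \<bar>v a - v b\<bar> powr p / real_of_int \<bar>a - b\<bar> powr p)"

definition shift_sum :: "real \<Rightarrow> int set \<Rightarrow> (int \<Rightarrow> real) \<Rightarrow> nat \<Rightarrow> real" where
  "shift_sum p I v k = (\<Sum>a | a \<in> I \<and> a + int k \<in> I. \<bar>v (a + int k) - v a\<bar> powr p)"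

lemma shift_sum_nonneg [simp]: "0 \<le> shift_sum p I v k"
  by (simp add: shift_sum_def sum_nonneg)

lemma gagliardo_nonneg [simp]: "0 \<le> gagliardo p I v"
  by (simp add: gagliardo_def sum_nonneg)

lemma sum_pairs_by_distance:
  fixes f :: "int \<Rightarrow> int \<Rightarrow> real"
  assumes I: "finite I" and K: "\<And>a b. a \<in> I \<Longrightarrow> b \<in> I \<Longrightarrow> b - a \<le> int K"
  shows "(\<Sum>(a,b) | a \<in> I \<and> b \<in> I \<and> a < b. f a b) = (\<Sum>k=1..K. \<Sum>a | a \<in> I \<and> a + int k \<in> I. f a (a + int k))"
proof -
  have "(\<Sum>k=1..K. \<Sum>a | a \<in> I \<and> a + int k \<in> I. f a (a + int k)) =
     (\<Sum>(k,a)\<in>(SIGMA k:{1..K}. {a. a \<in> I \<and> a + int k \<in> I}). f a (a + int k))"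
    using I by (subst sum.Sigma) auto
  also have "\<dots> = (\<Sum>(a,b) | a \<in> I \<and> b \<in> I \<and> a < b. f a b)"
    by (rule sum.reindex_bij_witness[of _ "\<lambda>(a,b). (nat (b - a), a)" "\<lambda>(k,a). (a, a + int k)"])
       (use K in \<open>force+\<close>)
  finally show ?thesis by simp
qed

text \<open>Unordered pairs are grouped by their distance k; the factor 2 stands for the two orders
  of a pair.\<close>

lemma gagliardo_by_distance:
  assumes I: "finite I" and K: "\<And>a b. a \<in> I \<Longrightarrow> b \<in> I \<Longrightarrow> b - a \<le> int K"
  shows "gagliardo p I v = 2 * (\<Sum>k=1..K. shift_sum p I v k / real k powr p)"
proof -
  define f where "f a b = \<bar>v a - v b\<bar> powr p / real_of_int \<bar>a - b\<bar> powr p" for a b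
  have sym: "f a b = f b a" and diag: "f a a = 0" for a b by (auto simp: f_def abs_minus_commute)
  let ?L = "{(a,b). a \<in> I \<and> b \<in> I \<and> a < b}" and ?G = "{(a,b). a \<in> I \<and> b \<in> I \<and> b < a}"
  have fin: "finite ?L" "finite ?G" by (rule finite_subset[of _ "I \<times> I"]; use I in auto)+
  have "gagliardo p I v = (\<Sum>(a,b)\<in>I \<times> I. f a b)"
    by (simp add: gagliardo_def f_def sum.cartesian_product)
  also have "\<dots> = (\<Sum>(a,b)\<in>?L \<union> ?G. f a b)"
    using I diag by (intro sum.mono_neutral_right) (auto, metis linorder_neqE)
  also have "\<dots> = (\<Sum>(a,b)\<in>?L. f a b) + (\<Sum>(a,b)\<in>?G. f a b)"
    using fin by (intro sum.union_disjoint) auto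
  also have "(\<Sum>(a,b)\<in>?G. f a b) = (\<Sum>(a,b)\<in>?L. f a b)"
    by (rule sum.reindex_bij_witness[of _ "\<lambda>(a,b). (b,a)" "\<lambda>(a,b). (b,a)"]) (auto simp: sym)
  also have "(\<Sum>(a,b)\<in>?L. f a b) = (\<Sum>k=1..K. shift_sum p I v k / real k powr p)"
    using sum_pairs_by_distance[OF I K, of f]
    by (simp add: shift_sum_def sum_divide_distrib f_def abs_minus_commute)
  finally show ?thesis by simp
qed

lemma shift_sum_le_gagliardo:
  assumes I: "finite I" and A: "finite A" "0 \<notin> A"
  shows "(\<Sum>k\<in>A. shift_sum p I v k / real k powr p) \<le> gagliardo p I v"
proof -
  obtain C where C: "\<And>a. a \<in> I \<Longrightarrow> \<bar>a\<bar> \<le> C"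
    using I by (meson Max_ge finite_imageI imageI)
  define K where "K = max (nat (2 * C)) (Max (insert 0 A))"
  have "b - a \<le> int K" if "a \<in> I" "b \<in> I" for a b
    using C[OF that(1)] C[OF that(2)] by (simp add: K_def)
  then have "gagliardo p I v = 2 * (\<Sum>k=1..K. shift_sum p I v k / real k powr p)"
    by (intro gagliardo_by_distance I)
  moreover have "k \<le> K" if "k \<in> A" for k
    using A that by (simp add: K_def le_max_iff_disj)
  then have "(\<Sum>k\<in>A. shift_sum p I v k / real k powr p) \<le> (\<Sum>k=1..K. shift_sum p I v k / real k powr p)"
    using A by (intro sum_mono2) (auto simp: Suc_le_eq intro!: gr0I)
  moreover have "0 \<le> (\<Sum>k=1..K. shift_sum p I v k / real k powr p)" by (intro sum_nonneg) auto
  ultimately show ?thesis by linarith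
qed

lemma sum_shift_le:
  fixes f :: "int \<Rightarrow> real"
  assumes "finite X" "\<And>x. x \<in> S \<Longrightarrow> x + j \<in> X" "\<And>x. 0 \<le> f x"
  shows "(\<Sum>x\<in>S. f (x + j)) \<le> (\<Sum>x\<in>X. f x)"
proof -
  have "(\<Sum>x\<in>S. f (x + j)) = (\<Sum>x\<in>(\<lambda>x. x + j) ` S. f x)"
    by (subst sum.reindex) (auto simp: inj_on_def)
  also have "\<dots> \<le> (\<Sum>x\<in>X. f x)" using assms by (intro sum_mono2) auto
  finally show ?thesis .
qed

lemma dx_step_up: "dx H x (int k) - dx H x 0 = (\<Sum>s<k. dx (dy H) x (int s))"
  by (induction k) (auto simp: dx_def dy_def algebra_simps)

lemma dx_step_across: "dx H (x + int k) y - dx H x y = (\<Sum>j<k. dx (dx H) (x + int j) y)"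
  by (induction k) (auto simp: dx_def algebra_simps)

lemma average_powr_le:
  fixes a :: "nat \<Rightarrow> real"
  assumes "1 \<le> p" "1 \<le> k"
  shows "(1 / real k * (\<Sum>j<k. \<bar>a j\<bar>)) powr p \<le> 1 / real k * (\<Sum>j<k. \<bar>a j\<bar> powr p)"
proof -
  have "\<bar>\<Sum>j<k. \<bar>a j\<bar>\<bar> powr p \<le> real k powr (p - 1) * (\<Sum>j<k. \<bar>a j\<bar> powr p)"
    using powr_sum_le[of "{..<k}" p "\<lambda>j. \<bar>a j\<bar>"] assms by simp
  also have "real k powr (p - 1) = real k powr p / real k" using assms by (simp add: powr_diff)
  finally have "(\<Sum>j<k. \<bar>a j\<bar>) powr p \<le> real k powr p / real k * (\<Sum>j<k. \<bar>a j\<bar> powr p)"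
    by (simp add: sum_nonneg)
  then show ?thesis using assms by (simp add: powr_mult powr_divide field_simps sum_nonneg)
qed

text \<open>The points \<open>(a, 0)\<close> and \<open>(b, 0)\<close> are joined by going up by \<open>b - a\<close>, across, and down again.\<close>

lemma gagliardo_trace_le:
  assumes p: "1 < p" "p < 2" and N: "0 < N" "2 * N \<le> M"
  shows "gagliardo p {-N..<N} (\<lambda>x. dx H x 0) \<le> 8 * (2 * hardy_const p + 1) * energy p M H"
proof -
  define I where "I = {-N..<N}"
  define K where "K = nat (2 * N)"
  have K: "b - a \<le> int K" if "a \<in> I" "b \<in> I" for a b using that N by (auto simp: I_def K_def)
  define v where "v x = dx H x 0" for x
  define A where "A a k = (1 / real k * (\<Sum>s<k. \<bar>dx (dy H) a (int s)\<bar>)) powr p" for a k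
  define B where "B a k = (1 / real k * (\<Sum>j<k. \<bar>dx (dx H) (a + int j) (int k)\<bar>)) powr p" for a k
  define J where "J k = {a. a \<in> I \<and> a + int k \<in> I}" for k :: nat
  have J: "finite (J k)" "J k \<subseteq> I" for k
    by (rule finite_subset[of _ I]) (auto simp: J_def I_def)
  have K_le: "k \<le> K" if "a \<in> J k" for a k
    using that N by (auto simp: J_def I_def K_def)
  have pt: "\<bar>v (a + int k) - v a\<bar> powr p / real k powr p \<le> 4 * (A a k + A (a + int k) k + B a k)" if "1 \<le> k" for a k
  proof -
    define b where "b = a + int k"
    have "v b - v a = (dx H b (int k) - dx H a (int k)) - (\<Sum>s<k. dx (dy H) b (int s)) + (\<Sum>s<k. dx (dy H) a (int s))"
      using dx_step_up[of H b k] dx_step_up[of H a k] by (simp add: v_def)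
    also have "dx H b (int k) - dx H a (int k) = (\<Sum>j<k. dx (dx H) (a + int j) (int k))"
      unfolding b_def by (rule dx_step_across)
    finally have "\<bar>v b - v a\<bar> \<le> (\<Sum>j<k. \<bar>dx (dx H) (a + int j) (int k)\<bar>) + (\<Sum>s<k. \<bar>dx (dy H) b (int s)\<bar>) + (\<Sum>s<k. \<bar>dx (dy H) a (int s)\<bar>)"
      using sum_abs[of "\<lambda>j. dx (dx H) (a + int j) (int k)" "{..<k}"] sum_abs[of "\<lambda>s. dx (dy H) b (int s)" "{..<k}"]
         sum_abs[of "\<lambda>s. dx (dy H) a (int s)" "{..<k}"] by linarith
    then have "\<bar>v b - v a\<bar> / real k \<le> 1 / real k * (\<Sum>s<k. \<bar>dx (dy H) a (int s)\<bar>) + 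
       1 / real k * (\<Sum>s<k. \<bar>dx (dy H) b (int s)\<bar>) + 1 / real k * (\<Sum>j<k. \<bar>dx (dx H) (a + int j) (int k)\<bar>)" (is "_ \<le> ?a + ?b + ?c")
      using that by (simp add: field_simps)
    then have "(\<bar>v b - v a\<bar> / real k) powr p \<le> \<bar>?a + ?b + ?c\<bar> powr p"
      using p by (intro powr_mono2) auto
    also have "\<dots> \<le> 4 * (\<bar>?a\<bar> powr p + \<bar>?b\<bar> powr p + \<bar>?c\<bar> powr p)"
      using p by (intro powr_add3_le) auto
    also have "\<dots> = 4 * (A a k + A b k + B a k)" by (simp add: A_def B_def sum_nonneg)
    finally show ?thesis by (simp add: b_def powr_divide)
  qed
  have Apos: "0 \<le> A a k" and Bpos: "0 \<le> B a k" for a k by (auto simp: A_def B_def)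
  \<comment> \<open>The vertical legs: k is both the distance and the height climbed, so averaging
    over s < k and summing over k is the discrete Hardy inequality in each column.\<close>
  have hardy: "(\<Sum>a\<in>I. \<Sum>k=1..K. A a k) \<le> hardy_const p * energy p M H"
  proof -
    have "(\<Sum>a\<in>I. \<Sum>k=1..K. A a k) \<le> (\<Sum>a\<in>I. hardy_const p * (\<Sum>s<K. \<bar>dx (dy H) a (int s)\<bar> powr p))"
      unfolding A_def by (intro sum_mono discrete_hardy p)
    also have "\<dots> = hardy_const p * (\<Sum>(a,s)\<in>I \<times> {..<K}. \<bar>dx (dy H) a (int s)\<bar> powr p)"
      by (simp add: sum_distrib_left sum.cartesian_product case_prod_unfold)
    also have "(\<Sum>(a,s)\<in>I \<times> {..<K}. \<bar>dx (dy H) a (int s)\<bar> powr p) = (\<Sum>q\<in>(\<lambda>(a,s). (a, int s)) ` (I \<times> {..<K}). \<bar>dx (dy H) (fst q) (snd q)\<bar> powr p)"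
      by (subst sum.reindex) (auto simp: inj_on_def case_prod_unfold)
    also have "\<dots> \<le> (\<Sum>q\<in>lbox M. \<bar>dx (dy H) (fst q) (snd q)\<bar> powr p)"
      using N by (intro sum_mono2) (auto simp: lbox_def I_def K_def)
    also have "\<dots> \<le> energy p M H" unfolding energy_def by (intro sum_mono) (simp add: hess_def)
    finally show ?thesis using hardy_const_nonneg[OF p] by (simp add: mult_left_mono)
  qed
  have 1: "(\<Sum>k=1..K. \<Sum>a\<in>J k. A a k) \<le> hardy_const p * energy p M H"
  proof -
    have "(\<Sum>k=1..K. \<Sum>a\<in>J k. A a k) \<le> (\<Sum>k=1..K. \<Sum>a\<in>I. A a k)"
      by (intro sum_mono sum_mono2 J Apos) (auto simp: I_def)
    then show ?thesis using hardy by (subst (asm) (2) sum.swap) simp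
  qed
  have 2: "(\<Sum>k=1..K. \<Sum>a\<in>J k. A (a + int k) k) \<le> hardy_const p * energy p M H"
  proof -
    have "(\<Sum>k=1..K. \<Sum>a\<in>J k. A (a + int k) k) \<le> (\<Sum>k=1..K. \<Sum>a\<in>I. A a k)"
      by (intro sum_mono sum_shift_le Apos) (auto simp: I_def J_def)
    then show ?thesis using hardy by (subst (asm) (2) sum.swap) simp
  qed
  \<comment> \<open>The horizontal legs: an average of k translates inside row k is at most the
    whole row, and different k use different rows.\<close>
  have 3: "(\<Sum>k=1..K. \<Sum>a\<in>J k. B a k) \<le> energy p M H"
  proof -
    have "(\<Sum>a\<in>J k. B a k) \<le> (\<Sum>x\<in>I. \<bar>dx (dx H) x (int k)\<bar> powr p)" if k: "k \<in> {1..K}" for k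
    proof -
      have "(\<Sum>a\<in>J k. B a k) \<le> (\<Sum>a\<in>J k. 1 / real k * (\<Sum>j<k. \<bar>dx (dx H) (a + int j) (int k)\<bar> powr p))"
        unfolding B_def using p k by (intro sum_mono average_powr_le) auto
      also have "\<dots> = 1 / real k * (\<Sum>j<k. \<Sum>a\<in>J k. \<bar>dx (dx H) (a + int j) (int k)\<bar> powr p)"
        by (subst sum.swap) (simp add: sum_distrib_left)
      also have "\<dots> \<le> 1 / real k * (\<Sum>j<k. \<Sum>x\<in>I. \<bar>dx (dx H) x (int k)\<bar> powr p)"
        by (intro mult_left_mono sum_mono sum_shift_le) (auto simp: I_def J_def)
      also have "\<dots> = (\<Sum>x\<in>I. \<bar>dx (dx H) x (int k)\<bar> powr p)" using k by simp
      finally show ?thesis .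
    qed
    then have "(\<Sum>k=1..K. \<Sum>a\<in>J k. B a k) \<le> (\<Sum>k=1..K. \<Sum>x\<in>I. \<bar>dx (dx H) x (int k)\<bar> powr p)"
      by (rule sum_mono)
    also have "\<dots> = (\<Sum>(k,x)\<in>{1..K} \<times> I. \<bar>dx (dx H) x (int k)\<bar> powr p)" by (simp add: sum.cartesian_product)
    also have "\<dots> = (\<Sum>q\<in>(\<lambda>(k,x). (x, int k)) ` ({1..K} \<times> I). \<bar>dx (dx H) (fst q) (snd q)\<bar> powr p)"
      by (subst sum.reindex) (auto simp: inj_on_def case_prod_unfold)
    also have "\<dots> \<le> (\<Sum>q\<in>lbox M. \<bar>dx (dx H) (fst q) (snd q)\<bar> powr p)"
      using N by (intro sum_mono2) (auto simp: lbox_def I_def K_def)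
    also have "\<dots> \<le> energy p M H" unfolding energy_def by (intro sum_mono) (simp add: hess_def)
    finally show ?thesis .
  qed
  have "gagliardo p I v = 2 * (\<Sum>k=1..K. \<Sum>a\<in>J k. \<bar>v (a + int k) - v a\<bar> powr p / real k powr p)"
    unfolding gagliardo_by_distance[OF finite_atLeastLessThan_int[of "-N" N, folded I_def] K, simplified] shift_sum_def J_def
    by (simp add: sum_divide_distrib)
  also have "\<dots> \<le> 2 * (\<Sum>k=1..K. \<Sum>a\<in>J k. 4 * (A a k + A (a + int k) k + B a k))"
    by (intro mult_left_mono sum_mono pt) auto
  also have "\<dots> = 8 * ((\<Sum>k=1..K. \<Sum>a\<in>J k. A a k) + (\<Sum>k=1..K. \<Sum>a\<in>J k. A (a + int k) k) + (\<Sum>k=1..K. \<Sum>a\<in>J k. B a k))"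
    by (simp add: sum.distrib sum_distrib_left algebra_simps)
  also have "\<dots> \<le> 8 * (hardy_const p * energy p M H + hardy_const p * energy p M H + energy p M H)"
    using 1 2 3 by (intro mult_left_mono add_mono) auto
  finally show ?thesis by (simp add: I_def v_def[abs_def] algebra_simps)
qed

subsection \<open>Smooth functions of one variable\<close>

text \<open>The function e^(-1/x) together with the negative powers that its derivatives produce, so
  that linear combinations of the family are closed under differentiation.\<close>

definition flat :: "nat \<Rightarrow> real \<Rightarrow> real" where
  "flat n x = (if x \<le> 0 then 0 else exp (- 1 / x) / x ^ n)"

lemma flat_nonneg [simp]: "0 \<le> flat n x"
  by (simp add: flat_def)

text \<open>A single term of the exponential series of 1 / x. The square on the right makes the
  derivative at 0 vanish, for all n at once.\<close>

lemma flat_le: "\<bar>flat n x\<bar> \<le> fact (n + 2) * x\<^sup>2"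
proof (cases "x \<le> 0")
  case True
  then show ?thesis by (simp add: flat_def)
next
  case False
  then have x: "0 < x" by simp
  have "(1 / x) ^ (n + 2) / fact (n + 2) = (\<Sum>k\<in>{n + 2}. (1 / x) ^ k /\<^sub>R fact k)"
    by (simp add: divide_inverse mult.commute)
  also have "\<dots> \<le> (\<Sum>k. (1 / x) ^ k /\<^sub>R fact k)"
    using x by (intro sum_le_suminf summable_exp_generic) auto
  also have "\<dots> = exp (1 / x)" by (simp add: exp_def)
  finally have "(1 / x) ^ (n + 2) \<le> fact (n + 2) * exp (1 / x)"
    by (subst (asm) pos_divide_le_eq) (auto simp: mult.commute simp del: fact_Suc)
  then have "exp (- 1 / x) * (1 / x ^ (n + 2)) \<le> exp (- 1 / x) * (fact (n + 2) * exp (1 / x))"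
    by (intro mult_left_mono) (auto simp: power_one_over simp del: fact_Suc)
  also have "\<dots> = fact (n + 2) * (exp (- 1 / x) * exp (1 / x))" by (simp add: algebra_simps del: fact_Suc)
  also have "exp (- 1 / x) * exp (1 / x) = 1" by (simp add: exp_add[symmetric])
  finally have "exp (- 1 / x) / x ^ (n + 2) \<le> fact (n + 2)" by (simp del: fact_Suc)
  then have "exp (- 1 / x) / x ^ (n + 2) * x\<^sup>2 \<le> fact (n + 2) * x\<^sup>2" by (rule mult_right_mono) simp
  moreover have "exp (- 1 / x) / x ^ (n + 2) * x\<^sup>2 = flat n x"
    using x by (simp add: flat_def power_add power2_eq_square)
  ultimately show ?thesis using flat_nonneg[of n x] by linarith
qed

lemma flat_has_derivative: "(flat n has_real_derivative (flat (n + 2) x - real n * flat (n + 1) x)) (at x)"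
proof -
  consider "x < 0" | "x = 0" | "0 < x" by linarith
  then show ?thesis
  proof cases
    case 1
    have "((\<lambda>x. 0) has_real_derivative 0) (at x)" by simp
    then have "(flat n has_real_derivative 0) (at x)"
      by (rule has_field_derivative_transform_within_open[of _ _ _ "{..<0}"]) (use 1 in \<open>auto simp: flat_def\<close>)
    then show ?thesis using 1 by (simp add: flat_def)
  next
    case 2
    have "((\<lambda>h. (flat n (0 + h) - flat n 0) / h) \<longlongrightarrow> 0) (at 0)"
    proof (rule Lim_null_comparison)
      show "\<forall>\<^sub>F h in at 0. norm ((flat n (0 + h) - flat n 0) / h) \<le> fact (n + 2) * \<bar>h\<bar>"
      proof (rule always_eventually, intro allI)
        fix h :: real
        show "norm ((flat n (0 + h) - flat n 0) / h) \<le> fact (n + 2) * \<bar>h\<bar>"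
        proof (cases "h = 0")
          case False
          have "\<bar>flat n h\<bar> \<le> fact (n + 2) * \<bar>h\<bar> * \<bar>h\<bar>" using flat_le[of n h] by (simp add: power2_eq_square mult.assoc)
          moreover have "flat n 0 = 0" by (simp add: flat_def)
          ultimately show ?thesis using False by (simp add: field_simps)
        qed simp
      qed
      show "((\<lambda>h::real. fact (n + 2) * \<bar>h\<bar>) \<longlongrightarrow> 0) (at 0)"
        by (auto intro!: tendsto_eq_intros)
    qed
    then have "(flat n has_real_derivative 0) (at 0)" by (simp add: DERIV_def)
    then show ?thesis using 2 by (simp add: flat_def)
  next
    case 3
    have "((\<lambda>x. exp (- 1 / x) / x ^ n) has_real_derivative (flat (n + 2) x - real n * flat (n + 1) x)) (at x)"
      using 3 by (auto intro!: derivative_eq_intros simp: flat_def field_simps power2_eq_square)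
         (cases n; auto simp: field_simps)
    then show ?thesis
      by (rule has_field_derivative_transform_within_open[of _ _ _ "{0<..}"]) (use 3 in \<open>auto simp: flat_def\<close>)
  qed
qed

text \<open>A class generated by rules rather than by a condition on all derivatives: every rule has
  a differentiation rule with result in the class, so \<open>smooth_real_deriv\<close> can be
  iterated. The last rule admits antiderivatives.\<close>

inductive smooth_real :: "(real \<Rightarrow> real) \<Rightarrow> bool" where
  smooth_flat: "smooth_real (flat n)"
| smooth_const: "smooth_real (\<lambda>x. c)"
| smooth_add: "smooth_real f \<Longrightarrow> smooth_real g \<Longrightarrow> smooth_real (\<lambda>x. f x + g x)"
| smooth_mult: "smooth_real f \<Longrightarrow> smooth_real g \<Longrightarrow> smooth_real (\<lambda>x. f x * g x)"
| smooth_affine: "smooth_real f \<Longrightarrow> smooth_real (\<lambda>x. f (a * x + b))"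
| smooth_antideriv: "(\<And>x. (f has_real_derivative g x) (at x)) \<Longrightarrow> smooth_real g \<Longrightarrow> smooth_real f"

lemma smooth_cmult: "smooth_real f \<Longrightarrow> smooth_real (\<lambda>x. c * f x)"
  by (intro smooth_mult smooth_const)

lemma smooth_diff: "smooth_real f \<Longrightarrow> smooth_real g \<Longrightarrow> smooth_real (\<lambda>x. f x - g x)"
  using smooth_add[of f "\<lambda>x. (-1) * g x"] smooth_cmult[of g "-1"] by simp

lemma smooth_real_deriv:
  assumes "smooth_real f"
  shows "\<exists>f'. smooth_real f' \<and> (\<forall>x. (f has_real_derivative f' x) (at x))"
  using assms
proof induction
  case (smooth_flat n)
  show ?case
    by (intro exI[of _ "\<lambda>x. flat (n + 2) x - real n * flat (n + 1) x"] conjI allI flat_has_derivative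
        smooth_diff smooth_cmult smooth_real.smooth_flat)
next
  case (smooth_const c)
  show ?case by (intro exI[of _ "\<lambda>x. 0"]) (auto intro: smooth_real.smooth_const)
next
  case (smooth_add f g)
  then obtain f' g' where "smooth_real f'" "smooth_real g'" "\<forall>x. (f has_real_derivative f' x) (at x)"
    "\<forall>x. (g has_real_derivative g' x) (at x)" by blast
  then show ?case
    by (intro exI[of _ "\<lambda>x. f' x + g' x"]) (auto intro: smooth_real.smooth_add DERIV_add)
next
  case (smooth_mult f g)
  then obtain f' g' where "smooth_real f'" "smooth_real g'" "\<forall>x. (f has_real_derivative f' x) (at x)"
    "\<forall>x. (g has_real_derivative g' x) (at x)" by blast
  then show ?case using smooth_mult
    by (intro exI[of _ "\<lambda>x. f' x * g x + g' x * f x"])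
       (auto intro!: smooth_real.smooth_add smooth_real.smooth_mult DERIV_mult)
next
  case (smooth_affine f a b)
  then obtain f' where f': "smooth_real f'" "\<forall>x. (f has_real_derivative f' x) (at x)" by blast
  have "((\<lambda>x. f (a * x + b)) has_real_derivative a * f' (a * x + b)) (at x)" for x
  proof -
    have "((\<lambda>x. a * x + b) has_real_derivative a) (at x)" by (auto intro!: derivative_eq_intros)
    then show ?thesis using DERIV_chain2[of f "f' (a * x + b)" "\<lambda>x. a * x + b" x a UNIV] f'(2)
      by (simp add: mult.commute[of a "f' _"])
  qed
  then show ?case
    using f'(1) by (intro exI[of _ "\<lambda>x. a * f' (a * x + b)"] conjI smooth_cmult smooth_real.smooth_affine) auto
next
  case (smooth_antideriv f g)
  then show ?case by blast
qed

lemma smooth_real_continuous: "smooth_real f \<Longrightarrow> continuous_on S f"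
  using smooth_real_deriv by (meson DERIV_isCont continuous_at_imp_continuous_on)

section \<open>A mollifier and its first and second antiderivatives\<close>

definition bump :: "real \<Rightarrow> real" where
  "bump x = flat 0 (1 + x) * flat 0 (1 - x)"

definition moll :: "real \<Rightarrow> real" where
  "moll x = bump x / integral {-1..1} bump"

text \<open>The lower limit lies strictly to the left of the support [-1, 1] of \<open>moll\<close>:
  a point is either in the region where the integral is 0 or interior to the range of
  integration.\<close>

definition step :: "real \<Rightarrow> real" where
  "step x = integral {-2..x} moll"

definition ramp :: "real \<Rightarrow> real" where
  "ramp x = integral {-2..x} step"

lemma smooth_bump: "smooth_real bump"
proof -
  have "smooth_real (\<lambda>x. flat 0 (1 * x + 1) * flat 0 ((-1) * x + 1))"
    by (intro smooth_mult smooth_affine smooth_flat)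
  moreover have "bump = (\<lambda>x. flat 0 (1 * x + 1) * flat 0 ((-1) * x + 1))"
    by (simp add: bump_def fun_eq_iff add.commute)
  ultimately show ?thesis by simp
qed

lemma smooth_moll: "smooth_real moll"
proof -
  have "moll = (\<lambda>x. (1 / integral {-1..1} bump) * bump x)" by (simp add: moll_def fun_eq_iff)
  then show ?thesis using smooth_cmult[OF smooth_bump] by metis
qed

lemma bump_integral_pos: "0 < integral {-1..1} bump"
proof -
  have cont: "continuous_on {-1..1} bump" by (rule smooth_real_continuous[OF smooth_bump])
  have "integral {-1..1} bump \<noteq> 0"
  proof
    assume "integral {-1..1} bump = 0"
    then have "\<forall>x\<in>{-1..1}. bump x = 0"
      using integral_eq_0_iff[of "-1" 1 bump] cont by (auto simp: bump_def)
    then have "bump 0 = 0" by auto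
    then show False by (simp add: bump_def flat_def)
  qed
  moreover have "0 \<le> integral {-1..1} bump"
    by (intro integral_nonneg integrable_continuous_real cont) (auto simp: bump_def)
  ultimately show ?thesis by simp
qed

lemma moll_nonneg [simp]: "0 \<le> moll x"
  using bump_integral_pos by (simp add: moll_def bump_def)

lemma moll_eq_0: "1 \<le> \<bar>x\<bar> \<Longrightarrow> moll x = 0"
  by (auto simp: moll_def bump_def flat_def abs_if split: if_splits)

lemma moll_minus: "moll (- x) = moll x"
  by (simp add: moll_def bump_def mult.commute)

lemma has_derivative_integral_from:
  assumes g: "continuous_on UNIV g" and 0: "\<And>x. x \<le> -1 \<Longrightarrow> g x = 0"
  shows "((\<lambda>x. integral {-2..x} g) has_real_derivative g x) (at x)" "x \<le> -1 \<Longrightarrow> integral {-2..x} g = 0"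
proof -
  have zero: "integral {-2..x} g = 0" if "x \<le> -1" for x
  proof -
    have "integral {-2..x} g = integral {-2..x} (\<lambda>x. 0)" using that by (intro integral_cong 0) auto
    then show ?thesis by simp
  qed
  show "x \<le> -1 \<Longrightarrow> integral {-2..x} g = 0" by (rule zero)
  show "((\<lambda>x. integral {-2..x} g) has_real_derivative g x) (at x)"
  proof (cases "x < -1")
    case True
    have "((\<lambda>x. 0) has_real_derivative 0) (at x)" by simp
    then have "((\<lambda>x. integral {-2..x} g) has_real_derivative 0) (at x)"
      by (rule has_field_derivative_transform_within_open[of _ _ _ "{..<-1}"]) (use True zero in auto)
    then show ?thesis using True 0 by simp
  next
    case False
    have "((\<lambda>x. integral {-2..x} g) has_real_derivative g x) (at x within {-2..x+1})"
      using False by (intro integral_has_real_derivative continuous_on_subset[OF g]) auto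
    moreover have "at x within {-2..x+1} = at x"
      using False by (intro at_within_interior) auto
    ultimately show ?thesis by simp
  qed
qed

lemma step_deriv: "(step has_real_derivative moll x) (at x)"
  and step_eq_0: "x \<le> -1 \<Longrightarrow> step x = 0"
  using has_derivative_integral_from[of moll x] smooth_real_continuous[OF smooth_moll] moll_eq_0
  by (auto simp: step_def[abs_def])

lemma smooth_step: "smooth_real step"
  by (rule smooth_antideriv[OF step_deriv smooth_moll])

lemma ramp_deriv: "(ramp has_real_derivative step x) (at x)"
  and ramp_eq_0: "x \<le> -1 \<Longrightarrow> ramp x = 0"
  using has_derivative_integral_from[of step x] smooth_real_continuous[OF smooth_step] step_eq_0
  by (auto simp: ramp_def[abs_def])

lemma smooth_ramp: "smooth_real ramp"
  by (rule smooth_antideriv[OF ramp_deriv smooth_step])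

lemma deriv_zero_eq:
  fixes f :: "real \<Rightarrow> real"
  assumes "\<And>x. (f has_real_derivative 0) (at x)"
  shows "f x = f y"
  using DERIV_isconst_all[of f x y] assms by blast

lemma step_mono: "x \<le> y \<Longrightarrow> step x \<le> step y"
  by (rule DERIV_nonneg_imp_nondecreasing[of x y step]) (use step_deriv moll_nonneg in blast)+

lemma step_1: "step 1 = 1"
proof -
  have "step 1 = integral {-2..-1} moll + integral {-1..1} moll"
    unfolding step_def
    by (rule Henstock_Kurzweil_Integration.integral_combine[symmetric])
       (auto intro!: integrable_continuous_real smooth_real_continuous smooth_moll)
  also have "integral {-2..-1} moll = 0" using step_eq_0[of "-1"] by (simp add: step_def)
  also have "integral {-1..1} moll = 1"
  proof -
    have "moll = (\<lambda>x. bump x * (1 / integral {-1..1} bump))" by (simp add: moll_def fun_eq_iff)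
    then have "integral {-1..1} moll = integral {-1..1} (\<lambda>x. bump x * (1 / integral {-1..1} bump))" by simp
    also have "\<dots> = integral {-1..1} bump * (1 / integral {-1..1} bump)" by (rule integral_mult_left)
    also have "\<dots> = 1" using bump_integral_pos by simp
    finally show ?thesis .
  qed
  finally show ?thesis by simp
qed

lemma step_eq_1: "1 \<le> x \<Longrightarrow> step x = 1"
proof -
  assume x: "1 \<le> x"
  have "step x = step 1"
  proof (cases "x = 1")
    case False
    then show ?thesis using x
      by (intro DERIV_isconst2[of 1 x step])
         (auto simp: moll_eq_0 intro!: smooth_real_continuous smooth_step DERIV_cong[OF step_deriv])
  qed simp
  then show ?thesis using step_1 by simp
qed

lemma step_nonneg [simp]: "0 \<le> step x"
  using step_mono[of "min x (-1)" x] step_eq_0[of "min x (-1)"] by simp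

lemma step_le_1 [simp]: "step x \<le> 1"
  using step_mono[of x "max x 1"] step_eq_1[of "max x 1"] by simp

lemma step_minus: "step x + step (- x) = 1"
proof -
  have "((\<lambda>x. step x + step (- x)) has_real_derivative 0) (at x)" for x
    using moll_minus[of x]
    by (auto intro!: derivative_eq_intros step_deriv DERIV_chain2[OF step_deriv])
  then have "step x + step (- x) = step 1 + step (- 1)" by (rule deriv_zero_eq)
  then show ?thesis by (simp add: step_1 step_eq_0)
qed

text \<open>Because \<open>moll\<close> is even there is no additive constant: ramp x - ramp (-x) -
  x has derivative step x + step (-x) - 1 = 0 and vanishes at 0.\<close>

lemma ramp_eq: "1 \<le> x \<Longrightarrow> ramp x = x"
proof -
  assume x: "1 \<le> x"
  have "((\<lambda>x. ramp x - ramp (- x) - x) has_real_derivative 0) (at x)" for x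
    using step_minus[of x]
    by (auto intro!: derivative_eq_intros ramp_deriv DERIV_chain2[OF ramp_deriv])
  then have "ramp x - ramp (- x) - x = ramp 0 - ramp (- 0) - 0" by (rule deriv_zero_eq)
  then show ?thesis using ramp_eq_0[of "-x"] x by simp
qed

lemma moll_bounded: "\<exists>C>0. \<forall>x. \<bar>moll x\<bar> \<le> C"
proof -
  have "compact (moll ` {-1..1})"
    by (intro compact_continuous_image smooth_real_continuous smooth_moll) auto
  then have "bounded (moll ` {-1..1})" by (rule compact_imp_bounded)
  then obtain C where C: "\<And>x. x \<in> {-1..1} \<Longrightarrow> \<bar>moll x\<bar> \<le> C"
    unfolding bounded_iff by (metis imageI real_norm_def)
  have "\<bar>moll x\<bar> \<le> max C 1" for x
    using C[of x] moll_eq_0[of x] by (cases "x \<in> {-1..1}") (auto simp: abs_if split: if_splits)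
  then show ?thesis by (intro exI[of _ "max C 1"]) auto
qed

lemma has_bounded_deriv_moll: "\<exists>m' C. (\<forall>x. (moll has_real_derivative m' x) (at x)) \<and> (\<forall>x. \<bar>m' x\<bar> \<le> C)"
proof -
  obtain m' where m': "smooth_real m'" "\<And>x. (moll has_real_derivative m' x) (at x)"
    using smooth_real_deriv[OF smooth_moll] by blast
  have "compact (m' ` {-1..1})"
    by (intro compact_continuous_image smooth_real_continuous m') auto
  then have "bounded (m' ` {-1..1})" by (rule compact_imp_bounded)
  then obtain C where C: "\<And>x. x \<in> {-1..1} \<Longrightarrow> \<bar>m' x\<bar> \<le> C"
    unfolding bounded_iff by (metis imageI real_norm_def)
  have "m' x = 0" if "1 < \<bar>x\<bar>" for x
  proof -
    have "open {x::real. 1 < \<bar>x\<bar>}" by (intro open_Collect_less continuous_intros)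
    then have "(moll has_real_derivative 0) (at x)"
      using that moll_eq_0 DERIV_const[of 0 "at x"]
      by (intro has_field_derivative_transform_within_open[of "\<lambda>_. 0" 0 x "{x. 1 < \<bar>x\<bar>}" moll]) auto
    then show ?thesis using m'(2) DERIV_unique by blast
  qed
  then have "\<bar>m' x\<bar> \<le> max C 0" for x
    using C[of x] by (cases "1 < \<bar>x\<bar>") (auto simp: not_less abs_le_iff le_max_iff_disj)
  then show ?thesis using m'(2) by blast
qed

text \<open>A plateau made of two opposite steps, equal to 1 on [-1, 1] and to 0 outside (-2,
  2).\<close>

definition cutoff :: "real \<Rightarrow> real" where
  "cutoff t = step (3 - 2 * t) + step (3 + 2 * t) - 1"

lemma cutoff_eq_1: "\<bar>t\<bar> \<le> 1 \<Longrightarrow> cutoff t = 1"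
  by (simp add: cutoff_def step_eq_1 abs_le_iff)

lemma cutoff_eq_0: "2 \<le> \<bar>t\<bar> \<Longrightarrow> cutoff t = 0"
  by (cases "0 \<le> t") (simp_all add: cutoff_def step_eq_1 step_eq_0)

lemma cutoff_abs_le: "\<bar>cutoff t\<bar> \<le> 1"
  by (cases "0 \<le> t") (simp_all add: cutoff_def step_eq_1)

text \<open>The mean value theorem twice, first for the increment f (x + h) - f x as a function of
  x.\<close>

lemma second_difference_bound:
  fixes f f' f'' :: "real \<Rightarrow> real"
  assumes 1: "\<And>x. (f has_real_derivative f' x) (at x)" and 2: "\<And>x. (f' has_real_derivative f'' x) (at x)"
    and B: "\<And>x. \<bar>f'' x\<bar> \<le> B" and h: "0 \<le> h"
  shows "\<bar>f (t + 2 * h) - 2 * f (t + h) + f t\<bar> \<le> B * h\<^sup>2"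
proof (cases "h = 0")
  case False
  then have h: "0 < h" using h by simp
  define g where "g x = f (x + h) - f x" for x
  have "\<exists>z. t < z \<and> z < t + h \<and> g (t + h) - g t = (t + h - t) * (f' (z + h) - f' z)"
    unfolding g_def using h
    by (intro MVT2) (auto intro!: derivative_eq_intros 1 DERIV_chain2[OF 1])
  then obtain z where z: "g (t + h) - g t = h * (f' (z + h) - f' z)" by auto
  have "\<exists>w. z < w \<and> w < z + h \<and> f' (z + h) - f' z = (z + h - z) * f'' w"
    using h by (intro MVT2) (auto intro!: 2)
  then obtain w where "f' (z + h) - f' z = h * f'' w" by auto
  then have "g (t + h) - g t = h\<^sup>2 * f'' w" using z by (simp add: power2_eq_square)
  moreover have "\<bar>h\<^sup>2 * f'' w\<bar> \<le> B * h\<^sup>2" using mult_right_mono[OF B[of w], of "h\<^sup>2"] by (simp add: abs_mult mult.commute)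
  moreover have "g (t + h) - g t = f (t + 2 * h) - 2 * f (t + h) + f t" by (simp add: g_def algebra_simps)
  ultimately show ?thesis by simp
qed simp

lemma first_difference_bound:
  fixes f f' :: "real \<Rightarrow> real"
  assumes 1: "\<And>x. (f has_real_derivative f' x) (at x)" and B: "\<And>x. \<bar>f' x\<bar> \<le> B" and h: "0 \<le> h"
  shows "\<bar>f (t + h) - f t\<bar> \<le> B * h"
proof (cases "h = 0")
  case False
  then have "\<exists>w. t < w \<and> w < t + h \<and> f (t + h) - f t = (t + h - t) * f' w"
    using h by (intro MVT2) (auto intro!: 1)
  then obtain w where "f (t + h) - f t = h * f' w" by auto
  then show ?thesis using mult_right_mono[OF B[of w], of h] h by (simp add: abs_mult mult.commute)
qed simp

lemma cutoff_differences:
  "\<exists>C\<ge>1. \<forall>t h. 0 \<le> h \<longrightarrow> \<bar>cutoff (t + h) - cutoff t\<bar> \<le> C * h \<and>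
      \<bar>cutoff (t + 2 * h) - 2 * cutoff (t + h) + cutoff t\<bar> \<le> C * h\<^sup>2"
proof -
  obtain C0 where C0: "\<And>x. \<bar>moll x\<bar> \<le> C0" using moll_bounded by blast
  obtain m' C1 where m': "\<And>x. (moll has_real_derivative m' x) (at x)" and C1: "\<And>x. \<bar>m' x\<bar> \<le> C1"
    using has_bounded_deriv_moll by blast
  define f' where "f' t = - 2 * moll (3 - 2 * t) + 2 * moll (3 + 2 * t)" for t
  define f'' where "f'' t = 4 * m' (3 - 2 * t) + 4 * m' (3 + 2 * t)" for t
  have 1: "(cutoff has_real_derivative f' t) (at t)" for t
    unfolding cutoff_def[abs_def] f'_def
    by (auto intro!: derivative_eq_intros DERIV_chain2[OF step_deriv])
  have 2: "(f' has_real_derivative f'' t) (at t)" for t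
    unfolding f'_def[abs_def] f''_def
    by (auto intro!: derivative_eq_intros DERIV_chain2[OF m'])
  define C where "C = max 1 (max (4 * C0) (8 * C1))"
  have B1: "\<bar>f' t\<bar> \<le> C" for t using C0[of "3 - 2 * t"] C0[of "3 + 2 * t"] unfolding f'_def C_def by linarith
  have B2: "\<bar>f'' t\<bar> \<le> C" for t using C1[of "3 - 2 * t"] C1[of "3 + 2 * t"] unfolding f''_def C_def by linarith
  show ?thesis
    using first_difference_bound[OF 1 B1] second_difference_bound[OF 1 2 B2]
    by (intro exI[of _ C]) (auto simp: C_def)
qed

subsection \<open>Extension from a line\<close>

definition fdiff :: "(int \<Rightarrow> real) \<Rightarrow> int \<Rightarrow> real" where
  "fdiff f = (\<lambda>x. f (x + 1) - f x)"

text \<open>The intervals are symmetric about x so that the first-order term drops out: a change of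
  length alters the mean only through differences of first differences. A one-sided average would
  drift with the slope of f.\<close>

definition cesaro :: "(int \<Rightarrow> real) \<Rightarrow> int \<Rightarrow> nat \<Rightarrow> real" where
  "cesaro f x n = (\<Sum>j<n. (f (x + int j) + f (x - int j)) / 2) / real n"

definition line_ext :: "(int \<Rightarrow> real) \<Rightarrow> lattice_fun" where
  "line_ext f = (\<lambda>x y. cesaro f x (Suc (nat \<bar>y\<bar>)))"

text \<open>The increment from i - 1 to i of the symmetric mean (f (x + i) + f (x - i)) / 2, which
  is half a difference of first differences at distance 2 i - 1.\<close>

definition odd_diff :: "(int \<Rightarrow> real) \<Rightarrow> int \<Rightarrow> nat \<Rightarrow> real" where
  "odd_diff f x i = (fdiff f (x + int i - 1) - fdiff f (x - int i)) / 2"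

lemma line_ext_0: "line_ext f x 0 = f x"
  by (simp add: line_ext_def cesaro_def)

lemma dx_line_ext: "dx (line_ext f) = line_ext (fdiff f)"
proof (intro ext)
  fix x y
  show "dx (line_ext f) x y = line_ext (fdiff f) x y"
    unfolding dx_def line_ext_def cesaro_def diff_divide_distrib[symmetric] sum_subtractf[symmetric]
    by (intro arg_cong2[where f="(/)"] sum.cong refl) (simp add: fdiff_def field_simps)
qed

text \<open>Both half-sums telescope, leaving only boundary values of v.\<close>

lemma cesaro_shift:
  assumes "1 \<le> n"
  shows "cesaro v (x + 1) n - cesaro v x n = ((v (x + int n) - v x) + (v (x + 1) - v (x + 1 - int n))) / (2 * real n)"
proof -
  have "(\<Sum>j<n. (v (x + 1 + int j) + v (x + 1 - int j)) / 2) - (\<Sum>j<n. (v (x + int j) + v (x - int j)) / 2)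
     = ((v (x + int n) - v x) + (v (x + 1) - v (x + 1 - int n))) / 2" for n
    by (induction n) (auto simp: field_simps)
  from this[of n] show ?thesis
    unfolding cesaro_def diff_divide_distrib[symmetric] by (simp only: divide_divide_eq_left)
qed

lemma cesaro_Suc:
  assumes "1 \<le> n"
  shows "cesaro v x (Suc n) - cesaro v x n =
    (\<Sum>j<n. ((v (x + int n) - v (x + int j)) + (v (x - int n) - v (x - int j))) / 2) / (real n * (real n + 1))"
proof -
  define e where "e j = (v (x + int j) + v (x - int j)) / 2" for j :: nat
  have "cesaro v x (Suc n) - cesaro v x n = ((\<Sum>j<n. e j) + e n) / (real n + 1) - (\<Sum>j<n. e j) / real n"
    by (simp add: cesaro_def e_def algebra_simps)
  also have "\<dots> = (real n * e n - (\<Sum>j<n. e j)) / (real n * (real n + 1))"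
    using assms by (simp add: divide_simps) (simp add: algebra_simps)
  also have "real n * e n - (\<Sum>j<n. e j) = (\<Sum>j<n. e n - e j)" by (simp add: sum_subtractf)
  also have "\<dots> = (\<Sum>j<n. ((v (x + int n) - v (x + int j)) + (v (x - int n) - v (x - int j))) / 2)"
    by (intro sum.cong refl) (simp add: e_def field_simps)
  finally show ?thesis .
qed

text \<open>Summation by parts in \<open>cesaro_Suc\<close>: the deviations of the newest symmetric
  mean from the n earlier ones contain the i-th increment i times.\<close>

lemma cesaro_Suc_odd_diff:
  assumes "1 \<le> n"
  shows "cesaro f x (Suc n) - cesaro f x n = (\<Sum>i=1..n. real i * odd_diff f x i) / (real n * (real n + 1))"
proof -
  define e where "e j = (f (x + int j) + f (x - int j)) / 2" for j :: nat
  have e: "e (Suc i) - e i = odd_diff f x (Suc i)" for i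
    by (simp add: e_def odd_diff_def fdiff_def field_simps)
  have "(\<Sum>j<n. e n - e j) = (\<Sum>i=1..n. real i * odd_diff f x i)" for n
  proof (induction n)
    case (Suc n)
    have "(\<Sum>j<Suc n. e (Suc n) - e j) = (\<Sum>j<n. e n - e j) + real (Suc n) * (e (Suc n) - e n)"
      by (simp add: sum_subtractf algebra_simps)
    then show ?case using Suc e[of n] by simp
  qed simp
  moreover have "(\<Sum>j<n. ((f (x + int n) - f (x + int j)) + (f (x - int n) - f (x - int j))) / 2) = (\<Sum>j<n. e n - e j)"
    by (intro sum.cong refl) (simp add: e_def field_simps)
  ultimately show ?thesis unfolding cesaro_Suc[OF assms] by simp
qed

lemma cesaro_second_diff:
  assumes "1 \<le> n"
  shows "\<bar>cesaro f x (n + 2) - 2 * cesaro f x (n + 1) + cesaro f x n\<bar>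
    \<le> \<bar>odd_diff f x (n + 1)\<bar> / real (n + 1) + 2 / (real (n + 1))\<^sup>2 * (\<Sum>i=1..n+1. \<bar>odd_diff f x i\<bar>)"
proof -
  define G where "G = (\<Sum>i=1..n. real i * odd_diff f x i)"
  define a where "a = odd_diff f x (n + 1)"
  have 1: "cesaro f x (n + 1) - cesaro f x n = G / (real n * (real n + 1))"
    using cesaro_Suc_odd_diff[OF assms] by (simp add: G_def)
  have 2: "cesaro f x (n + 2) - cesaro f x (n + 1) = (G + (real n + 1) * a) / ((real n + 1) * (real n + 2))"
    using cesaro_Suc_odd_diff[of "Suc n" f x] by (simp add: G_def a_def algebra_simps)
  have G: "\<bar>G\<bar> \<le> real n * (\<Sum>i=1..n+1. \<bar>odd_diff f x i\<bar>)"
  proof -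
    have "\<bar>G\<bar> \<le> (\<Sum>i=1..n. \<bar>real i * odd_diff f x i\<bar>)" unfolding G_def by (rule sum_abs)
    also have "\<dots> \<le> (\<Sum>i=1..n. real n * \<bar>odd_diff f x i\<bar>)"
      by (intro sum_mono) (auto simp: abs_mult intro!: mult_right_mono)
    also have "\<dots> \<le> (\<Sum>i=1..n+1. real n * \<bar>odd_diff f x i\<bar>)" by (intro sum_mono2) auto
    finally show ?thesis by (simp only: sum_distrib_left)
  qed
  \<comment> \<open>The two occurrences of G nearly cancel; the remainder 2 G / (n (n+1) (n+2))
    gains one power of n over each of them.\<close>
  have "cesaro f x (n + 2) - 2 * cesaro f x (n + 1) + cesaro f x n = a / (real n + 2) - 2 * G / (real n * (real n + 1) * (real n + 2))"
  proof -
    have "(G + (real n + 1) * a) / ((real n + 1) * (real n + 2)) - G / (real n * (real n + 1))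
       = a / (real n + 2) - 2 * G / (real n * (real n + 1) * (real n + 2))"
      using assms by (simp add: divide_simps) (simp add: algebra_simps)
    then show ?thesis using 1 2 by linarith
  qed
  also have "\<bar>\<dots>\<bar> \<le> \<bar>a\<bar> / (real n + 2) + 2 * \<bar>G\<bar> / (real n * (real n + 1) * (real n + 2))"
    by (rule order_trans[OF abs_triangle_ineq4]) (simp add: abs_mult abs_divide)
  also have "\<bar>a\<bar> / (real n + 2) \<le> \<bar>a\<bar> / real (n + 1)" by (intro divide_left_mono) auto
  also have "2 * \<bar>G\<bar> / (real n * (real n + 1) * (real n + 2)) \<le> 2 / (real (n + 1))\<^sup>2 * (\<Sum>i=1..n+1. \<bar>odd_diff f x i\<bar>)"
  proof -
    have "2 * \<bar>G\<bar> / (real n * (real n + 1) * (real n + 2)) \<le> 2 * (real n * (\<Sum>i=1..n+1. \<bar>odd_diff f x i\<bar>)) / (real n * (real n + 1) * (real n + 2))"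
      using G by (intro divide_right_mono mult_left_mono) auto
    also have "\<dots> = 2 * (\<Sum>i=1..n+1. \<bar>odd_diff f x i\<bar>) / ((real n + 1) * (real n + 2))" using assms by simp
    also have "\<dots> \<le> 2 * (\<Sum>i=1..n+1. \<bar>odd_diff f x i\<bar>) / ((real n + 1) * (real n + 1))"
      by (intro divide_left_mono mult_left_mono mult_nonneg_nonneg sum_nonneg) auto
    finally show ?thesis by (simp add: power2_eq_square add.commute)
  qed
  finally show ?thesis by (simp add: a_def)
qed

definition ext_dy_bound :: "(int \<Rightarrow> real) \<Rightarrow> int \<Rightarrow> nat \<Rightarrow> real" where
  "ext_dy_bound f x n = \<bar>odd_diff f x n\<bar> / real n + 2 / (real n)\<^sup>2 * (\<Sum>i=1..n. \<bar>odd_diff f x i\<bar>)"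

lemma dy_dy_line_ext: "\<bar>dy (dy (line_ext f)) x y\<bar> \<le> ext_dy_bound f x (Suc (nat \<bar>y + 1\<bar>))"
proof -
  have eq: "dy (dy (line_ext f)) x y = cesaro f x (Suc (nat \<bar>y + 2\<bar>)) - 2 * cesaro f x (Suc (nat \<bar>y + 1\<bar>)) + cesaro f x (Suc (nat \<bar>y\<bar>))"
    by (simp add: dy_def line_ext_def algebra_simps)
  consider "0 \<le> y" | "y = -1" | "y < -1" by linarith
  then show ?thesis
  proof cases
    case 1
    then obtain k where "y = int k" using nonneg_int_cases by blast
    then show ?thesis unfolding eq using cesaro_second_diff[of "Suc k" f x]
      by (simp add: ext_dy_bound_def nat_add_distrib)
  next
    \<comment> \<open>The stencil straddles row 0. By the symmetry in y the second difference is
      twice a first difference, and the symmetric average turns that into a single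
      \<open>odd_diff\<close>.\<close>
    case 2
    have "cesaro f x (Suc 1) - cesaro f x 1 = odd_diff f x 1 / 2"
      using cesaro_Suc_odd_diff[of 1 f x] by simp
    then have "dy (dy (line_ext f)) x y = odd_diff f x 1" unfolding eq using 2 by simp
    then show ?thesis using 2 by (simp add: ext_dy_bound_def)
  next
    case 3
    define k where "k = nat (- y - 2)"
    have k: "y = - int k - 2" using 3 by (simp add: k_def)
    have nats: "nat \<bar>y + 2\<bar> = k" "nat \<bar>y + 1\<bar> = k + 1" "nat \<bar>y\<bar> = k + 2" using k by auto
    moreover have "cesaro f x (Suc k) - 2 * cesaro f x (Suc (k + 1)) + cesaro f x (Suc (k + 2)) =
        cesaro f x (Suc k + 2) - 2 * cesaro f x (Suc k + 1) + cesaro f x (Suc k)"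
      by simp
    ultimately have "dy (dy (line_ext f)) x y = cesaro f x (Suc k + 2) - 2 * cesaro f x (Suc k + 1) + cesaro f x (Suc k)"
      unfolding eq by simp
    then show ?thesis using cesaro_second_diff[of "Suc k" f x] nats(2)
      by (simp add: ext_dy_bound_def)
  qed
qed

text \<open>n is the smaller of the averaging lengths of the rows y and y + 1. Below row 0 the
  lengths decrease as y grows, hence the absolute values.\<close>

lemma dy_line_ext:
  assumes n: "n = (if 0 \<le> y then Suc (nat y) else nat (- y))"
  shows "\<bar>dy (line_ext v) x y\<bar> = \<bar>cesaro v x (Suc n) - cesaro v x n\<bar>" "1 \<le> n"
proof -
  show "1 \<le> n" using n by auto
  have "nat \<bar>y + 1\<bar> = (if 0 \<le> y then Suc (nat y) else nat (- y) - 1)" by auto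
  moreover have "nat \<bar>y\<bar> = (if 0 \<le> y then nat y else nat (- y))" by auto
  ultimately show "\<bar>dy (line_ext v) x y\<bar> = \<bar>cesaro v x (Suc n) - cesaro v x n\<bar>"
    using n by (auto simp: dy_def line_ext_def abs_minus_commute)
qed

text \<open>Rows above and below 0 share averaging lengths, while within each half the length
  determines the row.\<close>

lemma sum_two_to_one:
  fixes F :: "nat \<Rightarrow> real" and \<phi> :: "int \<Rightarrow> nat"
  assumes "finite S" "\<And>n. 0 \<le> F n" "\<phi> ` S \<subseteq> A" "finite A" "inj_on \<phi> (S \<inter> {0..})" "inj_on \<phi> (S \<inter> {..<0})"
  shows "(\<Sum>y\<in>S. F (\<phi> y)) \<le> 2 * (\<Sum>n\<in>A. F n)"
proof -
  have "(\<Sum>y\<in>S. F (\<phi> y)) = (\<Sum>y\<in>(S \<inter> {0..}) \<union> (S \<inter> {..<0}). F (\<phi> y))"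
    by (rule sum.cong) auto
  also have "\<dots> = (\<Sum>y\<in>S \<inter> {0..}. F (\<phi> y)) + (\<Sum>y\<in>S \<inter> {..<0}. F (\<phi> y))"
    using assms by (intro sum.union_disjoint) auto
  also have "(\<Sum>y\<in>S \<inter> {0..}. F (\<phi> y)) = (\<Sum>n\<in>\<phi> ` (S \<inter> {0..}). F n)"
    using assms by (subst sum.reindex) auto
  also have "(\<Sum>y\<in>S \<inter> {..<0}. F (\<phi> y)) = (\<Sum>n\<in>\<phi> ` (S \<inter> {..<0}). F n)"
    using assms by (subst sum.reindex) auto
  also have "(\<Sum>n\<in>\<phi> ` (S \<inter> {0..}). F n) \<le> (\<Sum>n\<in>A. F n)" using assms by (intro sum_mono2) auto
  also have "(\<Sum>n\<in>\<phi> ` (S \<inter> {..<0}). F n) \<le> (\<Sum>n\<in>A. F n)" using assms by (intro sum_mono2) auto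
  finally show ?thesis by simp
qed

lemma sum_diff_le_shift_sum:
  assumes "finite I" "\<And>x. x \<in> X \<Longrightarrow> x + a \<in> I" "\<And>x. x \<in> X \<Longrightarrow> x + b \<in> I" "b = a + int k"
  shows "(\<Sum>x\<in>X. \<bar>v (x + b) - v (x + a)\<bar> powr p) \<le> shift_sum p I v k"
proof -
  have "(\<Sum>x\<in>X. \<bar>v (x + a + int k) - v (x + a)\<bar> powr p) \<le> (\<Sum>c | c \<in> I \<and> c + int k \<in> I. \<bar>v (c + int k) - v c\<bar> powr p)"
    using assms by (intro sum_shift_le[where f="\<lambda>c. \<bar>v (c + int k) - v c\<bar> powr p"]) (auto simp: add.assoc)
  then show ?thesis using assms(4) by (simp add: shift_sum_def add.assoc)
qed

lemma powr_two_le_4: "p \<le> 2 \<Longrightarrow> 2 powr p \<le> (4::real)"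
  using powr_mono[of p 2 "2::real"] by simp

text \<open>After exchanging the sums, the tail of n powr (-p - 1) from k on is at most 2 k powr
  (-p), the Gagliardo weight at distance k.\<close>

lemma sum_triangle_weight_le:
  fixes q :: "nat \<Rightarrow> real"
  assumes p: "1 \<le> p" and q: "\<And>k. 0 \<le> q k"
  shows "(\<Sum>n=1..Y. real n powr (- p - 1) * (\<Sum>k=1..n. q k)) \<le> 2 * (\<Sum>k=1..Y. q k / real k powr p)"
proof -
  have "(\<Sum>n=1..Y. real n powr (- p - 1) * (\<Sum>k=1..n. q k)) = (\<Sum>n=1..Y. \<Sum>k=1..Y. if k \<le> n then real n powr (- p - 1) * q k else 0)"
  proof (intro sum.cong refl)
    fix n assume "n \<in> {1..Y}"
    then have "(\<Sum>k=1..Y. if k \<le> n then real n powr (- p - 1) * q k else 0) = (\<Sum>k=1..n. real n powr (- p - 1) * q k)"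
      by (intro sum.mono_neutral_cong_right) auto
    then show "real n powr (- p - 1) * (\<Sum>k=1..n. q k) = (\<Sum>k=1..Y. if k \<le> n then real n powr (- p - 1) * q k else 0)"
      by (simp add: sum_distrib_left)
  qed
  also have "\<dots> = (\<Sum>k=1..Y. \<Sum>n=1..Y. if k \<le> n then real n powr (- p - 1) * q k else 0)" by (rule sum.swap)
  also have "\<dots> \<le> (\<Sum>k=1..Y. 2 * (q k / real k powr p))"
  proof (intro sum_mono)
    fix k assume k: "k \<in> {1..Y}"
    have "(\<Sum>n=1..Y. if k \<le> n then real n powr (- p - 1) * q k else 0) = (\<Sum>n=k..Y. real n powr (- p - 1) * q k)"
      using k by (intro sum.mono_neutral_cong_right) auto
    also have "\<dots> = (\<Sum>n=k..Y. real n powr (- p - 1)) * q k" by (simp add: sum_distrib_right)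
    also have "\<dots> \<le> ((1 + 1 / p) * real k powr (- p)) * q k"
      using k p q by (intro mult_right_mono sum_powr_tail_le) auto
    also have "\<dots> \<le> (2 * real k powr (- p)) * q k" using p q by (intro mult_right_mono) auto
    finally show "(\<Sum>n=1..Y. if k \<le> n then real n powr (- p - 1) * q k else 0) \<le> 2 * (q k / real k powr p)"
      by (simp add: powr_minus divide_inverse mult.commute mult.left_commute)
  qed
  finally show ?thesis by (simp add: sum_distrib_left)
qed

text \<open>The converse of the trace inequality. Each second difference of the averages is bounded
  by shift sums of the row differences, which are collected by distance. The constant is 160 = 2 (4
  + 4 + 72), with 2 for the two half-planes and one summand for each kind of second
  difference.\<close>

lemma line_ext_hess_sum_le:
  assumes p: "1 < p" "p < 2" and I: "finite I" and X: "\<And>x j. x \<in> X \<Longrightarrow> \<bar>j\<bar> \<le> Y \<Longrightarrow> x + j \<in> I"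
    and fX: "finite X" and S: "finite S" "\<And>y. y \<in> S \<Longrightarrow> \<bar>y\<bar> + 2 \<le> Y"
  shows "(\<Sum>y\<in>S. \<Sum>x\<in>X. hess p (line_ext f) (x, y)) \<le> 160 * gagliardo p I (fdiff f)"
proof -
  define v where "v = fdiff f"
  define q where "q = shift_sum p I v"
  define Yn where "Yn = nat Y"
  define \<Gamma> where "\<Gamma> = gagliardo p I v"
  have q0: "0 \<le> q k" for k by (simp add: q_def)
  have Y: "int n \<le> Y" if "n \<in> {1..Yn}" for n using that by (auto simp: Yn_def)
  have gag: "(\<Sum>k=1..Yn. q k / real k powr p) \<le> \<Gamma>"
    unfolding q_def \<Gamma>_def by (intro shift_sum_le_gagliardo I) auto
  \<comment> \<open>\<open>odd_diff\<close> involves only the odd distances 2 k - 1; comparing their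
    weights with that of k costs 2 powr p \<le> 4.\<close>
  have gag_odd: "(\<Sum>k=1..Yn. q (2 * k - 1) / real k powr p) \<le> 4 * \<Gamma>"
  proof -
    have "(\<Sum>k=1..Yn. q (2 * k - 1) / real k powr p) \<le> (\<Sum>k=1..Yn. 4 * (q (2 * k - 1) / real (2 * k - 1) powr p))"
    proof (intro sum_mono)
      fix k assume k: "k \<in> {1..Yn}"
      have "real (2 * k - 1) powr p \<le> (2 * real k) powr p" using k p by (intro powr_mono2) auto
      also have "\<dots> \<le> 4 * real k powr p" using p powr_two_le_4[of p] by (simp add: powr_mult mult_right_mono)
      finally have "q (2 * k - 1) / (4 * real k powr p) \<le> q (2 * k - 1) / real (2 * k - 1) powr p"
        using k q0 by (intro divide_left_mono) auto
      then show "q (2 * k - 1) / real k powr p \<le> 4 * (q (2 * k - 1) / real (2 * k - 1) powr p)" by simp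
    qed
    also have "\<dots> = 4 * (\<Sum>j\<in>(\<lambda>k. 2 * k - 1) ` {1..Yn}. q j / real j powr p)"
      by (subst sum.reindex) (auto simp: inj_on_def sum_distrib_left)
    also have "\<dots> \<le> 4 * \<Gamma>"
      unfolding q_def \<Gamma>_def by (intro mult_left_mono shift_sum_le_gagliardo I) auto
    finally show ?thesis .
  qed
  define F1 where "F1 n = (\<Sum>x\<in>X. \<bar>cesaro v (x + 1) n - cesaro v x n\<bar> powr p)" for n
  define F2 where "F2 n = (\<Sum>x\<in>X. \<bar>cesaro v x (Suc n) - cesaro v x n\<bar> powr p)" for n
  define F3 where "F3 n = (\<Sum>x\<in>X. \<bar>ext_dy_bound f x n\<bar> powr p)" for n
  have odd: "(\<Sum>x\<in>X. \<bar>odd_diff f x i\<bar> powr p) \<le> q (2 * i - 1)" if "1 \<le> i" "int i \<le> Y" for i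
  proof -
    have "\<bar>odd_diff f x i\<bar> powr p \<le> \<bar>v (x + (int i - 1)) - v (x + (- int i))\<bar> powr p" for x
      using p by (intro powr_mono2) (auto simp: odd_diff_def v_def add_diff_eq)
    then have "(\<Sum>x\<in>X. \<bar>odd_diff f x i\<bar> powr p) \<le> (\<Sum>x\<in>X. \<bar>v (x + (int i - 1)) - v (x + (- int i))\<bar> powr p)"
      by (rule sum_mono)
    also have "\<dots> \<le> q (2 * i - 1)" unfolding q_def using that
      by (intro sum_diff_le_shift_sum I X) auto
    finally show ?thesis .
  qed
  have 1: "F1 n \<le> 4 * (q n / real n powr p)" if n: "n \<in> {1..Yn}" for n
  proof -
    have "\<bar>cesaro v (x + 1) n - cesaro v x n\<bar> powr p \<le> 2 * (\<bar>v (x + int n) - v (x + 0)\<bar> powr p + \<bar>v (x + 1) - v (x + (1 - int n))\<bar> powr p) / real n powr p" for x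
    proof -
      have n1: "1 \<le> n" using n by simp
      have "\<bar>cesaro v (x + 1) n - cesaro v x n\<bar> powr p \<le> (\<bar>(v (x + int n) - v x) + (v (x + 1) - v (x + 1 - int n))\<bar> / real n) powr p"
        unfolding cesaro_shift[OF n1] using p n1 by (intro powr_mono2) (auto simp: abs_divide divide_simps)
      also have "\<dots> = \<bar>(v (x + int n) - v x) + (v (x + 1) - v (x + 1 - int n))\<bar> powr p / real n powr p"
        by (simp add: powr_divide)
      also have "\<dots> \<le> 2 * (\<bar>v (x + int n) - v (x + 0)\<bar> powr p + \<bar>v (x + 1) - v (x + (1 - int n))\<bar> powr p) / real n powr p"
        using powr_add_le[of p "v (x + int n) - v x" "v (x + 1) - v (x + 1 - int n)"] p
        by (intro divide_right_mono) (auto simp: add_diff_eq)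
      finally show ?thesis .
    qed
    then have "F1 n \<le> (\<Sum>x\<in>X. 2 * (\<bar>v (x + int n) - v (x + 0)\<bar> powr p + \<bar>v (x + 1) - v (x + (1 - int n))\<bar> powr p) / real n powr p)"
      unfolding F1_def by (rule sum_mono)
    also have "\<dots> = 2 * ((\<Sum>x\<in>X. \<bar>v (x + int n) - v (x + 0)\<bar> powr p) + (\<Sum>x\<in>X. \<bar>v (x + 1) - v (x + (1 - int n))\<bar> powr p)) / real n powr p"
      by (simp add: sum.distrib sum_divide_distrib[symmetric] sum_distrib_left)
    also have "\<dots> \<le> 2 * (q n + q n) / real n powr p"
      unfolding q_def using n Y[OF n] by (intro divide_right_mono mult_left_mono add_mono sum_diff_le_shift_sum I X) auto
    finally show ?thesis by simp
  qed
  have 2: "F2 n \<le> 2 * (real n powr (- p - 1) * (\<Sum>k=1..n. q k))" if n: "n \<in> {1..Yn}" for n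
  proof -
    have n1: "1 \<le> n" using n by simp
    have pt: "\<bar>cesaro v x (Suc n) - cesaro v x n\<bar> powr p \<le> real n powr (- p - 1) * 
       (\<Sum>j<n. \<bar>v (x + int n) - v (x + int j)\<bar> powr p + \<bar>v (x + - int j) - v (x + - int n)\<bar> powr p)" for x
    proof -
      define w where "w j = ((v (x + int n) - v (x + int j)) + (v (x - int n) - v (x - int j))) / 2" for j
      have "\<bar>cesaro v x (Suc n) - cesaro v x n\<bar> \<le> \<bar>\<Sum>j<n. w j\<bar> / (real n * real n)"
        unfolding cesaro_Suc[OF n1] w_def[symmetric] abs_divide using n1
        by (intro divide_left_mono) (auto simp: abs_mult)
      then have "\<bar>cesaro v x (Suc n) - cesaro v x n\<bar> powr p \<le> (\<bar>\<Sum>j<n. w j\<bar> / (real n * real n)) powr p"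
        using p by (intro powr_mono2) auto
      also have "\<dots> = \<bar>\<Sum>j<n. w j\<bar> powr p * real n powr (- (2 * p))"
        using n1 by (simp add: powr_divide powr_mult powr_minus_divide powr_add[symmetric])
      also have "\<dots> \<le> (real n powr (p - 1) * (\<Sum>j<n. \<bar>w j\<bar> powr p)) * real n powr (- (2 * p))"
        using powr_sum_le[of "{..<n}" p w] p by (intro mult_right_mono) auto
      also have "\<dots> = real n powr (- p - 1) * (\<Sum>j<n. \<bar>w j\<bar> powr p)"
      proof -
        have "real n powr (p - 1) * real n powr (- (2 * p)) = real n powr (- p - 1)"
          unfolding powr_add[symmetric] by simp
        then show ?thesis by (simp add: mult.commute mult.left_commute)
      qed
      also have "(\<Sum>j<n. \<bar>w j\<bar> powr p) \<le> (\<Sum>j<n. \<bar>v (x + int n) - v (x + int j)\<bar> powr p + \<bar>v (x + - int j) - v (x + - int n)\<bar> powr p)"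
      proof (intro sum_mono)
        fix j
        have "\<bar>w j\<bar> powr p = \<bar>(v (x + int n) - v (x + int j)) + (v (x - int n) - v (x - int j))\<bar> powr p / 2 powr p"
          by (simp add: w_def abs_divide powr_divide)
        also have "\<dots> \<le> 2 * (\<bar>v (x + int n) - v (x + int j)\<bar> powr p + \<bar>v (x - int n) - v (x - int j)\<bar> powr p) / 2 powr p"
          using p by (intro divide_right_mono powr_add_le) auto
        also have "\<dots> \<le> 2 * (\<bar>v (x + int n) - v (x + int j)\<bar> powr p + \<bar>v (x - int n) - v (x - int j)\<bar> powr p) / 2"
          using p powr_mono[of 1 p "2::real"] by (intro divide_left_mono) auto
        finally show "\<bar>w j\<bar> powr p \<le> \<bar>v (x + int n) - v (x + int j)\<bar> powr p + \<bar>v (x + - int j) - v (x + - int n)\<bar> powr p"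
          by (simp add: abs_minus_commute)
      qed
      finally show ?thesis by (simp add: mult_left_mono)
    qed
    have "F2 n \<le> (\<Sum>x\<in>X. real n powr (- p - 1) * (\<Sum>j<n. \<bar>v (x + int n) - v (x + int j)\<bar> powr p + \<bar>v (x + - int j) - v (x + - int n)\<bar> powr p))"
      unfolding F2_def by (intro sum_mono pt)
    also have "\<dots> = real n powr (- p - 1) * (\<Sum>j<n. (\<Sum>x\<in>X. \<bar>v (x + int n) - v (x + int j)\<bar> powr p) + (\<Sum>x\<in>X. \<bar>v (x + - int j) - v (x + - int n)\<bar> powr p))"
      unfolding sum_distrib_left[symmetric] sum.distrib[symmetric] by (subst sum.swap) simp
    also have "\<dots> \<le> real n powr (- p - 1) * (\<Sum>j<n. q (n - j) + q (n - j))"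
      unfolding q_def using n Y[OF n] by (intro mult_left_mono sum_mono add_mono sum_diff_le_shift_sum I X) auto
    also have "(\<Sum>j<n. q (n - j) + q (n - j)) = 2 * (\<Sum>j<n. q (n - j))" by (simp add: sum_distrib_left)
    also have "(\<Sum>j<n. q (n - j)) = (\<Sum>k=1..n. q k)"
      by (rule sum.reindex_bij_witness[of _ "\<lambda>k. n - k" "\<lambda>j. n - j"]) auto
    finally show ?thesis by simp
  qed
  have 3: "F3 n \<le> 2 * (q (2 * n - 1) / real n powr p) + 8 * (real n powr (- p - 1) * (\<Sum>k=1..n. q (2 * k - 1)))" if n: "n \<in> {1..Yn}" for n
  proof -
    have n1: "1 \<le> n" using n by simp
    have pt: "\<bar>ext_dy_bound f x n\<bar> powr p \<le> 2 * (\<bar>odd_diff f x n\<bar> powr p / real n powr p) + 8 * (real n powr (- p - 1) * (\<Sum>i=1..n. \<bar>odd_diff f x i\<bar> powr p))" for x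
    proof -
      have "\<bar>ext_dy_bound f x n\<bar> powr p \<le> 2 * (\<bar>\<bar>odd_diff f x n\<bar> / real n\<bar> powr p + \<bar>2 / (real n)\<^sup>2 * (\<Sum>i=1..n. \<bar>odd_diff f x i\<bar>)\<bar> powr p)"
        unfolding ext_dy_bound_def using p by (intro powr_add_le) auto
      also have "\<bar>\<bar>odd_diff f x n\<bar> / real n\<bar> powr p = \<bar>odd_diff f x n\<bar> powr p / real n powr p"
        by (simp add: abs_divide powr_divide)
      also have "\<bar>2 / (real n)\<^sup>2 * (\<Sum>i=1..n. \<bar>odd_diff f x i\<bar>)\<bar> powr p = 2 powr p * (real n powr (- (2 * p)) * \<bar>\<Sum>i=1..n. \<bar>odd_diff f x i\<bar>\<bar> powr p)"
        using n1 by (simp add: abs_mult abs_divide powr_mult powr_divide power2_eq_square powr_minus_divide powr_add[symmetric])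
      also have "\<bar>\<Sum>i=1..n. \<bar>odd_diff f x i\<bar>\<bar> powr p \<le> real n powr (p - 1) * (\<Sum>i=1..n. \<bar>odd_diff f x i\<bar> powr p)"
        using powr_sum_le[of "{1..n}" p "\<lambda>i. \<bar>odd_diff f x i\<bar>"] p by simp
      also have "real n powr (- (2 * p)) * (real n powr (p - 1) * (\<Sum>i=1..n. \<bar>odd_diff f x i\<bar> powr p)) = real n powr (- p - 1) * (\<Sum>i=1..n. \<bar>odd_diff f x i\<bar> powr p)"
        by (simp add: mult.assoc[symmetric] powr_add[symmetric])
      also have "2 powr p * (real n powr (- p - 1) * (\<Sum>i=1..n. \<bar>odd_diff f x i\<bar> powr p)) \<le> 4 * (real n powr (- p - 1) * (\<Sum>i=1..n. \<bar>odd_diff f x i\<bar> powr p))"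
        using p powr_two_le_4[of p] by (intro mult_right_mono mult_nonneg_nonneg sum_nonneg) auto
      finally show ?thesis by (simp add: mult_left_mono)
    qed
    have "F3 n \<le> (\<Sum>x\<in>X. 2 * (\<bar>odd_diff f x n\<bar> powr p / real n powr p) + 8 * (real n powr (- p - 1) * (\<Sum>i=1..n. \<bar>odd_diff f x i\<bar> powr p)))"
      unfolding F3_def by (intro sum_mono pt)
    also have "\<dots> = 2 * ((\<Sum>x\<in>X. \<bar>odd_diff f x n\<bar> powr p) / real n powr p) + 8 * (real n powr (- p - 1) * (\<Sum>i=1..n. \<Sum>x\<in>X. \<bar>odd_diff f x i\<bar> powr p))"
      unfolding sum.distrib sum_distrib_left[symmetric] sum_divide_distrib[symmetric] by (subst (2) sum.swap) simp
    also have "\<dots> \<le> 2 * (q (2 * n - 1) / real n powr p) + 8 * (real n powr (- p - 1) * (\<Sum>i=1..n. q (2 * i - 1)))"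
      using n Y[OF n] by (intro add_mono mult_left_mono divide_right_mono sum_mono odd) auto
    finally show ?thesis .
  qed
  have G1: "(\<Sum>n=1..Yn. F1 n) \<le> 4 * \<Gamma>"
  proof -
    have "(\<Sum>n=1..Yn. F1 n) \<le> (\<Sum>n=1..Yn. 4 * (q n / real n powr p))" by (intro sum_mono 1)
    also have "\<dots> = 4 * (\<Sum>n=1..Yn. q n / real n powr p)" by (rule sum_distrib_left[symmetric])
    finally show ?thesis using gag by linarith
  qed
  have G2: "(\<Sum>n=1..Yn. F2 n) \<le> 4 * \<Gamma>"
  proof -
    have "(\<Sum>n=1..Yn. F2 n) \<le> (\<Sum>n=1..Yn. 2 * (real n powr (- p - 1) * (\<Sum>k=1..n. q k)))" by (intro sum_mono 2)
    also have "\<dots> = 2 * (\<Sum>n=1..Yn. real n powr (- p - 1) * (\<Sum>k=1..n. q k))" by (simp only: sum_distrib_left)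
    also have "\<dots> \<le> 2 * (2 * \<Gamma>)"
      using sum_triangle_weight_le[of p q Yn] gag p q0 by (intro mult_left_mono) auto
    finally show ?thesis by simp
  qed
  have G3: "(\<Sum>n=1..Yn. F3 n) \<le> 72 * \<Gamma>"
  proof -
    have "(\<Sum>n=1..Yn. F3 n) \<le> (\<Sum>n=1..Yn. 2 * (q (2 * n - 1) / real n powr p) + 8 * (real n powr (- p - 1) * (\<Sum>k=1..n. q (2 * k - 1))))" by (intro sum_mono 3)
    also have "\<dots> = 2 * (\<Sum>n=1..Yn. q (2 * n - 1) / real n powr p) + 8 * (\<Sum>n=1..Yn. real n powr (- p - 1) * (\<Sum>k=1..n. q (2 * k - 1)))"
      by (simp only: sum_distrib_left sum.distrib)
    also have "\<dots> \<le> 2 * (4 * \<Gamma>) + 8 * (2 * (4 * \<Gamma>))"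
      using sum_triangle_weight_le[of p "\<lambda>k. q (2 * k - 1)" Yn] gag_odd p q0 by (intro add_mono mult_left_mono) auto
    finally show ?thesis by simp
  qed
  have "(\<Sum>y\<in>S. \<Sum>x\<in>X. hess p (line_ext f) (x, y)) =
    (\<Sum>y\<in>S. \<Sum>x\<in>X. \<bar>dx (line_ext v) x y\<bar> powr p) + (\<Sum>y\<in>S. \<Sum>x\<in>X. \<bar>dy (line_ext v) x y\<bar> powr p)
     + (\<Sum>y\<in>S. \<Sum>x\<in>X. \<bar>dy (dy (line_ext f)) x y\<bar> powr p)"
  proof -
    have "dx (dy K) = dy (dx K)" for K by (simp add: dx_def dy_def fun_eq_iff)
    then show ?thesis by (simp add: hess_def sum.distrib dx_line_ext v_def)
  qed
  moreover have "(\<Sum>y\<in>S. \<Sum>x\<in>X. \<bar>dx (line_ext v) x y\<bar> powr p) \<le> 2 * (4 * \<Gamma>)"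
  proof -
    have "(\<Sum>y\<in>S. \<Sum>x\<in>X. \<bar>dx (line_ext v) x y\<bar> powr p) = (\<Sum>y\<in>S. F1 (Suc (nat \<bar>y\<bar>)))"
      by (simp add: F1_def dx_def line_ext_def)
    also have "\<dots> \<le> 2 * (\<Sum>n\<in>{1..Yn}. F1 n)"
      using S by (intro sum_two_to_one) (force simp: F1_def Yn_def inj_on_def intro!: sum_nonneg)+
    finally show ?thesis using G1 by simp
  qed
  moreover have "(\<Sum>y\<in>S. \<Sum>x\<in>X. \<bar>dy (line_ext v) x y\<bar> powr p) \<le> 2 * (4 * \<Gamma>)"
  proof -
    have "(\<Sum>y\<in>S. \<Sum>x\<in>X. \<bar>dy (line_ext v) x y\<bar> powr p) = (\<Sum>y\<in>S. F2 (if 0 \<le> y then Suc (nat y) else nat (- y)))"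
      by (simp add: F2_def dy_line_ext(1)[OF refl])
    also have "\<dots> \<le> 2 * (\<Sum>n\<in>{1..Yn}. F2 n)"
      using S by (intro sum_two_to_one) (force simp: F2_def Yn_def inj_on_def intro!: sum_nonneg)+
    finally show ?thesis using G2 by simp
  qed
  moreover have "(\<Sum>y\<in>S. \<Sum>x\<in>X. \<bar>dy (dy (line_ext f)) x y\<bar> powr p) \<le> 2 * (72 * \<Gamma>)"
  proof -
    have "(\<Sum>y\<in>S. \<Sum>x\<in>X. \<bar>dy (dy (line_ext f)) x y\<bar> powr p) \<le> (\<Sum>y\<in>S. F3 (Suc (nat \<bar>y + 1\<bar>)))"
      unfolding F3_def using p dy_dy_line_ext by (intro sum_mono powr_mono2) (auto intro: order_trans[OF dy_dy_line_ext])
    also have "\<dots> \<le> 2 * (\<Sum>n\<in>{1..Yn}. F3 n)"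
      using S by (intro sum_two_to_one) (force simp: F3_def Yn_def inj_on_def intro!: sum_nonneg)+
    finally show ?thesis using G3 by simp
  qed
  ultimately show ?thesis by (simp add: \<Gamma>_def v_def)
qed

section \<open>Reflection beyond the ends of the row and a Poincare inequality\<close>

definition reflect :: "int \<Rightarrow> (int \<Rightarrow> real) \<Rightarrow> int \<Rightarrow> real" where
  "reflect N f x = (if N < x then 2 * f N - f (2 * N - x)
     else if x < -N then 2 * f (-N) - f (-2 * N - x) else f x)"

definition fold_line :: "int \<Rightarrow> int \<Rightarrow> int" where
  "fold_line N x = (if N \<le> x then 2 * N - 1 - x else if x < -N then -2 * N - 1 - x else x)"

text \<open>The odd point reflections of \<open>f\<close> at \<open>N\<close> and \<open>-N\<close> act as even reflections on its differences.\<close>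

lemma fdiff_reflect: "0 < N \<Longrightarrow> fdiff (reflect N f) x = fdiff f (fold_line N x)"
proof -
  assume N: "0 < N"
  consider "N < x" | "x = N" | "- N \<le> x" "x < N" | "x = - N - 1" | "x < - N - 1" by linarith
  then show ?thesis
  proof cases
    case 1
    have "2 * N - (x + 1) = 2 * N - 1 - x" "2 * N - 1 - x + 1 = 2 * N - x" by auto
    then show ?thesis using 1 N by (simp only: fdiff_def reflect_def fold_line_def) simp
  next
    case 5
    have "- 2 * N - (x + 1) = - 2 * N - 1 - x" "- 2 * N - 1 - x + 1 = - 2 * N - x" by auto
    then show ?thesis using 5 N by (simp only: fdiff_def reflect_def fold_line_def) simp
  next
    case 4
    then have "x + 1 = - N" "- 2 * N - x = - N + 1" "- 2 * N - 1 - x = - N" by auto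
    then show ?thesis using 4 N by (simp add: fdiff_def reflect_def fold_line_def)
  qed (use N in \<open>auto simp: fdiff_def reflect_def fold_line_def\<close>)
qed

lemma fold_line_contract: "0 < N \<Longrightarrow> x \<in> {-3 * N..<3 * N} \<Longrightarrow> y \<in> {-3 * N..<3 * N} \<Longrightarrow> \<bar>fold_line N x - fold_line N y\<bar> \<le> \<bar>x - y\<bar>"
  by (auto simp: fold_line_def)

lemma sum_fold_line:
  fixes F :: "int \<Rightarrow> real"
  assumes N: "0 < N"
  shows "(\<Sum>x\<in>{-3 * N..<3 * N}. F (fold_line N x)) = 3 * (\<Sum>i\<in>{-N..<N}. F i)"
proof -
  have "{-3 * N..<3 * N} = {-3 * N..<-N} \<union> ({-N..<N} \<union> {N..<3 * N})" using N by auto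
  then have "(\<Sum>x\<in>{-3 * N..<3 * N}. F (fold_line N x)) = (\<Sum>x\<in>{-3 * N..<-N}. F (fold_line N x))
     + ((\<Sum>x\<in>{-N..<N}. F (fold_line N x)) + (\<Sum>x\<in>{N..<3 * N}. F (fold_line N x)))"
    using N by (simp only:) (subst sum.union_disjoint; force intro: sum.union_disjoint)+
  also have "(\<Sum>x\<in>{-3 * N..<-N}. F (fold_line N x)) = (\<Sum>i\<in>{-N..<N}. F i)"
    by (rule sum.reindex_bij_witness[of _ "\<lambda>i. -2 * N - 1 - i" "\<lambda>i. -2 * N - 1 - i"]) (use N in \<open>auto simp: fold_line_def\<close>)
  also have "(\<Sum>x\<in>{-N..<N}. F (fold_line N x)) = (\<Sum>i\<in>{-N..<N}. F i)"
    by (rule sum.cong) (auto simp: fold_line_def)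
  also have "(\<Sum>x\<in>{N..<3 * N}. F (fold_line N x)) = (\<Sum>i\<in>{-N..<N}. F i)"
    by (rule sum.reindex_bij_witness[of _ "\<lambda>i. 2 * N - 1 - i" "\<lambda>i. 2 * N - 1 - i"]) (use N in \<open>auto simp: fold_line_def\<close>)
  finally show ?thesis by simp
qed

text \<open>Folding shortens distances and hits every index of the row three times, which gives a
  factor 3 in each variable. Pairs with equal fold contribute 0.\<close>

lemma gagliardo_fold_le:
  assumes N: "0 < N" and p: "1 < p"
  shows "gagliardo p {-3 * N..<3 * N} (\<lambda>x. v (fold_line N x)) \<le> 9 * gagliardo p {-N..<N} v"
proof -
  let ?W = "{-3 * N..<3 * N}"
  define g where "g i j = \<bar>v i - v j\<bar> powr p / real_of_int \<bar>i - j\<bar> powr p" for i j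
  have "gagliardo p ?W (\<lambda>x. v (fold_line N x)) \<le> (\<Sum>a\<in>?W. \<Sum>b\<in>?W. g (fold_line N a) (fold_line N b))"
    unfolding gagliardo_def
  proof (intro sum_mono)
    fix a b assume ab: "a \<in> ?W" "b \<in> ?W"
    have le: "\<bar>fold_line N a - fold_line N b\<bar> \<le> \<bar>a - b\<bar>" by (rule fold_line_contract[OF N ab])
    show "\<bar>v (fold_line N a) - v (fold_line N b)\<bar> powr p / real_of_int \<bar>a - b\<bar> powr p \<le> g (fold_line N a) (fold_line N b)"
    proof (cases "fold_line N a = fold_line N b")
      case False
      then have "0 < \<bar>fold_line N a - fold_line N b\<bar>" by simp
      then have "0 < real_of_int \<bar>fold_line N a - fold_line N b\<bar>" by linarith
      moreover have "real_of_int \<bar>fold_line N a - fold_line N b\<bar> \<le> real_of_int \<bar>a - b\<bar>" using le by linarith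
      ultimately show ?thesis unfolding g_def using p
        by (intro divide_left_mono powr_mono2 mult_pos_pos) (auto simp del: of_int_abs)
    qed (simp add: g_def)
  qed
  also have "\<dots> = (\<Sum>a\<in>?W. 3 * (\<Sum>j\<in>{-N..<N}. g (fold_line N a) j))"
    by (intro sum.cong refl sum_fold_line N)
  also have "\<dots> = 3 * (\<Sum>a\<in>?W. (\<Sum>j\<in>{-N..<N}. g (fold_line N a) j))" by (rule sum_distrib_left[symmetric])
  also have "\<dots> = 9 * gagliardo p {-N..<N} v"
    using sum_fold_line[OF N, of "\<lambda>i. \<Sum>j\<in>{-N..<N}. g i j"] by (simp add: gagliardo_def g_def)
  finally show ?thesis .
qed

definition slope :: "int \<Rightarrow> (int \<Rightarrow> real) \<Rightarrow> real" where
  "slope N f = (f N - f (-N)) / real_of_int (2 * N)"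

text \<open>Subtracting the chord slope gives the differences mean zero over the row, as a Poincare
  inequality requires; subtracting the value at 0 then allows values to be recovered from
  differences.\<close>

definition normalized :: "int \<Rightarrow> (int \<Rightarrow> real) \<Rightarrow> int \<Rightarrow> real" where
  "normalized N f x = f x - f 0 - slope N f * real_of_int x"

lemma sum_fdiff: "(\<Sum>x\<in>{a..<a + int n}. fdiff f x) = f (a + int n) - f a"
proof (induction n)
  case (Suc n)
  have "{a..<a + int (Suc n)} = insert (a + int n) {a..<a + int n}" by auto
  then show ?case using Suc by (simp add: fdiff_def add.assoc add.commute[of 1])
qed simp

lemma fdiff_normalized: "fdiff (normalized N f) x = fdiff f x - slope N f"
  by (simp add: fdiff_def normalized_def algebra_simps)

text \<open>A fractional Poincare inequality: a difference minus the mean is the average of its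
  deviations from all others, and distances within the row are at most 2 N.\<close>

lemma sum_normalized_le:
  assumes N: "0 < N" and p: "1 < p"
  shows "(\<Sum>x\<in>{-N..<N}. \<bar>fdiff (normalized N f) x\<bar> powr p) \<le> real_of_int (2 * N) powr (p - 1) * gagliardo p {-N..<N} (fdiff f)"
proof -
  let ?I = "{-N..<N}"
  define v where "v = fdiff f"
  define K where "K = real_of_int (2 * N)"
  have K: "0 < K" using N by (simp add: K_def)
  have card: "real (card ?I) = K" using N by (simp add: K_def)
  have "(\<Sum>b\<in>?I. v b) = f N - f (-N)"
    using sum_fdiff[of f "-N" "nat (2 * N)"] N by (simp add: v_def)
  then have mean: "(\<Sum>b\<in>?I. v b) = K * slope N f" using K unfolding slope_def K_def[symmetric] by simp
  have "\<bar>fdiff (normalized N f) x\<bar> powr p \<le> K powr (p - 1) * (\<Sum>b\<in>?I. \<bar>v x - v b\<bar> powr p / real_of_int \<bar>x - b\<bar> powr p)" if x: "x \<in> ?I" for x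
  proof -
    have "(\<Sum>b\<in>?I. v x - v b) = K * (v x - slope N f)"
      using mean card by (simp add: sum_subtractf right_diff_distrib)
    then have "fdiff (normalized N f) x = (\<Sum>b\<in>?I. v x - v b) / K"
      using K by (simp add: fdiff_normalized v_def)
    then have "\<bar>fdiff (normalized N f) x\<bar> powr p = \<bar>\<Sum>b\<in>?I. v x - v b\<bar> powr p / K powr p"
      using K by (simp add: abs_divide powr_divide)
    also have "\<dots> \<le> (K powr (p - 1) * (\<Sum>b\<in>?I. \<bar>v x - v b\<bar> powr p)) / K powr p"
      using powr_sum_le[of ?I p "\<lambda>b. v x - v b"] p card by (intro divide_right_mono) auto
    also have "\<dots> = K powr (-1) * (\<Sum>b\<in>?I. \<bar>v x - v b\<bar> powr p)"
      using K by (simp add: powr_diff powr_minus field_simps)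
    also have "\<dots> \<le> K powr (-1) * (\<Sum>b\<in>?I. K powr p * (\<bar>v x - v b\<bar> powr p / real_of_int \<bar>x - b\<bar> powr p))"
    proof (intro mult_left_mono sum_mono)
      fix b assume b: "b \<in> ?I"
      show "\<bar>v x - v b\<bar> powr p \<le> K powr p * (\<bar>v x - v b\<bar> powr p / real_of_int \<bar>x - b\<bar> powr p)"
      proof (cases "x = b")
        case False
        then have pos: "0 < real_of_int \<bar>x - b\<bar>" by simp
        have "\<bar>x - b\<bar> \<le> 2 * N" using x b by auto
        then have "real_of_int \<bar>x - b\<bar> \<le> K" unfolding K_def of_int_le_iff .
        then have "real_of_int \<bar>x - b\<bar> powr p \<le> K powr p" using p by (intro powr_mono2) auto
        then have "\<bar>v x - v b\<bar> powr p * real_of_int \<bar>x - b\<bar> powr p \<le> K powr p * \<bar>v x - v b\<bar> powr p"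
          by (subst mult.commute) (intro mult_right_mono, auto)
        then show ?thesis using pos by (simp add: pos_le_divide_eq del: of_int_abs)
      qed simp
    qed simp
    also have "\<dots> = (K powr (-1) * K powr p) * (\<Sum>b\<in>?I. \<bar>v x - v b\<bar> powr p / real_of_int \<bar>x - b\<bar> powr p)"
      by (simp only: sum_distrib_left mult.assoc)
    also have "K powr (-1) * K powr p = K powr (p - 1)" unfolding powr_add[symmetric] by simp
    finally show ?thesis .
  qed
  then have "(\<Sum>x\<in>?I. \<bar>fdiff (normalized N f) x\<bar> powr p) \<le> (\<Sum>x\<in>?I. K powr (p - 1) * (\<Sum>b\<in>?I. \<bar>v x - v b\<bar> powr p / real_of_int \<bar>x - b\<bar> powr p))"
    by (rule sum_mono)
  then show ?thesis by (simp add: gagliardo_def v_def K_def sum_distrib_left[symmetric])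
qed

subsection \<open>Cutoff functions on the lattice\<close>

definition lcutoff :: "real \<Rightarrow> real \<Rightarrow> int \<Rightarrow> lattice_fun" where
  "lcutoff r s a x y = cutoff (real_of_int (x - a) / r) * cutoff (real_of_int y / s)"

text \<open>c is a reciprocal length: one power of it for each difference taken.\<close>

definition cut_bounds :: "real \<Rightarrow> lattice_fun \<Rightarrow> bool" where
  "cut_bounds c \<kappa> \<longleftrightarrow> (\<forall>x y. \<bar>\<kappa> x y\<bar> \<le> 1 \<and> \<bar>dx \<kappa> x y\<bar> \<le> c \<and> \<bar>dy \<kappa> x y\<bar> \<le> c \<and>
     \<bar>dx (dx \<kappa>) x y\<bar> \<le> c\<^sup>2 \<and> \<bar>dx (dy \<kappa>) x y\<bar> \<le> c\<^sup>2 \<and> \<bar>dy (dy \<kappa>) x y\<bar> \<le> c\<^sup>2)"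

text \<open>Since s \<le> r, the vertical scale s is the smaller one and alone controls all
  differences.\<close>

lemma lcutoff_bounds: "\<exists>C\<ge>1. \<forall>r s a. 0 < s \<and> s \<le> r \<longrightarrow> cut_bounds (C / s) (lcutoff r s a)"
proof -
  obtain C where C: "1 \<le> C" "\<And>t h. 0 \<le> h \<Longrightarrow> \<bar>cutoff (t + h) - cutoff t\<bar> \<le> C * h"
     "\<And>t h. 0 \<le> h \<Longrightarrow> \<bar>cutoff (t + 2 * h) - 2 * cutoff (t + h) + cutoff t\<bar> \<le> C * h\<^sup>2"
    using cutoff_differences by blast
  have "cut_bounds (C / s) (lcutoff r s a)" if s: "0 < s" "s \<le> r" for r s a
  proof -
    have r: "0 < r" using s by simp
    define A where "A x = cutoff (real_of_int (x - a) / r)" for x :: int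
    define B where "B y = cutoff (real_of_int y / s)" for y :: int
    have le: "C * (1 / r) \<le> C / s" "C * (1 / r)\<^sup>2 \<le> (C / s)\<^sup>2" "C * (1 / s)\<^sup>2 \<le> (C / s)\<^sup>2"
    proof -
      show 1: "C * (1 / r) \<le> C / s" using s C(1) by (simp add: frac_le)
      have "C * (1 / r)\<^sup>2 \<le> C\<^sup>2 * (1 / r)\<^sup>2" using C(1) by (intro mult_right_mono) (auto simp: power2_eq_square)
      also have "\<dots> = (C * (1 / r))\<^sup>2" by (simp only: power_mult_distrib)
      also have "\<dots> \<le> (C / s)\<^sup>2" using 1 C(1) r by (intro power_mono) auto
      finally show "C * (1 / r)\<^sup>2 \<le> (C / s)\<^sup>2" .
      have "C * (1 / s)\<^sup>2 \<le> C\<^sup>2 * (1 / s)\<^sup>2" using C(1) by (intro mult_right_mono) (auto simp: power2_eq_square)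
      then show "C * (1 / s)\<^sup>2 \<le> (C / s)\<^sup>2" by (simp add: power_mult_distrib power_divide)
    qed
    have A0: "\<bar>A x\<bar> \<le> 1" and B0: "\<bar>B x\<bar> \<le> 1" for x by (auto simp: A_def B_def cutoff_abs_le)
    have A1: "\<bar>A (x + 1) - A x\<bar> \<le> C / s" for x
      using C(2)[of "1 / r" "real_of_int (x - a) / r"] r le by (simp add: A_def add_divide_distrib[symmetric] algebra_simps)
    have A2: "\<bar>A (x + 2) - 2 * A (x + 1) + A x\<bar> \<le> (C / s)\<^sup>2" for x
      using C(3)[of "1 / r" "real_of_int (x - a) / r"] r le by (simp add: A_def add_divide_distrib[symmetric] algebra_simps)
    have B1: "\<bar>B (x + 1) - B x\<bar> \<le> C / s" for x
      using C(2)[of "1 / s" "real_of_int x / s"] s le by (simp add: B_def add_divide_distrib[symmetric])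
    have B2: "\<bar>B (x + 2) - 2 * B (x + 1) + B x\<bar> \<le> (C / s)\<^sup>2" for x
      using C(3)[of "1 / s" "real_of_int x / s"] s le by (simp add: B_def add_divide_distrib[symmetric])
    have prod: "\<bar>\<alpha> * \<beta>\<bar> \<le> a * b" if "\<bar>\<alpha>\<bar> \<le> a" "\<bar>\<beta>\<bar> \<le> b" for \<alpha> \<beta> a b :: real
      unfolding abs_mult using that by (intro mult_mono) auto
    have eq: "lcutoff r s a = (\<lambda>x y. A x * B y)" by (simp add: lcutoff_def A_def B_def fun_eq_iff)
    have d: "dx (\<lambda>x y. A x * B y) x y = (A (x + 1) - A x) * B y"
      "dy (\<lambda>x y. A x * B y) x y = A x * (B (y + 1) - B y)"
      "dx (dx (\<lambda>x y. A x * B y)) x y = (A (x + 2) - 2 * A (x + 1) + A x) * B y"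
      "dx (dy (\<lambda>x y. A x * B y)) x y = (A (x + 1) - A x) * (B (y + 1) - B y)"
      "dy (dy (\<lambda>x y. A x * B y)) x y = A x * (B (y + 2) - 2 * B (y + 1) + B y)" for x y
      by (simp_all add: dx_def dy_def algebra_simps)
    show ?thesis unfolding cut_bounds_def eq d
      using prod[OF A0 B0] prod[OF A1 B0] prod[OF A0 B1] prod[OF A2 B0] prod[OF A1 B1] prod[OF A0 B2]
      by (simp add: power2_eq_square)
  qed
  then show ?thesis using C(1) by blast
qed

text \<open>The discrete product rule. It evaluates \<kappa> and its differences at shifted points,
  which is harmless because their bounds are uniform; all differences of h stay at the point
  itself.\<close>

lemma hess_cut_le:
  assumes p: "1 < p" "p < 2" and c: "cut_bounds c \<kappa>"
  shows "hess p (\<lambda>x y. \<kappa> x y * h x y) (x, y) \<le> 40 * (hess p h (x, y)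
     + c powr p * (\<bar>dx h x y\<bar> powr p + \<bar>dy h x y\<bar> powr p) + (c\<^sup>2) powr p * \<bar>h x y\<bar> powr p)"
proof -
  have b: "\<bar>\<kappa> x y\<bar> \<le> 1" "\<bar>dx \<kappa> x y\<bar> \<le> c" "\<bar>dy \<kappa> x y\<bar> \<le> c" "\<bar>dx (dx \<kappa>) x y\<bar> \<le> c\<^sup>2"
     "\<bar>dx (dy \<kappa>) x y\<bar> \<le> c\<^sup>2" "\<bar>dy (dy \<kappa>) x y\<bar> \<le> c\<^sup>2" for x y
    using c unfolding cut_bounds_def by blast+
  have c0: "0 \<le> c" using b(2)[of x y] by linarith
  have pm: "\<bar>\<alpha> * \<beta>\<bar> powr p \<le> a powr p * \<bar>\<beta>\<bar> powr p" if "\<bar>\<alpha>\<bar> \<le> a" for \<alpha> \<beta> a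
    using that p by (simp add: abs_mult powr_mult mult_right_mono powr_mono2)
  have pm1: "\<bar>\<alpha> * \<beta>\<bar> powr p \<le> \<bar>\<beta>\<bar> powr p" if "\<bar>\<alpha>\<bar> \<le> 1" for \<alpha> \<beta>
    using pm[OF that, of \<beta>] by simp
  have pm2: "\<bar>2 * (\<alpha> * \<beta>)\<bar> powr p \<le> 4 * (a powr p * \<bar>\<beta>\<bar> powr p)" if "\<bar>\<alpha>\<bar> \<le> a" for \<alpha> \<beta> a
  proof -
    have "\<bar>2 * (\<alpha> * \<beta>)\<bar> powr p = 2 powr p * \<bar>\<alpha> * \<beta>\<bar> powr p" by (simp add: abs_mult powr_mult)
    also have "\<dots> \<le> 4 * (a powr p * \<bar>\<beta>\<bar> powr p)" using powr_two_le_4[of p] pm[OF that, of \<beta>] p by (intro mult_mono) auto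
    finally show ?thesis .
  qed
  let ?H1 = "\<bar>dx (dx h) x y\<bar> powr p" and ?H2 = "\<bar>dx (dy h) x y\<bar> powr p" and ?H3 = "\<bar>dy (dy h) x y\<bar> powr p"
  let ?X = "c powr p * \<bar>dx h x y\<bar> powr p" and ?Y = "c powr p * \<bar>dy h x y\<bar> powr p" and ?Z = "(c\<^sup>2) powr p * \<bar>h x y\<bar> powr p"
  have p': "1 \<le> p" "p \<le> 2" using p by auto
  have 1: "\<bar>dx (dx (\<lambda>x y. \<kappa> x y * h x y)) x y\<bar> powr p \<le> 4 * (?H1 + 4 * ?X + ?Z)"
  proof -
    have "dx (dx (\<lambda>x y. \<kappa> x y * h x y)) x y = \<kappa> (x + 2) y * dx (dx h) x y + 2 * (dx \<kappa> (x + 1) y * dx h x y) + dx (dx \<kappa>) x y * h x y"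
      by (simp add: dx_def algebra_simps)
    then have "\<bar>dx (dx (\<lambda>x y. \<kappa> x y * h x y)) x y\<bar> powr p \<le> 4 * (\<bar>\<kappa> (x + 2) y * dx (dx h) x y\<bar> powr p + \<bar>2 * (dx \<kappa> (x + 1) y * dx h x y)\<bar> powr p + \<bar>dx (dx \<kappa>) x y * h x y\<bar> powr p)"
      by (simp only: powr_add3_le[OF p'])
    also have "\<dots> \<le> 4 * (?H1 + 4 * ?X + ?Z)"
      by (intro mult_left_mono add_mono pm1 pm2 pm b) auto
    finally show ?thesis .
  qed
  have 3: "\<bar>dy (dy (\<lambda>x y. \<kappa> x y * h x y)) x y\<bar> powr p \<le> 4 * (?H3 + 4 * ?Y + ?Z)"
  proof -
    have "dy (dy (\<lambda>x y. \<kappa> x y * h x y)) x y = \<kappa> x (y + 2) * dy (dy h) x y + 2 * (dy \<kappa> x (y + 1) * dy h x y) + dy (dy \<kappa>) x y * h x y"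
      by (simp add: dy_def algebra_simps)
    then have "\<bar>dy (dy (\<lambda>x y. \<kappa> x y * h x y)) x y\<bar> powr p \<le> 4 * (\<bar>\<kappa> x (y + 2) * dy (dy h) x y\<bar> powr p + \<bar>2 * (dy \<kappa> x (y + 1) * dy h x y)\<bar> powr p + \<bar>dy (dy \<kappa>) x y * h x y\<bar> powr p)"
      by (simp only: powr_add3_le[OF p'])
    also have "\<dots> \<le> 4 * (?H3 + 4 * ?Y + ?Z)"
      by (intro mult_left_mono add_mono pm1 pm2 pm b) auto
    finally show ?thesis .
  qed
  have 2: "\<bar>dx (dy (\<lambda>x y. \<kappa> x y * h x y)) x y\<bar> powr p \<le> 2 * (2 * (?H2 + ?Y) + 2 * (?X + ?Z))"
  proof -
    have "dx (dy (\<lambda>x y. \<kappa> x y * h x y)) x y = (\<kappa> (x + 1) (y + 1) * dx (dy h) x y + dx \<kappa> x (y + 1) * dy h x y)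
         + (dy \<kappa> (x + 1) y * dx h x y + dx (dy \<kappa>) x y * h x y)"
      by (simp add: dx_def dy_def algebra_simps)
    then have "\<bar>dx (dy (\<lambda>x y. \<kappa> x y * h x y)) x y\<bar> powr p \<le> 2 * (\<bar>\<kappa> (x + 1) (y + 1) * dx (dy h) x y + dx \<kappa> x (y + 1) * dy h x y\<bar> powr p
         + \<bar>dy \<kappa> (x + 1) y * dx h x y + dx (dy \<kappa>) x y * h x y\<bar> powr p)"
      by (simp only: powr_add_le[OF p'])
    also have "\<dots> \<le> 2 * (2 * (\<bar>\<kappa> (x + 1) (y + 1) * dx (dy h) x y\<bar> powr p + \<bar>dx \<kappa> x (y + 1) * dy h x y\<bar> powr p)
         + 2 * (\<bar>dy \<kappa> (x + 1) y * dx h x y\<bar> powr p + \<bar>dx (dy \<kappa>) x y * h x y\<bar> powr p))"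
      by (intro mult_left_mono add_mono powr_add_le[OF p']) auto
    also have "\<dots> \<le> 2 * (2 * (?H2 + ?Y) + 2 * (?X + ?Z))"
      by (intro mult_left_mono add_mono pm1 pm b) auto
    finally show ?thesis .
  qed
  have "hess p (\<lambda>x y. \<kappa> x y * h x y) (x, y) \<le> 4 * (?H1 + 4 * ?X + ?Z) + 2 * (2 * (?H2 + ?Y) + 2 * (?X + ?Z)) + 4 * (?H3 + 4 * ?Y + ?Z)"
    unfolding hess_def fst_conv snd_conv by (intro add_mono 1 2 3)
  also have "\<dots> = 4 * (?H1 + ?H2 + ?H3) + 20 * (?X + ?Y) + 12 * ?Z" by (simp add: algebra_simps)
  also have "\<dots> \<le> 40 * (?H1 + ?H2 + ?H3) + 40 * (?X + ?Y) + 40 * ?Z"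
    by (intro add_mono mult_right_mono add_nonneg_nonneg) auto
  finally show ?thesis by (simp add: hess_def algebra_simps)
qed

lemma hess_eq_0:
  assumes "\<And>i j. i \<in> {0,1,2} \<Longrightarrow> j \<in> {0,1,2} \<Longrightarrow> h (x + i) (y + j) = 0" and p: "0 < p"
  shows "hess p h (x, y) = 0"
proof -
  have "dx (dx h) x y = h (x + 2) (y + 0) - 2 * h (x + 1) (y + 0) + h (x + 0) (y + 0)"
    "dy (dy h) x y = h (x + 0) (y + 2) - 2 * h (x + 0) (y + 1) + h (x + 0) (y + 0)"
    "dx (dy h) x y = h (x + 1) (y + 1) - h (x + 1) (y + 0) - h (x + 0) (y + 1) + h (x + 0) (y + 0)"
    by (simp_all add: dx_def dy_def algebra_simps)
  moreover have "h (x + 0) (y + 0) = 0" "h (x + 0) (y + 1) = 0" "h (x + 0) (y + 2) = 0" "h (x + 1) (y + 0) = 0"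
    "h (x + 1) (y + 1) = 0" "h (x + 2) (y + 0) = 0"
    by (intro assms(1); simp)+
  ultimately show ?thesis using p by (simp add: hess_def)
qed

section \<open>Sizes of the averages and of their first differences; the part coming from the bottom
  row\<close>

lemma cesaro_powr_le:
  assumes p: "1 \<le> p" and n: "1 \<le> n"
  shows "\<bar>cesaro g x n\<bar> powr p \<le> 1 / real n * (\<Sum>j<n. \<bar>g (x + int j)\<bar> powr p + \<bar>g (x + - int j)\<bar> powr p)"
proof -
  have half: "\<bar>(a + b) / 2\<bar> powr p \<le> \<bar>a\<bar> powr p + \<bar>b\<bar> powr p" for a b :: real
  proof -
    have "\<bar>(a + b) / 2\<bar> \<le> max \<bar>a\<bar> \<bar>b\<bar>" using abs_triangle_ineq[of a b] by (auto simp: max_def)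
    then have "\<bar>(a + b) / 2\<bar> powr p \<le> (max \<bar>a\<bar> \<bar>b\<bar>) powr p" using p by (intro powr_mono2) auto
    then show ?thesis by (auto simp: max_def split: if_splits intro: order_trans)
  qed
  have "\<bar>cesaro g x n\<bar> \<le> 1 / real n * (\<Sum>j<n. \<bar>(g (x + int j) + g (x - int j)) / 2\<bar>)"
    unfolding cesaro_def abs_divide using sum_abs[of "\<lambda>j. (g (x + int j) + g (x - int j)) / 2" "{..<n}"]
    by (simp add: divide_right_mono)
  then have "\<bar>cesaro g x n\<bar> powr p \<le> (1 / real n * (\<Sum>j<n. \<bar>(g (x + int j) + g (x - int j)) / 2\<bar>)) powr p"
    using p by (intro powr_mono2) auto
  also have "\<dots> \<le> 1 / real n * (\<Sum>j<n. \<bar>(g (x + int j) + g (x - int j)) / 2\<bar> powr p)"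
    by (rule average_powr_le[OF p n])
  also have "\<dots> \<le> 1 / real n * (\<Sum>j<n. \<bar>g (x + int j)\<bar> powr p + \<bar>g (x + - int j)\<bar> powr p)"
    using half by (intro mult_left_mono sum_mono) auto
  finally show ?thesis .
qed

lemma sum_cesaro_powr_le:
  assumes p: "1 \<le> p" and n: "1 \<le> n" "int n \<le> Y" and W: "finite W" and X: "\<And>x j. x \<in> X \<Longrightarrow> \<bar>j\<bar> \<le> Y \<Longrightarrow> x + j \<in> W"
  shows "(\<Sum>x\<in>X. \<bar>cesaro g x n\<bar> powr p) \<le> 2 * (\<Sum>x\<in>W. \<bar>g x\<bar> powr p)"
proof -
  have "(\<Sum>x\<in>X. \<bar>cesaro g x n\<bar> powr p) \<le> (\<Sum>x\<in>X. 1 / real n * (\<Sum>j<n. \<bar>g (x + int j)\<bar> powr p + \<bar>g (x + - int j)\<bar> powr p))"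
    by (intro sum_mono cesaro_powr_le p n)
  also have "\<dots> = 1 / real n * (\<Sum>j<n. (\<Sum>x\<in>X. \<bar>g (x + int j)\<bar> powr p) + (\<Sum>x\<in>X. \<bar>g (x + - int j)\<bar> powr p))"
    unfolding sum_distrib_left[symmetric] sum.distrib[symmetric] by (subst sum.swap) simp
  also have "\<dots> \<le> 1 / real n * (\<Sum>j<n. (\<Sum>x\<in>W. \<bar>g x\<bar> powr p) + (\<Sum>x\<in>W. \<bar>g x\<bar> powr p))"
    using n by (intro mult_left_mono sum_mono add_mono sum_shift_le[where f="\<lambda>x. \<bar>g x\<bar> powr p"] W X) auto
  also have "\<dots> = 2 * (\<Sum>x\<in>W. \<bar>g x\<bar> powr p)" using n by simp
  finally show ?thesis .
qed

text \<open>The weights i in \<open>cesaro_Suc_odd_diff\<close> are at most n, so a vertical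
  difference of the averages is dominated by an average of first differences of f.\<close>

lemma sum_dy_line_ext_le:
  assumes p: "1 \<le> p" and n: "1 \<le> n" "int n \<le> Y" and W: "finite W" and X: "\<And>x j. x \<in> X \<Longrightarrow> \<bar>j\<bar> \<le> Y \<Longrightarrow> x + j \<in> W"
  shows "(\<Sum>x\<in>X. \<bar>cesaro f x (Suc n) - cesaro f x n\<bar> powr p) \<le> 2 * (\<Sum>x\<in>W. \<bar>fdiff f x\<bar> powr p)"
proof -
  have pt: "\<bar>cesaro f x (Suc n) - cesaro f x n\<bar> powr p \<le> 1 / real n * (\<Sum>j<n. \<bar>fdiff f (x + int j)\<bar> powr p + \<bar>fdiff f (x + (- int j - 1))\<bar> powr p)" for x
  proof -
    have "\<bar>\<Sum>i=1..n. real i * odd_diff f x i\<bar> \<le> (\<Sum>i=1..n. real n * \<bar>odd_diff f x i\<bar>)"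
      by (rule order_trans[OF sum_abs]) (auto simp: abs_mult intro!: sum_mono mult_right_mono)
    also have "\<dots> \<le> (real n + 1) * (\<Sum>i=1..n. \<bar>odd_diff f x i\<bar>)"
      unfolding sum_distrib_left[symmetric] by (intro mult_right_mono sum_nonneg) auto
    finally have "\<bar>\<Sum>i=1..n. real i * odd_diff f x i\<bar> / (real n * (real n + 1)) \<le> ((real n + 1) * (\<Sum>i=1..n. \<bar>odd_diff f x i\<bar>)) / (real n * (real n + 1))"
      by (rule divide_right_mono) simp
    then have "\<bar>cesaro f x (Suc n) - cesaro f x n\<bar> \<le> 1 / real n * (\<Sum>i=1..n. \<bar>odd_diff f x i\<bar>)"
      unfolding cesaro_Suc_odd_diff[OF n(1)] using n by (simp add: abs_divide abs_mult)
    also have "(\<Sum>i=1..n. \<bar>odd_diff f x i\<bar>) = (\<Sum>j<n. \<bar>odd_diff f x (Suc j)\<bar>)"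
      by (rule sum.reindex_bij_witness[of _ Suc "\<lambda>k. k - 1"]) auto
    finally have "\<bar>cesaro f x (Suc n) - cesaro f x n\<bar> powr p \<le> (1 / real n * (\<Sum>j<n. \<bar>odd_diff f x (Suc j)\<bar>)) powr p"
      using p by (intro powr_mono2) auto
    also have "\<dots> \<le> 1 / real n * (\<Sum>j<n. \<bar>odd_diff f x (Suc j)\<bar> powr p)" by (rule average_powr_le[OF p n(1)])
    also have "\<dots> \<le> 1 / real n * (\<Sum>j<n. \<bar>fdiff f (x + int j)\<bar> powr p + \<bar>fdiff f (x + (- int j - 1))\<bar> powr p)"
    proof (intro mult_left_mono sum_mono)
      fix j
      have "\<bar>odd_diff f x (Suc j)\<bar> \<le> max \<bar>fdiff f (x + int j)\<bar> \<bar>fdiff f (x + (- int j - 1))\<bar>"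
        using abs_triangle_ineq4[of "fdiff f (x + int j)" "fdiff f (x + (- int j - 1))"]
        by (auto simp: odd_diff_def max_def algebra_simps)
      then have "\<bar>odd_diff f x (Suc j)\<bar> powr p \<le> (max \<bar>fdiff f (x + int j)\<bar> \<bar>fdiff f (x + (- int j - 1))\<bar>) powr p"
        using p by (intro powr_mono2) auto
      then show "\<bar>odd_diff f x (Suc j)\<bar> powr p \<le> \<bar>fdiff f (x + int j)\<bar> powr p + \<bar>fdiff f (x + (- int j - 1))\<bar> powr p"
        by (auto simp: max_def split: if_splits intro: order_trans)
    qed simp
    finally show ?thesis .
  qed
  have "(\<Sum>x\<in>X. \<bar>cesaro f x (Suc n) - cesaro f x n\<bar> powr p) \<le> (\<Sum>x\<in>X. 1 / real n * (\<Sum>j<n. \<bar>fdiff f (x + int j)\<bar> powr p + \<bar>fdiff f (x + (- int j - 1))\<bar> powr p))"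
    by (intro sum_mono pt)
  also have "\<dots> = 1 / real n * (\<Sum>j<n. (\<Sum>x\<in>X. \<bar>fdiff f (x + int j)\<bar> powr p) + (\<Sum>x\<in>X. \<bar>fdiff f (x + (- int j - 1))\<bar> powr p))"
    unfolding sum_distrib_left[symmetric] sum.distrib[symmetric] by (subst sum.swap) simp
  also have "\<dots> \<le> 1 / real n * (\<Sum>j<n. (\<Sum>x\<in>W. \<bar>fdiff f x\<bar> powr p) + (\<Sum>x\<in>W. \<bar>fdiff f x\<bar> powr p))"
    using n by (intro mult_left_mono sum_mono add_mono sum_shift_le[where f="\<lambda>x. \<bar>fdiff f x\<bar> powr p"] W X) auto
  also have "\<dots> = 2 * (\<Sum>x\<in>W. \<bar>fdiff f x\<bar> powr p)" using n by simp
  finally show ?thesis .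
qed

text \<open>Width N but height only N / 4: on the support of the cutoff the averages then stay
  within distance 3 N of the origin, the range over which the reflected row is controlled.\<close>

definition line_rem :: "int \<Rightarrow> (int \<Rightarrow> real) \<Rightarrow> lattice_fun" where
  "line_rem N f x y = lcutoff (real_of_int N) (real_of_int N / 4) 0 x y * line_ext (reflect N (normalized N f)) x y"

definition line_part :: "int \<Rightarrow> (int \<Rightarrow> real) \<Rightarrow> lattice_fun" where
  "line_part N f x y = f 0 + slope N f * real_of_int x + line_rem N f x y"

lemma line_rem_eq_0:
  assumes "0 < N" "2 * N \<le> \<bar>x\<bar> \<or> N \<le> 2 * \<bar>y\<bar>"
  shows "line_rem N f x y = 0"
proof -
  have "cutoff (real_of_int x / real_of_int N) = 0 \<or> cutoff (real_of_int y / (real_of_int N / 4)) = 0"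
    using assms(2)
  proof
    assume "2 * N \<le> \<bar>x\<bar>"
    then have "real_of_int (2 * N) \<le> real_of_int \<bar>x\<bar>" by (simp only: of_int_le_iff)
    then show ?thesis using assms(1) by (intro disjI1 cutoff_eq_0) (simp add: field_simps)
  next
    assume "N \<le> 2 * \<bar>y\<bar>"
    then have "real_of_int N \<le> real_of_int (2 * \<bar>y\<bar>)" by (simp only: of_int_le_iff)
    then show ?thesis using assms(1) by (intro disjI2 cutoff_eq_0) (simp add: field_simps)
  qed
  then show ?thesis by (auto simp: line_rem_def lcutoff_def)
qed

lemma line_part_0:
  assumes "0 < N" "\<bar>x\<bar> \<le> N"
  shows "line_part N f x 0 = f x"
proof -
  have "real_of_int \<bar>x\<bar> \<le> real_of_int N" using assms by (simp only: of_int_le_iff)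
  then have "cutoff (real_of_int x / real_of_int N) = 1" using assms by (intro cutoff_eq_1) (simp add: field_simps)
  moreover have "\<not> N < x" "\<not> x < - N" using assms by linarith+
  then have "reflect N (normalized N f) x = normalized N f x" by (simp add: reflect_def)
  ultimately show ?thesis
    by (simp add: line_part_def line_rem_def lcutoff_def line_ext_0 normalized_def cutoff_eq_1)
qed

lemma hess_affine_add: "hess p (\<lambda>x y. a + b * real_of_int x + h x y) q = hess p h q"
proof -
  have "dx (dx (\<lambda>x y. a + b * real_of_int x + h x y)) = dx (dx h)" "dx (dy (\<lambda>x y. a + b * real_of_int x + h x y)) = dx (dy h)"
    "dy (dy (\<lambda>x y. a + b * real_of_int x + h x y)) = dy (dy h)"
    by (auto simp: dx_def dy_def fun_eq_iff algebra_simps)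
  then show ?thesis by (simp add: hess_def)
qed

text \<open>Cutting off costs first differences over N and values over N^2. By the Poincare
  inequality for the normalised row both are of the order of the Gagliardo seminorm, the powers of N
  cancelling. The bound 16 leaves room for the stencils around the support.\<close>

lemma line_part_energy:
  assumes p: "1 < p" "p < 2"
  shows "\<exists>C>0. \<forall>N M f. 16 \<le> N \<longrightarrow> energy p M (line_part N f) \<le> C * gagliardo p {-N..<N} (fdiff f)"
proof -
  obtain C where C: "1 \<le> C" "\<And>r s a. 0 < s \<Longrightarrow> s \<le> r \<Longrightarrow> cut_bounds (C / s) (lcutoff r s a)"
    using lcutoff_bounds by blast
  define K where "K = 40 * (1440 + 12 * (8 * C) powr p + 60 * (24 * C) powr (2 * p))"
  have K: "0 < K" using C by (simp add: K_def add_pos_nonneg)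
  have "energy p M (line_part N f) \<le> K * gagliardo p {-N..<N} (fdiff f)" if N: "16 \<le> N" for N M f
  proof -
    define \<Gamma> where "\<Gamma> = gagliardo p {-N..<N} (fdiff f)"
    have \<Gamma>0: "0 \<le> \<Gamma>" by (simp add: \<Gamma>_def)
    define n where "n = real_of_int N"
    have n: "16 \<le> n" using N by (simp add: n_def)
    define W where "W = {-3 * N..<3 * N}"
    define X where "X = {- (2 * N) - 2..2 * N + 2}"
    define S where "S = {- (N div 2) - 2..N div 2 + 2}"
    define Y where "Y = N div 2 + 4"
    have W: "finite W" and fX: "finite X" and fS: "finite S" by (auto simp: W_def X_def S_def)
    have XW: "x + j \<in> W" if "x \<in> X" "\<bar>j\<bar> \<le> Y" for x j using that N by (auto simp: X_def W_def Y_def)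
    have SY: "\<bar>y\<bar> + 2 \<le> Y" if "y \<in> S" for y using that by (auto simp: S_def Y_def)
    have cX: "real (card X) \<le> 5 * n" and cS: "real (card S) \<le> 2 * n"
    proof -
      have "int (card X) = 4 * N + 5" using N by (simp add: X_def)
      then have "int (card X) \<le> 5 * N" using N by simp
      then show "real (card X) \<le> 5 * n" unfolding n_def by linarith
      have "int (card S) = 2 * (N div 2) + 5" using N by (simp add: S_def)
      then have "int (card S) \<le> 2 * N" using N by linarith
      then show "real (card S) \<le> 2 * n" unfolding n_def by linarith
    qed
    define F where "F = reflect N (normalized N f)"
    define u where "u = line_ext F"
    define V where "V = (\<Sum>x\<in>W. \<bar>fdiff F x\<bar> powr p)"
    have V0: "0 \<le> V" by (simp add: V_def sum_nonneg)
    have fdF: "fdiff F = (\<lambda>x. fdiff (normalized N f) (fold_line N x))"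
      using N by (simp add: F_def fdiff_reflect fun_eq_iff)
    have gag: "gagliardo p W (fdiff F) \<le> 9 * \<Gamma>"
    proof -
      have "gagliardo p W (fdiff F) \<le> 9 * gagliardo p {-N..<N} (fdiff (normalized N f))"
        unfolding fdF W_def using N p by (intro gagliardo_fold_le) auto
      then show ?thesis by (simp add: \<Gamma>_def gagliardo_def fdiff_normalized)
    qed
    have V: "V \<le> 3 * (2 * n) powr (p - 1) * \<Gamma>"
    proof -
      have "V = 3 * (\<Sum>x\<in>{-N..<N}. \<bar>fdiff (normalized N f) x\<bar> powr p)"
        unfolding V_def fdF W_def using N by (intro sum_fold_line[where F="\<lambda>i. \<bar>fdiff (normalized N f) i\<bar> powr p"]) auto
      then show ?thesis using sum_normalized_le[of N p f] N p by (simp add: \<Gamma>_def n_def)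
    qed
    \<comment> \<open>F vanishes at 0, so each value is a sum of differences along the row, and
      Hoelder gives a uniform bound.\<close>
    have Fpt: "\<bar>F x\<bar> powr p \<le> (6 * n) powr (p - 1) * V" if x: "x \<in> W" for x
    proof -
      have F0: "F 0 = 0" using N by (simp add: F_def reflect_def normalized_def)
      have "\<bar>F x\<bar> \<le> (\<Sum>x\<in>W. \<bar>fdiff F x\<bar>)"
      proof (cases "0 \<le> x")
        case True
        have "F x = (\<Sum>i\<in>{0..<x}. fdiff F i)" using sum_fdiff[of F 0 "nat x"] True F0 by simp
        also have "\<bar>\<dots>\<bar> \<le> (\<Sum>i\<in>{0..<x}. \<bar>fdiff F i\<bar>)" by (rule sum_abs)
        also have "\<dots> \<le> (\<Sum>x\<in>W. \<bar>fdiff F x\<bar>)" using x N by (intro sum_mono2) (auto simp: W_def)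
        finally show ?thesis .
      next
        case False
        have "- F x = (\<Sum>i\<in>{x..<0}. fdiff F i)" using sum_fdiff[of F x "nat (-x)"] False F0 by simp
        also have "\<bar>\<dots>\<bar> \<le> (\<Sum>i\<in>{x..<0}. \<bar>fdiff F i\<bar>)" by (rule sum_abs)
        also have "\<dots> \<le> (\<Sum>x\<in>W. \<bar>fdiff F x\<bar>)" using x N by (intro sum_mono2) (auto simp: W_def)
        finally show ?thesis by simp
      qed
      then have "\<bar>F x\<bar> powr p \<le> \<bar>\<Sum>x\<in>W. \<bar>fdiff F x\<bar>\<bar> powr p" using p by (intro powr_mono2) auto
      also have "\<dots> \<le> real (card W) powr (p - 1) * (\<Sum>x\<in>W. \<bar>\<bar>fdiff F x\<bar>\<bar> powr p)"
        using p W by (intro powr_sum_le) auto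
      also have "real (card W) = 6 * n" using N by (simp add: W_def n_def)
      finally show ?thesis by (simp add: V_def)
    qed
    have k_in: "1 \<le> Suc (nat \<bar>y\<bar>)" "int (Suc (nat \<bar>y\<bar>)) \<le> Y" if "y \<in> S" for y using SY[OF that] by auto
    have D1: "(\<Sum>y\<in>S. \<Sum>x\<in>X. \<bar>dx u x y\<bar> powr p) \<le> 4 * n * V"
    proof -
      have "(\<Sum>x\<in>X. \<bar>dx u x y\<bar> powr p) \<le> 2 * V" if "y \<in> S" for y
        unfolding u_def dx_line_ext unfolding line_ext_def V_def
        using p k_in[OF that] XW W by (intro sum_cesaro_powr_le) auto
      then have "(\<Sum>y\<in>S. \<Sum>x\<in>X. \<bar>dx u x y\<bar> powr p) \<le> (\<Sum>y\<in>S. 2 * V)" by (rule sum_mono)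
      also have "\<dots> = real (card S) * (2 * V)" by simp
      also have "\<dots> \<le> (2 * n) * (2 * V)" using cS V0 by (intro mult_right_mono) auto
      finally show ?thesis by simp
    qed
    have D2: "(\<Sum>y\<in>S. \<Sum>x\<in>X. \<bar>dy u x y\<bar> powr p) \<le> 4 * n * V"
    proof -
      have "(\<Sum>x\<in>X. \<bar>dy u x y\<bar> powr p) \<le> 2 * V" if y: "y \<in> S" for y
      proof -
        define m where "m = (if 0 \<le> y then Suc (nat y) else nat (- y))"
        have "1 \<le> m" "int m \<le> Y" using SY[OF y] by (auto simp: m_def)
        then show ?thesis unfolding u_def dy_line_ext(1)[OF m_def] V_def using p W XW by (intro sum_dy_line_ext_le) auto
      qed
      then have "(\<Sum>y\<in>S. \<Sum>x\<in>X. \<bar>dy u x y\<bar> powr p) \<le> (\<Sum>y\<in>S. 2 * V)" by (rule sum_mono)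
      also have "\<dots> = real (card S) * (2 * V)" by simp
      also have "\<dots> \<le> (2 * n) * (2 * V)" using cS V0 by (intro mult_right_mono) auto
      finally show ?thesis by simp
    qed
    have D0: "(\<Sum>y\<in>S. \<Sum>x\<in>X. \<bar>u x y\<bar> powr p) \<le> 20 * n\<^sup>2 * (6 * n) powr (p - 1) * V"
    proof -
      have "\<bar>u x y\<bar> powr p \<le> 2 * ((6 * n) powr (p - 1) * V)" if xy: "x \<in> X" "y \<in> S" for x y
      proof -
        define k where "k = Suc (nat \<bar>y\<bar>)"
        have k: "1 \<le> k" "int k \<le> Y" using k_in[OF xy(2)] by (auto simp: k_def)
        have "\<bar>u x y\<bar> powr p \<le> 1 / real k * (\<Sum>j<k. \<bar>F (x + int j)\<bar> powr p + \<bar>F (x + - int j)\<bar> powr p)"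
          unfolding u_def line_ext_def k_def[symmetric] using p k by (intro cesaro_powr_le) auto
        also have "\<dots> \<le> 1 / real k * (\<Sum>j<k. (6 * n) powr (p - 1) * V + (6 * n) powr (p - 1) * V)"
          using k by (intro mult_left_mono sum_mono add_mono Fpt XW xy) auto
        also have "\<dots> = 2 * ((6 * n) powr (p - 1) * V)" using k by simp
        finally show ?thesis .
      qed
      then have "(\<Sum>y\<in>S. \<Sum>x\<in>X. \<bar>u x y\<bar> powr p) \<le> (\<Sum>y\<in>S. \<Sum>x\<in>X. 2 * ((6 * n) powr (p - 1) * V))"
        by (intro sum_mono)
      also have "\<dots> = real (card S) * real (card X) * (2 * ((6 * n) powr (p - 1) * V))" by simp
      also have "\<dots> \<le> (2 * n) * (5 * n) * (2 * ((6 * n) powr (p - 1) * V))"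
        using cS cX V0 n by (intro mult_right_mono mult_mono) auto
      finally show ?thesis by (simp add: power2_eq_square mult.assoc)
    qed
    have D3: "(\<Sum>y\<in>S. \<Sum>x\<in>X. hess p u (x, y)) \<le> 1440 * \<Gamma>"
      using line_ext_hess_sum_le[OF p W XW fX fS SY, of F] gag by (simp add: u_def)
    define c where "c = C / (n / 4)"
    have c0: "0 < c" using C n by (simp add: c_def)
    have cut: "cut_bounds c (lcutoff n (n / 4) 0)" unfolding c_def using n by (intro C) auto
    define \<kappa> where "\<kappa> = lcutoff n (n / 4) 0"
    have rem: "line_rem N f = (\<lambda>x y. \<kappa> x y * u x y)"
      by (simp add: line_rem_def \<kappa>_def n_def u_def F_def fun_eq_iff)
    \<comment> \<open>c is of order 1 / n and V of order n powr (p - 1), so c powr p * n * V does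
      not depend on the scale.\<close>
    have e1: "c powr p * (8 * n * V) \<le> 12 * (8 * C) powr p * \<Gamma>"
    proof -
      have "c powr p * (8 * n * V) \<le> c powr p * (8 * n * (3 * (2 * n) powr (p - 1) * \<Gamma>))"
        using V n by (intro mult_left_mono) auto
      also have "\<dots> = 12 * (c powr p * (2 * n) powr p) * \<Gamma>" using n by (simp add: powr_diff)
      also have "c powr p * (2 * n) powr p = (8 * C) powr p"
        using C n by (subst powr_mult[symmetric]) (auto simp: c_def)
      finally show ?thesis .
    qed
    have e2: "(c\<^sup>2) powr p * (20 * n\<^sup>2 * (6 * n) powr (p - 1) * V) \<le> 60 * (24 * C) powr (2 * p) * \<Gamma>"
    proof -
      have "20 * n\<^sup>2 * (6 * n) powr (p - 1) * V \<le> 20 * n\<^sup>2 * (6 * n) powr (p - 1) * (3 * (2 * n) powr (p - 1) * \<Gamma>)"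
        using V n by (intro mult_left_mono) auto
      also have "\<dots> \<le> 20 * (6 * n)\<^sup>2 * (6 * n) powr (p - 1) * (3 * (6 * n) powr (p - 1) * \<Gamma>)"
        using n p \<Gamma>0 by (intro mult_mono mult_right_mono powr_mono2 power_mono) auto
      also have "\<dots> = 60 * (6 * n) powr (2 * p) * \<Gamma>"
      proof -
        have "(6 * n)\<^sup>2 = (6 * n) powr 2" using n by simp
        then have "(6 * n)\<^sup>2 * (6 * n) powr (p - 1) * (6 * n) powr (p - 1) = (6 * n) powr (2 * p)"
          by (simp add: powr_add[symmetric])
        moreover have "20 * (6 * n)\<^sup>2 * (6 * n) powr (p - 1) * (3 * (6 * n) powr (p - 1) * \<Gamma>) =
           60 * ((6 * n)\<^sup>2 * (6 * n) powr (p - 1) * (6 * n) powr (p - 1)) * \<Gamma>" by (simp add: mult_ac)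
        ultimately show ?thesis by simp
      qed
      finally have "(c\<^sup>2) powr p * (20 * n\<^sup>2 * (6 * n) powr (p - 1) * V) \<le> (c\<^sup>2) powr p * (60 * (6 * n) powr (2 * p) * \<Gamma>)"
        by (intro mult_left_mono) auto
      also have cc: "(c\<^sup>2) powr p = c powr (2 * p)" using c0 by (simp add: power2_eq_square powr_mult powr_add[symmetric])
      also have "c powr (2 * p) * (60 * (6 * n) powr (2 * p) * \<Gamma>) = 60 * (c powr (2 * p) * (6 * n) powr (2 * p)) * \<Gamma>" by simp
      also have "c powr (2 * p) * (6 * n) powr (2 * p) = (24 * C) powr (2 * p)"
        using C n by (subst powr_mult[symmetric]) (auto simp: c_def)
      finally show ?thesis unfolding cc .
    qed
    have "energy p M (line_part N f) = (\<Sum>q\<in>lbox M. hess p (line_rem N f) q)"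
      unfolding energy_def line_part_def[abs_def] hess_affine_add ..
    also have "\<dots> \<le> (\<Sum>q\<in>lbox M \<union> X \<times> S. hess p (line_rem N f) q)"
      using fX fS by (intro sum_mono2) auto
    also have "\<dots> = (\<Sum>q\<in>X \<times> S. hess p (line_rem N f) q)"
    proof (rule sum.mono_neutral_right)
      show "\<forall>q\<in>lbox M \<union> X \<times> S - X \<times> S. hess p (line_rem N f) q = 0"
      proof
        fix q assume q: "q \<in> lbox M \<union> X \<times> S - X \<times> S"
        obtain x y where xy: "q = (x, y)" by (cases q)
        have "x \<notin> X \<or> y \<notin> S" using q xy by auto
        then show "hess p (line_rem N f) q = 0" unfolding xy
          using p N by (intro hess_eq_0 line_rem_eq_0) (auto simp: X_def S_def)
      qed
    qed (use fX fS in auto)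
    also have "\<dots> = (\<Sum>y\<in>S. \<Sum>x\<in>X. hess p (\<lambda>x y. \<kappa> x y * u x y) (x, y))"
      unfolding rem by (subst sum.swap) (simp add: sum.cartesian_product)
    also have "\<dots> \<le> (\<Sum>y\<in>S. \<Sum>x\<in>X. 40 * (hess p u (x, y) + c powr p * (\<bar>dx u x y\<bar> powr p + \<bar>dy u x y\<bar> powr p) + (c\<^sup>2) powr p * \<bar>u x y\<bar> powr p))"
      using cut by (intro sum_mono hess_cut_le p) (simp add: \<kappa>_def)
    also have "\<dots> = 40 * ((\<Sum>y\<in>S. \<Sum>x\<in>X. hess p u (x, y)) + c powr p * ((\<Sum>y\<in>S. \<Sum>x\<in>X. \<bar>dx u x y\<bar> powr p)
       + (\<Sum>y\<in>S. \<Sum>x\<in>X. \<bar>dy u x y\<bar> powr p)) + (c\<^sup>2) powr p * (\<Sum>y\<in>S. \<Sum>x\<in>X. \<bar>u x y\<bar> powr p))"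
      by (simp only: sum.distrib sum_distrib_left[symmetric])
    also have "\<dots> \<le> 40 * (1440 * \<Gamma> + c powr p * (4 * n * V + 4 * n * V) + (c\<^sup>2) powr p * (20 * n\<^sup>2 * (6 * n) powr (p - 1) * V))"
      by (intro mult_left_mono add_mono D0 D1 D2 D3) auto
    also have "\<dots> \<le> 40 * (1440 * \<Gamma> + 12 * (8 * C) powr p * \<Gamma> + 60 * (24 * C) powr (2 * p) * \<Gamma>)"
      using e1 e2 by (intro mult_left_mono add_mono) auto
    also have "\<dots> = K * \<Gamma>" by (simp add: K_def algebra_simps)
    finally show ?thesis by (simp add: \<Gamma>_def)
  qed
  then show ?thesis using K by blast
qed

subsection \<open>Averages along vertical chains\<close>

text \<open>A segment of length n at height n - 1, to the upper right of z: growing n sweeps out a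
  cone over z. For n = 1 this is the single value u z 0.\<close>

definition row_avg :: "lattice_fun \<Rightarrow> int \<Rightarrow> nat \<Rightarrow> real" where
  "row_avg u z n = (\<Sum>j<n. u (z + int j) (int n - 1)) / real n"

definition grad :: "real \<Rightarrow> lattice_fun \<Rightarrow> int \<times> int \<Rightarrow> real" where
  "grad p u q = \<bar>dx u (fst q) (snd q)\<bar> powr p + \<bar>dy u (fst q) (snd q)\<bar> powr p"

lemma grad_nonneg [simp]: "0 \<le> grad p u q"
  by (simp add: grad_def)

lemma grad_dy_le_hess: "grad p (dy G) q \<le> hess p G q"
  by (simp add: grad_def hess_def)

lemma diff_le_sum_dx:
  assumes "a \<le> b"
  shows "\<bar>u b y - u a y\<bar> \<le> (\<Sum>x\<in>{a..<b}. \<bar>dx u x y\<bar>)"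
proof -
  have "u b y - u a y = (\<Sum>x\<in>{a..<b}. dx u x y)"
    using sum_fdiff[of "\<lambda>x. u x y" a "nat (b - a)"] assms by (simp add: fdiff_def dx_def)
  then show ?thesis by simp
qed

text \<open>Rising by one row costs vertical differences and lengthening the segment by one point
  costs horizontal ones; either contribution is a mean over the row.\<close>

lemma row_avg_Suc:
  assumes n: "1 \<le> n"
  shows "\<bar>row_avg u z (Suc n) - row_avg u z n\<bar> \<le>
    (\<Sum>j\<le>n. \<bar>dx u (z + int j) (int n - 1)\<bar> + \<bar>dy u (z + int j) (int n - 1)\<bar>) / real n"
proof -
  define w where "w j = u (z + int j) (int n - 1)" for j
  define v where "v j = dy u (z + int j) (int n - 1)" for j
  define h where "h j = \<bar>dx u (z + int j) (int n - 1)\<bar>" for j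
  have wj: "\<bar>w n - w j\<bar> \<le> (\<Sum>i<n. h i)" if "j < n" for j
  proof -
    have "\<bar>w n - w j\<bar> \<le> (\<Sum>x\<in>{z + int j..<z + int n}. \<bar>dx u x (int n - 1)\<bar>)"
      unfolding w_def using that by (intro diff_le_sum_dx) auto
    also have "\<dots> \<le> (\<Sum>x\<in>(\<lambda>i. z + int i) ` {..<n}. \<bar>dx u x (int n - 1)\<bar>)"
    proof (intro sum_mono2)
      show "{z + int j..<z + int n} \<subseteq> (\<lambda>i. z + int i) ` {..<n}"
      proof
        fix x assume "x \<in> {z + int j..<z + int n}"
        then have "x = z + int (nat (x - z))" "nat (x - z) < n" by auto
        then show "x \<in> (\<lambda>i. z + int i) ` {..<n}" by blast
      qed
    qed auto
    also have "\<dots> = (\<Sum>i<n. h i)" by (subst sum.reindex) (auto simp: inj_on_def h_def)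
    finally show ?thesis .
  qed
  have "row_avg u z (Suc n) = (\<Sum>j<Suc n. w j + v j) / (real n + 1)"
    by (simp add: row_avg_def w_def v_def dy_def add.commute)
  also have "\<dots> = ((\<Sum>j<n. w j) + w n) / (real n + 1) + (\<Sum>j\<le>n. v j) / (real n + 1)"
    by (simp add: sum.distrib add_divide_distrib lessThan_Suc_atMost[symmetric])
  finally have "row_avg u z (Suc n) - row_avg u z n = (((\<Sum>j<n. w j) + w n) / (real n + 1) - (\<Sum>j<n. w j) / real n) + (\<Sum>j\<le>n. v j) / (real n + 1)"
    by (simp add: row_avg_def w_def)
  also have "((\<Sum>j<n. w j) + w n) / (real n + 1) - (\<Sum>j<n. w j) / real n = (\<Sum>j<n. w n - w j) / (real n * (real n + 1))"
    using n by (simp add: divide_simps sum_subtractf) (simp add: algebra_simps)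
  finally have eq: "row_avg u z (Suc n) - row_avg u z n = (\<Sum>j<n. w n - w j) / (real n * (real n + 1)) + (\<Sum>j\<le>n. v j) / (real n + 1)" .
  have "\<bar>\<Sum>j<n. w n - w j\<bar> \<le> real n * (\<Sum>i<n. h i)"
    using order_trans[OF sum_abs sum_mono[of "{..<n}" "\<lambda>j. \<bar>w n - w j\<bar>" "\<lambda>_. \<Sum>i<n. h i"]] wj by simp
  then have "\<bar>\<Sum>j<n. w n - w j\<bar> / (real n * (real n + 1)) \<le> real n * (\<Sum>i<n. h i) / (real n * (real n + 1))"
    by (rule divide_right_mono) simp
  then have "\<bar>(\<Sum>j<n. w n - w j) / (real n * (real n + 1))\<bar> \<le> real n * (\<Sum>i<n. h i) / (real n * (real n + 1))"
    by (simp only: abs_divide abs_mult abs_of_nat abs_of_nonneg[of "real n + 1"])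
  also have "\<dots> = (\<Sum>i<n. h i) / (real n + 1)" using n by simp
  also have "\<dots> \<le> (\<Sum>i\<le>n. h i) / (real n + 1)"
    by (intro divide_right_mono sum_mono2) (auto simp: h_def)
  finally have 1: "\<bar>(\<Sum>j<n. w n - w j) / (real n * (real n + 1))\<bar> \<le> (\<Sum>i\<le>n. h i) / (real n + 1)" .
  have 2: "\<bar>(\<Sum>j\<le>n. v j) / (real n + 1)\<bar> \<le> (\<Sum>j\<le>n. \<bar>v j\<bar>) / (real n + 1)"
    by (simp add: abs_divide divide_right_mono)
  have "\<bar>row_avg u z (Suc n) - row_avg u z n\<bar> \<le> ((\<Sum>j\<le>n. h j) + (\<Sum>j\<le>n. \<bar>v j\<bar>)) / (real n + 1)"
    unfolding eq add_divide_distrib using 1 2 abs_triangle_ineq by (meson add_mono order_trans)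
  also have "\<dots> \<le> ((\<Sum>j\<le>n. h j) + (\<Sum>j\<le>n. \<bar>v j\<bar>)) / real n"
    using n by (intro divide_left_mono add_nonneg_nonneg sum_nonneg) (auto simp: h_def)
  finally show ?thesis by (simp add: h_def v_def sum.distrib)
qed

definition chain_const :: "real \<Rightarrow> real" where
  "chain_const p = 2 * (2 * (1 + (p - 1) / (2 - p))) powr (p - 1)"

lemma chain_const_nonneg: "0 \<le> chain_const p"
  by (simp add: chain_const_def)

text \<open>Hoelder's inequality along the chain; the dual weights are summable because \<open>p < 2\<close>.\<close>

lemma row_avg_chain:
  assumes p: "1 < p" "p < 2" and R: "1 \<le> R" "R \<le> n1"
    and V: "finite V" "\<And>n j. R \<le> n \<Longrightarrow> n < n1 \<Longrightarrow> j \<le> n \<Longrightarrow> (z + int j, int n - 1) \<in> V"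
  shows "real R powr (2 - p) * \<bar>row_avg u z n1 - row_avg u z R\<bar> powr p \<le> chain_const p * (\<Sum>q\<in>V. grad p u q)"
proof -
  \<comment> \<open>The exponent for which the Hoelder weight n powr (-\<beta> - 2) cancels the
    factor 1 / n, since (\<beta> + 2) (p - 1) = p. Row n carries n + 1 points, so the weights add up
    like n powr (-\<beta> - 1), which is summable because \<beta> > 0, that is, p < 2.\<close>
  define \<beta> where "\<beta> = (2 - p) / (p - 1)"
  have \<beta>: "0 < \<beta>" using p by (simp add: \<beta>_def)
  define B where "B = (SIGMA n:{R..<n1}. {..n})"
  define Y where "Y i = \<bar>dx u (z + int (snd i)) (int (fst i) - 1)\<bar> + \<bar>dy u (z + int (snd i)) (int (fst i) - 1)\<bar>" for i :: "nat \<times> nat"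
  have Y0: "0 \<le> Y i" for i by (simp add: Y_def)
  have fB: "finite B" by (simp add: B_def)
  have "\<bar>row_avg u z n1 - row_avg u z R\<bar> \<le> (\<Sum>n=R..<n1. (\<Sum>j\<le>n. Y (n, j)) / real n)"
    using R(2)
  proof (induction n1 rule: dec_induct)
    case (step n)
    have "\<bar>row_avg u z (Suc n) - row_avg u z n\<bar> \<le> (\<Sum>j\<le>n. Y (n, j)) / real n"
      using row_avg_Suc[of n u z] step R by (simp add: Y_def)
    then show ?case using step by simp
  qed simp
  also have "\<dots> = (\<Sum>i\<in>B. Y i / real (fst i))"
    unfolding B_def using sum.Sigma[of "{R..<n1}" "\<lambda>n. {..n}" "\<lambda>n j. Y (n, j) / real n"]
    by (simp add: case_prod_unfold sum_divide_distrib)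
  finally have "\<bar>row_avg u z n1 - row_avg u z R\<bar> powr p \<le> \<bar>\<Sum>i\<in>B. Y i / real (fst i)\<bar> powr p"
    using p by (intro powr_mono2) auto
  also have "\<dots> \<le> (\<Sum>i\<in>B. real (fst i) powr (- \<beta> - 2)) powr (p - 1) *
      (\<Sum>i\<in>B. (real (fst i) powr (- \<beta> - 2)) powr (1 - p) * \<bar>Y i / real (fst i)\<bar> powr p)"
    using p R fB by (intro powr_sum_weighted) (auto simp: B_def)
  also have "(\<Sum>i\<in>B. (real (fst i) powr (- \<beta> - 2)) powr (1 - p) * \<bar>Y i / real (fst i)\<bar> powr p) = (\<Sum>i\<in>B. Y i powr p)"
  proof (intro sum.cong refl)
    fix i assume "i \<in> B"
    then have n: "0 < real (fst i)" using R by (auto simp: B_def)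
    have "(- \<beta> - 2) * (1 - p) = p" using p by (simp add: \<beta>_def field_simps)
    then have "(real (fst i) powr (- \<beta> - 2)) powr (1 - p) = real (fst i) powr p" by (simp only: powr_powr)
    then show "(real (fst i) powr (- \<beta> - 2)) powr (1 - p) * \<bar>Y i / real (fst i)\<bar> powr p = Y i powr p"
      using n Y0[of i] by (simp add: powr_divide)
  qed
  finally have base: "\<bar>row_avg u z n1 - row_avg u z R\<bar> powr p \<le> (\<Sum>i\<in>B. real (fst i) powr (- \<beta> - 2)) powr (p - 1) * (\<Sum>i\<in>B. Y i powr p)" .
  have wsum: "(\<Sum>i\<in>B. real (fst i) powr (- \<beta> - 2)) \<le> 2 * (1 + 1 / \<beta>) * real R powr (- \<beta>)"
  proof -
    have "(\<Sum>i\<in>B. real (fst i) powr (- \<beta> - 2)) = (\<Sum>n=R..<n1. real (Suc n) * real n powr (- \<beta> - 2))"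
      unfolding B_def using sum.Sigma[of "{R..<n1}" "\<lambda>n. {..n}" "\<lambda>n j. real n powr (- \<beta> - 2)"] by (simp add: case_prod_unfold)
    also have "\<dots> \<le> (\<Sum>n=R..<n1. 2 * real n powr (- \<beta> - 1))"
    proof (intro sum_mono)
      fix n assume n: "n \<in> {R..<n1}"
      have "real (Suc n) * real n powr (- \<beta> - 2) \<le> (2 * real n) * real n powr (- \<beta> - 2)"
        using n R by (intro mult_right_mono) auto
      also have "\<dots> = 2 * (real n powr 1 * real n powr (- \<beta> - 2))" using n R by simp
      also have "real n powr 1 * real n powr (- \<beta> - 2) = real n powr (- \<beta> - 1)"
        unfolding powr_add[symmetric] by (rule arg_cong[where f="\<lambda>e. real n powr e"]) simp
      finally show "real (Suc n) * real n powr (- \<beta> - 2) \<le> 2 * real n powr (- \<beta> - 1)" .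
    qed
    also have "\<dots> \<le> (\<Sum>n=R..n1. 2 * real n powr (- \<beta> - 1))" by (intro sum_mono2) auto
    also have "\<dots> = 2 * (\<Sum>n=R..n1. real n powr (- \<beta> - 1))" by (rule sum_distrib_left[symmetric])
    also have "\<dots> \<le> 2 * ((1 + 1 / \<beta>) * real R powr (- \<beta>))"
      using R \<beta> by (intro mult_left_mono sum_powr_tail_le) auto
    finally show ?thesis by (simp only: mult.assoc)
  qed
  have const: "(2 * (1 + 1 / \<beta>) * real R powr (- \<beta>)) powr (p - 1) = (chain_const p / 2) * real R powr (- (2 - p))"
  proof -
    have "(- \<beta>) * (p - 1) = - (2 - p)" using p by (simp add: \<beta>_def)
    moreover have "1 / \<beta> = (p - 1) / (2 - p)" by (simp add: \<beta>_def)
    ultimately show ?thesis by (simp add: powr_mult powr_powr chain_const_def)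
  qed
  have "(\<Sum>i\<in>B. Y i powr p) \<le> (\<Sum>i\<in>B. 2 * grad p u (z + int (snd i), int (fst i) - 1))"
    proof (intro sum_mono)
      fix i
      show "Y i powr p \<le> 2 * grad p u (z + int (snd i), int (fst i) - 1)"
        using powr_add_le[of p "\<bar>dx u (z + int (snd i)) (int (fst i) - 1)\<bar>" "\<bar>dy u (z + int (snd i)) (int (fst i) - 1)\<bar>"] p
        by (simp add: Y_def grad_def)
    qed
    also have "\<dots> = 2 * (\<Sum>q\<in>(\<lambda>i. (z + int (snd i), int (fst i) - 1)) ` B. grad p u q)"
      by (subst sum.reindex) (auto simp: inj_on_def sum_distrib_left)
    also have "\<dots> \<le> 2 * (\<Sum>q\<in>V. grad p u q)"
      using V by (intro mult_left_mono sum_mono2) (auto simp: B_def)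
  finally have Y2: "(\<Sum>i\<in>B. Y i powr p) \<le> 2 * (\<Sum>q\<in>V. grad p u q)" .
  have "\<bar>row_avg u z n1 - row_avg u z R\<bar> powr p \<le> (2 * (1 + 1 / \<beta>) * real R powr (- \<beta>)) powr (p - 1) * (2 * (\<Sum>q\<in>V. grad p u q))"
    using p by (intro order_trans[OF base] mult_mono[OF _ Y2] powr_mono2 wsum) (auto intro!: sum_nonneg)
  then have *: "\<bar>row_avg u z n1 - row_avg u z R\<bar> powr p \<le> chain_const p / 2 * real R powr (- (2 - p)) * (2 * (\<Sum>q\<in>V. grad p u q))"
    unfolding const .
  have "real R powr (2 - p) * \<bar>row_avg u z n1 - row_avg u z R\<bar> powr p
     \<le> real R powr (2 - p) * (chain_const p / 2 * real R powr (- (2 - p)) * (2 * (\<Sum>q\<in>V. grad p u q)))"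
    using * by (intro mult_left_mono) auto
  also have "\<dots> = (real R powr (2 - p) * real R powr (- (2 - p))) * (chain_const p * (\<Sum>q\<in>V. grad p u q))" by simp
  also have "real R powr (2 - p) * real R powr (- (2 - p)) = 1" unfolding powr_add[symmetric] using R by simp
  finally show ?thesis by simp
qed

definition pair_const :: "real \<Rightarrow> real" where
  "pair_const p = 8 * chain_const p + 24"

text \<open>Siblings at distance d are compared with their parent, whose average has scale d. The
  right sibling sits at the position of the parent, so one vertical chain suffices. The left one
  climbs to a row between d / 2 and d, crosses by d there, and joins the right chain.\<close>

lemma row_avg_pair:
  fixes d R :: nat and z :: int
  assumes p: "1 < p" "p < 2" and R: "1 \<le> R" "2 * R \<le> d"
  defines "V \<equiv> {z..<z + 2 * int d} \<times> {int R - 1..<int d - 1}"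
  shows "real R powr (2 - p) * \<bar>row_avg u (z + int d) R - row_avg u (z + int d) d\<bar> powr p \<le> pair_const p * (\<Sum>q\<in>V. grad p u q)"
    and "real R powr (2 - p) * \<bar>row_avg u z R - row_avg u (z + int d) d\<bar> powr p \<le> pair_const p * (\<Sum>q\<in>V. grad p u q)"
proof -
  define G where "G = (\<Sum>q\<in>V. grad p u q)"
  have G0: "0 \<le> G" by (simp add: G_def sum_nonneg)
  have fV: "finite V" by (simp add: V_def)
  have c0: "0 \<le> chain_const p" by (rule chain_const_nonneg)
  have right: "real r powr (2 - p) * \<bar>row_avg u (z + int d) d - row_avg u (z + int d) r\<bar> powr p \<le> chain_const p * G" if "R \<le> r" "r \<le> d" for r
    unfolding G_def using that R by (intro row_avg_chain p fV) (auto simp: V_def)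
  have left: "real R powr (2 - p) * \<bar>row_avg u z n - row_avg u z R\<bar> powr p \<le> chain_const p * G" if "R \<le> n" "n \<le> d" for n
    unfolding G_def using that R by (intro row_avg_chain p fV) (auto simp: V_def)
  show "real R powr (2 - p) * \<bar>row_avg u (z + int d) R - row_avg u (z + int d) d\<bar> powr p \<le> pair_const p * (\<Sum>q\<in>V. grad p u q)"
  proof -
    have "chain_const p * G \<le> pair_const p * G" using c0 G0 by (intro mult_right_mono) (auto simp: pair_const_def)
    then show ?thesis using right[of R] R by (simp add: G_def abs_minus_commute)
  qed
  define n0 where "n0 = d - d div 2"
  define I where "I = {n0..<d}"
  have n0: "R \<le> n0" "n0 < d" using R by (auto simp: n0_def)
  have "d \<le> 3 * (d div 2)" using R by presburger
  then have cI: "real d \<le> 3 * real (card I)" using R by (simp add: I_def n0_def)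
  define X where "X = {z..<z + 2 * int d}"
  define f where "f n = (\<Sum>x\<in>X. \<bar>dx u x (int n - 1)\<bar> powr p)" for n :: nat
  \<comment> \<open>The crossing uses the best of about d / 2 rows, whose horizontal energy is at
    most their average; a row fixed in advance could carry all of it.\<close>
  obtain n where n: "n \<in> I" "\<And>m. m \<in> I \<Longrightarrow> f n \<le> f m"
    using ex_min_if_finite[of "f ` I"] n0 by (force simp: I_def not_less)
  have fn: "real d * f n \<le> 3 * G"
  proof -
    have "real (card I) * f n \<le> (\<Sum>m\<in>I. f m)" using n(2) sum_bounded_below[of I "f n" f] by simp
    also have "\<dots> = (\<Sum>q\<in>I \<times> X. \<bar>dx u (snd q) (int (fst q) - 1)\<bar> powr p)"
      unfolding f_def by (simp add: sum.cartesian_product case_prod_unfold)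
    also have "\<dots> \<le> (\<Sum>q\<in>I \<times> X. grad p u (snd q, int (fst q) - 1))" by (intro sum_mono) (simp add: grad_def)
    also have "\<dots> = (\<Sum>q\<in>(\<lambda>q. (snd q, int (fst q) - 1)) ` (I \<times> X). grad p u q)"
      by (subst sum.reindex) (auto simp: inj_on_def)
    also have "\<dots> \<le> G" unfolding G_def using n0 fV by (intro sum_mono2) (auto simp: V_def X_def I_def)
    finally have "real (card I) * f n \<le> G" .
    moreover have "real d * f n \<le> 3 * real (card I) * f n" using cI by (intro mult_right_mono) (auto simp: f_def sum_nonneg)
    ultimately show ?thesis by simp
  qed
  have nR: "R \<le> n" "n \<le> d" "1 \<le> n" using n(1) n0 R by (auto simp: I_def)
  have cross: "real R powr (2 - p) * \<bar>row_avg u z n - row_avg u (z + int d) n\<bar> powr p \<le> 6 * G"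
  proof -
    define s where "s = (\<Sum>x\<in>X. \<bar>dx u x (int n - 1)\<bar>)"
    have s0: "0 \<le> s" by (simp add: s_def sum_nonneg)
    have "\<bar>u (z + int j) (int n - 1) - u (z + int d + int j) (int n - 1)\<bar> \<le> s" if "j < n" for j
    proof -
      have "\<bar>u (z + int j) (int n - 1) - u (z + int d + int j) (int n - 1)\<bar> \<le> (\<Sum>x\<in>{z + int j..<z + int d + int j}. \<bar>dx u x (int n - 1)\<bar>)"
        by (subst abs_minus_commute) (rule diff_le_sum_dx, simp)
      also have "\<dots> \<le> s" unfolding s_def using that nR by (intro sum_mono2) (auto simp: X_def)
      finally show ?thesis .
    qed
    then have "\<bar>\<Sum>j<n. u (z + int j) (int n - 1) - u (z + int d + int j) (int n - 1)\<bar> \<le> (\<Sum>j<n. s)"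
      by (intro order_trans[OF sum_abs] sum_mono) auto
    then have "\<bar>row_avg u z n - row_avg u (z + int d) n\<bar> \<le> s"
      unfolding row_avg_def diff_divide_distrib[symmetric] sum_subtractf[symmetric] abs_divide
      using nR by (simp add: field_simps)
    then have "\<bar>row_avg u z n - row_avg u (z + int d) n\<bar> powr p \<le> \<bar>s\<bar> powr p" using p s0 by (intro powr_mono2) auto
    also have "\<dots> \<le> real (card X) powr (p - 1) * f n"
      using powr_sum_le[of X p "\<lambda>x. \<bar>dx u x (int n - 1)\<bar>"] p by (simp add: s_def f_def X_def)
    also have "real (card X) = 2 * real d" by (simp add: X_def)
    finally have "real R powr (2 - p) * \<bar>row_avg u z n - row_avg u (z + int d) n\<bar> powr p \<le> real R powr (2 - p) * ((2 * real d) powr (p - 1) * f n)"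
      by (intro mult_left_mono) auto
    \<comment> \<open>The scales match: d powr (2 - p) from the weight and d powr (p - 1) from
      Hoelder give the factor d that the choice of the row has paid for.\<close>
    also have "\<dots> \<le> real d powr (2 - p) * ((2 * real d) powr (p - 1) * f n)"
      using p R by (intro mult_right_mono powr_mono2 mult_nonneg_nonneg) (auto simp: f_def sum_nonneg)
    also have "\<dots> = 2 powr (p - 1) * ((real d powr (2 - p) * real d powr (p - 1)) * f n)" by (simp add: powr_mult)
    also have "real d powr (2 - p) * real d powr (p - 1) = real d" unfolding powr_add[symmetric] using R by simp
    also have "2 powr (p - 1) * (real d * f n) \<le> 2 powr 1 * (3 * G)"
      using p G0 by (intro mult_mono[OF _ fn] powr_mono) (auto simp: f_def sum_nonneg)
    finally show ?thesis by simp
  qed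
  have right': "real R powr (2 - p) * \<bar>row_avg u (z + int d) n - row_avg u (z + int d) d\<bar> powr p \<le> chain_const p * G"
  proof -
    have "real R powr (2 - p) * \<bar>row_avg u (z + int d) n - row_avg u (z + int d) d\<bar> powr p
       \<le> real n powr (2 - p) * \<bar>row_avg u (z + int d) d - row_avg u (z + int d) n\<bar> powr p"
      using p nR by (simp add: abs_minus_commute mult_right_mono powr_mono2)
    then show ?thesis using right[of n] nR by linarith
  qed
  have "real R powr (2 - p) * \<bar>row_avg u z R - row_avg u (z + int d) d\<bar> powr p
    \<le> real R powr (2 - p) * (4 * (\<bar>row_avg u z R - row_avg u z n\<bar> powr p + \<bar>row_avg u z n - row_avg u (z + int d) n\<bar> powr p
        + \<bar>row_avg u (z + int d) n - row_avg u (z + int d) d\<bar> powr p))"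
    using powr_add3_le[of p "row_avg u z R - row_avg u z n" "row_avg u z n - row_avg u (z + int d) n" "row_avg u (z + int d) n - row_avg u (z + int d) d"] p
    by (intro mult_left_mono) auto
  also have "\<dots> = 4 * (real R powr (2 - p) * \<bar>row_avg u z n - row_avg u z R\<bar> powr p + real R powr (2 - p) * \<bar>row_avg u z n - row_avg u (z + int d) n\<bar> powr p
        + real R powr (2 - p) * \<bar>row_avg u (z + int d) n - row_avg u (z + int d) d\<bar> powr p)"
    by (simp add: distrib_left abs_minus_commute)
  also have "\<dots> \<le> 4 * (chain_const p * G + 6 * G + chain_const p * G)"
    using left[of n] cross right' nR by (intro mult_left_mono add_mono) auto
  also have "\<dots> = pair_const p * G" by (simp add: pair_const_def algebra_simps)
  finally show "real R powr (2 - p) * \<bar>row_avg u z R - row_avg u (z + int d) d\<bar> powr p \<le> pair_const p * (\<Sum>q\<in>V. grad p u q)"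
    by (simp add: G_def)
qed

subsection \<open>Cantor sets of integers\<close>

text \<open>Leaves of the binary tree of depth \<open>L\<close> are placed at \<open>z0\<close> minus a sum of some of the \<open>d l\<close>;
  \<open>pos l m\<close> is the rightmost leaf below the \<open>m\<close>-th node of level \<open>l\<close>, and \<open>rad l\<close> is comparable to
  the diameter of the cluster of leaves below such a node (or \<open>1\<close> for a single leaf).\<close>

locale cantor_tree =
  fixes L :: nat and d :: "nat \<Rightarrow> int" and z0 :: int
  assumes L: "1 \<le> L" and d_L: "d L = 2" and d_step: "\<And>l. 1 \<le> l \<Longrightarrow> l < L \<Longrightarrow> 100 * d (Suc l) \<le> d l"
begin

fun pos :: "nat \<Rightarrow> nat \<Rightarrow> int" where
  "pos 0 m = z0"
| "pos (Suc l) m = pos l (m div 2) - (if even m then d (Suc l) else 0)"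

definition rad :: "nat \<Rightarrow> int" where
  "rad l = (if l < L then d (Suc l) else 1)"

lemma d_ge_2: "1 \<le> l \<Longrightarrow> l \<le> L \<Longrightarrow> 2 \<le> d l"
proof (induction "L - l" arbitrary: l)
  case 0
  then show ?case using d_L by simp
next
  case (Suc n)
  have "n = L - Suc l" "Suc l \<le> L" using Suc.hyps(2) by auto
  then have "2 \<le> d (Suc l)" by (intro Suc.hyps(1)) auto
  moreover have "100 * d (Suc l) \<le> d l" using \<open>Suc l \<le> L\<close> Suc.prems by (intro d_step) auto
  ultimately show ?case by simp
qed

lemma rad_ge_1: "1 \<le> rad l"
  using d_ge_2[of "Suc l"] by (auto simp: rad_def)

lemma rad_le_d: "1 \<le> l \<Longrightarrow> l \<le> L \<Longrightarrow> 2 * rad l \<le> d l"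
  using d_step[of l] d_ge_2[of "Suc l"] d_L by (cases "l < L") (auto simp: rad_def)

lemma rad_Suc: "Suc l \<le> L \<Longrightarrow> 2 * rad (Suc l) \<le> rad l"
  using rad_le_d[of "Suc l"] by (auto simp: rad_def)

lemma rad_antimono: "l \<le> k \<Longrightarrow> rad k \<le> rad l"
proof (induction k rule: dec_induct)
  case (step k)
  then show ?case using rad_Suc[of k] rad_ge_1[of "Suc k"] rad_ge_1[of l] by (cases "Suc k \<le> L") (auto simp: rad_def)
qed simp

lemma d_le_rad: "l < k \<Longrightarrow> k \<le> L \<Longrightarrow> d k \<le> rad l"
  using rad_antimono[of l "k - 1"] by (cases k) (auto simp: rad_def)

lemma rad_100: "l < k \<Longrightarrow> k < L \<Longrightarrow> 100 * rad k \<le> rad l"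
proof -
  assume lk: "l < k" "k < L"
  then obtain k' where k': "k = Suc k'" by (cases k) auto
  then have "rad k' \<le> rad l" using lk by (intro rad_antimono) auto
  moreover have "100 * rad k \<le> rad k'" using d_step[of k] lk k' by (simp add: rad_def)
  ultimately show ?thesis by simp
qed

text \<open>A geometric series kept as an invariant: level k + 1 displaces by at most rad k, and 2
  rad (k+1) \<le> rad k absorbs this into the term - 2 rad k.\<close>

lemma pos_descendant: "l \<le> k \<Longrightarrow> k \<le> L \<Longrightarrow> pos k m \<le> pos l (m div 2 ^ (k - l)) \<and> pos l (m div 2 ^ (k - l)) \<le> pos k m + 2 * rad l - 2 * rad k"
proof (induction k arbitrary: m rule: dec_induct)
  case (step k)
  have eq: "m div 2 ^ (Suc k - l) = m div 2 div 2 ^ (k - l)"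
    using step by (simp add: Suc_diff_le div_mult2_eq)
  have "d (Suc k) = rad k" "0 \<le> d (Suc k)" using step d_ge_2[of "Suc k"] by (auto simp: rad_def)
  then show ?case using step.IH[of "m div 2"] step.prems rad_Suc[of k] unfolding eq by auto
qed simp

text \<open>Siblings differ by exactly d l. For different parents, the distance of the parents is at
  least 100 d l and is reduced by at most d l.\<close>

lemma pos_separated:
  "1 \<le> l \<Longrightarrow> l \<le> L \<Longrightarrow> m < 2 ^ l \<Longrightarrow> m' < 2 ^ l \<Longrightarrow> m \<noteq> m' \<Longrightarrow> d l \<le> \<bar>pos l m - pos l m'\<bar>"
proof (induction l arbitrary: m m')
  case (Suc l)
  have d: "2 \<le> d (Suc l)" using Suc.prems by (intro d_ge_2) auto
  show ?case
  proof (cases "m div 2 = m' div 2")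
    case True
    then have "even m \<noteq> even m'" using Suc.prems(5) by (metis dvd_mult_div_cancel odd_two_times_div_two_succ)
    then show ?thesis using True d by auto
  next
    case False
    then have l: "1 \<le> l" using Suc.prems by (cases l) auto
    then have "d l \<le> \<bar>pos l (m div 2) - pos l (m' div 2)\<bar>" using Suc False by auto
    then show ?thesis using d_step[of l] l Suc.prems d by auto
  qed
qed simp

lemma pos_bounds: "l \<le> L \<Longrightarrow> pos l m \<in> {z0 - 2 * d 1..z0}"
  using pos_descendant[of 0 l m] rad_ge_1[of l] L by (auto simp: rad_def)

definition tree_w :: "real \<Rightarrow> nat \<Rightarrow> real" where
  "tree_w p l = real_of_int (rad l) powr (2 - p)"

lemma tree_w_pos: "0 < tree_w p l"
  using rad_ge_1[of l] by (simp add: tree_w_def)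

text \<open>Each pair of siblings is charged to its own box, and the boxes are pairwise disjoint.
  The total is therefore at most one energy of G, whatever the depth of the tree.\<close>

lemma tree_energy_trace_le:
  assumes p: "1 < p" "p < 2" and M: "\<bar>z0\<bar> + 3 * d 1 \<le> M"
  shows "tree_energy p L (tree_w p) (\<lambda>l m. row_avg (dy G) (pos l m) (nat (rad l))) \<le> 2 * pair_const p * energy p M G"
proof -
  define u where "u = dy G"
  define VV where "VV l m = row_avg u (pos l m) (nat (rad l))" for l m
  define Q where "Q l k = {pos (l - 1) k - d l..<pos (l - 1) k + d l} \<times> {rad l - 1..<d l - 1}" for l k
  define J where "J = (SIGMA l:{1..L}. {..<2 ^ (l - 1) :: nat})"
  have pc: "0 \<le> pair_const p" using chain_const_nonneg by (simp add: pair_const_def)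
  have pair: "tree_w p l * (\<Sum>m<2 ^ l. \<bar>VV l m - VV (l - 1) (m div 2)\<bar> powr p) \<le> (\<Sum>k<2 ^ (l - 1). 2 * pair_const p * (\<Sum>q\<in>Q l k. grad p u q))"
    if l: "l \<in> {1..L}" for l
  proof -
    obtain l' where l': "l = Suc l'" using l by (cases l) auto
    define D where "D = nat (d l)"
    define r where "r = nat (rad l)"
    have D: "int D = d l" and r: "int r = rad l" using d_ge_2[of l] rad_ge_1[of l] l by (auto simp: D_def r_def)
    have r1: "1 \<le> r" "2 * r \<le> D" using rad_ge_1[of l] rad_le_d[of l] l D r by auto
    have radl': "nat (rad l') = D" using l l' by (auto simp: rad_def D_def)
    have w: "tree_w p l = real r powr (2 - p)" unfolding tree_w_def r[symmetric] by simp
    have "(\<Sum>m<2 ^ l. \<bar>VV l m - VV (l - 1) (m div 2)\<bar> powr p) = (\<Sum>k<2 ^ l'. \<bar>VV l (2 * k) - VV l' k\<bar> powr p + \<bar>VV l (2 * k + 1) - VV l' k\<bar> powr p)"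
      unfolding l' power_Suc sum_lessThan_double by simp
    then have "tree_w p l * (\<Sum>m<2 ^ l. \<bar>VV l m - VV (l - 1) (m div 2)\<bar> powr p) = (\<Sum>k<2 ^ l'. real r powr (2 - p) * \<bar>VV l (2 * k) - VV l' k\<bar> powr p + real r powr (2 - p) * \<bar>VV l (2 * k + 1) - VV l' k\<bar> powr p)"
      by (simp add: w sum_distrib_left distrib_left)
    also have "\<dots> \<le> (\<Sum>k<2 ^ l'. pair_const p * (\<Sum>q\<in>Q l k. grad p u q) + pair_const p * (\<Sum>q\<in>Q l k. grad p u q))"
    proof (intro sum_mono add_mono)
      fix k
      define z where "z = pos l' k - int D"
      have dl: "d (Suc l') = int D" using D l' by simp
      have "pos (Suc l') (2 * k) = pos l' k - d (Suc l')" "pos (Suc l') (2 * k + 1) = pos l' k" by simp_all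
      then have "pos l (2 * k) = z" "pos l (2 * k + 1) = z + int D" "pos l' k = z + int D"
        unfolding z_def dl l' by simp_all
      then have V: "VV l (2 * k) = row_avg u z r" "VV l (2 * k + 1) = row_avg u (z + int D) r" "VV l' k = row_avg u (z + int D) D"
        unfolding VV_def radl' r_def by simp_all
      have Q: "Q l k = {z..<z + 2 * int D} \<times> {int r - 1..<int D - 1}"
      proof -
        have "pos (l - 1) k - d l = z" "pos (l - 1) k + d l = z + 2 * d l" unfolding z_def D l' by simp_all
        then show ?thesis by (simp only: Q_def D r)
      qed
      show "real r powr (2 - p) * \<bar>VV l (2 * k) - VV l' k\<bar> powr p \<le> pair_const p * (\<Sum>q\<in>Q l k. grad p u q)"
        using row_avg_pair(2)[OF p r1, of u z] unfolding V Q .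
      show "real r powr (2 - p) * \<bar>VV l (2 * k + 1) - VV l' k\<bar> powr p \<le> pair_const p * (\<Sum>q\<in>Q l k. grad p u q)"
        using row_avg_pair(1)[OF p r1, of u z] unfolding V Q .
    qed
    finally show ?thesis by (simp add: l' mult.assoc)
  qed
  \<comment> \<open>Levels use different rows: the boxes of level l2 end below d l2, and a coarser
    level starts at rad l - 1 with d l2 \<le> rad l. Within one level the half-width is d l, while
    the parents are at least 100 d l apart.\<close>
  have disj: "Q (fst i) (snd i) \<inter> Q (fst j) (snd j) = {}" if i: "i \<in> J" and j: "j \<in> J" and ij: "i \<noteq> j" for i j
  proof -
    obtain l k l2 k2 where e: "i = (l, k)" "j = (l2, k2)" by (cases i, cases j) auto
    have rows: "Q l k \<inter> Q l2 k2 = {}" if "l < l2" "1 \<le> l" "l2 \<le> L" for l k l2 k2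
    proof -
      have "d l2 \<le> rad l" using that by (intro d_le_rad) auto
      then show ?thesis by (auto simp: Q_def)
    qed
    consider "l < l2" | "l2 < l" | "l = l2" "k \<noteq> k2" using ij e by fastforce
    then show ?thesis
    proof cases
      case 1
      then show ?thesis using rows i j e by (auto simp: J_def)
    next
      case 2
      then show ?thesis using rows[of l2 l k2 k] i j e by (auto simp: J_def)
    next
      case 3
      then have l: "1 \<le> l - 1" using i j e by (cases "l - 1") (auto simp: J_def)
      have "d (l - 1) \<le> \<bar>pos (l - 1) k - pos (l - 1) k2\<bar>"
        using 3 l i j e by (intro pos_separated) (auto simp: J_def)
      moreover have "100 * d l \<le> d (l - 1)" "2 \<le> d l" using d_step[of "l - 1"] d_ge_2[of l] l i e by (auto simp: J_def)
      ultimately show ?thesis using 3 e by (auto simp: Q_def)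
    qed
  qed
  have sub: "Q (fst i) (snd i) \<subseteq> lbox M" if "i \<in> J" for i
  proof -
    obtain l k where e: "i = (l, k)" by (cases i)
    have l: "1 \<le> l" "l \<le> L" using that e by (auto simp: J_def)
    have 1: "pos (l - 1) k \<in> {z0 - 2 * d 1..z0}" using l by (intro pos_bounds) auto
    have 2: "d l \<le> d 1" using d_le_rad[of 0 l] l L by (auto simp: rad_def)
    have 3: "1 \<le> rad l" "2 \<le> d l" using rad_ge_1 d_ge_2 l by auto
    show ?thesis
    proof
      fix q assume q: "q \<in> Q (fst i) (snd i)"
      obtain x y where xy: "q = (x, y)" by (cases q)
      have x: "pos (l - 1) k - d l \<le> x" "x < pos (l - 1) k + d l" "rad l - 1 \<le> y" "y < d l - 1"
        using q by (auto simp: xy e Q_def)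
      have "z0 - 2 * d 1 \<le> pos (l - 1) k" "pos (l - 1) k \<le> z0" using 1 by auto
      then have "- M \<le> x" "x \<le> M" "-M \<le> y" "y \<le> M" using x M 2 3 by linarith+
      then show "q \<in> lbox M" by (simp add: lbox_def xy)
    qed
  qed
  have "tree_energy p L (tree_w p) VV \<le> (\<Sum>l=1..L. \<Sum>k<2 ^ (l - 1). 2 * pair_const p * (\<Sum>q\<in>Q l k. grad p u q))"
    unfolding tree_energy_def by (intro sum_mono pair)
  also have "\<dots> = (\<Sum>i\<in>J. 2 * pair_const p * (\<Sum>q\<in>Q (fst i) (snd i). grad p u q))"
    unfolding J_def by (subst sum.Sigma) (auto simp: case_prod_unfold)
  also have "\<dots> = 2 * pair_const p * (\<Sum>i\<in>J. \<Sum>q\<in>Q (fst i) (snd i). grad p u q)" by (simp add: sum_distrib_left)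
  also have "(\<Sum>i\<in>J. \<Sum>q\<in>Q (fst i) (snd i). grad p u q) = (\<Sum>q\<in>(\<Union>i\<in>J. Q (fst i) (snd i)). grad p u q)"
    by (rule sum.UNION_disjoint[symmetric]) (use disj in \<open>auto simp: J_def Q_def\<close>)
  also have "\<dots> \<le> (\<Sum>q\<in>lbox M. grad p u q)" using sub by (intro sum_mono2) auto
  also have "\<dots> \<le> energy p M G" unfolding energy_def u_def by (intro sum_mono grad_dy_le_hess)
  finally show ?thesis using pc by (simp add: VV_def u_def mult_left_mono)
qed

end

section \<open>Lattice functions with prescribed slopes at the clusters\<close>

lemma dx_sum: "dx (\<lambda>x y. \<Sum>i\<in>I. c i * \<phi> i x y) = (\<lambda>x y. \<Sum>i\<in>I. c i * dx (\<phi> i) x y)"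
  and dy_sum: "dy (\<lambda>x y. \<Sum>i\<in>I. c i * \<phi> i x y) = (\<lambda>x y. \<Sum>i\<in>I. c i * dy (\<phi> i) x y)"
  by (simp_all add: dx_def dy_def fun_eq_iff sum_subtractf right_diff_distrib)

text \<open>At each point at most one summand has a nonzero Hessian, so p-th powers add exactly and
  the number of summands costs nothing.\<close>

lemma hess_disjoint_sum:
  assumes I: "finite I" and p: "0 < p"
    and disj: "\<And>i j. i \<in> I \<Longrightarrow> j \<in> I \<Longrightarrow> i \<noteq> j \<Longrightarrow> hess p (\<phi> i) q = 0 \<or> hess p (\<phi> j) q = 0"
  shows "hess p (\<lambda>x y. \<Sum>i\<in>I. c i * \<phi> i x y) q = (\<Sum>i\<in>I. \<bar>c i\<bar> powr p * hess p (\<phi> i) q)"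
proof (cases "\<exists>i\<in>I. hess p (\<phi> i) q \<noteq> 0")
  case False
  have z: "dx (dx (\<phi> i)) (fst q) (snd q) = 0" "dx (dy (\<phi> i)) (fst q) (snd q) = 0" "dy (dy (\<phi> i)) (fst q) (snd q) = 0" if "i \<in> I" for i
  proof -
    have "hess p (\<phi> i) q = 0" using False that by blast
    then show "dx (dx (\<phi> i)) (fst q) (snd q) = 0" "dx (dy (\<phi> i)) (fst q) (snd q) = 0" "dy (dy (\<phi> i)) (fst q) (snd q) = 0"
      unfolding hess_def by (simp_all add: add_nonneg_eq_0_iff)
  qed
  then show ?thesis using False by (simp add: hess_def dx_sum dy_sum)
next
  case True
  then obtain i0 where i0: "i0 \<in> I" "hess p (\<phi> i0) q \<noteq> 0" by blast
  have h0: "hess p (\<phi> i) q = 0" if "i \<in> I - {i0}" for i using disj[of i i0] i0 that by auto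
  then have z: "dx (dx (\<phi> i)) (fst q) (snd q) = 0" "dx (dy (\<phi> i)) (fst q) (snd q) = 0" "dy (dy (\<phi> i)) (fst q) (snd q) = 0" if "i \<in> I - {i0}" for i
    using h0[OF that] unfolding hess_def by (simp_all add: add_nonneg_eq_0_iff)
  have single: "(\<Sum>i\<in>I. f i) = f i0" if "\<And>i. i \<in> I - {i0} \<Longrightarrow> f i = 0" for f :: "_ \<Rightarrow> real"
    using sum.remove[OF I i0(1), of f] that by simp
  have "(\<Sum>i\<in>I. c i * dx (dx (\<phi> i)) (fst q) (snd q)) = c i0 * dx (dx (\<phi> i0)) (fst q) (snd q)"
    "(\<Sum>i\<in>I. c i * dx (dy (\<phi> i)) (fst q) (snd q)) = c i0 * dx (dy (\<phi> i0)) (fst q) (snd q)"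
    "(\<Sum>i\<in>I. c i * dy (dy (\<phi> i)) (fst q) (snd q)) = c i0 * dy (dy (\<phi> i0)) (fst q) (snd q)"
    by (rule single; simp add: z)+
  then have "hess p (\<lambda>x y. \<Sum>i\<in>I. c i * \<phi> i x y) q = \<bar>c i0\<bar> powr p * hess p (\<phi> i0) q"
    by (simp add: hess_def dx_sum dy_sum abs_mult powr_mult distrib_left)
  also have "\<dots> = (\<Sum>i\<in>I. \<bar>c i\<bar> powr p * hess p (\<phi> i) q)" by (rule single[symmetric]) (simp add: h0)
  finally show ?thesis .
qed

lemma hess_eq_0_linear:
  assumes "\<And>i j. i \<in> {0,1,2} \<Longrightarrow> j \<in> {0,1,2} \<Longrightarrow> h (x + i) (y + j) = real_of_int (y + j)" and p: "0 < p"
  shows "hess p h (x, y) = 0"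
proof -
  have "dx (dx h) x y = h (x + 2) (y + 0) - 2 * h (x + 1) (y + 0) + h (x + 0) (y + 0)"
    "dy (dy h) x y = h (x + 0) (y + 2) - 2 * h (x + 0) (y + 1) + h (x + 0) (y + 0)"
    "dx (dy h) x y = h (x + 1) (y + 1) - h (x + 1) (y + 0) - h (x + 0) (y + 1) + h (x + 0) (y + 0)"
    by (simp_all add: dx_def dy_def algebra_simps)
  moreover have "h (x + 0) (y + 0) = real_of_int (y + 0)" "h (x + 0) (y + 1) = real_of_int (y + 1)" "h (x + 0) (y + 2) = real_of_int (y + 2)" 
     "h (x + 1) (y + 0) = real_of_int (y + 0)" "h (x + 1) (y + 1) = real_of_int (y + 1)" "h (x + 2) (y + 0) = real_of_int (y + 0)"
    by (intro assms(1); simp)+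
  ultimately show ?thesis using p by (simp add: hess_def)
qed

lemma hess_linear_add: "hess p (\<lambda>x y. b * real_of_int y + h x y) q = hess p h q"
proof -
  have "dx (dx (\<lambda>x y. b * real_of_int y + h x y)) = dx (dx h)" "dx (dy (\<lambda>x y. b * real_of_int y + h x y)) = dx (dy h)"
    "dy (dy (\<lambda>x y. b * real_of_int y + h x y)) = dy (dy h)"
    by (auto simp: dx_def dy_def fun_eq_iff algebra_simps)
  then show ?thesis by (simp add: hess_def)
qed

text \<open>Differences are simply bounded by values. This is meant for the leaves, where the scale
  is 1 and nothing is gained from differencing.\<close>

lemma hess_le_values:
  assumes p: "1 < p" "p < 2"
  shows "hess p h (x, y) \<le> 48 * (\<Sum>i\<in>{0,1,2}. \<Sum>j\<in>{0,1,2}. \<bar>h (x + i) (y + j)\<bar> powr p)"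
proof -
  have p': "1 \<le> p" "p \<le> 2" using p by auto
  define b where "b i j = \<bar>h (x + i) (y + j)\<bar> powr p" for i j
  have b0: "0 \<le> b i j" for i j by (simp add: b_def)
  have m2: "\<bar>- (2 * t)\<bar> powr p \<le> 4 * \<bar>t\<bar> powr p" for t :: real
    using powr_two_le_4[of p] p by (simp add: abs_mult powr_mult mult_right_mono)
  have three: "\<bar>u - 2 * v + w\<bar> powr p \<le> 16 * (\<bar>u\<bar> powr p + \<bar>v\<bar> powr p + \<bar>w\<bar> powr p)" for u v w :: real
  proof -
    have "\<bar>u - 2 * v + w\<bar> powr p \<le> 4 * (\<bar>u\<bar> powr p + \<bar>- (2 * v)\<bar> powr p + \<bar>w\<bar> powr p)"
      using powr_add3_le[OF p', of u "- (2 * v)" w] by simp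
    also have "\<dots> \<le> 4 * (\<bar>u\<bar> powr p + 4 * \<bar>v\<bar> powr p + \<bar>w\<bar> powr p)"
      by (intro mult_left_mono add_mono m2) auto
    also have "\<dots> \<le> 16 * (\<bar>u\<bar> powr p + \<bar>v\<bar> powr p + \<bar>w\<bar> powr p)"
      by simp
    finally show ?thesis .
  qed
  have four: "\<bar>u - v - w + t\<bar> powr p \<le> 16 * (\<bar>u\<bar> powr p + \<bar>v\<bar> powr p + \<bar>w\<bar> powr p + \<bar>t\<bar> powr p)" for u v w t :: real
  proof -
    have "\<bar>u - v - w + t\<bar> powr p \<le> 2 * (\<bar>u - v\<bar> powr p + \<bar>- w + t\<bar> powr p)"
      using powr_add_le[OF p', of "u - v" "- w + t"] by (simp only: diff_conv_add_uminus add.assoc)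
    also have "\<dots> \<le> 2 * (2 * (\<bar>u\<bar> powr p + \<bar>v\<bar> powr p) + 2 * (\<bar>w\<bar> powr p + \<bar>t\<bar> powr p))"
      using powr_add_le[OF p', of u "-v"] powr_add_le[OF p', of "-w" t] by (intro mult_left_mono add_mono) auto
    also have "\<dots> \<le> 16 * (\<bar>u\<bar> powr p + \<bar>v\<bar> powr p + \<bar>w\<bar> powr p + \<bar>t\<bar> powr p)" by simp
    finally show ?thesis .
  qed
  have 1: "\<bar>dx (dx h) x y\<bar> powr p \<le> 16 * (b 2 0 + b 1 0 + b 0 0)"
    using three[of "h (x + 2) y" "h (x + 1) y" "h x y"] by (simp add: dx_def b_def algebra_simps)
  have 2: "\<bar>dy (dy h) x y\<bar> powr p \<le> 16 * (b 0 2 + b 0 1 + b 0 0)"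
    using three[of "h x (y + 2)" "h x (y + 1)" "h x y"] by (simp add: dy_def b_def algebra_simps)
  have 3: "\<bar>dx (dy h) x y\<bar> powr p \<le> 16 * (b 1 1 + b 1 0 + b 0 1 + b 0 0)"
    using four[of "h (x + 1) (y + 1)" "h (x + 1) y" "h x (y + 1)" "h x y"] by (simp add: dx_def dy_def b_def algebra_simps)
  have "hess p h (x, y) \<le> 16 * (b 2 0 + b 1 0 + b 0 0) + 16 * (b 1 1 + b 1 0 + b 0 1 + b 0 0) + 16 * (b 0 2 + b 0 1 + b 0 0)"
    unfolding hess_def fst_conv snd_conv by (intro add_mono 1 2 3)
  also have "\<dots> \<le> 48 * b 0 0 + 48 * (b 2 0 + b 1 0 + b 1 1 + b 0 1 + b 0 2 + b 1 2 + b 2 1 + b 2 2)"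
    using b0[of 2 0] b0[of 1 0] b0[of 1 1] b0[of 0 1] b0[of 0 2] b0[of 1 2] b0[of 2 1] b0[of 2 2] by simp
  finally have "hess p h (x, y) \<le> 48 * b 0 0 + 48 * (b 2 0 + b 1 0 + b 1 1 + b 0 1 + b 0 2 + b 1 2 + b 2 1 + b 2 2)" .
  moreover have "(\<Sum>i\<in>{0,1,2}. \<Sum>j\<in>{0,1,2}. b i j) = b 0 0 + b 0 1 + b 0 2 + (b 1 0 + b 1 1 + b 1 2) + (b 2 0 + b 2 1 + b 2 2)"
    by simp
  ultimately show ?thesis by (simp add: b_def)
qed

text \<open>Fixed by choice, so that one absolute constant serves every node and every p.\<close>

definition cut_const :: real where
  "cut_const = (SOME C. 1 \<le> C \<and> (\<forall>r s a. 0 < s \<and> s \<le> r \<longrightarrow> cut_bounds (C / s) (lcutoff r s a)))"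

lemma cut_const: "1 \<le> cut_const" "0 < s \<Longrightarrow> s \<le> r \<Longrightarrow> cut_bounds (cut_const / s) (lcutoff r s a)"
proof -
  have "1 \<le> cut_const \<and> (\<forall>r s a. 0 < s \<and> s \<le> r \<longrightarrow> cut_bounds (cut_const / s) (lcutoff r s a))"
    unfolding cut_const_def by (rule someI_ex[OF lcutoff_bounds[unfolded Bex_def]])
  then show "1 \<le> cut_const" "0 < s \<Longrightarrow> s \<le> r \<Longrightarrow> cut_bounds (cut_const / s) (lcutoff r s a)" by auto
qed

text \<open>361 = 19^2 bounds the number of lattice points of the support in units of rad^2. The two
  powers stem from one difference of the cutoff times the slope 1 of y, and from two differences
  times |y| \<le> 9 rad.\<close>

definition node_const :: "real \<Rightarrow> real" where
  "node_const p = 361 * (40 * ((cut_const / 4) powr p + (9 * cut_const\<^sup>2 / 16) powr p))"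

lemma node_const_nonneg: "0 \<le> node_const p"
  by (simp add: node_const_def)

context cantor_tree
begin

text \<open>The function y localised to a cluster: slope 1 up to distance 4 rad, gone at 8 rad. The
  factor y leaves the bottom row untouched.\<close>

definition node_cut :: "nat \<Rightarrow> nat \<Rightarrow> lattice_fun" where
  "node_cut l m x y = lcutoff (4 * real_of_int (rad l)) (4 * real_of_int (rad l)) (pos l m) x y * real_of_int y"

lemma node_cut_eq_0:
  assumes "8 * rad l \<le> \<bar>x - pos l m\<bar> \<or> 8 * rad l \<le> \<bar>y\<bar>"
  shows "node_cut l m x y = 0"
proof -
  define r where "r = real_of_int (rad l)"
  have r: "1 \<le> r" using rad_ge_1[of l] by (simp add: r_def)
  have "cutoff (real_of_int (x - pos l m) / (4 * r)) = 0 \<or> cutoff (real_of_int y / (4 * r)) = 0"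
    using assms
  proof
    assume "8 * rad l \<le> \<bar>x - pos l m\<bar>"
    then have "real_of_int (8 * rad l) \<le> real_of_int \<bar>x - pos l m\<bar>" by (simp only: of_int_le_iff)
    then show ?thesis using r by (intro disjI1 cutoff_eq_0) (simp add: field_simps r_def[symmetric])
  next
    assume "8 * rad l \<le> \<bar>y\<bar>"
    then have "real_of_int (8 * rad l) \<le> real_of_int \<bar>y\<bar>" by (simp only: of_int_le_iff)
    then show ?thesis using r by (intro disjI2 cutoff_eq_0) (simp add: field_simps r_def[symmetric])
  qed
  then show ?thesis by (auto simp: node_cut_def lcutoff_def r_def)
qed

lemma node_cut_eq_linear:
  assumes "\<bar>x - pos l m\<bar> \<le> 4 * rad l" "\<bar>y\<bar> \<le> 4 * rad l"
  shows "node_cut l m x y = real_of_int y"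
proof -
  define r where "r = real_of_int (rad l)"
  have r: "1 \<le> r" using rad_ge_1[of l] by (simp add: r_def)
  have "real_of_int \<bar>x - pos l m\<bar> \<le> real_of_int (4 * rad l)" "real_of_int \<bar>y\<bar> \<le> real_of_int (4 * rad l)"
    using assms by (simp_all only: of_int_le_iff)
  then have "cutoff (real_of_int (x - pos l m) / (4 * r)) = 1" "cutoff (real_of_int y / (4 * r)) = 1"
    using r by (auto intro!: cutoff_eq_1 simp: field_simps r_def[symmetric])
  then show ?thesis by (simp add: node_cut_def lcutoff_def r_def)
qed

text \<open>The radii 3 and 9 leave a margin around 4 and 8 for a stencil that reaches two steps
  right and up. This needs rad l \<ge> 2, hence l < L; at the leaves there is no such room, and they
  are treated separately.\<close>

lemma hess_node_cut_support:
  assumes p: "0 < p" and l: "l < L" and nz: "hess p (node_cut l m) (x, y) \<noteq> 0" 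
  shows "\<bar>x - pos l m\<bar> \<le> 9 * rad l" "\<bar>y\<bar> \<le> 9 * rad l" "3 * rad l < \<bar>x - pos l m\<bar> \<or> 3 * rad l < \<bar>y\<bar>"
proof -
  have r: "2 \<le> rad l" using l d_ge_2[of "Suc l"] by (simp add: rad_def)
  show "\<bar>x - pos l m\<bar> \<le> 9 * rad l"
  proof (rule ccontr)
    assume "\<not> \<bar>x - pos l m\<bar> \<le> 9 * rad l"
    then have "hess p (node_cut l m) (x, y) = 0"
      using r p by (intro hess_eq_0 node_cut_eq_0) auto
    then show False using nz by simp
  qed
  show "\<bar>y\<bar> \<le> 9 * rad l"
  proof (rule ccontr)
    assume "\<not> \<bar>y\<bar> \<le> 9 * rad l"
    then have "hess p (node_cut l m) (x, y) = 0"
      using r p by (intro hess_eq_0 node_cut_eq_0) auto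
    then show False using nz by simp
  qed
  show "3 * rad l < \<bar>x - pos l m\<bar> \<or> 3 * rad l < \<bar>y\<bar>"
  proof (rule ccontr)
    assume "\<not> (3 * rad l < \<bar>x - pos l m\<bar> \<or> 3 * rad l < \<bar>y\<bar>)"
    then have "hess p (node_cut l m) (x, y) = 0"
      using r p by (intro hess_eq_0_linear node_cut_eq_linear) auto
    then show False using nz by simp
  qed
qed

text \<open>If m is not the level-l ancestor of m', that ancestor is at least 100 rad l away from m.
  If it is, the support of the finer Hessian, of radius 9 rad k around a point at most 2 rad l off,
  lies within 3 rad l of the coarser centre, where the coarser function is still linear.\<close>

lemma hess_node_cut_disjoint:
  assumes p: "0 < p" and lk: "l \<le> k" "1 \<le> l" "k < L" and m: "m < 2 ^ l" "m' < 2 ^ k" "(l, m) \<noteq> (k, m')"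
  shows "hess p (node_cut l m) (x, y) = 0 \<or> hess p (node_cut k m') (x, y) = 0"
proof (rule ccontr)
  assume "\<not> (hess p (node_cut l m) (x, y) = 0 \<or> hess p (node_cut k m') (x, y) = 0)"
  then have nz: "hess p (node_cut l m) (x, y) \<noteq> 0" "hess p (node_cut k m') (x, y) \<noteq> 0" by auto
  have l: "l < L" using lk by simp
  note s1 = hess_node_cut_support[OF p l nz(1)] and s2 = hess_node_cut_support[OF p lk(3) nz(2)]
  define a where "a = m' div 2 ^ (k - l)"
  have a: "a < 2 ^ l"
    unfolding a_def using m lk by (simp add: less_mult_imp_div_less power_add[symmetric])
  have da: "pos k m' \<le> pos l a" "pos l a \<le> pos k m' + 2 * rad l"
    using pos_descendant[of l k m'] lk rad_ge_1[of k] by (auto simp: a_def)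
  have dl: "100 * rad l \<le> d l" using d_step[of l] lk l by (simp add: rad_def)
  have rl: "1 \<le> rad l" "1 \<le> rad k" "rad k \<le> rad l" using rad_ge_1 rad_antimono lk by auto
  show False
  proof (cases "a = m")
    case False
    then have "d l \<le> \<bar>pos l a - pos l m\<bar>" using a m lk l by (intro pos_separated) auto
    then show False using dl s1(1) s2(1) da rl by linarith
  next
    case True
    then have "l \<noteq> k" using m a_def by auto
    then have "100 * rad k \<le> rad l" using lk by (intro rad_100) auto
    then show False using s1(3) s2(1,2) da rl unfolding True by linarith
  qed
qed

text \<open>A Hessian of size 1 / rad on about rad^2 points: the origin of the weight rad powr (2 -
  p).\<close>

lemma energy_node_cut:
  assumes p: "1 < p" "p < 2"
    and l: "l < L" and A: "finite A"
  shows "(\<Sum>q\<in>A. hess p (node_cut l m) q) \<le> node_const p * tree_w p l"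
proof -
  define r where "r = real_of_int (rad l)"
  have r: "1 \<le> r" using rad_ge_1[of l] by (simp add: r_def)
  define c where "c = cut_const / (4 * r)"
  define \<kappa> where "\<kappa> = lcutoff (4 * r) (4 * r) (pos l m)"
  have C: "1 \<le> cut_const" by (rule cut_const)
  have c: "cut_bounds c \<kappa>" unfolding c_def \<kappa>_def using r by (intro cut_const) auto
  have c0: "0 \<le> c" using C r by (simp add: c_def)
  define Z where "Z = {pos l m - 9 * rad l..pos l m + 9 * rad l} \<times> {- (9 * rad l)..9 * rad l}"
  define B where "B = 40 * ((cut_const / 4) powr p + (9 * cut_const\<^sup>2 / 16) powr p) * r powr (- p)"
  have B0: "0 \<le> B" by (simp add: B_def)
  have pt: "hess p (node_cut l m) q \<le> B" if "q \<in> Z" for q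
  proof -
    obtain x y where q: "q = (x, y)" by (cases q)
    have "\<bar>y\<bar> \<le> 9 * rad l" using that by (auto simp: q Z_def)
    then have "real_of_int \<bar>y\<bar> \<le> real_of_int (9 * rad l)" by (simp only: of_int_le_iff)
    then have y: "\<bar>real_of_int y\<bar> \<le> 9 * r" by (simp add: r_def)
    define h :: lattice_fun where "h = (\<lambda>x y. real_of_int y)"
    have h: "hess p h (x, y) = 0" "dx h x y = 0" "dy h x y = 1" "h x y = real_of_int y"
      using p by (simp_all add: h_def hess_def dx_def dy_def)
    have "hess p (node_cut l m) (x, y) = hess p (\<lambda>x y. \<kappa> x y * h x y) (x, y)"
      by (simp add: node_cut_def[abs_def] \<kappa>_def r_def h_def)
    also have "\<dots> \<le> 40 * (c powr p + (c\<^sup>2) powr p * \<bar>real_of_int y\<bar> powr p)"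
      using hess_cut_le[OF p c, of h x y] p unfolding h by simp
    also have "\<dots> \<le> 40 * (c powr p + (c\<^sup>2) powr p * (9 * r) powr p)"
      using y p c0 by (intro mult_left_mono add_mono powr_mono2) auto
    also have "c powr p = (cut_const / 4) powr p * r powr (- p)"
    proof -
      have "c = (cut_const / 4) / r" by (simp add: c_def)
      then show ?thesis using C r by (simp only: powr_divide[of "cut_const / 4" r] powr_minus_divide) simp
    qed
    also have "(c\<^sup>2) powr p * (9 * r) powr p = (9 * cut_const\<^sup>2 / 16) powr p * r powr (- p)"
    proof -
      have "(c\<^sup>2) powr p * (9 * r) powr p = (c\<^sup>2 * (9 * r)) powr p" using r by (subst powr_mult) auto
      also have "c\<^sup>2 * (9 * r) = (9 * cut_const\<^sup>2 / 16) / r" using r by (simp add: c_def power2_eq_square)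
      also have "((9 * cut_const\<^sup>2 / 16) / r) powr p = (9 * cut_const\<^sup>2 / 16) powr p * r powr (- p)"
        using r by (simp only: powr_divide[of _ r] powr_minus_divide) simp
      finally show ?thesis .
    qed
    finally show ?thesis by (simp add: q B_def algebra_simps)
  qed
  have "(\<Sum>q\<in>A. hess p (node_cut l m) q) \<le> (\<Sum>q\<in>A \<union> Z. hess p (node_cut l m) q)"
    using A by (intro sum_mono2) (auto simp: Z_def)
  also have "\<dots> = (\<Sum>q\<in>Z. hess p (node_cut l m) q)"
  proof (rule sum.mono_neutral_right)
    show "\<forall>q\<in>A \<union> Z - Z. hess p (node_cut l m) q = 0"
    proof (rule ballI, rule ccontr)
      fix q assume q: "q \<in> A \<union> Z - Z" "hess p (node_cut l m) q \<noteq> 0"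
      obtain x y where xy: "q = (x, y)" by (cases q)
      have "\<bar>x - pos l m\<bar> \<le> 9 * rad l" "\<bar>y\<bar> \<le> 9 * rad l"
        using hess_node_cut_support[of p l m x y] q(2) p l by (auto simp: xy)
      then show False using q(1) by (auto simp: xy Z_def)
    qed
  qed (use A in \<open>auto simp: Z_def\<close>)
  also have "\<dots> \<le> real (card Z) * B" using sum_bounded_above[of Z "hess p (node_cut l m)" B] pt by simp
  also have "real (card Z) \<le> 361 * r\<^sup>2"
  proof -
    have "real (card Z) = (18 * r + 1) * (18 * r + 1)"
      using rad_ge_1[of l] by (simp add: Z_def r_def)
    also have "\<dots> \<le> (19 * r) * (19 * r)" using r by (intro mult_mono) auto
    finally show ?thesis by (simp add: power2_eq_square)
  qed
  also have "361 * r\<^sup>2 * B = node_const p * r powr (2 - p)"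
  proof -
    have "r powr (2 - p) = r\<^sup>2 * r powr (- p)" using r by (simp add: powr_diff powr_minus_divide)
    then show ?thesis by (simp add: B_def node_const_def algebra_simps)
  qed
  finally show ?thesis using B0 by (simp add: tree_w_def r_def mult_right_mono)
qed

text \<open>Isolated values at height 1 take the place of cutoffs for the last increments, from
  level L - 1 to the leaves.\<close>

definition leaf_part :: "(nat \<Rightarrow> real) \<Rightarrow> lattice_fun" where
  "leaf_part a x y = (\<Sum>m<2 ^ L. if x = pos L m \<and> y = 1 then a m else 0)"

lemma pos_inj: "m < 2 ^ L \<Longrightarrow> m' < 2 ^ L \<Longrightarrow> pos L m = pos L m' \<Longrightarrow> m = m'"
  using pos_separated[of L m m'] d_L L by force

lemma leaf_part_pos: "m < 2 ^ L \<Longrightarrow> leaf_part a (pos L m) 1 = a m"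
proof -
  assume m: "m < 2 ^ L"
  have "leaf_part a (pos L m) 1 = (\<Sum>m'<2 ^ L. if m' = m then a m' else 0)"
    unfolding leaf_part_def using pos_inj m by (intro sum.cong refl) auto
  then show ?thesis using m by simp
qed

lemma leaf_part_eq_0: "(\<And>m. m < 2 ^ L \<Longrightarrow> (x, y) \<noteq> (pos L m, 1)) \<Longrightarrow> leaf_part a x y = 0"
  unfolding leaf_part_def by (intro sum.neutral) auto

text \<open>Leaves have distinct positions, so each of the nine translates in the stencil sees every
  leaf value at most once; 432 = 9 * 48.\<close>

lemma energy_leaf_part:
  assumes p: "1 < p" "p < 2" and A: "finite A"
  shows "(\<Sum>q\<in>A. hess p (leaf_part a) q) \<le> 432 * (\<Sum>m<2 ^ L. \<bar>a m\<bar> powr p)"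
proof -
  define g where "g q = \<bar>leaf_part a (fst q) (snd q)\<bar> powr p" for q
  define P where "P = (\<lambda>m. (pos L m, 1::int)) ` {..<2 ^ L}"
  have gP: "(\<Sum>q\<in>P. g q) = (\<Sum>m<2 ^ L. \<bar>a m\<bar> powr p)"
    unfolding P_def by (subst sum.reindex) (auto simp: inj_on_def pos_inj g_def leaf_part_pos)
  have shift: "(\<Sum>q\<in>A. g (fst q + i, snd q + j)) \<le> (\<Sum>m<2 ^ L. \<bar>a m\<bar> powr p)" for i j
  proof -
    define B where "B = (\<lambda>q. (fst q + i, snd q + j)) ` A"
    have "(\<Sum>q\<in>A. g (fst q + i, snd q + j)) = (\<Sum>q\<in>B. g q)"
      unfolding B_def by (subst sum.reindex) (auto simp: inj_on_def prod_eq_iff)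
    also have "\<dots> \<le> (\<Sum>q\<in>B \<union> P. g q)" using A by (intro sum_mono2) (auto simp: B_def P_def g_def)
    also have "\<dots> = (\<Sum>q\<in>P. g q)"
      using A p by (intro sum.mono_neutral_right) (auto simp: B_def P_def g_def intro!: leaf_part_eq_0)
    finally show ?thesis using gP by simp
  qed
  have "(\<Sum>q\<in>A. hess p (leaf_part a) q) \<le> (\<Sum>q\<in>A. 48 * (\<Sum>i\<in>{0,1,2}. \<Sum>j\<in>{0,1,2}. g (fst q + i, snd q + j)))"
  proof (intro sum_mono)
    fix q :: "int \<times> int"
    show "hess p (leaf_part a) q \<le> 48 * (\<Sum>i\<in>{0,1,2}. \<Sum>j\<in>{0,1,2}. g (fst q + i, snd q + j))"
      using hess_le_values[OF p, of "leaf_part a" "fst q" "snd q"] unfolding g_def by simp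
  qed
  also have "\<dots> = 48 * (\<Sum>i\<in>{0,1,2}. \<Sum>j\<in>{0,1,2}. \<Sum>q\<in>A. g (fst q + i, snd q + j))"
    unfolding sum_distrib_left[symmetric]
    by (subst sum.swap, rule arg_cong[where f="\<lambda>t. 48 * t"], rule sum.cong[OF refl], rule sum.swap)
  also have "\<dots> \<le> 48 * (\<Sum>i\<in>{0,1,2::int}. \<Sum>j\<in>{0,1,2::int}. \<Sum>m<2 ^ L. \<bar>a m\<bar> powr p)"
    by (intro mult_left_mono sum_mono shift) auto
  also have "\<dots> = 432 * (\<Sum>m<2 ^ L. \<bar>a m\<bar> powr p)" by simp
  finally show ?thesis .
qed

text \<open>Only the levels 1 to L - 1: the root is carried by a global linear function, the leaves
  by \<open>leaf_part\<close>.\<close>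

definition tree_nodes :: "(nat \<times> nat) set" where
  "tree_nodes = (SIGMA l:{1..<L}. {..<2 ^ l})"

definition incr :: "(nat \<Rightarrow> nat \<Rightarrow> real) \<Rightarrow> nat \<Rightarrow> nat \<Rightarrow> real" where
  "incr U l m = U l m - U (l - 1) (m div 2)"

definition node_part :: "(nat \<Rightarrow> nat \<Rightarrow> real) \<Rightarrow> lattice_fun" where
  "node_part U x y = (\<Sum>i\<in>tree_nodes. incr U (fst i) (snd i) * node_cut (fst i) (snd i) x y)"

definition tree_rem :: "(nat \<Rightarrow> nat \<Rightarrow> real) \<Rightarrow> lattice_fun" where
  "tree_rem U x y = node_part U x y + leaf_part (incr U L) x y"

definition tree_part :: "(nat \<Rightarrow> nat \<Rightarrow> real) \<Rightarrow> lattice_fun" where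
  "tree_part U x y = U 0 0 * real_of_int y + tree_rem U x y"

lemma finite_tree_nodes [simp]: "finite tree_nodes"
  by (simp add: tree_nodes_def)

lemma energy_tree_part:
  assumes p: "1 < p" "p < 2"
  shows "energy p M (tree_part U) \<le> 2 * (node_const p + 432) * tree_energy p L (tree_w p) U"
proof -
  have nodes: "energy p M (node_part U) \<le> node_const p * (\<Sum>l=1..<L. tree_w p l * (\<Sum>m<2 ^ l. \<bar>incr U l m\<bar> powr p))"
  proof -
    have disj: "hess p (node_cut (fst i) (snd i)) q = 0 \<or> hess p (node_cut (fst j) (snd j)) q = 0"
      if ij: "i \<in> tree_nodes" "j \<in> tree_nodes" "i \<noteq> j" for i j q
    proof -
      obtain l m k m' x y where e: "i = (l, m)" "j = (k, m')" "q = (x, y)" by (metis surj_pair)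
      show ?thesis
      proof (cases "l \<le> k")
        case True
        then show ?thesis unfolding e fst_conv snd_conv
          using ij p e by (intro hess_node_cut_disjoint) (auto simp: tree_nodes_def)
      next
        case False
        have "hess p (node_cut k m') (x, y) = 0 \<or> hess p (node_cut l m) (x, y) = 0"
          using False ij p e by (intro hess_node_cut_disjoint) (auto simp: tree_nodes_def)
        then show ?thesis unfolding e by auto
      qed
    qed
    have "energy p M (node_part U) = (\<Sum>q\<in>lbox M. \<Sum>i\<in>tree_nodes. \<bar>incr U (fst i) (snd i)\<bar> powr p * hess p (node_cut (fst i) (snd i)) q)"
      unfolding energy_def node_part_def[abs_def] using p disj by (intro sum.cong refl hess_disjoint_sum) auto
    also have "\<dots> = (\<Sum>i\<in>tree_nodes. \<bar>incr U (fst i) (snd i)\<bar> powr p * (\<Sum>q\<in>lbox M. hess p (node_cut (fst i) (snd i)) q))"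
      by (subst sum.swap) (simp add: sum_distrib_left)
    also have "\<dots> \<le> (\<Sum>i\<in>tree_nodes. \<bar>incr U (fst i) (snd i)\<bar> powr p * (node_const p * tree_w p (fst i)))"
      by (intro sum_mono mult_left_mono energy_node_cut p) (auto simp: tree_nodes_def)
    also have "\<dots> = (\<Sum>l=1..<L. \<Sum>m<2 ^ l. \<bar>incr U l m\<bar> powr p * (node_const p * tree_w p l))"
      unfolding tree_nodes_def by (subst sum.Sigma) (auto simp: case_prod_unfold)
    also have "\<dots> = node_const p * (\<Sum>l=1..<L. tree_w p l * (\<Sum>m<2 ^ l. \<bar>incr U l m\<bar> powr p))"
      by (simp add: sum_distrib_left mult_ac)
    finally show ?thesis .
  qed
  have leaves: "energy p M (leaf_part (incr U L)) \<le> 432 * (\<Sum>m<2 ^ L. \<bar>incr U L m\<bar> powr p)"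
    unfolding energy_def by (rule energy_leaf_part[OF p]) simp
  define S1 where "S1 = (\<Sum>l=1..<L. tree_w p l * (\<Sum>m<2 ^ l. \<bar>incr U l m\<bar> powr p))"
  define S2 where "S2 = (\<Sum>m<2 ^ L. \<bar>incr U L m\<bar> powr p)"
  have S: "0 \<le> S1" "0 \<le> S2" using tree_w_pos by (auto simp: S1_def S2_def less_imp_le intro!: sum_nonneg mult_nonneg_nonneg)
  have te: "tree_energy p L (tree_w p) U = S1 + S2"
  proof -
    have "{1..L} = insert L {1..<L}" using L by auto
    moreover have "tree_w p L = 1" by (simp add: tree_w_def rad_def)
    ultimately show ?thesis by (simp add: tree_energy_def S1_def S2_def incr_def)
  qed
  have "energy p M (tree_part U) = energy p M (tree_rem U)"
    unfolding energy_def tree_part_def[abs_def] hess_linear_add ..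
  also have "\<dots> \<le> 2 * (energy p M (node_part U) + energy p M (leaf_part (incr U L)))"
    unfolding tree_rem_def[abs_def] using p by (intro energy_add) auto
  also have "\<dots> \<le> 2 * (node_const p * S1 + 432 * S2)"
    using nodes leaves by (simp add: S1_def S2_def)
  also have "\<dots> \<le> 2 * ((node_const p + 432) * (S1 + S2))"
    using S node_const_nonneg[of p] by (simp add: algebra_simps)
  finally show ?thesis unfolding te by (simp only: mult.assoc)
qed

lemma tree_part_0: "tree_part U x 0 = 0"
  by (simp add: tree_part_def tree_rem_def node_part_def node_cut_def leaf_part_def)

text \<open>At height 1 a leaf lies on the plateau of each ancestor's cutoff and outside the support
  of every other one, by the separation of clusters.\<close>

lemma node_cut_leaf:
  assumes l: "1 \<le> l" "l < L" and m: "m < 2 ^ L" "m' < 2 ^ l"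
  shows "node_cut l m' (pos L m) 1 = (if m' = m div 2 ^ (L - l) then 1 else 0)"
proof -
  define a where "a = m div 2 ^ (L - l)"
  have a: "a < 2 ^ l" unfolding a_def using m l by (simp add: less_mult_imp_div_less power_add[symmetric])
  have da: "pos L m \<le> pos l a" "pos l a \<le> pos L m + 2 * rad l"
    using pos_descendant[of l L m] l rad_ge_1[of L] by (auto simp: a_def)
  have rl: "1 \<le> rad l" by (rule rad_ge_1)
  show ?thesis
  proof (cases "m' = a")
    case True
    then have "node_cut l m' (pos L m) 1 = real_of_int 1"
      using da rl by (intro node_cut_eq_linear) auto
    then show ?thesis using True by (simp add: a_def)
  next
    case False
    have "d l \<le> \<bar>pos l m' - pos l a\<bar>" using a m l False by (intro pos_separated) auto
    moreover have "100 * rad l \<le> d l" using d_step[of l] l by (simp add: rad_def)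
    ultimately have "node_cut l m' (pos L m) 1 = 0" using da rl by (intro node_cut_eq_0) auto
    then show ?thesis using False by (simp add: a_def)
  qed
qed

lemma tree_part_leaf:
  assumes m: "m < 2 ^ L"
  shows "tree_part U (pos L m) 1 = U L m"
proof -
  have "node_part U (pos L m) 1 = (\<Sum>l=1..<L. \<Sum>m'<2 ^ l. incr U l m' * node_cut l m' (pos L m) 1)"
    unfolding node_part_def tree_nodes_def by (subst sum.Sigma) (auto simp: case_prod_unfold)
  also have "\<dots> = (\<Sum>l=1..<L. incr U l (m div 2 ^ (L - l)))"
  proof (intro sum.cong refl)
    fix l assume l: "l \<in> {1..<L}"
    define a where "a = m div 2 ^ (L - l)"
    have a: "a < 2 ^ l" unfolding a_def using m l by (simp add: less_mult_imp_div_less power_add[symmetric])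
    have "(\<Sum>m'<2 ^ l. incr U l m' * node_cut l m' (pos L m) 1) = (\<Sum>m'<2 ^ l. if m' = a then incr U l m' else 0)"
      using l m by (intro sum.cong refl) (auto simp: node_cut_leaf a_def)
    then show "(\<Sum>m'<2 ^ l. incr U l m' * node_cut l m' (pos L m) 1) = incr U l (m div 2 ^ (L - l))"
      using a by (simp add: a_def)
  qed
  finally have node: "node_part U (pos L m) 1 = (\<Sum>l=1..<L. incr U l (m div 2 ^ (L - l)))" .
  \<comment> \<open>Along the ancestors of m the increments telescope from the root down to level k
    - 1.\<close>
  have tele: "U 0 0 + (\<Sum>l=1..<k. incr U l (m div 2 ^ (L - l))) = U (k - 1) (m div 2 ^ (L - (k - 1)))" if "1 \<le> k" "k \<le> L" for k
    using that
  proof (induction k rule: dec_induct)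
    case base
    then show ?case using m by simp
  next
    case (step k)
    have "L - (k - 1) = Suc (L - k)" using step by simp
    then have "m div 2 ^ (L - (k - 1)) = m div 2 ^ (L - k) div 2" by (metis div_mult2_eq power_Suc2)
    then show ?case using step by (simp add: incr_def)
  qed
  have "tree_part U (pos L m) 1 = U (L - 1) (m div 2 ^ (L - (L - 1))) + incr U L m"
    using tele[of L] L m by (simp add: tree_part_def tree_rem_def node leaf_part_pos)
  then show ?thesis using L by (simp add: incr_def)
qed

lemma tree_rem_eq_0:
  assumes "6 * d 1 \<le> \<bar>x - z0\<bar> \<or> 4 * d 1 \<le> \<bar>y\<bar>"
  shows "tree_rem U x y = 0"
proof -
  have d1: "2 \<le> d 1" using d_ge_2[of 1] L by simp
  have "node_cut l m x y = 0" if l: "1 \<le> l" "l < L" for l m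
  proof (rule node_cut_eq_0)
    have "100 * rad l \<le> rad 0" using l by (intro rad_100) auto
    then have "8 * rad l \<le> d 1" using L rad_ge_1[of l] by (auto simp: rad_def)
    moreover have "z0 - 2 * d 1 \<le> pos l m" "pos l m \<le> z0" using pos_bounds[of l m] l by auto
    ultimately show "8 * rad l \<le> \<bar>x - pos l m\<bar> \<or> 8 * rad l \<le> \<bar>y\<bar>" using assms d1 by linarith
  qed
  moreover have "leaf_part a x y = 0" for a
  proof (rule leaf_part_eq_0)
    fix m
    have "z0 - 2 * d 1 \<le> pos L m" "pos L m \<le> z0" using pos_bounds[of L m] by auto
    then show "(x, y) \<noteq> (pos L m, 1)" using assms d1 by auto
  qed
  ultimately show ?thesis by (auto simp: tree_rem_def node_part_def tree_nodes_def intro!: sum.neutral)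
qed

end

subsection \<open>The extension operator on the lattice\<close>

lemma line_rem_add: "line_rem N (\<lambda>x. f x + g x) x y = line_rem N f x y + line_rem N g x y"
proof -
  have "reflect N (normalized N (\<lambda>x. f x + g x)) = (\<lambda>x. reflect N (normalized N f) x + reflect N (normalized N g) x)"
    by (auto simp: reflect_def normalized_def slope_def fun_eq_iff add_divide_distrib diff_divide_distrib algebra_simps)
  moreover have "line_ext (\<lambda>x. a x + b x) x y = line_ext a x y + line_ext b x y" for a b
    by (simp add: line_ext_def cesaro_def add_divide_distrib sum.distrib algebra_simps)
  ultimately show ?thesis by (simp add: line_rem_def distrib_left)
qed

lemma line_rem_cmult: "line_rem N (\<lambda>x. c * f x) x y = c * line_rem N f x y"
proof -
  have "reflect N (normalized N (\<lambda>x. c * f x)) = (\<lambda>x. c * reflect N (normalized N f) x)"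
    by (auto simp: reflect_def normalized_def slope_def fun_eq_iff diff_divide_distrib algebra_simps)
  moreover have "line_ext (\<lambda>x. c * a x) x y = c * line_ext a x y" for a
    by (simp add: line_ext_def cesaro_def sum_distrib_left sum_divide_distrib distrib_left mult_ac)
  ultimately show ?thesis by (simp add: line_rem_def mult_ac)
qed

lemma slope_add: "slope N (\<lambda>x. f x + g x) = slope N f + slope N g"
  and slope_cmult: "slope N (\<lambda>x. c * f x) = c * slope N f"
  by (simp_all add: slope_def add_divide_distrib diff_divide_distrib algebra_simps)

lemma line_part_add: "line_part N (\<lambda>x. f x + g x) x y = line_part N f x y + line_part N g x y"
  by (simp add: line_part_def line_rem_add slope_add distrib_right)

lemma line_part_cmult: "line_part N (\<lambda>x. c * f x) x y = c * line_part N f x y"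
  by (simp add: line_part_def line_rem_cmult slope_cmult distrib_left)

definition extension_const :: "real \<Rightarrow> real" where
  "extension_const p = (SOME C. 0 < C \<and> (\<forall>N M f. 16 \<le> N \<longrightarrow> energy p M (line_part N f) \<le> C * gagliardo p {-N..<N} (fdiff f)))"

lemma extension_const:
  assumes p: "1 < p" "p < 2"
  shows "0 < extension_const p" "16 \<le> N \<Longrightarrow> energy p M (line_part N f) \<le> extension_const p * gagliardo p {-N..<N} (fdiff f)"
proof -
  have "0 < extension_const p \<and> (\<forall>N M f. 16 \<le> N \<longrightarrow> energy p M (line_part N f) \<le> extension_const p * gagliardo p {-N..<N} (fdiff f))"
    unfolding extension_const_def by (rule someI_ex[OF line_part_energy[OF p]])
  then show "0 < extension_const p" "16 \<le> N \<Longrightarrow> energy p M (line_part N f) \<le> extension_const p * gagliardo p {-N..<N} (fdiff f)" by auto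
qed

definition line_const :: "real \<Rightarrow> real" where
  "line_const p = extension_const p * (8 * (2 * hardy_const p + 1))"

text \<open>To be read from the inside: the energy of a competitor minus the row part, its trace on
  the tree, the near-minimal extension there, its realisation by cutoffs; the row part is added
  again at the end.\<close>

definition lattice_const :: "real \<Rightarrow> real" where
  "lattice_const p = 2 * (line_const p + 2 * (node_const p + 432) * (2 powr p * hardy_const p * (2 * pair_const p * (2 * (1 + line_const p)))))"

context cantor_tree
begin

text \<open>Once the row part is subtracted, the bottom row is zero, so the value left at height 1
  is a vertical difference.\<close>

definition leaf_data :: "int \<Rightarrow> lattice_fun \<Rightarrow> nat \<Rightarrow> real" where
  "leaf_data N f m = f (pos L m) 1 - line_part N (\<lambda>x. f x 0) (pos L m) 1"

definition node_vals :: "real \<Rightarrow> int \<Rightarrow> lattice_fun \<Rightarrow> nat \<Rightarrow> nat \<Rightarrow> real" where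
  "node_vals p N f = tree_ext L (tree_weight p (tree_w p)) (leaf_data N f)"

text \<open>\<open>lattice_ext\<close> without its affine part; only this compactly supported rest
  will be interpolated.\<close>

definition lattice_rem :: "real \<Rightarrow> int \<Rightarrow> lattice_fun \<Rightarrow> lattice_fun" where
  "lattice_rem p N f x y = line_rem N (\<lambda>x. f x 0) x y + tree_rem (node_vals p N f) x y"

definition lattice_ext :: "real \<Rightarrow> int \<Rightarrow> lattice_fun \<Rightarrow> lattice_fun" where
  "lattice_ext p N f x y = line_part N (\<lambda>x. f x 0) x y + tree_part (node_vals p N f) x y"

lemma lattice_ext_eq:
  "lattice_ext p N f x y = f 0 0 + slope N (\<lambda>x. f x 0) * real_of_int x + node_vals p N f 0 0 * real_of_int y + lattice_rem p N f x y"
  by (simp add: lattice_ext_def lattice_rem_def line_part_def tree_part_def)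

lemma node_vals_add: "node_vals p N (\<lambda>x y. f x y + g x y) l m = node_vals p N f l m + node_vals p N g l m"
proof -
  have "leaf_data N (\<lambda>x y. f x y + g x y) = (\<lambda>m. leaf_data N f m + leaf_data N g m)"
    by (simp add: leaf_data_def line_part_add fun_eq_iff)
  then show ?thesis by (simp add: node_vals_def tree_ext_add)
qed

lemma node_vals_cmult: "node_vals p N (\<lambda>x y. c * f x y) l m = c * node_vals p N f l m"
proof -
  have "leaf_data N (\<lambda>x y. c * f x y) = (\<lambda>m. c * leaf_data N f m)"
    by (simp add: leaf_data_def line_part_cmult fun_eq_iff right_diff_distrib)
  then show ?thesis by (simp add: node_vals_def tree_ext_cmult)
qed

lemma tree_rem_add: "tree_rem (\<lambda>l m. U l m + V l m) x y = tree_rem U x y + tree_rem V x y"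
proof -
  have e: "incr (\<lambda>l m. U l m + V l m) l = (\<lambda>m. incr U l m + incr V l m)" for l by (simp add: incr_def fun_eq_iff)
  have "leaf_part (\<lambda>m. a m + b m) x y = leaf_part a x y + leaf_part b x y" for a b
    unfolding leaf_part_def sum.distrib[symmetric] by (intro sum.cong refl) auto
  then show ?thesis
    by (simp add: tree_rem_def node_part_def e distrib_right sum.distrib)
qed

lemma tree_rem_cmult: "tree_rem (\<lambda>l m. c * U l m) x y = c * tree_rem U x y"
proof -
  have e: "incr (\<lambda>l m. c * U l m) l = (\<lambda>m. c * incr U l m)" for l by (simp add: incr_def right_diff_distrib fun_eq_iff)
  have "leaf_part (\<lambda>m. c * a m) x y = c * leaf_part a x y" for a
    unfolding leaf_part_def sum_distrib_left by (intro sum.cong refl) auto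
  then show ?thesis
    by (simp add: tree_rem_def node_part_def e distrib_left sum_distrib_left mult.assoc)
qed

lemma lattice_rem_add: "lattice_rem p N (\<lambda>x y. f x y + g x y) x y = lattice_rem p N f x y + lattice_rem p N g x y"
proof -
  have "node_vals p N (\<lambda>x y. f x y + g x y) = (\<lambda>l m. node_vals p N f l m + node_vals p N g l m)"
    by (intro ext node_vals_add)
  then show ?thesis by (simp add: lattice_rem_def line_rem_add tree_rem_add)
qed

lemma lattice_rem_cmult: "lattice_rem p N (\<lambda>x y. c * f x y) x y = c * lattice_rem p N f x y"
proof -
  have "node_vals p N (\<lambda>x y. c * f x y) = (\<lambda>l m. c * node_vals p N f l m)"
    by (intro ext node_vals_cmult)
  then show ?thesis by (simp add: lattice_rem_def line_rem_cmult tree_rem_cmult distrib_left)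
qed

lemma lattice_rem_eq_0:
  assumes N: "0 < N" "\<bar>z0\<bar> + 6 * d 1 \<le> N" and xy: "2 * N \<le> \<bar>x\<bar> \<or> N \<le> \<bar>y\<bar>"
  shows "lattice_rem p N f x y = 0"
proof -
  have "2 \<le> d 1" using d_ge_2[of 1] L by simp
  have "line_rem N (\<lambda>x. f x 0) x y = 0" using N xy by (intro line_rem_eq_0) auto
  moreover have "tree_rem (node_vals p N f) x y = 0" using N xy \<open>2 \<le> d 1\<close> by (intro tree_rem_eq_0) auto
  ultimately show ?thesis by (simp add: lattice_rem_def)
qed

lemma lattice_ext_row:
  assumes "0 < N" "\<bar>x\<bar> \<le> N"
  shows "lattice_ext p N f x 0 = f x 0"
  using line_part_0[OF assms] by (simp add: lattice_ext_def tree_part_0)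

lemma tree_weight_pos: "0 < tree_weight p (tree_w p) i"
  using tree_w_pos[of p i] by (simp add: tree_weight_def)

lemma lattice_ext_leaf:
  assumes "m < 2 ^ L"
  shows "lattice_ext p N f (pos L m) 1 = f (pos L m) 1"
  using tree_ext_leaf[of "tree_weight p (tree_w p)" L "leaf_data N f" m] assms
  by (simp add: lattice_ext_def tree_part_leaf node_vals_def tree_weight_pos leaf_data_def)

text \<open>Tree functions live on all natural numbers, so the identification of the leaf data in
  \<open>lattice_ext_energy\<close> must also hold for indices beyond the 2 ^ L actual
  leaves.\<close>

lemma pos_mod: "pos l m = pos l (m mod 2 ^ l)"
proof (induction l arbitrary: m)
  case (Suc l)
  have "m mod 2 ^ Suc l div 2 = m div 2 mod 2 ^ l" by (simp add: mod_mult2_eq)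
  moreover have "even (m mod 2 ^ Suc l) = even m" by (simp add: dvd_mod_iff)
  ultimately show ?case using Suc[of "m div 2"] Suc[of "m mod 2 ^ Suc l div 2"] by simp
qed simp

text \<open>G is any lattice function with the prescribed values. The row part is bounded by the
  trace of G. The difference G' vanishes on the row, so the averages of its vertical differences
  form a competitor on the tree with exactly the leaf data; near-minimality of the linear tree
  extension does the rest.\<close>

theorem lattice_ext_energy:
  assumes p: "1 < p" "p < 2" and N: "16 \<le> N" "\<bar>z0\<bar> + 6 * d 1 \<le> N"
    and G0: "\<And>x. \<bar>x\<bar> \<le> N \<Longrightarrow> G x 0 = f x 0" and G1: "\<And>m. m < 2 ^ L \<Longrightarrow> G (pos L m) 1 = f (pos L m) 1"
  shows "energy p (4 * N) (lattice_ext p N f) \<le> lattice_const p * energy p (4 * N) G"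
proof -
  have d1: "2 \<le> d 1" using d_ge_2[of 1] L by simp
  have p': "1 \<le> p" "p \<le> 2" using p by auto
  define E where "E = energy p (4 * N) G"
  define F1 where "F1 = line_part N (\<lambda>x. f x 0)"
  define G' where "G' = (\<lambda>x y. G x y - F1 x y)"
  have E0: "0 \<le> E" by (simp add: E_def)
  have F1: "energy p (4 * N) F1 \<le> line_const p * E"
  proof -
    have "energy p (4 * N) F1 \<le> extension_const p * gagliardo p {-N..<N} (fdiff (\<lambda>x. f x 0))"
      unfolding F1_def by (rule extension_const(2)[OF p N(1)])
    also have "gagliardo p {-N..<N} (fdiff (\<lambda>x. f x 0)) = gagliardo p {-N..<N} (\<lambda>x. dx G x 0)"
    proof -
      have "fdiff (\<lambda>x. f x 0) x = dx G x 0" if "x \<in> {-N..<N}" for x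
        using G0[of x] G0[of "x + 1"] that by (auto simp: fdiff_def dx_def)
      then show ?thesis unfolding gagliardo_def by (intro sum.cong refl) simp
    qed
    also have "\<dots> \<le> 8 * (2 * hardy_const p + 1) * E"
      unfolding E_def using N by (intro gagliardo_trace_le p) auto
    finally show ?thesis using extension_const(1)[OF p] by (simp add: line_const_def mult.assoc mult_left_mono)
  qed
  have G': "energy p (4 * N) G' \<le> 2 * (1 + line_const p) * E"
    using energy_diff[OF p', of "4 * N" G F1] F1 by (simp add: G'_def E_def algebra_simps)
  define V where "V l m = row_avg (dy G') (pos l m) (nat (rad l))" for l m
  have "V L = leaf_data N f"
  proof
    fix m :: nat
    define k where "k = m mod 2 ^ L"
    have k: "k < 2 ^ L" "pos L m = pos L k" using pos_mod[of L m] by (simp_all add: k_def)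
    have b: "\<bar>pos L k\<bar> \<le> N" using pos_bounds[of L k] N d1 by auto
    have "V L m = dy G' (pos L k) 0" by (simp add: V_def rad_def row_avg_def k)
    also have "\<dots> = G' (pos L k) 1 - G' (pos L k) 0" by (simp add: dy_def)
    also have "G' (pos L k) 0 = 0" using b N by (simp add: G'_def F1_def line_part_0 G0)
    also have "G' (pos L k) 1 = leaf_data N f m" using k by (simp add: G'_def F1_def leaf_data_def G1)
    finally show "V L m = leaf_data N f m" by simp
  qed
  then have "tree_energy p L (tree_w p) (node_vals p N f) \<le> 2 powr p * hardy_const p * tree_energy p L (tree_w p) V"
    using tree_energy_ext_le[OF p, of "tree_w p" L V] tree_w_pos by (simp add: node_vals_def)
  also have "\<dots> \<le> 2 powr p * hardy_const p * (2 * pair_const p * energy p (4 * N) G')"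
    unfolding V_def using N d1 hardy_const_nonneg[OF p] by (intro mult_left_mono tree_energy_trace_le p) auto
  also have "\<dots> \<le> 2 powr p * hardy_const p * (2 * pair_const p * (2 * (1 + line_const p) * E))"
    using hardy_const_nonneg[OF p] chain_const_nonneg[of p] G' by (intro mult_left_mono) (auto simp: pair_const_def)
  finally have U: "tree_energy p L (tree_w p) (node_vals p N f) \<le> 2 powr p * hardy_const p * (2 * pair_const p * (2 * (1 + line_const p) * E))" .
  have "energy p (4 * N) (lattice_ext p N f) \<le> 2 * (energy p (4 * N) F1 + energy p (4 * N) (tree_part (node_vals p N f)))"
    unfolding lattice_ext_def[abs_def] F1_def using energy_add[OF p'] by blast
  also have "\<dots> \<le> 2 * (line_const p * E + 2 * (node_const p + 432) * (2 powr p * hardy_const p * (2 * pair_const p * (2 * (1 + line_const p) * E))))"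
  proof (intro mult_left_mono add_mono F1)
    have "energy p (4 * N) (tree_part (node_vals p N f)) \<le> 2 * (node_const p + 432) * tree_energy p L (tree_w p) (node_vals p N f)"
      by (rule energy_tree_part[OF p])
    also have "\<dots> \<le> 2 * (node_const p + 432) * (2 powr p * hardy_const p * (2 * pair_const p * (2 * (1 + line_const p) * E)))"
      using node_const_nonneg[of p] by (intro mult_left_mono U) auto
    finally show "energy p (4 * N) (tree_part (node_vals p N f)) \<le> 2 * (node_const p + 432) * (2 powr p * hardy_const p * (2 * pair_const p * (2 * (1 + line_const p) * E)))" .
  qed simp
  also have "\<dots> = lattice_const p * E" by (simp add: lattice_const_def algebra_simps)
  finally show ?thesis by (simp add: E_def)
qed

end

lemma lattice_const_nonneg:
  assumes p: "1 < p" "p < 2"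
  shows "0 \<le> lattice_const p"
proof -
  have "0 \<le> line_const p" using extension_const(1)[OF p] hardy_const_nonneg[OF p] by (simp add: line_const_def)
  moreover have "0 \<le> pair_const p" using chain_const_nonneg by (simp add: pair_const_def)
  ultimately show ?thesis using hardy_const_nonneg[OF p] node_const_nonneg[of p]
    by (simp add: lattice_const_def)
qed

subsection \<open>Test functions of product form\<close>

text \<open>The axes i and j remain parameters so that every estimate also holds with the
  coordinates exchanged.\<close>

definition pr :: "plane \<Rightarrow> plane \<Rightarrow> (real \<Rightarrow> real) \<Rightarrow> (real \<Rightarrow> real) \<Rightarrow> plane \<Rightarrow> real" where
  "pr i j a b = (\<lambda>q. a (q \<bullet> i) * b (q \<bullet> j))"

lemma Basis_plane: "(Basis :: plane set) = {(1, 0), (0, 1)}"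
  by (auto simp: Basis_prod_def)

lemma pr_has_derivative:
  assumes a: "(a has_real_derivative a') (at (q \<bullet> i))" and b: "(b has_real_derivative b') (at (q \<bullet> j))"
  shows "(pr i j a b has_derivative (\<lambda>h. a' * (h \<bullet> i) * b (q \<bullet> j) + a (q \<bullet> i) * (b' * (h \<bullet> j)))) (at q)"
proof -
  have A: "((\<lambda>q. a (q \<bullet> i)) has_derivative (\<lambda>h. a' * (h \<bullet> i))) (at q)"
    using has_derivative_compose[of "\<lambda>q. q \<bullet> i" "\<lambda>h. h \<bullet> i" q UNIV a "\<lambda>t. a' * t"] a
    by (simp add: has_field_derivative_def bounded_linear_imp_has_derivative bounded_linear_inner_left)
  have B: "((\<lambda>q. b (q \<bullet> j)) has_derivative (\<lambda>h. b' * (h \<bullet> j))) (at q)"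
    using has_derivative_compose[of "\<lambda>q. q \<bullet> j" "\<lambda>h. h \<bullet> j" q UNIV b "\<lambda>t. b' * t"] b
    by (simp add: has_field_derivative_def bounded_linear_imp_has_derivative bounded_linear_inner_left)
  show ?thesis unfolding pr_def
    by (rule has_derivative_eq_rhs[OF has_derivative_mult[OF A B]]) (simp add: fun_eq_iff algebra_simps)
qed

lemma partial_pr:
  assumes ij: "i \<in> Basis" "j \<in> Basis" "i \<noteq> j"
    and a: "\<And>x. (a has_real_derivative a' x) (at x)" and b: "\<And>x. (b has_real_derivative b' x) (at x)"
  shows "partial i (pr i j a b) = pr i j a' b" "partial j (pr i j a b) = pr i j a b'"
proof -
  have d: "frechet_derivative (pr i j a b) (at q) = (\<lambda>h. a' (q \<bullet> i) * (h \<bullet> i) * b (q \<bullet> j) + a (q \<bullet> i) * (b' (q \<bullet> j) * (h \<bullet> j)))" for q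
    using frechet_derivative_at[OF pr_has_derivative[OF a b]] by metis
  have "i \<bullet> i = 1" "j \<bullet> j = 1" "i \<bullet> j = 0" "j \<bullet> i = 0" using ij by (auto simp: inner_Basis)
  then show "partial i (pr i j a b) = pr i j a' b" "partial j (pr i j a b) = pr i j a b'"
    unfolding partial_def d by (simp_all add: pr_def)
qed

lemma smooth_pr:
  assumes ij: "i \<in> Basis" "j \<in> Basis" "i \<noteq> j" and ab: "smooth_real a" "smooth_real b"
  shows "smooth (pr i j a b)"
proof -
  have B: "Basis = {i, j}" using ij by (auto simp: Basis_plane)
  have iter: "\<exists>a2 b2. smooth_real a2 \<and> smooth_real b2 \<and> foldr partial bs (pr i j a b) = pr i j a2 b2" if "set bs \<subseteq> Basis" for bs
    using that
  proof (induction bs)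
    case Nil
    then show ?case using ab by auto
  next
    case (Cons c bs)
    then obtain a2 b2 where 2: "smooth_real a2" "smooth_real b2" "foldr partial bs (pr i j a b) = pr i j a2 b2" by auto
    obtain a3 where a3: "smooth_real a3" "\<And>x. (a2 has_real_derivative a3 x) (at x)" using smooth_real_deriv[OF 2(1)] by blast
    obtain b3 where b3: "smooth_real b3" "\<And>x. (b2 has_real_derivative b3 x) (at x)" using smooth_real_deriv[OF 2(2)] by blast
    have "c = i \<or> c = j" using Cons.prems B by auto
    then show ?case
    proof
      assume "c = i"
      then show ?case using partial_pr(1)[OF ij a3(2) b3(2)] 2 a3(1) by (metis comp_apply foldr_Cons)
    next
      assume "c = j"
      then show ?case using partial_pr(2)[OF ij a3(2) b3(2)] 2 b3(1) by (metis comp_apply foldr_Cons)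
    qed
  qed
  show ?thesis unfolding smooth_def
  proof (intro allI impI)
    fix bs :: "plane list" and x
    assume "set bs \<subseteq> Basis"
    then obtain a2 b2 where 2: "smooth_real a2" "smooth_real b2" "foldr partial bs (pr i j a b) = pr i j a2 b2"
      using iter by blast
    obtain a3 where "\<And>x. (a2 has_real_derivative a3 x) (at x)" using smooth_real_deriv[OF 2(1)] by blast
    moreover obtain b3 where "\<And>x. (b2 has_real_derivative b3 x) (at x)" using smooth_real_deriv[OF 2(2)] by blast
    ultimately show "foldr partial bs (pr i j a b) differentiable at x"
      unfolding 2(3) differentiable_def using pr_has_derivative by blast
  qed
qed

definition vanishes_outside :: "real \<Rightarrow> real \<Rightarrow> (real \<Rightarrow> real) \<Rightarrow> bool" where
  "vanishes_outside l u a \<longleftrightarrow> (\<forall>x. x < l \<or> u < x \<longrightarrow> a x = 0)"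

lemma plane_norm_le:
  assumes "i \<in> Basis" "j \<in> Basis" "i \<noteq> j"
  shows "norm (q :: plane) \<le> \<bar>q \<bullet> i\<bar> + \<bar>q \<bullet> j\<bar>"
proof -
  have B: "Basis = {i, j}" using assms by (auto simp: Basis_plane)
  have "norm q \<le> (\<Sum>b\<in>{i, j}. \<bar>q \<bullet> b\<bar>)" using norm_le_l1[of q] unfolding B .
  then show ?thesis using assms(3) by simp
qed

lemma pr_support:
  assumes ij: "i \<in> Basis" "j \<in> Basis" "i \<noteq> j" and a: "vanishes_outside l u a" and b: "vanishes_outside l' u' b"
  shows "compact (closure {q. pr i j a b q \<noteq> 0})"
proof -
  have "bounded {q. pr i j a b q \<noteq> 0}"
    unfolding bounded_iff
  proof (intro exI[of _ "\<bar>l\<bar> + \<bar>u\<bar> + \<bar>l'\<bar> + \<bar>u'\<bar>"] ballI)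
    fix q assume "q \<in> {q. pr i j a b q \<noteq> 0}"
    then have "a (q \<bullet> i) \<noteq> 0" "b (q \<bullet> j) \<noteq> 0" by (auto simp: pr_def)
    then have "\<not> (q \<bullet> i < l \<or> u < q \<bullet> i)" "\<not> (q \<bullet> j < l' \<or> u' < q \<bullet> j)"
      using a b unfolding vanishes_outside_def by auto
    then show "norm q \<le> \<bar>l\<bar> + \<bar>u\<bar> + \<bar>l'\<bar> + \<bar>u'\<bar>" using plane_norm_le[OF ij, of q] by linarith
  qed
  then show ?thesis by (simp add: compact_closure)
qed

lemma pr_test_function:
  assumes "i \<in> Basis" "j \<in> Basis" "i \<noteq> j" "smooth_real a" "smooth_real b" "vanishes_outside l u a" "vanishes_outside l' u' b"
  shows "pr i j a b \<in> test_functions"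
  unfolding test_functions_def using smooth_pr[OF assms(1-5)] pr_support[OF assms(1-3,6,7)] by simp

lemma continuous_pr: "continuous_on UNIV a \<Longrightarrow> continuous_on UNIV b \<Longrightarrow> continuous_on UNIV (pr i j a b)"
proof -
  assume ab: "continuous_on UNIV a" "continuous_on UNIV b"
  have "continuous_on UNIV (\<lambda>q. a (q \<bullet> i))"
    by (rule continuous_on_compose2[OF ab(1)]) (auto intro: continuous_intros)
  moreover have "continuous_on UNIV (\<lambda>q. b (q \<bullet> j))"
    by (rule continuous_on_compose2[OF ab(2)]) (auto intro: continuous_intros)
  ultimately show ?thesis unfolding pr_def by (rule continuous_on_mult)
qed

lemma integrable_continuous_compact_support:
  fixes f :: "plane \<Rightarrow> real"
  assumes f: "continuous_on UNIV f" and K: "compact K" "\<And>x. x \<notin> K \<Longrightarrow> f x = 0"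
  shows "integrable lborel f"
proof -
  have "integrable lborel (\<lambda>x. indicator K x *\<^sub>R f x)"
    by (rule borel_integrable_compact[OF K(1) continuous_on_subset[OF f]]) auto
  moreover have "(\<lambda>x. indicator K x *\<^sub>R f x) = f" using K(2) by (auto simp: fun_eq_iff indicator_def)
  ultimately show ?thesis by simp
qed

lemma integrable_mult_pr:
  assumes ij: "i \<in> Basis" "j \<in> Basis" "i \<noteq> j" and G: "continuous_on UNIV G" and ab: "continuous_on UNIV a" "continuous_on UNIV b"
    and v: "vanishes_outside l u a" "vanishes_outside l' u' b"
  shows "integrable lborel (\<lambda>q. G q * pr i j a b q)"
proof (rule integrable_continuous_compact_support)
  show "continuous_on UNIV (\<lambda>q. G q * pr i j a b q)" by (intro continuous_intros G continuous_pr ab)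
  show "compact (closure {q. pr i j a b q \<noteq> 0})" by (rule pr_support[OF ij v])
  show "G q * pr i j a b q = 0" if "q \<notin> closure {q. pr i j a b q \<noteq> 0}" for q
    using that closure_subset[of "{q. pr i j a b q \<noteq> 0}"] by auto
qed

text \<open>Large enough for the supports of the test functions that produce second differences at \<open>q\<close> with step \<open>h\<close>.\<close>

definition sq :: "plane \<Rightarrow> real \<Rightarrow> plane set" where
  "sq q h = {x. \<forall>b\<in>Basis. q \<bullet> b - h \<le> x \<bullet> b \<and> x \<bullet> b \<le> q \<bullet> b + 3 * h}"

lemma sq_cbox: "sq q h = cbox (q - h *\<^sub>R One) (q + (3 * h) *\<^sub>R One)"
  unfolding sq_def cbox_def
  by (intro Collect_cong ball_cong refl) (simp add: inner_diff_left inner_add_left)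

lemma compact_sq: "compact (sq q h)" by (simp add: sq_cbox)

lemma measure_sq: "0 \<le> h \<Longrightarrow> measure lborel (sq q h) = 16 * h\<^sup>2"
proof -
  assume h: "0 \<le> h"
  have "measure lborel (sq q h) = (\<Prod>b\<in>Basis. (q + (3 * h) *\<^sub>R One - (q - h *\<^sub>R One)) \<bullet> b)"
    unfolding sq_cbox using h by (subst measure_lborel_cbox_eq) (auto simp: inner_diff_left inner_add_left)
  also have "\<dots> = (\<Prod>b\<in>(Basis :: plane set). 4 * h)"
    by (intro prod.cong refl) (auto simp: inner_diff_left inner_add_left)
  finally show ?thesis by (simp add: Basis_plane power2_eq_square)
qed

text \<open>How weak derivatives control point values: if a second derivative of a test function of
  size at most 1 approximates a combination of point masses, that combination of values of G is at
  most a local L^1 norm of g.\<close>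

lemma weak_bound:
  assumes w: "is_weak_partial2 c d G g" and t: "\<phi> \<in> test_functions" and b: "\<And>x. \<bar>\<phi> x\<bar> \<le> 1" and z: "\<And>x. x \<notin> sq q h \<Longrightarrow> \<phi> x = 0"
  shows "\<bar>\<integral>x. G x * partial c (partial d \<phi>) x \<partial>lborel\<bar> \<le> (\<integral>x. indicator (sq q h) x * \<bar>g x\<bar> \<partial>lborel)"
proof -
  have gi: "integrable lborel (\<lambda>x. indicator (sq q h) x * g x)"
    using w compact_sq[of q h] unfolding is_weak_partial2_def locally_integrable_def set_integrable_def by simp
  have gi2: "integrable lborel (\<lambda>x. indicator (sq q h) x * \<bar>g x\<bar>)"
    using integrable_abs[OF gi] by (simp add: abs_mult)
  have "(\<integral>x. G x * partial c (partial d \<phi>) x \<partial>lborel) = (\<integral>x. g x * \<phi> x \<partial>lborel)"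
    using w t unfolding is_weak_partial2_def by blast
  also have "\<bar>\<dots>\<bar> \<le> (\<integral>x. \<bar>g x * \<phi> x\<bar> \<partial>lborel)" by (rule integral_abs_bound)
  also have "\<dots> \<le> (\<integral>x. indicator (sq q h) x * \<bar>g x\<bar> \<partial>lborel)"
  proof (rule integral_mono')
    show "\<bar>g x * \<phi> x\<bar> \<le> indicator (sq q h) x * \<bar>g x\<bar>" for x
      using b[of x] z[of x] by (auto simp: abs_mult indicator_def mult_left_le)
  qed (use gi2 in auto)
  finally show ?thesis .
qed

subsection \<open>Mollified point values\<close>

text \<open>An approximate point mass at s of width \<delta>, followed by its first and second
  antiderivatives. The argument (x - s) / \<delta> is written in the affine form that
  \<open>smooth_affine\<close> expects.\<close>

definition moll_at :: "real \<Rightarrow> real \<Rightarrow> real \<Rightarrow> real" where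
  "moll_at \<delta> s x = moll (1 / \<delta> * x + (- s / \<delta>)) / \<delta>"

definition step_at :: "real \<Rightarrow> real \<Rightarrow> real \<Rightarrow> real" where
  "step_at \<delta> s x = step (1 / \<delta> * x + (- s / \<delta>))"

definition ramp_at :: "real \<Rightarrow> real \<Rightarrow> real \<Rightarrow> real" where
  "ramp_at \<delta> s x = \<delta> * ramp (1 / \<delta> * x + (- s / \<delta>))"

lemma smooth_at: "smooth_real (moll_at \<delta> s)" "smooth_real (step_at \<delta> s)" "smooth_real (ramp_at \<delta> s)"
proof -
  have "smooth_real (\<lambda>x. 1 / \<delta> * moll (1 / \<delta> * x + (- s / \<delta>)))"
    by (intro smooth_cmult smooth_affine smooth_moll)
  then show "smooth_real (moll_at \<delta> s)" by (simp add: moll_at_def[abs_def])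
  show "smooth_real (step_at \<delta> s)" unfolding step_at_def[abs_def] by (intro smooth_affine smooth_step)
  show "smooth_real (ramp_at \<delta> s)" unfolding ramp_at_def[abs_def] by (intro smooth_cmult smooth_affine smooth_ramp)
qed

lemma affine_deriv: "((\<lambda>x. k * x + c) has_real_derivative k) (at x)" for k c x :: real
  by (auto intro!: derivative_eq_intros)

lemma step_at_deriv: "(step_at \<delta> s has_real_derivative moll_at \<delta> s x) (at x)"
  using DERIV_chain2[OF step_deriv affine_deriv[of "1 / \<delta>" "- s / \<delta>" x]]
  by (simp add: step_at_def[abs_def] moll_at_def)

lemma ramp_at_deriv:
  assumes "0 < \<delta>"
  shows "(ramp_at \<delta> s has_real_derivative step_at \<delta> s x) (at x)"
  using DERIV_cmult[OF DERIV_chain2[OF ramp_deriv affine_deriv[of "1 / \<delta>" "- s / \<delta>" x]], of \<delta>] assms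
  by (simp add: ramp_at_def[abs_def] step_at_def)

lemma step_at_0: "0 < \<delta> \<Longrightarrow> x \<le> s - \<delta> \<Longrightarrow> step_at \<delta> s x = 0"
  by (simp add: step_at_def step_eq_0 field_simps)

lemma step_at_1: "0 < \<delta> \<Longrightarrow> s + \<delta> \<le> x \<Longrightarrow> step_at \<delta> s x = 1"
  by (simp add: step_at_def step_eq_1 field_simps)

lemma ramp_at_0: "0 < \<delta> \<Longrightarrow> x \<le> s - \<delta> \<Longrightarrow> ramp_at \<delta> s x = 0"
  by (simp add: ramp_at_def ramp_eq_0 field_simps)

lemma ramp_at_id: "0 < \<delta> \<Longrightarrow> s + \<delta> \<le> x \<Longrightarrow> ramp_at \<delta> s x = x - s"
  by (simp add: ramp_at_def ramp_eq field_simps)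

lemma moll_at_0: "0 < \<delta> \<Longrightarrow> \<delta> \<le> \<bar>x - s\<bar> \<Longrightarrow> moll_at \<delta> s x = 0"
proof -
  assume \<delta>: "0 < \<delta>" "\<delta> \<le> \<bar>x - s\<bar>"
  have "1 / \<delta> * x + (- s / \<delta>) = (x - s) / \<delta>" using \<delta> by (simp add: field_simps)
  moreover have "1 \<le> \<bar>(x - s) / \<delta>\<bar>" using \<delta> by (simp add: abs_divide field_simps)
  ultimately show ?thesis by (simp add: moll_at_def moll_eq_0)
qed

lemma moll_at_nonneg: "0 < \<delta> \<Longrightarrow> 0 \<le> moll_at \<delta> s x"
  by (simp add: moll_at_def)

lemma step_at_range: "0 \<le> step_at \<delta> s x" "step_at \<delta> s x \<le> 1"
  by (simp_all add: step_at_def)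

lemma step_at_mono: "0 < \<delta> \<Longrightarrow> s \<le> s' \<Longrightarrow> step_at \<delta> s' x \<le> step_at \<delta> s x"
  unfolding step_at_def by (intro step_mono) (simp add: divide_right_mono)

lemma ramp_at_diff:
  assumes \<delta>: "0 < \<delta>" and h: "0 \<le> h"
  shows "0 \<le> ramp_at \<delta> s x - ramp_at \<delta> (s + h) x" "ramp_at \<delta> s x - ramp_at \<delta> (s + h) x \<le> h"
proof -
  have eq: "ramp_at \<delta> (s + h) x = ramp_at \<delta> s (x - h)"
    by (simp add: ramp_at_def diff_divide_distrib add_divide_distrib algebra_simps)
  have "\<exists>t. ramp_at \<delta> s x - ramp_at \<delta> s (x - h) = h * step_at \<delta> s t"
  proof (cases "h = 0")
    case False
    then have "\<exists>z. x - h < z \<and> z < x \<and> ramp_at \<delta> s x - ramp_at \<delta> s (x - h) = (x - (x - h)) * step_at \<delta> s z"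
      using h by (intro MVT2) (auto intro!: ramp_at_deriv[OF \<delta>])
    then show ?thesis by auto
  qed simp
  then obtain t where t: "ramp_at \<delta> s x - ramp_at \<delta> s (x - h) = h * step_at \<delta> s t" by blast
  then show "0 \<le> ramp_at \<delta> s x - ramp_at \<delta> (s + h) x" "ramp_at \<delta> s x - ramp_at \<delta> (s + h) x \<le> h"
    unfolding eq t using h step_at_range[of \<delta> s t] by (auto simp: mult_left_le)
qed

lemma integral_moll_at:
  assumes \<delta>: "0 < \<delta>"
  shows "integrable lborel (moll_at \<delta> s)" "(\<integral>x. moll_at \<delta> s x \<partial>lborel) = 1"
proof -
  have c: "continuous_on {s - \<delta>..s + \<delta>} (moll_at \<delta> s)" by (intro smooth_real_continuous smooth_at)
  have "has_bochner_integral lborel (\<lambda>x. indicator {s - \<delta>..s + \<delta>} x *\<^sub>R moll_at \<delta> s x) (step_at \<delta> s (s + \<delta>) - step_at \<delta> s (s - \<delta>))"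
    using \<delta> step_at_deriv[of \<delta> s] has_field_derivative_at_within[OF step_at_deriv[of \<delta> s]]
    by (intro has_bochner_integral_FTC_Icc[OF _ _ c]) (auto simp: has_real_derivative_iff_has_vector_derivative)
  moreover have "(\<lambda>x. indicator {s - \<delta>..s + \<delta>} x *\<^sub>R moll_at \<delta> s x) = moll_at \<delta> s"
  proof
    fix x
    show "indicator {s - \<delta>..s + \<delta>} x *\<^sub>R moll_at \<delta> s x = moll_at \<delta> s x"
    proof (cases "x \<in> {s - \<delta>..s + \<delta>}")
      case False
      then have "\<delta> \<le> \<bar>x - s\<bar>" by auto
      then show ?thesis using moll_at_0[OF \<delta>, of x s] by simp
    qed simp
  qed
  moreover have "step_at \<delta> s (s + \<delta>) - step_at \<delta> s (s - \<delta>) = 1" using \<delta> by (simp add: step_at_0 step_at_1)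
  ultimately have "has_bochner_integral lborel (moll_at \<delta> s) 1" by simp
  then show "integrable lborel (moll_at \<delta> s)" "(\<integral>x. moll_at \<delta> s x \<partial>lborel) = 1"
    by (simp_all add: has_bochner_integral_iff)
qed

lemma integral_pr:
  assumes ij: "i \<in> Basis" "j \<in> Basis" "i \<noteq> j" and ab: "continuous_on UNIV a" "continuous_on UNIV b"
    and v: "vanishes_outside l u a" "vanishes_outside l' u' b"
  shows "integrable lborel (pr i j a b)" "(\<integral>q. pr i j a b q \<partial>lborel) = (\<integral>x. a x \<partial>lborel) * (\<integral>x. b x \<partial>lborel)"
proof -
  have main: "integrable lborel (pr (1, 0) (0, 1) a b) \<and> (\<integral>q. pr (1, 0) (0, 1) a b q \<partial>lborel) = (\<integral>x. a x \<partial>lborel) * (\<integral>x. b x \<partial>lborel)"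
    if ab: "continuous_on UNIV a" "continuous_on UNIV b" and v: "vanishes_outside l u a" "vanishes_outside l' u' b" for a b l u l' u'
  proof
    show int: "integrable lborel (pr (1, 0) (0, 1) a b)"
      using integrable_mult_pr[of "(1,0)" "(0,1)" "\<lambda>_. 1" a b] ab v by (simp add: Basis_plane)
    have "(\<integral>q. pr (1, 0) (0, 1) a b q \<partial>lborel) = (\<integral>x. \<integral>y. pr (1, 0) (0, 1) a b (x, y) \<partial>lborel \<partial>lborel)"
      using lborel_pair.integral_fst'[of "pr (1, 0) (0, 1) a b"] int by (simp add: lborel_prod)
    then show "(\<integral>q. pr (1, 0) (0, 1) a b q \<partial>lborel) = (\<integral>x. a x \<partial>lborel) * (\<integral>x. b x \<partial>lborel)"
      by (simp add: pr_def)
  qed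
  have "(i = (1, 0) \<and> j = (0, 1)) \<or> (i = (0, 1) \<and> j = (1, 0))" using ij by (auto simp: Basis_plane)
  then have "integrable lborel (pr i j a b) \<and> (\<integral>q. pr i j a b q \<partial>lborel) = (\<integral>x. a x \<partial>lborel) * (\<integral>x. b x \<partial>lborel)"
  proof
    assume "i = (1, 0) \<and> j = (0, 1)"
    then show ?thesis using main[OF ab v] by simp
  next
    assume e: "i = (0, 1) \<and> j = (1, 0)"
    have "pr i j a b = pr (1, 0) (0, 1) b a" using e by (simp add: pr_def mult.commute)
    then show ?thesis using main[OF ab(2,1) v(2,1)] by simp
  qed
  then show "integrable lborel (pr i j a b)" "(\<integral>q. pr i j a b q \<partial>lborel) = (\<integral>x. a x \<partial>lborel) * (\<integral>x. b x \<partial>lborel)" by auto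
qed

lemma vanishes_moll_at: "0 < \<delta> \<Longrightarrow> vanishes_outside (s - \<delta>) (s + \<delta>) (moll_at \<delta> s)"
  unfolding vanishes_outside_def
proof (intro allI impI)
  fix x assume "0 < \<delta>" "x < s - \<delta> \<or> s + \<delta> < x"
  then show "moll_at \<delta> s x = 0" by (intro moll_at_0) auto
qed

lemma continuous_moll_at: "continuous_on UNIV (moll_at \<delta> s)"
  by (intro smooth_real_continuous smooth_at)

definition moll_val :: "plane \<Rightarrow> plane \<Rightarrow> (plane \<Rightarrow> real) \<Rightarrow> real \<Rightarrow> plane \<Rightarrow> real" where
  "moll_val i j G \<delta> q = (\<integral>x. G x * pr i j (moll_at \<delta> (q \<bullet> i)) (moll_at \<delta> (q \<bullet> j)) x \<partial>lborel)"

lemma moll_val_close: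
  assumes ij: "i \<in> Basis" "j \<in> Basis" "i \<noteq> j" and G: "continuous_on UNIV G" and \<delta>: "0 < \<delta>"
    and e: "\<And>x. \<bar>x \<bullet> i - q \<bullet> i\<bar> \<le> \<delta> \<Longrightarrow> \<bar>x \<bullet> j - q \<bullet> j\<bar> \<le> \<delta> \<Longrightarrow> \<bar>G x - G q\<bar> \<le> e"
  shows "\<bar>moll_val i j G \<delta> q - G q\<bar> \<le> e"
proof -
  define w where "w = pr i j (moll_at \<delta> (q \<bullet> i)) (moll_at \<delta> (q \<bullet> j))"
  note c = continuous_moll_at and v = vanishes_moll_at[OF \<delta>]
  have w: "integrable lborel w" "(\<integral>x. w x \<partial>lborel) = 1"
    unfolding w_def using integral_pr[OF ij c c v v] integral_moll_at[OF \<delta>] by simp_all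
  have w0: "0 \<le> w x" for x using \<delta> by (simp add: w_def pr_def moll_at_nonneg)
  have Gw: "integrable lborel (\<lambda>x. G x * w x)" unfolding w_def by (rule integrable_mult_pr[OF ij G c c v v])
  have "moll_val i j G \<delta> q - G q = (\<integral>x. G x * w x \<partial>lborel) - (\<integral>x. G q * w x \<partial>lborel)"
    using w by (simp add: moll_val_def w_def)
  also have "\<dots> = (\<integral>x. G x * w x - G q * w x \<partial>lborel)"
    by (rule Bochner_Integration.integral_diff[symmetric]) (use Gw w in auto)
  also have "\<bar>\<dots>\<bar> \<le> (\<integral>x. \<bar>G x * w x - G q * w x\<bar> \<partial>lborel)" by (rule integral_abs_bound)
  also have "\<dots> \<le> (\<integral>x. e * w x \<partial>lborel)"
  proof (rule integral_mono)
    show "integrable lborel (\<lambda>x. \<bar>G x * w x - G q * w x\<bar>)"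
      by (intro integrable_abs Bochner_Integration.integrable_diff Gw) (use w in auto)
    show "\<bar>G x * w x - G q * w x\<bar> \<le> e * w x" for x
    proof (cases "w x = 0")
      case False
      then have "moll_at \<delta> (q \<bullet> i) (x \<bullet> i) \<noteq> 0" "moll_at \<delta> (q \<bullet> j) (x \<bullet> j) \<noteq> 0" by (auto simp: w_def pr_def)
      then have "\<bar>x \<bullet> i - q \<bullet> i\<bar> \<le> \<delta>" "\<bar>x \<bullet> j - q \<bullet> j\<bar> \<le> \<delta>"
        using moll_at_0[OF \<delta>, of "x \<bullet> i" "q \<bullet> i"] moll_at_0[OF \<delta>, of "x \<bullet> j" "q \<bullet> j"] by linarith+
      then have "\<bar>G x - G q\<bar> * w x \<le> e * w x" using e w0 by (intro mult_right_mono) auto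
      then show ?thesis using w0[of x] by (simp add: left_diff_distrib[symmetric] abs_mult)
    qed simp
  qed (use w in auto)
  also have "\<dots> = e" using w by simp
  finally show ?thesis .
qed

lemma moll_val_tendsto:
  assumes ij: "i \<in> Basis" "j \<in> Basis" "i \<noteq> j" and G: "continuous_on UNIV G"
  shows "((\<lambda>\<delta>. moll_val i j G \<delta> q) \<longlongrightarrow> G q) (at_right 0)"
proof (rule tendstoI)
  fix e :: real assume e: "0 < e"
  have "isCont G q" using G continuous_on_eq_continuous_at[OF open_UNIV, of G] by blast
  then obtain r where r: "0 < r" "\<And>x. norm (x - q) < r \<Longrightarrow> \<bar>G x - G q\<bar> < e / 2"
    using e unfolding continuous_at_eps_delta dist_norm real_norm_def by (metis half_gt_zero)
  have "dist (moll_val i j G \<delta> q) (G q) < e" if \<delta>: "0 < \<delta>" "\<delta> < r / 2" for \<delta>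
  proof -
    have "\<bar>moll_val i j G \<delta> q - G q\<bar> \<le> e / 2"
    proof (rule moll_val_close[OF ij G \<delta>(1)])
      fix x assume x: "\<bar>x \<bullet> i - q \<bullet> i\<bar> \<le> \<delta>" "\<bar>x \<bullet> j - q \<bullet> j\<bar> \<le> \<delta>"
      have "norm (x - q) < r" using plane_norm_le[OF ij, of "x - q"] x \<delta> by (simp add: inner_diff_left)
      then show "\<bar>G x - G q\<bar> \<le> e / 2" using r(2) by (simp add: less_imp_le)
    qed
    then show ?thesis using e by (simp add: dist_real_def)
  qed
  then show "eventually (\<lambda>\<delta>. dist (moll_val i j G \<delta> q) (G q) < e) (at_right 0)"
    using r(1) by (intro eventually_at_rightI[of 0 "r / 2"]) auto
qed

lemma sq_iff:
  assumes "i \<in> Basis" "j \<in> Basis" "i \<noteq> j"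
  shows "x \<in> sq q h \<longleftrightarrow> q \<bullet> i - h \<le> x \<bullet> i \<and> x \<bullet> i \<le> q \<bullet> i + 3 * h \<and> q \<bullet> j - h \<le> x \<bullet> j \<and> x \<bullet> j \<le> q \<bullet> j + 3 * h"
proof -
  have B: "Basis = {i, j}" using assms by (auto simp: Basis_plane)
  show ?thesis unfolding sq_def B by auto
qed

lemma pr_bound: "\<bar>a (x \<bullet> i)\<bar> \<le> A \<Longrightarrow> \<bar>b (x \<bullet> j)\<bar> \<le> B \<Longrightarrow> \<bar>pr i j a b x\<bar> \<le> A * B"
  unfolding pr_def abs_mult by (intro mult_mono) auto

lemma vanishes_outside_diff: "vanishes_outside l u a \<Longrightarrow> vanishes_outside l u b \<Longrightarrow> vanishes_outside l u (\<lambda>x. a x - b x)"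
  by (simp add: vanishes_outside_def)

lemma vanishes_outside_mono: "vanishes_outside l u a \<Longrightarrow> l' \<le> l \<Longrightarrow> u \<le> u' \<Longrightarrow> vanishes_outside l' u' a"
  unfolding vanishes_outside_def by (meson less_le_trans le_less_trans)

text \<open>The test function is a product of differences of steps, bounded by 1; its mixed
  derivative is the product of differences of mollifiers and thus produces the mixed difference of
  mollified values.\<close>

lemma moll_val_mixed_diff:
  assumes ij: "i \<in> Basis" "j \<in> Basis" "i \<noteq> j" and G: "continuous_on UNIV G" and \<delta>: "0 < \<delta>" "\<delta> \<le> h"
    and w: "is_weak_partial2 i j G g"
  shows "\<bar>moll_val i j G \<delta> (q + h *\<^sub>R i + h *\<^sub>R j) - moll_val i j G \<delta> (q + h *\<^sub>R i) - moll_val i j G \<delta> (q + h *\<^sub>R j) + moll_val i j G \<delta> q\<bar>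
     \<le> (\<integral>x. indicator (sq q h) x * \<bar>g x\<bar> \<partial>lborel)"
proof -
  have inn: "i \<bullet> i = 1" "j \<bullet> j = 1" "i \<bullet> j = 0" "j \<bullet> i = 0" using ij by (auto simp: inner_Basis)
  define m where "m s = moll_at \<delta> s" for s
  define \<psi> where "\<psi> s x = step_at \<delta> s x - step_at \<delta> (s + h) x" for s x
  define \<psi>' where "\<psi>' s x = m s x - m (s + h) x" for s x
  have sm: "smooth_real (\<psi> s)" for s unfolding \<psi>_def[abs_def] by (intro smooth_diff smooth_at)
  have der: "(\<psi> s has_real_derivative \<psi>' s x) (at x)" for s x
    unfolding \<psi>_def[abs_def] \<psi>'_def m_def by (intro DERIV_diff step_at_deriv)
  have van: "vanishes_outside (s - h) (s + 3 * h) (\<psi> s)" for s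
    unfolding vanishes_outside_def \<psi>_def using \<delta> by (auto simp: step_at_0 step_at_1)
  have bd: "\<bar>\<psi> s x\<bar> \<le> 1" for s x
    using step_at_range[of \<delta> s x] step_at_range[of \<delta> "s + h" x] by (simp add: \<psi>_def)
  define \<phi> where "\<phi> = pr i j (\<psi> (q \<bullet> i)) (\<psi> (q \<bullet> j))"
  have t: "\<phi> \<in> test_functions" unfolding \<phi>_def by (rule pr_test_function[OF ij sm sm van van])
  have \<phi>1: "\<bar>\<phi> x\<bar> \<le> 1" for x using pr_bound[of "\<psi> (q \<bullet> i)" x i 1 "\<psi> (q \<bullet> j)" j 1] bd by (simp add: \<phi>_def)
  have \<phi>0: "\<phi> x = 0" if "x \<notin> sq q h" for x
    using that van unfolding sq_iff[OF ij] \<phi>_def pr_def vanishes_outside_def by (auto simp: not_le)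
  have "partial j \<phi> = pr i j (\<psi> (q \<bullet> i)) (\<psi>' (q \<bullet> j))" unfolding \<phi>_def by (rule partial_pr(2)[OF ij der der])
  moreover obtain m' where "\<And>x. (\<psi>' (q \<bullet> j) has_real_derivative m' x) (at x)"
    using smooth_real_deriv[of "\<psi>' (q \<bullet> j)"] smooth_diff[OF smooth_at(1) smooth_at(1)] unfolding \<psi>'_def[abs_def] m_def by blast
  ultimately have pp: "partial i (partial j \<phi>) = pr i j (\<psi>' (q \<bullet> i)) (\<psi>' (q \<bullet> j))"
    using partial_pr(1)[OF ij der] by metis
  have I: "integrable lborel (\<lambda>x. G x * pr i j (m s) (m t) x)" for s t
    unfolding m_def by (rule integrable_mult_pr[OF ij G continuous_moll_at continuous_moll_at vanishes_moll_at[OF \<delta>(1)] vanishes_moll_at[OF \<delta>(1)]])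
  let ?s = "q \<bullet> i" and ?t = "q \<bullet> j"
  have "(\<integral>x. G x * partial i (partial j \<phi>) x \<partial>lborel) = (\<integral>x. (G x * pr i j (m (?s + h)) (m (?t + h)) x - G x * pr i j (m (?s + h)) (m ?t) x)
       - (G x * pr i j (m ?s) (m (?t + h)) x - G x * pr i j (m ?s) (m ?t) x) \<partial>lborel)"
    unfolding pp by (intro Bochner_Integration.integral_cong refl) (simp add: pr_def \<psi>'_def algebra_simps)
  also have "\<dots> = ((\<integral>x. G x * pr i j (m (?s + h)) (m (?t + h)) x \<partial>lborel) - (\<integral>x. G x * pr i j (m (?s + h)) (m ?t) x \<partial>lborel))
       - ((\<integral>x. G x * pr i j (m ?s) (m (?t + h)) x \<partial>lborel) - (\<integral>x. G x * pr i j (m ?s) (m ?t) x \<partial>lborel))"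
    by (simp add: I)
  also have "\<dots> = moll_val i j G \<delta> (q + h *\<^sub>R i + h *\<^sub>R j) - moll_val i j G \<delta> (q + h *\<^sub>R i) - moll_val i j G \<delta> (q + h *\<^sub>R j) + moll_val i j G \<delta> q"
    by (simp add: moll_val_def m_def inner_add_left inn)
  finally have eq: "(\<integral>x. G x * partial i (partial j \<phi>) x \<partial>lborel) = \<dots>" .
  show ?thesis using weak_bound[OF w t \<phi>1 \<phi>0, where q=q and h=h] unfolding eq by simp
qed

text \<open>The obvious test function, a double antiderivative in direction i times a mollifier in
  direction j, is of size h / \<delta> and blows up. The mollifier in j is therefore replaced by its
  average \<open>av\<close> over length h; the error \<open>av\<close> minus mollifier is the
  derivative of the bounded function \<open>be\<close> and is absorbed by the mixed derivative. Both
  test functions are bounded by 1 for all \<delta>.\<close>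

lemma moll_val_pure_diff:
  assumes ij: "i \<in> Basis" "j \<in> Basis" "i \<noteq> j" and G: "continuous_on UNIV G" and \<delta>: "0 < \<delta>" "\<delta> \<le> h"
    and w1: "is_weak_partial2 i i G g1" and w2: "is_weak_partial2 i j G g2"
  shows "\<bar>moll_val i j G \<delta> (q + (2 * h) *\<^sub>R i) - 2 * moll_val i j G \<delta> (q + h *\<^sub>R i) + moll_val i j G \<delta> q\<bar>
     \<le> (\<integral>x. indicator (sq q h) x * \<bar>g1 x\<bar> \<partial>lborel) + (\<integral>x. indicator (sq q h) x * \<bar>g2 x\<bar> \<partial>lborel)"
proof -
  have inn: "i \<bullet> i = 1" "j \<bullet> j = 1" "i \<bullet> j = 0" "j \<bullet> i = 0" using ij by (auto simp: inner_Basis)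
  have h: "0 < h" using \<delta> by simp
  let ?s = "q \<bullet> i" and ?t = "q \<bullet> j"
  define m where "m s = moll_at \<delta> s" for s
  define \<tau> where "\<tau> x = (ramp_at \<delta> ?s x - ramp_at \<delta> (?s + h) x) - (ramp_at \<delta> (?s + h) x - ramp_at \<delta> (?s + h + h) x)" for x
  define \<tau>1 where "\<tau>1 x = (step_at \<delta> ?s x - step_at \<delta> (?s + h) x) - (step_at \<delta> (?s + h) x - step_at \<delta> (?s + h + h) x)" for x
  define \<tau>2 where "\<tau>2 x = (m ?s x - m (?s + h) x) - (m (?s + h) x - m (?s + h + h) x)" for x
  define av where "av x = (1 / h) * (step_at \<delta> ?t x - step_at \<delta> (?t + h) x)" for x
  define be where "be x = (1 / h) * (ramp_at \<delta> ?t x - ramp_at \<delta> (?t + h) x) - step_at \<delta> ?t x" for x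
  have smt: "smooth_real \<tau>" "smooth_real \<tau>1" "smooth_real \<tau>2" "smooth_real av" "smooth_real be"
    unfolding \<tau>_def[abs_def] \<tau>1_def[abs_def] \<tau>2_def[abs_def] av_def[abs_def] be_def[abs_def] m_def
    by (intro smooth_diff smooth_cmult smooth_at)+
  have d1: "(\<tau> has_real_derivative \<tau>1 x) (at x)" for x
    unfolding \<tau>_def[abs_def] \<tau>1_def by (intro DERIV_diff ramp_at_deriv \<delta>)
  have d2: "(\<tau>1 has_real_derivative \<tau>2 x) (at x)" for x
    unfolding \<tau>1_def[abs_def] \<tau>2_def m_def by (intro DERIV_diff step_at_deriv)
  have d3: "(be has_real_derivative (av x - m ?t x)) (at x)" for x
    unfolding be_def[abs_def] av_def m_def by (intro DERIV_diff DERIV_cmult ramp_at_deriv step_at_deriv \<delta>)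
  obtain av' where d4: "\<And>x. (av has_real_derivative av' x) (at x)" using smooth_real_deriv[OF smt(4)] by blast
  obtain bm where d5: "\<And>x. ((\<lambda>x. av x - m ?t x) has_real_derivative bm x) (at x)"
    using smooth_real_deriv[OF smooth_diff[OF smt(4) smooth_at(1)[of \<delta> ?t]]] unfolding m_def by blast
  have v\<tau>: "vanishes_outside (?s - h) (?s + 3 * h) \<tau>" "vanishes_outside (?s - h) (?s + 3 * h) \<tau>1"
    unfolding vanishes_outside_def \<tau>_def \<tau>1_def using \<delta> by (auto simp: ramp_at_0 ramp_at_id step_at_0 step_at_1)
  have vt: "vanishes_outside (?t - h) (?t + 3 * h) av" "vanishes_outside (?t - h) (?t + 3 * h) be"
    unfolding vanishes_outside_def av_def be_def using \<delta> h by (auto simp: ramp_at_0 ramp_at_id step_at_0 step_at_1)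
  have b1: "\<bar>\<tau> x\<bar> \<le> h" for x
    using ramp_at_diff[OF \<delta>(1), of h ?s x] ramp_at_diff[OF \<delta>(1), of h "?s + h" x] h unfolding \<tau>_def by linarith
  have b2: "\<bar>\<tau>1 x\<bar> \<le> 1" for x
    using step_at_mono[OF \<delta>(1), of ?s "?s + h" x] step_at_mono[OF \<delta>(1), of "?s + h" "?s + h + h" x] h
      step_at_range[of \<delta> ?s x] step_at_range[of \<delta> "?s + h" x] step_at_range[of \<delta> "?s + h + h" x] unfolding \<tau>1_def by linarith
  have b3: "\<bar>av x\<bar> \<le> 1 / h" for x
  proof -
    have "\<bar>step_at \<delta> ?t x - step_at \<delta> (?t + h) x\<bar> \<le> 1"
      using step_at_range[of \<delta> ?t x] step_at_range[of \<delta> "?t + h" x] by linarith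
    then show ?thesis using h by (simp add: av_def abs_mult divide_right_mono)
  qed
  have b4: "\<bar>be x\<bar> \<le> 1" for x
  proof -
    have "0 \<le> (1 / h) * (ramp_at \<delta> ?t x - ramp_at \<delta> (?t + h) x)" "(1 / h) * (ramp_at \<delta> ?t x - ramp_at \<delta> (?t + h) x) \<le> 1"
      using ramp_at_diff[OF \<delta>(1), of h ?t x] h by (auto simp: field_simps)
    then show ?thesis using step_at_range[of \<delta> ?t x] unfolding be_def by linarith
  qed
  define \<phi>1 where "\<phi>1 = pr i j \<tau> av"
  define \<phi>2 where "\<phi>2 = pr i j \<tau>1 be"
  have t1: "\<phi>1 \<in> test_functions" unfolding \<phi>1_def by (rule pr_test_function[OF ij smt(1,4) v\<tau>(1) vt(1)])
  have t2: "\<phi>2 \<in> test_functions" unfolding \<phi>2_def by (rule pr_test_function[OF ij smt(2,5) v\<tau>(2) vt(2)])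
  have \<phi>1b: "\<bar>\<phi>1 x\<bar> \<le> 1" for x using pr_bound[of \<tau> x i h av j "1 / h"] b1 b3 h by (simp add: \<phi>1_def)
  have \<phi>2b: "\<bar>\<phi>2 x\<bar> \<le> 1" for x using pr_bound[of \<tau>1 x i 1 be j 1] b2 b4 by (simp add: \<phi>2_def)
  have z1: "\<phi>1 x = 0" if "x \<notin> sq q h" for x
    using that v\<tau> vt unfolding sq_iff[OF ij] \<phi>1_def pr_def vanishes_outside_def by (auto simp: not_le)
  have z2: "\<phi>2 x = 0" if "x \<notin> sq q h" for x
    using that v\<tau> vt unfolding sq_iff[OF ij] \<phi>2_def pr_def vanishes_outside_def by (auto simp: not_le)
  have pp1: "partial i (partial i \<phi>1) = pr i j \<tau>2 av"
    unfolding \<phi>1_def partial_pr(1)[OF ij d1 d4] by (rule partial_pr(1)[OF ij d2 d4])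
  have pp2: "partial i (partial j \<phi>2) = pr i j \<tau>2 (\<lambda>x. av x - m ?t x)"
    unfolding \<phi>2_def partial_pr(2)[OF ij d2 d3] by (rule partial_pr(1)[OF ij d2 d5])
  have vm: "vanishes_outside (s - \<delta>) (s + \<delta>) (m s)" for s unfolding m_def by (rule vanishes_moll_at[OF \<delta>(1)])
  have v2: "vanishes_outside (?s - \<delta>) (?s + h + h + \<delta>) \<tau>2"
    unfolding \<tau>2_def[abs_def] using h by (intro vanishes_outside_diff vanishes_outside_mono[OF vm]) auto
  have v3: "vanishes_outside (?t - h) (?t + 3 * h) (\<lambda>x. av x - m ?t x)"
    using h \<delta> by (intro vanishes_outside_diff vt vanishes_outside_mono[OF vm]) auto
  have c: "continuous_on UNIV \<tau>2" "continuous_on UNIV av" "continuous_on UNIV (\<lambda>x. av x - m ?t x)"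
    using smt smooth_at unfolding m_def by (auto intro!: smooth_real_continuous smooth_diff)
  have I: "integrable lborel (\<lambda>x. G x * pr i j (m s) (m t) x)" for s t
    unfolding m_def by (rule integrable_mult_pr[OF ij G continuous_moll_at continuous_moll_at vanishes_moll_at[OF \<delta>(1)] vanishes_moll_at[OF \<delta>(1)]])
  have I1: "integrable lborel (\<lambda>x. G x * pr i j \<tau>2 av x)" by (rule integrable_mult_pr[OF ij G c(1,2) v2 vt(1)])
  have I2: "integrable lborel (\<lambda>x. G x * pr i j \<tau>2 (\<lambda>x. av x - m ?t x) x)" by (rule integrable_mult_pr[OF ij G c(1,3) v2 v3])
  have "(\<integral>x. G x * partial i (partial i \<phi>1) x \<partial>lborel) - (\<integral>x. G x * partial i (partial j \<phi>2) x \<partial>lborel)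
     = (\<integral>x. G x * pr i j \<tau>2 av x - G x * pr i j \<tau>2 (\<lambda>x. av x - m ?t x) x \<partial>lborel)"
    unfolding pp1 pp2 using I1 I2 by simp
  also have "\<dots> = (\<integral>x. (G x * pr i j (m (?s + h + h)) (m ?t) x - 2 * (G x * pr i j (m (?s + h)) (m ?t) x)) + G x * pr i j (m ?s) (m ?t) x \<partial>lborel)"
    by (intro Bochner_Integration.integral_cong refl) (simp add: pr_def \<tau>2_def algebra_simps)
  also have "\<dots> = (\<integral>x. G x * pr i j (m (?s + h + h)) (m ?t) x \<partial>lborel) - 2 * (\<integral>x. G x * pr i j (m (?s + h)) (m ?t) x \<partial>lborel) + (\<integral>x. G x * pr i j (m ?s) (m ?t) x \<partial>lborel)"
    using I by simp
  also have "\<dots> = moll_val i j G \<delta> (q + (2 * h) *\<^sub>R i) - 2 * moll_val i j G \<delta> (q + h *\<^sub>R i) + moll_val i j G \<delta> q"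
    by (simp add: moll_val_def m_def inner_add_left inn add.assoc)
  finally have eq: "(\<integral>x. G x * partial i (partial i \<phi>1) x \<partial>lborel) - (\<integral>x. G x * partial i (partial j \<phi>2) x \<partial>lborel) = \<dots>" .
  show ?thesis
    using weak_bound[OF w1 t1 \<phi>1b z1, where q=q and h=h] weak_bound[OF w2 t2 \<phi>2b z2, where q=q and h=h] unfolding eq[symmetric] by linarith
qed

text \<open>The bounds for mollified values are uniform in \<delta>, and continuity of G lets
  \<delta> tend to 0.\<close>

lemma second_difference_le:
  assumes ij: "i \<in> Basis" "j \<in> Basis" "i \<noteq> j" and G: "continuous_on UNIV G" and h: "0 < h"
    and w1: "is_weak_partial2 i i G g1" and w2: "is_weak_partial2 i j G g2"
  shows "\<bar>G (q + (2 * h) *\<^sub>R i) - 2 * G (q + h *\<^sub>R i) + G q\<bar>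
     \<le> (\<integral>x. indicator (sq q h) x * \<bar>g1 x\<bar> \<partial>lborel) + (\<integral>x. indicator (sq q h) x * \<bar>g2 x\<bar> \<partial>lborel)"
    and "\<bar>G (q + h *\<^sub>R i + h *\<^sub>R j) - G (q + h *\<^sub>R i) - G (q + h *\<^sub>R j) + G q\<bar> \<le> (\<integral>x. indicator (sq q h) x * \<bar>g2 x\<bar> \<partial>lborel)"
proof -
  note t = moll_val_tendsto[OF ij G]
  have ev: "eventually (\<lambda>\<delta>. 0 < \<delta> \<and> \<delta> \<le> h) (at_right 0)"
    using h by (intro eventually_at_rightI[of 0 h]) auto
  show "\<bar>G (q + (2 * h) *\<^sub>R i) - 2 * G (q + h *\<^sub>R i) + G q\<bar>
     \<le> (\<integral>x. indicator (sq q h) x * \<bar>g1 x\<bar> \<partial>lborel) + (\<integral>x. indicator (sq q h) x * \<bar>g2 x\<bar> \<partial>lborel)"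
  proof (rule tendsto_upperbound)
    show "((\<lambda>\<delta>. \<bar>moll_val i j G \<delta> (q + (2 * h) *\<^sub>R i) - 2 * moll_val i j G \<delta> (q + h *\<^sub>R i) + moll_val i j G \<delta> q\<bar>)
        \<longlongrightarrow> \<bar>G (q + (2 * h) *\<^sub>R i) - 2 * G (q + h *\<^sub>R i) + G q\<bar>) (at_right 0)"
      by (intro tendsto_intros t)
    show "eventually (\<lambda>\<delta>. \<bar>moll_val i j G \<delta> (q + (2 * h) *\<^sub>R i) - 2 * moll_val i j G \<delta> (q + h *\<^sub>R i) + moll_val i j G \<delta> q\<bar>
        \<le> (\<integral>x. indicator (sq q h) x * \<bar>g1 x\<bar> \<partial>lborel) + (\<integral>x. indicator (sq q h) x * \<bar>g2 x\<bar> \<partial>lborel)) (at_right 0)"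
      using ev by eventually_elim (rule moll_val_pure_diff[OF ij G _ _ w1 w2], auto)
  qed simp
  show "\<bar>G (q + h *\<^sub>R i + h *\<^sub>R j) - G (q + h *\<^sub>R i) - G (q + h *\<^sub>R j) + G q\<bar> \<le> (\<integral>x. indicator (sq q h) x * \<bar>g2 x\<bar> \<partial>lborel)"
  proof (rule tendsto_upperbound)
    show "((\<lambda>\<delta>. \<bar>moll_val i j G \<delta> (q + h *\<^sub>R i + h *\<^sub>R j) - moll_val i j G \<delta> (q + h *\<^sub>R i) - moll_val i j G \<delta> (q + h *\<^sub>R j) + moll_val i j G \<delta> q\<bar>)
        \<longlongrightarrow> \<bar>G (q + h *\<^sub>R i + h *\<^sub>R j) - G (q + h *\<^sub>R i) - G (q + h *\<^sub>R j) + G q\<bar>) (at_right 0)"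
      by (intro tendsto_intros t)
    show "eventually (\<lambda>\<delta>. \<bar>moll_val i j G \<delta> (q + h *\<^sub>R i + h *\<^sub>R j) - moll_val i j G \<delta> (q + h *\<^sub>R i) - moll_val i j G \<delta> (q + h *\<^sub>R j) + moll_val i j G \<delta> q\<bar>
        \<le> (\<integral>x. indicator (sq q h) x * \<bar>g2 x\<bar> \<partial>lborel)) (at_right 0)"
      using ev by eventually_elim (rule moll_val_mixed_diff[OF ij G _ _ w2], auto)
  qed simp
qed

subsection \<open>Uniqueness of weak derivatives\<close>

text \<open>Positive and negative part of k are densities of measures that agree on boxes, a
  generator stable under intersection. Restricting to a bounded box B first makes both measures
  finite.\<close>

lemma AE_zero_if_box_integrals_zero:
  fixes k :: "plane \<Rightarrow> real"
  assumes k[measurable]: "k \<in> borel_measurable borel" and int: "\<And>K. compact K \<Longrightarrow> integrable lborel (\<lambda>x. indicator K x * k x)"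
    and z: "\<And>a b. (\<integral>x. indicator (box a b) x * k x \<partial>lborel) = 0"
  shows "AE x in lborel. k x = 0"
proof -
  have "AE x in lborel. x \<in> box (- real n *\<^sub>R One) (real n *\<^sub>R One) \<longrightarrow> k x = 0" for n
  proof -
    define B :: "plane set" where "B = box (- real n *\<^sub>R One) (real n *\<^sub>R One)"
    define f where "f x = ennreal (max 0 (k x)) * indicator B x" for x
    define g where "g x = ennreal (max 0 (- k x)) * indicator B x" for x
    have B[measurable]: "B \<in> sets borel" by (simp add: B_def)
    have [measurable]: "f \<in> borel_measurable borel" "g \<in> borel_measurable borel" by (simp_all add: f_def[abs_def] g_def[abs_def])
    have ib: "integrable lborel (\<lambda>x. indicator (box a b) x * k x)" for a b
    proof (rule Bochner_Integration.integrable_bound[OF int[of "cbox a b"]])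
      show "AE x in lborel. norm (indicator (box a b) x * k x) \<le> norm (indicator (cbox a b) x * k x)"
        using box_subset_cbox[of a b] by (auto simp: indicator_def)
    qed auto
    have fg: "(\<integral>\<^sup>+x. f x * indicator (box a b) x \<partial>lborel) = (\<integral>\<^sup>+x. g x * indicator (box a b) x \<partial>lborel)"
      "(\<integral>\<^sup>+x. f x * indicator (box a b) x \<partial>lborel) \<noteq> \<infinity>" for a b
    proof -
      obtain a' b' where ab: "B \<inter> box a b = box a' b'" unfolding B_def by (auto simp: box_Int_box)
      have i1: "integrable lborel (\<lambda>x. indicator (box a' b') x * max 0 (k x))"
        by (rule Bochner_Integration.integrable_bound[OF ib[of a' b']]) (auto simp: indicator_def)
      have i2: "integrable lborel (\<lambda>x. indicator (box a' b') x * max 0 (- k x))"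
        by (rule Bochner_Integration.integrable_bound[OF ib[of a' b']]) (auto simp: indicator_def)
      have e1: "(\<integral>\<^sup>+x. f x * indicator (box a b) x \<partial>lborel) = ennreal (\<integral>x. indicator (box a' b') x * max 0 (k x) \<partial>lborel)"
      proof -
        have "f x * indicator (box a b) x = ennreal (indicator (box a' b') x * max 0 (k x))" for x
          unfolding ab[symmetric] by (auto simp: f_def indicator_def)
        then show ?thesis using nn_integral_eq_integral[OF i1] by (simp add: indicator_def)
      qed
      have e2: "(\<integral>\<^sup>+x. g x * indicator (box a b) x \<partial>lborel) = ennreal (\<integral>x. indicator (box a' b') x * max 0 (- k x) \<partial>lborel)"
      proof -
        have "g x * indicator (box a b) x = ennreal (indicator (box a' b') x * max 0 (- k x))" for x
          unfolding ab[symmetric] by (auto simp: g_def indicator_def)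
        then show ?thesis using nn_integral_eq_integral[OF i2] by (simp add: indicator_def)
      qed
      have "(\<integral>x. indicator (box a' b') x * max 0 (k x) \<partial>lborel) - (\<integral>x. indicator (box a' b') x * max 0 (- k x) \<partial>lborel)
         = (\<integral>x. indicator (box a' b') x * max 0 (k x) - indicator (box a' b') x * max 0 (- k x) \<partial>lborel)"
        using i1 i2 by simp
      also have "\<dots> = (\<integral>x. indicator (box a' b') x * k x \<partial>lborel)"
        by (intro Bochner_Integration.integral_cong refl) (auto simp: max_def)
      also have "\<dots> = 0" by (rule z)
      finally show "(\<integral>\<^sup>+x. f x * indicator (box a b) x \<partial>lborel) = (\<integral>\<^sup>+x. g x * indicator (box a b) x \<partial>lborel)"
        unfolding e1 e2 by simp
      show "(\<integral>\<^sup>+x. f x * indicator (box a b) x \<partial>lborel) \<noteq> \<infinity>" unfolding e1 by simp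
    qed
    have "density lborel f = density lborel g"
    proof (rule measure_eqI_generator_eq)
      let ?E = "range (\<lambda>(a, b). box a b :: plane set)"
      show "Int_stable ?E" by (auto simp: Int_stable_def box_Int_box)
      show "?E \<subseteq> Pow UNIV" "sets (density lborel f) = sigma_sets UNIV ?E" "sets (density lborel g) = sigma_sets UNIV ?E"
        by (simp_all add: borel_eq_box)
      let ?A = "\<lambda>n::nat. box (- (real n *\<^sub>R One)) (real n *\<^sub>R One) :: plane set"
      show "range ?A \<subseteq> ?E" "(\<Union>i. ?A i) = UNIV" unfolding UN_box_eq_UNIV by auto
      show "emeasure (density lborel f) (?A i) \<noteq> \<infinity>" for i using fg(2) by (subst emeasure_density) auto
      show "emeasure (density lborel f) X = emeasure (density lborel g) X" if "X \<in> ?E" for X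
        using that fg(1) by (auto simp: emeasure_density)
    qed
    moreover have "integral\<^sup>N lborel f \<noteq> \<infinity>"
    proof -
      have "f x * indicator B x = f x" for x by (simp add: f_def indicator_def)
      then show ?thesis using fg(2)[of "- real n *\<^sub>R One" "real n *\<^sub>R One"] by (simp add: B_def)
    qed
    ultimately have "AE x in lborel. f x = g x"
      using finite_density_unique[of f lborel g] by simp
    then show ?thesis
    proof eventually_elim
      case (elim x)
      show ?case
      proof
        assume "x \<in> box (- real n *\<^sub>R One) (real n *\<^sub>R One)"
        then have "ennreal (max 0 (k x)) = ennreal (max 0 (- k x))" using elim by (simp add: f_def g_def B_def)
        then show "k x = 0" by (auto simp: max_def split: if_splits)
      qed
    qed
  qed
  then have "AE x in lborel. \<forall>n. x \<in> box (- real n *\<^sub>R One) (real n *\<^sub>R One) \<longrightarrow> k x = 0"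
    by (subst AE_all_countable) (rule allI)
  then show ?thesis
  proof eventually_elim
    case (elim x)
    have "x \<in> (\<Union>n. box (- (real n *\<^sub>R One)) (real n *\<^sub>R One))" unfolding UN_box_eq_UNIV by simp
    then show ?case using elim by auto
  qed
qed

text \<open>The steps are shifted inwards by their own width, so the approximations vanish exactly
  outside the open interval and the limit is also right at the endpoints.\<close>

lemma step_bump_tendsto:
  assumes "a < b"
  shows "(\<lambda>n. step_at (1 / real (Suc n)) (a + 1 / real (Suc n)) x - step_at (1 / real (Suc n)) (b - 1 / real (Suc n)) x) \<longlonglongrightarrow> indicator {a<..<b} x"
proof -
  have lim: "(\<lambda>n. 1 / real (Suc n)) \<longlonglongrightarrow> 0" by (rule LIMSEQ_Suc[OF lim_1_over_n])
  have ev: "eventually (\<lambda>n. 2 * (1 / real (Suc n)) < c) sequentially" if "0 < c" for c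
    using order_tendstoD(2)[OF tendsto_mult_right_zero[OF lim, of 2] that] by simp
  have 1: "(\<lambda>n. step_at (1 / real (Suc n)) (a + 1 / real (Suc n)) x) \<longlonglongrightarrow> (if a < x then 1 else 0)"
  proof (cases "a < x")
    case True
    have "eventually (\<lambda>n. step_at (1 / real (Suc n)) (a + 1 / real (Suc n)) x = 1) sequentially"
      using ev[of "x - a"] True by (auto elim!: eventually_mono intro!: step_at_1)
    then show ?thesis using True by (simp add: tendsto_eventually)
  next
    case False
    then show ?thesis by (simp add: step_at_0)
  qed
  have 2: "(\<lambda>n. step_at (1 / real (Suc n)) (b - 1 / real (Suc n)) x) \<longlonglongrightarrow> (if x < b then 0 else 1)"
  proof (cases "x < b")
    case True
    have "eventually (\<lambda>n. step_at (1 / real (Suc n)) (b - 1 / real (Suc n)) x = 0) sequentially"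
      using ev[of "b - x"] True by (auto elim!: eventually_mono intro!: step_at_0)
    then show ?thesis using True by (simp add: tendsto_eventually)
  next
    case False
    then show ?thesis by (simp add: step_at_1)
  qed
  have "(if a < x then 1 else 0) - (if x < b then 0 else 1) = (indicator {a<..<b} x :: real)"
    using assms by (auto simp: indicator_def)
  then show ?thesis using tendsto_diff[OF 1 2] by simp
qed

text \<open>Products of smoothed interval indicators are test functions bounded by 1 with a common
  compact support; dominated convergence turns the weak identity into vanishing integrals over
  boxes.\<close>

lemma weak_partial_unique:
  assumes g: "is_weak_partial2 i j F g" and g': "is_weak_partial2 i j F g'"
  shows "AE x in lborel. g x = g' x"
proof -
  define k where "k x = g x - g' x" for x
  have gm[measurable]: "g \<in> borel_measurable borel" "g' \<in> borel_measurable borel"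
    using g g' by (auto simp: is_weak_partial2_def locally_integrable_def)
  have km[measurable]: "k \<in> borel_measurable borel" by (simp add: k_def[abs_def])
  have gi: "integrable lborel (\<lambda>x. indicator K x * g x)" "integrable lborel (\<lambda>x. indicator K x * g' x)" if "compact K" for K
    using g g' that by (auto simp: is_weak_partial2_def locally_integrable_def set_integrable_def)
  have ki: "integrable lborel (\<lambda>x. indicator K x * k x)" if "compact K" for K
    using Bochner_Integration.integrable_diff[OF gi(1)[OF that] gi(2)[OF that]] by (simp add: k_def right_diff_distrib)
  have ij: "(1, 0) \<in> (Basis :: plane set)" "(0, 1) \<in> (Basis :: plane set)" "(1, 0) \<noteq> ((0, 1) :: plane)"
    by (auto simp: Basis_plane)
  have "(\<integral>x. indicator (box a b) x * k x \<partial>lborel) = 0" for a b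
  proof (cases "fst a < fst b \<and> snd a < snd b")
    case False
    have "box a b = {}" using False by (cases a; cases b) (auto simp: box_def Basis_plane)
    then show ?thesis by simp
  next
    case ab: True
    define \<psi> where "\<psi> u v n x = step_at (1 / real (Suc n)) (u + 1 / real (Suc n)) x - step_at (1 / real (Suc n)) (v - 1 / real (Suc n)) x" for u v n x
    define \<phi> where "\<phi> n = pr (1, 0) (0, 1) (\<psi> (fst a) (fst b) n) (\<psi> (snd a) (snd b) n)" for n
    have sm: "smooth_real (\<psi> u v n)" for u v n unfolding \<psi>_def[abs_def] by (intro smooth_diff smooth_at)
    have van: "vanishes_outside (u - 2) (v + 2) (\<psi> u v n)" if "u < v" for u v n
    proof -
      define \<delta> where "\<delta> = 1 / real (Suc n)"
      have \<delta>: "0 < \<delta>" "\<delta> \<le> 1" by (simp_all add: \<delta>_def)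
      show ?thesis unfolding vanishes_outside_def \<psi>_def \<delta>_def[symmetric]
        using \<delta> that by (auto simp: step_at_0 step_at_1)
    qed
    have bd: "\<bar>\<psi> u v n x\<bar> \<le> 1" for u v n x
      using step_at_range[of "1 / real (Suc n)" "u + 1 / real (Suc n)" x] step_at_range[of "1 / real (Suc n)" "v - 1 / real (Suc n)" x]
      unfolding \<psi>_def by linarith
    have t: "\<phi> n \<in> test_functions" for n
      unfolding \<phi>_def using ab by (intro pr_test_function[OF ij sm sm van van]) auto
    have \<phi>1: "\<bar>\<phi> n x\<bar> \<le> 1" for n x
      using pr_bound[of "\<psi> (fst a) (fst b) n" x "(1, 0)" 1 "\<psi> (snd a) (snd b) n" "(0, 1)" 1] bd by (simp add: \<phi>_def)
    define K where "K = cbox (fst a - 2, snd a - 2) (fst b + 2, snd b + 2)"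
    have K: "compact K" by (simp add: K_def)
    have \<phi>0: "\<phi> n x = 0" if "x \<notin> K" for n x
    proof -
      have "fst x < fst a - 2 \<or> fst b + 2 < fst x \<or> snd x < snd a - 2 \<or> snd b + 2 < snd x"
        using that by (cases x) (auto simp: K_def cbox_Pair_eq)
      then show ?thesis using van[of "fst a" "fst b" n] van[of "snd a" "snd b" n] ab
        by (cases x) (auto simp: \<phi>_def pr_def vanishes_outside_def)
    qed
    have [measurable]: "\<phi> n \<in> borel_measurable borel" for n
      unfolding \<phi>_def by (intro borel_measurable_continuous_onI continuous_pr smooth_real_continuous sm)
    have ip: "integrable lborel (\<lambda>x. f x * \<phi> n x)" if f: "integrable lborel (\<lambda>x. indicator K x * f x)" and [measurable]: "f \<in> borel_measurable borel" for f n
    proof (rule Bochner_Integration.integrable_bound[OF f])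
      show "AE x in lborel. norm (f x * \<phi> n x) \<le> norm (indicator K x * f x)"
        using \<phi>1 \<phi>0 by (intro AE_I2) (auto simp: indicator_def abs_mult intro!: mult_left_le)
    qed measurable
    have zero: "(\<integral>x. k x * \<phi> n x \<partial>lborel) = 0" for n
    proof -
      have "(\<integral>x. k x * \<phi> n x \<partial>lborel) = (\<integral>x. g x * \<phi> n x \<partial>lborel) - (\<integral>x. g' x * \<phi> n x \<partial>lborel)"
        unfolding k_def left_diff_distrib using ip[OF gi(1)[OF K]] ip[OF gi(2)[OF K]] by simp
      also have "(\<integral>x. g x * \<phi> n x \<partial>lborel) = (\<integral>x. g' x * \<phi> n x \<partial>lborel)"
        using g g' t[of n] by (simp add: is_weak_partial2_def)
      finally show ?thesis by simp
    qed
    have "(\<lambda>n. \<integral>x. k x * \<phi> n x \<partial>lborel) \<longlonglongrightarrow> (\<integral>x. indicator (box a b) x * k x \<partial>lborel)"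
    proof (rule integral_dominated_convergence)
      show "integrable lborel (\<lambda>x. \<bar>indicator K x * k x\<bar>)" by (intro integrable_abs ki K)
      show "AE x in lborel. (\<lambda>n. k x * \<phi> n x) \<longlonglongrightarrow> indicator (box a b) x * k x"
      proof (intro AE_I2)
        fix x :: plane
        have "(\<lambda>n. \<psi> (fst a) (fst b) n (fst x) * \<psi> (snd a) (snd b) n (snd x)) \<longlonglongrightarrow> indicator {fst a<..<fst b} (fst x) * indicator {snd a<..<snd b} (snd x)"
          unfolding \<psi>_def using ab by (intro tendsto_mult step_bump_tendsto) auto
        moreover have "indicator {fst a<..<fst b} (fst x) * indicator {snd a<..<snd b} (snd x) = (indicator (box a b) x :: real)"
          by (cases a; cases b; cases x) (auto simp: indicator_def box_def Basis_plane)
        moreover have "\<phi> n x = \<psi> (fst a) (fst b) n (fst x) * \<psi> (snd a) (snd b) n (snd x)" for n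
          by (cases x) (simp add: \<phi>_def pr_def)
        ultimately show "(\<lambda>n. k x * \<phi> n x) \<longlonglongrightarrow> indicator (box a b) x * k x"
          using tendsto_mult_left[of "\<lambda>n. \<phi> n x" "indicator (box a b) x" sequentially "k x"] by (simp add: mult.commute)
      qed
      show "AE x in lborel. norm (k x * \<phi> n x) \<le> \<bar>indicator K x * k x\<bar>" for n
        using \<phi>1 \<phi>0 by (intro AE_I2) (auto simp: indicator_def abs_mult intro!: mult_left_le)
    qed measurable
    then have "(\<lambda>n. 0) \<longlonglongrightarrow> (\<integral>x. indicator (box a b) x * k x \<partial>lborel)" unfolding zero .
    then show ?thesis using LIMSEQ_unique[OF tendsto_const] by metis
  qed
  then have "AE x in lborel. k x = 0" by (intro AE_zero_if_box_integrals_zero ki) auto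
  then show ?thesis by eventually_elim (simp add: k_def)
qed

subsection \<open>Sampling a Sobolev function on a lattice\<close>

text \<open>Hoelder's inequality up to the factor 2 powr p, from the pointwise bound |g| \<le> t + t
  powr (1 - p) * |g| powr p with the t that balances the two integrals. If J = 0 there is no such t,
  and a small t gives a contradiction instead.\<close>

lemma L1_le_Lp_powr:
  fixes g :: "plane \<Rightarrow> real"
  assumes p: "1 < p" and A: "measure lborel K = A" "0 < A" and K: "emeasure lborel K < \<infinity>" "K \<in> sets borel"
    and i1: "integrable lborel (\<lambda>x. indicator K x * \<bar>g x\<bar>)" and ip: "integrable lborel (\<lambda>x. indicator K x * \<bar>g x\<bar> powr p)"
  shows "(\<integral>x. indicator K x * \<bar>g x\<bar> \<partial>lborel) powr p \<le> 2 powr p * A powr (p - 1) * (\<integral>x. indicator K x * \<bar>g x\<bar> powr p \<partial>lborel)"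
proof -
  define J where "J = (\<integral>x. indicator K x * \<bar>g x\<bar> powr p \<partial>lborel)"
  have J0: "0 \<le> J" unfolding J_def by (intro integral_nonneg_AE AE_I2) auto
  have iK: "integrable lborel (indicator K :: plane \<Rightarrow> real)" using K by simp
  have bound: "(\<integral>x. indicator K x * \<bar>g x\<bar> \<partial>lborel) \<le> t * A + t powr (1 - p) * J" if t: "0 < t" for t
  proof -
    have "(\<integral>x. indicator K x * \<bar>g x\<bar> \<partial>lborel) \<le> (\<integral>x. t * indicator K x + t powr (1 - p) * (indicator K x * \<bar>g x\<bar> powr p) \<partial>lborel)"
    proof (rule integral_mono[OF i1])
      show "indicator K x * \<bar>g x\<bar> \<le> t * indicator K x + t powr (1 - p) * (indicator K x * \<bar>g x\<bar> powr p)" for x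
      proof (cases "x \<in> K \<and> t < \<bar>g x\<bar>")
        case True
        have "\<bar>g x\<bar> = \<bar>g x\<bar> powr (1 - p) * \<bar>g x\<bar> powr p" using True t by (simp add: powr_add[symmetric])
        also have "\<dots> \<le> t powr (1 - p) * \<bar>g x\<bar> powr p"
          using True t p by (intro mult_right_mono powr_mono2') auto
        finally show ?thesis using True t by simp
      next
        case False
        then show ?thesis using t by (auto simp: indicator_def add_increasing2)
      qed
    qed (use iK ip in auto)
    also have "\<dots> = t * A + t powr (1 - p) * J" using iK ip A K by (simp add: J_def)
    finally show ?thesis .
  qed
  have nn: "0 \<le> (\<integral>x. indicator K x * \<bar>g x\<bar> \<partial>lborel)" by (intro integral_nonneg_AE AE_I2) auto
  show ?thesis
  proof (cases "J = 0")
    case True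
    have "(\<integral>x. indicator K x * \<bar>g x\<bar> \<partial>lborel) \<le> 0"
    proof (rule ccontr)
      assume *: "\<not> (\<integral>x. indicator K x * \<bar>g x\<bar> \<partial>lborel) \<le> 0"
      define I where "I = (\<integral>x. indicator K x * \<bar>g x\<bar> \<partial>lborel)"
      have "I \<le> I / (2 * A) * A" using bound[of "I / (2 * A)"] * A True by (simp add: I_def)
      then show False using * A by (simp add: I_def)
    qed
    then have "(\<integral>x. indicator K x * \<bar>g x\<bar> \<partial>lborel) = 0" using nn by simp
    then show ?thesis using True by (simp add: J_def)
  next
    case False
    then have J: "0 < J" using J0 by simp
    define t where "t = (J / A) powr (1 / p)"
    have t: "0 < t" using J A by (simp add: t_def)
    have tp: "t powr p = J / A" using p J A by (simp add: t_def powr_powr)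
    have "t powr (1 - p) * J = t * A"
      using t tp J A by (simp add: powr_diff)
    then have "(\<integral>x. indicator K x * \<bar>g x\<bar> \<partial>lborel) \<le> 2 * t * A" using bound[OF t] by (simp add: algebra_simps)
    then have "(\<integral>x. indicator K x * \<bar>g x\<bar> \<partial>lborel) powr p \<le> (2 * t * A) powr p"
      using nn p by (intro powr_mono2) auto
    also have "\<dots> = 2 powr p * (t powr p) * A powr p" using t A by (simp add: powr_mult)
    also have "\<dots> = 2 powr p * A powr (p - 1) * J" unfolding tp using A by (simp add: powr_diff)
    finally show ?thesis by (simp add: J_def)
  qed
qed

definition hess_norm :: "(plane \<Rightarrow> real) \<Rightarrow> plane \<Rightarrow> real" where
  "hess_norm F x = sqrt (\<Sum>i\<in>Basis. \<Sum>j\<in>Basis. (weak_partial2 i j F x)\<^sup>2)"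

lemma hess_norm_ge: "i \<in> Basis \<Longrightarrow> j \<in> Basis \<Longrightarrow> \<bar>weak_partial2 i j F x\<bar> \<le> hess_norm F x"
proof -
  assume ij: "i \<in> Basis" "j \<in> Basis"
  have "(weak_partial2 i j F x)\<^sup>2 \<le> (\<Sum>j\<in>Basis. (weak_partial2 i j F x)\<^sup>2)"
    using ij by (intro member_le_sum) auto
  also have "\<dots> \<le> (\<Sum>i\<in>Basis. \<Sum>j\<in>Basis. (weak_partial2 i j F x)\<^sup>2)"
    using ij by (intro member_le_sum[of i Basis "\<lambda>i. \<Sum>j\<in>Basis. (weak_partial2 i j F x)\<^sup>2"]) (auto intro: sum_nonneg)
  finally have "sqrt ((weak_partial2 i j F x)\<^sup>2) \<le> hess_norm F x" unfolding hess_norm_def by (rule real_sqrt_le_mono)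
  then show ?thesis by simp
qed

lemma hess_norm_nonneg [simp]: "0 \<le> hess_norm F x"
  by (simp add: hess_norm_def sum_nonneg)

lemma hess_norm_le: "hess_norm F x \<le> (\<Sum>i\<in>Basis. \<Sum>j\<in>Basis. \<bar>weak_partial2 i j F x\<bar>)"
proof -
  have sq: "(\<Sum>b\<in>A. (a b)\<^sup>2) \<le> (\<Sum>b\<in>A. \<bar>a b\<bar>)\<^sup>2" if "finite A" for A and a :: "plane \<times> plane \<Rightarrow> real"
    using that
  proof (induction A)
    case (insert b A)
    have "0 \<le> (\<Sum>b\<in>A. \<bar>a b\<bar>)" by (simp add: sum_nonneg)
    then have "0 \<le> 2 * \<bar>a b\<bar> * (\<Sum>b\<in>A. \<bar>a b\<bar>)" by simp
    then show ?case using insert.IH unfolding sum.insert[OF insert.hyps] power2_sum power2_abs by linarith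
  qed simp
  have "(\<Sum>i\<in>Basis. \<Sum>j\<in>Basis. (weak_partial2 i j F x)\<^sup>2) \<le> (\<Sum>i\<in>Basis. \<Sum>j\<in>Basis. \<bar>weak_partial2 i j F x\<bar>)\<^sup>2"
    using sq[of "Basis \<times> Basis" "\<lambda>(i, j). weak_partial2 i j F x"] by (simp add: sum.cartesian_product case_prod_unfold)
  then have "hess_norm F x \<le> sqrt ((\<Sum>i\<in>Basis. \<Sum>j\<in>Basis. \<bar>weak_partial2 i j F x\<bar>)\<^sup>2)"
    unfolding hess_norm_def by (rule real_sqrt_le_mono)
  also have "\<dots> = (\<Sum>i\<in>Basis. \<Sum>j\<in>Basis. \<bar>weak_partial2 i j F x\<bar>)" by (simp add: sum_nonneg)
  finally show ?thesis .
qed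

text \<open>The choice behind \<open>weak_partial2\<close> guarantees a weak derivative but not its
  integrability; the latter is inherited, by uniqueness, from a representative in L^p.\<close>

lemma weak_partial2_L2p:
  assumes "F \<in> L2p p" "i \<in> Basis" "j \<in> Basis"
  shows "is_weak_partial2 i j F (weak_partial2 i j F)" "in_Lp p (weak_partial2 i j F)"
proof -
  obtain g where g: "is_weak_partial2 i j F g" "in_Lp p g" using assms unfolding L2p_def by blast
  show w: "is_weak_partial2 i j F (weak_partial2 i j F)" unfolding weak_partial2_def by (rule someI[of _ g]) (rule g)
  have [measurable]: "weak_partial2 i j F \<in> borel_measurable borel" "g \<in> borel_measurable borel"
    using w g by (auto simp: is_weak_partial2_def locally_integrable_def)
  have "AE x in lborel. \<bar>g x\<bar> powr p = \<bar>weak_partial2 i j F x\<bar> powr p"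
    using weak_partial_unique[OF g(1) w] by eventually_elim simp
  then have "integrable lborel (\<lambda>x. \<bar>weak_partial2 i j F x\<bar> powr p)"
    using g(2) integrable_cong_AE[of "\<lambda>x. \<bar>g x\<bar> powr p" lborel "\<lambda>x. \<bar>weak_partial2 i j F x\<bar> powr p"]
    by (simp add: in_Lp_def)
  then show "in_Lp p (weak_partial2 i j F)" by (simp add: in_Lp_def)
qed

lemma hess_norm_integrable:
  assumes F: "F \<in> L2p p" and p: "1 < p"
  shows "hess_norm F \<in> borel_measurable borel" "integrable lborel (\<lambda>x. hess_norm F x powr p)"
proof -
  have wm: "weak_partial2 i j F \<in> borel_measurable borel" "integrable lborel (\<lambda>x. \<bar>weak_partial2 i j F x\<bar> powr p)" if "i \<in> Basis" "j \<in> Basis" for i j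
    using weak_partial2_L2p(2)[OF F that] by (auto simp: in_Lp_def)
  show m[measurable]: "hess_norm F \<in> borel_measurable borel"
    unfolding hess_norm_def[abs_def]
    by (intro measurable_compose[OF _ borel_measurable_sqrt] borel_measurable_sum borel_measurable_power wm)
  show "integrable lborel (\<lambda>x. hess_norm F x powr p)"
  proof (rule Bochner_Integration.integrable_bound)
    show "integrable lborel (\<lambda>x. 4 powr (p - 1) * (\<Sum>i\<in>Basis. \<Sum>j\<in>Basis. \<bar>weak_partial2 i j F x\<bar> powr p))"
      by (intro Bochner_Integration.integrable_mult_right Bochner_Integration.integrable_sum wm)
    show "AE x in lborel. norm (hess_norm F x powr p) \<le> norm (4 powr (p - 1) * (\<Sum>i\<in>Basis. \<Sum>j\<in>Basis. \<bar>weak_partial2 i j F x\<bar> powr p))"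
    proof (intro AE_I2)
      fix x
      have "hess_norm F x powr p \<le> \<bar>\<Sum>b\<in>Basis \<times> Basis. \<bar>weak_partial2 (fst b) (snd b) F x\<bar>\<bar> powr p"
        using hess_norm_le[of F x] p by (intro powr_mono2) (auto simp: sum.cartesian_product case_prod_unfold sum_nonneg)
      also have "\<dots> \<le> real (card ((Basis :: plane set) \<times> (Basis :: plane set))) powr (p - 1) * (\<Sum>b\<in>Basis \<times> Basis. \<bar>\<bar>weak_partial2 (fst b) (snd b) F x\<bar>\<bar> powr p)"
        using p by (intro powr_sum_le) auto
      also have "real (card ((Basis :: plane set) \<times> (Basis :: plane set))) = 4" by (simp add: card_cartesian_product)
      finally show "norm (hess_norm F x powr p) \<le> norm (4 powr (p - 1) * (\<Sum>i\<in>Basis. \<Sum>j\<in>Basis. \<bar>weak_partial2 i j F x\<bar> powr p))"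
        by (simp add: sum.cartesian_product case_prod_unfold sum_nonneg)
    qed
  qed simp
qed

text \<open>Bounded overlap: each coordinate lies in at most 5 of the intervals of length 4 h placed
  at spacing h.\<close>

lemma sum_indicator_sq_le:
  assumes h: "0 < h"
  shows "(\<Sum>m\<in>lbox M. indicator (sq (h * real_of_int (fst m), h * real_of_int (snd m)) h) x) \<le> (25 :: real)"
proof -
  define J where "J t = {\<lceil>t / h - 3\<rceil>..\<lfloor>t / h + 1\<rfloor>}" for t
  have cJ: "card (J t) \<le> 5" for t unfolding J_def by (simp; linarith)
  have in_J: "n \<in> J t" if "h * real_of_int n - h \<le> t" "t \<le> h * real_of_int n + 3 * h" for n t
  proof -
    have "real_of_int n - 1 \<le> t / h" "t / h \<le> real_of_int n + 3" using that h by (auto simp: field_simps)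
    then show ?thesis unfolding J_def atLeastAtMost_iff ceiling_le_iff le_floor_iff by simp
  qed
  have "(\<Sum>m\<in>lbox M. indicator (sq (h * real_of_int (fst m), h * real_of_int (snd m)) h) x) \<le> (\<Sum>m\<in>lbox M \<inter> J (fst x) \<times> J (snd x). (1::real))"
  proof -
    have "(\<Sum>m\<in>lbox M. indicator (sq (h * real_of_int (fst m), h * real_of_int (snd m)) h) x) \<le> (\<Sum>m\<in>lbox M. indicator (J (fst x) \<times> J (snd x)) m :: real)"
    proof (intro sum_mono)
      fix m
      have "m \<in> J (fst x) \<times> J (snd x)" if "x \<in> sq (h * real_of_int (fst m), h * real_of_int (snd m)) h"
        using that in_J by (cases m, cases x) (auto simp: sq_def Basis_plane)
      then show "indicator (sq (h * real_of_int (fst m), h * real_of_int (snd m)) h) x \<le> (indicator (J (fst x) \<times> J (snd x)) m :: real)"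
        by (auto simp: indicator_def)
    qed
    also have "\<dots> = (\<Sum>m\<in>lbox M \<inter> J (fst x) \<times> J (snd x). 1)" by (simp add: indicator_def sum.inter_restrict)
    finally show ?thesis .
  qed
  also have "\<dots> = real (card (lbox M \<inter> J (fst x) \<times> J (snd x)))" by simp
  also have "\<dots> \<le> real (card (J (fst x) \<times> J (snd x)))" by (intro of_nat_mono card_mono) (auto simp: J_def)
  also have "\<dots> = real (card (J (fst x)) * card (J (snd x)))" by (simp only: card_cartesian_product)
  also have "\<dots> \<le> real (5 * 5)" using cJ by (intro of_nat_mono mult_mono) auto
  finally show ?thesis by simp
qed

text \<open>Second differences are bounded by L^1 norms of the Hessian on squares of side 4 h, and
  Hoelder on such a square yields the factor (h^2) powr (p - 1). The constant is 25 for the overlap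
  times 768 = 3 * 4 * 4 * 16.\<close>

theorem energy_sample_le:
  assumes G: "G \<in> L2p p" and p: "1 < p" "p < 2" and h: "0 < h"
  shows "energy p M (\<lambda>x y. G (h * real_of_int x, h * real_of_int y)) \<le> 19200 * h powr (2 * p - 2) * (\<integral>x. hess_norm G x powr p \<partial>lborel)"
proof -
  define W where "W = hess_norm G"
  have W[measurable]: "W \<in> borel_measurable borel" "integrable lborel (\<lambda>x. W x powr p)" and W0: "0 \<le> W x" for x
    using hess_norm_integrable[OF G p(1)] by (simp_all add: W_def)
  define H where "H = (\<lambda>x y. G (h * real_of_int x, h * real_of_int y))"
  define Q where "Q m = sq (h * real_of_int (fst m), h * real_of_int (snd m)) h" for m :: "int \<times> int"
  have Qs[measurable]: "Q m \<in> sets borel" for m unfolding Q_def sq_cbox by simp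
  have Wp: "integrable lborel (\<lambda>x. indicator (Q m) x * W x powr p)" for m
    by (rule Bochner_Integration.integrable_bound[OF W(2)]) (auto simp: indicator_def)
  have mQ: "measure lborel (Q m) = 16 * h\<^sup>2" "emeasure lborel (Q m) < \<infinity>" for m
    unfolding Q_def using measure_sq[of h] h by (auto simp: sq_cbox emeasure_lborel_cbox_eq)
  have W1: "integrable lborel (\<lambda>x. indicator (Q m) x * W x)" for m
  proof (rule Bochner_Integration.integrable_bound)
    show "integrable lborel (\<lambda>x. indicator (Q m) x + indicator (Q m) x * W x powr p)"
      using Wp[of m] mQ[of m] by (intro Bochner_Integration.integrable_add) auto
    show "AE x in lborel. norm (indicator (Q m) x * W x) \<le> norm (indicator (Q m) x + indicator (Q m) x * W x powr p)"
    proof (intro AE_I2)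
      fix x
      have "W x \<le> 1 + W x powr p"
        using powr_mono[of 1 p "W x"] W0[of x] p by (cases "W x \<le> 1") (auto simp: add_increasing2)
      then show "norm (indicator (Q m) x * W x) \<le> norm (indicator (Q m) x + indicator (Q m) x * W x powr p)"
        using W0[of x] by (auto simp: indicator_def)
    qed
  qed simp
  have Gc: "continuous_on UNIV G" using G by (simp add: L2p_def)
  have weak: "is_weak_partial2 i j G (weak_partial2 i j G)" if "i \<in> Basis" "j \<in> Basis" for i j
    using weak_partial2_L2p(1)[OF G that] .
  have gW: "(\<integral>x. indicator (Q m) x * \<bar>weak_partial2 i j G x\<bar> \<partial>lborel) \<le> (\<integral>x. indicator (Q m) x * W x \<partial>lborel)" if "i \<in> Basis" "j \<in> Basis" for i j m
    by (rule integral_mono'[OF W1]) (use hess_norm_ge[OF that] W0 in \<open>auto simp: indicator_def W_def\<close>)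
  define B where "B m = 2 * (\<integral>x. indicator (Q m) x * W x \<partial>lborel)" for m
  have nn: "0 \<le> (\<integral>x. indicator (Q m) x * W x \<partial>lborel)" for m by (intro integral_nonneg_AE AE_I2) (use W0 in auto)
  let ?e = "(1, 0) :: plane" and ?f = "(0, 1) :: plane"
  have ef: "?e \<in> Basis" "?f \<in> Basis" "?e \<noteq> ?f" "?f \<noteq> ?e" by (auto simp: Basis_plane)
  have d: "\<bar>dx (dx H) x y\<bar> \<le> B (x, y)" "\<bar>dx (dy H) x y\<bar> \<le> B (x, y)" "\<bar>dy (dy H) x y\<bar> \<le> B (x, y)" for x y
  proof -
    define q where "q = (h * real_of_int x, h * real_of_int y)"
    have Q: "Q (x, y) = sq q h" by (simp add: Q_def q_def)
    have v: "H (x + 1) y = G (q + h *\<^sub>R ?e)" "H (x + 1 + 1) y = G (q + (2 * h) *\<^sub>R ?e)" "H x (y + 1) = G (q + h *\<^sub>R ?f)"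
       "H x (y + 1 + 1) = G (q + (2 * h) *\<^sub>R ?f)" "H (x + 1) (y + 1) = G (q + h *\<^sub>R ?e + h *\<^sub>R ?f)" "H x y = G q"
      by (simp_all add: H_def q_def algebra_simps)
    have "dx (dx H) x y = G (q + (2 * h) *\<^sub>R ?e) - 2 * G (q + h *\<^sub>R ?e) + G q" by (simp only: dx_def v)
    then show "\<bar>dx (dx H) x y\<bar> \<le> B (x, y)"
      using second_difference_le(1)[OF ef(1,2,3) Gc h weak[OF ef(1,1)] weak[OF ef(1,2)], of q] gW[OF ef(1,1), of "(x, y)"] gW[OF ef(1,2), of "(x, y)"]
      unfolding B_def Q by linarith
    have "dy (dy H) x y = G (q + (2 * h) *\<^sub>R ?f) - 2 * G (q + h *\<^sub>R ?f) + G q" by (simp only: dy_def v)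
    then show "\<bar>dy (dy H) x y\<bar> \<le> B (x, y)"
      using second_difference_le(1)[OF ef(2,1,4) Gc h weak[OF ef(2,2)] weak[OF ef(2,1)], of q] gW[OF ef(2,2), of "(x, y)"] gW[OF ef(2,1), of "(x, y)"]
      unfolding B_def Q by linarith
    have "dx (dy H) x y = G (q + h *\<^sub>R ?e + h *\<^sub>R ?f) - G (q + h *\<^sub>R ?e) - G (q + h *\<^sub>R ?f) + G q" by (simp only: dx_def dy_def v)
    then show "\<bar>dx (dy H) x y\<bar> \<le> B (x, y)"
      using second_difference_le(2)[OF ef(1,2,3) Gc h weak[OF ef(1,1)] weak[OF ef(1,2)], of q] gW[OF ef(1,2), of "(x, y)"] nn[of "(x, y)"]
      unfolding B_def Q by linarith
  qed
  have pt: "hess p H m \<le> 768 * h powr (2 * p - 2) * (\<integral>x. indicator (Q m) x * W x powr p \<partial>lborel)" for m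
  proof -
    obtain x y where m: "m = (x, y)" by (cases m)
    have "hess p H m \<le> B m powr p + B m powr p + B m powr p"
      unfolding hess_def m fst_conv snd_conv using d p by (intro add_mono powr_mono2) auto
    also have "\<dots> = 3 * (2 powr p * (\<integral>x. indicator (Q m) x * W x \<partial>lborel) powr p)"
      using nn[of m] by (simp add: B_def powr_mult)
    also have "\<dots> \<le> 3 * (4 * (4 * (16 * h powr (2 * p - 2)) * (\<integral>x. indicator (Q m) x * W x powr p \<partial>lborel)))"
    proof (intro mult_left_mono mult_mono)
      have "(\<integral>x. indicator (Q m) x * W x \<partial>lborel) powr p \<le> 2 powr p * (16 * h\<^sup>2) powr (p - 1) * (\<integral>x. indicator (Q m) x * W x powr p \<partial>lborel)"
        using L1_le_Lp_powr[OF p(1) mQ(1) _ mQ(2) Qs, of m W] W1[of m] Wp[of m] W0 h by simp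
      also have "\<dots> \<le> 4 * (16 * h powr (2 * p - 2)) * (\<integral>x. indicator (Q m) x * W x powr p \<partial>lborel)"
      proof (intro mult_right_mono mult_mono)
        have "(16 * h\<^sup>2) powr (p - 1) = 16 powr (p - 1) * (h\<^sup>2) powr (p - 1)" using h by (simp add: powr_mult)
        also have "(h\<^sup>2) powr (p - 1) = h powr (2 * p - 2)"
          using h by (simp add: power2_eq_square powr_mult powr_add[symmetric])
        also have "16 powr (p - 1) * h powr (2 * p - 2) \<le> 16 powr 1 * h powr (2 * p - 2)"
          using p by (intro mult_right_mono powr_mono) auto
        finally show "(16 * h\<^sup>2) powr (p - 1) \<le> 16 * h powr (2 * p - 2)" by simp
      qed (use p powr_two_le_4[of p] W0 in \<open>auto intro!: integral_nonneg_AE\<close>)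
      finally show "(\<integral>x. indicator (Q m) x * W x \<partial>lborel) powr p \<le> 4 * (16 * h powr (2 * p - 2)) * (\<integral>x. indicator (Q m) x * W x powr p \<partial>lborel)" .
    qed (use p powr_two_le_4[of p] in auto)
    finally show ?thesis by simp
  qed
  have "energy p M H \<le> (\<Sum>m\<in>lbox M. 768 * h powr (2 * p - 2) * (\<integral>x. indicator (Q m) x * W x powr p \<partial>lborel))"
    unfolding energy_def by (intro sum_mono pt)
  also have "\<dots> = 768 * h powr (2 * p - 2) * (\<integral>x. (\<Sum>m\<in>lbox M. indicator (Q m) x * W x powr p) \<partial>lborel)"
    by (subst Bochner_Integration.integral_sum) (rule Wp, rule sum_distrib_left[symmetric])
  also have "\<dots> \<le> 768 * h powr (2 * p - 2) * (\<integral>x. 25 * W x powr p \<partial>lborel)"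
  proof (intro mult_left_mono integral_mono)
    show "(\<Sum>m\<in>lbox M. indicator (Q m) x * W x powr p) \<le> 25 * W x powr p" for x
      unfolding sum_distrib_right[symmetric] Q_def using sum_indicator_sq_le[OF h] by (intro mult_right_mono) auto
    show "integrable lborel (\<lambda>x. \<Sum>m\<in>lbox M. indicator (Q m) x * W x powr p)"
      by (intro Bochner_Integration.integrable_sum Wp)
  qed (use W in auto)
  finally show ?thesis by (simp add: H_def W_def)
qed

subsection \<open>Classical derivatives are weak derivatives\<close>

text \<open>Differentiability along one direction only: together with continuity it is what
  integration by parts on lines and Fubini use.\<close>

definition deriv_along :: "plane \<Rightarrow> (plane \<Rightarrow> real) \<Rightarrow> (plane \<Rightarrow> real) \<Rightarrow> bool" where
  "deriv_along i F F' \<longleftrightarrow> (\<forall>q. ((\<lambda>t. F (q + t *\<^sub>R i)) has_real_derivative F' q) (at 0))"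

lemma deriv_along_at:
  assumes "deriv_along i F F'"
  shows "((\<lambda>t. F (q + t *\<^sub>R i)) has_real_derivative F' (q + s *\<^sub>R i)) (at s)"
proof -
  have "((\<lambda>t. F ((q + s *\<^sub>R i) + t *\<^sub>R i)) has_real_derivative F' (q + s *\<^sub>R i)) (at 0)"
    using assms unfolding deriv_along_def by blast
  then have "((\<lambda>t. F ((q + s *\<^sub>R i) + (t - s) *\<^sub>R i)) has_real_derivative F' (q + s *\<^sub>R i)) (at s)"
    using DERIV_shift[of "\<lambda>t. F ((q + s *\<^sub>R i) + (t - s) *\<^sub>R i)" "F' (q + s *\<^sub>R i)" 0 s] by (simp add: algebra_simps)
  then show ?thesis by (simp add: algebra_simps)
qed

lemma smooth_partial: "smooth f \<Longrightarrow> i \<in> Basis \<Longrightarrow> smooth (partial i f)"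
  unfolding smooth_def
proof (intro allI impI)
  fix bs :: "plane list" and x
  assume f: "\<forall>bs. set bs \<subseteq> Basis \<longrightarrow> (\<forall>x. foldr partial bs f differentiable at x)" and i: "i \<in> Basis" "set bs \<subseteq> Basis"
  then show "foldr partial bs (partial i f) differentiable at x"
    using f[rule_format, of "bs @ [i]"] by simp
qed

lemma smooth_differentiable: "smooth f \<Longrightarrow> f differentiable at x"
  unfolding smooth_def by (metis empty_set empty_subsetI foldr_Nil id_apply)

lemma smooth_continuous: "smooth f \<Longrightarrow> continuous_on UNIV f"
  using smooth_differentiable by (simp add: continuous_at_imp_continuous_on differentiable_imp_continuous_within)

lemma smooth_deriv_along:
  assumes "smooth f"
  shows "deriv_along i f (partial i f)"
  unfolding deriv_along_def
proof
  fix q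
  have d: "(f has_derivative frechet_derivative f (at q)) (at q)"
    using smooth_differentiable[OF assms] frechet_derivative_works by blast
  have "((\<lambda>t. q + t *\<^sub>R i) has_derivative (\<lambda>t. t *\<^sub>R i)) (at 0)" by (auto intro!: derivative_eq_intros)
  then have "((\<lambda>t. f (q + t *\<^sub>R i)) has_derivative (\<lambda>t. frechet_derivative f (at q) (t *\<^sub>R i))) (at 0)"
    using has_derivative_compose[of "\<lambda>t. q + t *\<^sub>R i" "\<lambda>t. t *\<^sub>R i" 0 UNIV f] d by simp
  moreover have "frechet_derivative f (at q) (t *\<^sub>R i) = t * partial i f q" for t
    using linear_scale[OF has_derivative_linear[OF d]] by (simp add: partial_def)
  ultimately show "((\<lambda>t. f (q + t *\<^sub>R i)) has_real_derivative partial i f q) (at 0)"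
    by (simp add: has_field_derivative_def mult_commute_abs)
qed

definition bounded_support :: "real \<Rightarrow> (plane \<Rightarrow> real) \<Rightarrow> bool" where
  "bounded_support R f \<longleftrightarrow> (\<forall>q. (\<exists>b\<in>Basis. R \<le> \<bar>q \<bullet> b\<bar>) \<longrightarrow> f q = 0)"

text \<open>A derivative vanishes where the function does in a whole neighbourhood; the strict gap
  between R and R' provides the neighbourhood.\<close>

lemma partial_bounded_support:
  assumes "bounded_support R f" "R < R'"
  shows "bounded_support R' (partial i f)"
  unfolding bounded_support_def
proof (intro allI impI)
  fix q :: plane assume "\<exists>b\<in>Basis. R' \<le> \<bar>q \<bullet> b\<bar>"
  then obtain b where b: "b \<in> Basis" "R < \<bar>q \<bullet> b\<bar>" using assms(2) by auto
  have "open {q :: plane. R < \<bar>q \<bullet> b\<bar>}" by (intro open_Collect_less continuous_intros)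
  moreover have "f x = 0" if "x \<in> {q :: plane. R < \<bar>q \<bullet> b\<bar>}" for x
  proof -
    have "\<exists>b\<in>Basis. R \<le> \<bar>x \<bullet> b\<bar>" using that b(1) by (intro bexI[of _ b]) auto
    then show ?thesis using assms(1) unfolding bounded_support_def by blast
  qed
  ultimately have "(f has_derivative (\<lambda>h. 0)) (at q)"
    using has_derivative_transform_within_open[of "\<lambda>_. 0" "\<lambda>_. 0" q UNIV "{q. R < \<bar>q \<bullet> b\<bar>}" f] b by simp
  then have "frechet_derivative f (at q) = (\<lambda>h. 0)" by (metis frechet_derivative_at)
  then show "partial i f q = 0" by (simp add: partial_def)
qed

lemma test_function_bounded_support:
  assumes "\<phi> \<in> test_functions"
  obtains R where "0 < R" "bounded_support R \<phi>"
proof -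
  have "bounded (closure {x. \<phi> x \<noteq> 0})" using assms by (simp add: test_functions_def compact_imp_bounded)
  then obtain R where R: "\<And>x. x \<in> closure {x. \<phi> x \<noteq> 0} \<Longrightarrow> norm x \<le> R" unfolding bounded_iff by blast
  have "bounded_support (\<bar>R\<bar> + 1) \<phi>" unfolding bounded_support_def
  proof (intro allI impI)
    fix q :: plane assume "\<exists>b\<in>Basis. \<bar>R\<bar> + 1 \<le> \<bar>q \<bullet> b\<bar>"
    then obtain b where b: "b \<in> Basis" "\<bar>R\<bar> + 1 \<le> \<bar>q \<bullet> b\<bar>" by blast
    then have "\<bar>R\<bar> + 1 \<le> norm q" using Basis_le_norm[OF b(1), of q] by linarith
    then have "q \<notin> closure {x. \<phi> x \<noteq> 0}" using R[of q] by auto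
    then show "\<phi> q = 0" using closure_subset[of "{x. \<phi> x \<noteq> 0}"] by auto
  qed
  then show ?thesis using that[of "\<bar>R\<bar> + 1"] by simp
qed

lemma compact_sym_box: "compact {q :: plane. \<forall>b\<in>Basis. \<bar>q \<bullet> b\<bar> \<le> R}"
proof -
  have "{q :: plane. \<forall>b\<in>Basis. \<bar>q \<bullet> b\<bar> \<le> R} = cbox (- (R *\<^sub>R One)) (R *\<^sub>R One)"
    unfolding cbox_def by (intro Collect_cong ball_cong refl) (auto simp: abs_le_iff)
  then show ?thesis by simp
qed

lemma integrable_bounded_support:
  assumes "continuous_on UNIV f" "bounded_support R f"
  shows "integrable lborel f"
proof (rule integrable_continuous_compact_support[OF assms(1) compact_sym_box[of R]])
  fix q :: plane assume "q \<notin> {q. \<forall>b\<in>Basis. \<bar>q \<bullet> b\<bar> \<le> R}"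
  then have "\<exists>b\<in>Basis. R \<le> \<bar>q \<bullet> b\<bar>" by force
  then show "f q = 0" using assms(2) unfolding bounded_support_def by blast
qed

lemma integral_deriv_line_zero:
  fixes w w' :: "real \<Rightarrow> real"
  assumes R: "0 < R" and d: "\<And>x. (w has_real_derivative w' x) (at x)" and c: "continuous_on UNIV w'"
    and z: "\<And>x. R \<le> \<bar>x\<bar> \<Longrightarrow> w x = 0" "\<And>x. R \<le> \<bar>x\<bar> \<Longrightarrow> w' x = 0"
  shows "(\<integral>x. w' x \<partial>lborel) = 0"
proof -
  have "(\<integral>x. indicator {-R..R} x *\<^sub>R w' x \<partial>lborel) = w R - w (-R)"
    using R has_field_derivative_at_within[OF d]
    by (intro integral_FTC_Icc continuous_on_subset[OF c]) (auto simp: has_real_derivative_iff_has_vector_derivative)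
  moreover have "(\<lambda>x. indicator {-R..R} x *\<^sub>R w' x) = w'"
  proof
    show "indicator {-R..R} x *\<^sub>R w' x = w' x" for x
      using z(2)[of x] by (cases "x \<in> {-R..R}") auto
  qed
  ultimately have "(\<integral>x. w' x \<partial>lborel) = w R - w (-R)" by simp
  then show ?thesis using z(1)[of R] z(1)[of "-R"] R by simp
qed

lemma integral_deriv_along_zero:
  assumes i: "i \<in> Basis" and R: "0 < R" and d: "deriv_along i w w'" and c: "continuous_on UNIV w'"
    and s: "bounded_support R w" "bounded_support R w'"
  shows "(\<integral>q. w' q \<partial>lborel) = 0"
proof -
  have int: "integrable (lborel \<Otimes>\<^sub>M lborel) w'" using integrable_bounded_support[OF c s(2)] by (simp add: lborel_prod)
  have z: "f (x, y) = 0" if "bounded_support R f" "R \<le> \<bar>x\<bar> \<or> R \<le> \<bar>y\<bar>" for f x y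
    using that unfolding bounded_support_def by (auto simp: Basis_plane)
  have cl: "continuous_on UNIV (\<lambda>x. w' (x, y))" "continuous_on UNIV (\<lambda>y. w' (x, y))" for x y
    by (intro continuous_on_compose2[OF c] continuous_intros; simp)+
  consider "i = (1, 0)" | "i = (0, 1)" using i by (auto simp: Basis_plane)
  then show ?thesis
  proof cases
    case 1
    have "(\<integral>x. w' (x, y) \<partial>lborel) = 0" for y
    proof (rule integral_deriv_line_zero[OF R _ cl(1)])
      show "((\<lambda>x. w (x, y)) has_real_derivative w' (x, y)) (at x)" for x
        using deriv_along_at[OF d, of "(0, y)" x] 1 by simp
    qed (use z s in auto)
    then have "(\<integral>y. \<integral>x. w' (x, y) \<partial>lborel \<partial>lborel) = 0" by simp
    then show ?thesis using lborel_pair.integral_snd[of "\<lambda>x y. w' (x, y)"] int by (simp add: lborel_prod)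
  next
    case 2
    have "(\<integral>y. w' (x, y) \<partial>lborel) = 0" for x
    proof (rule integral_deriv_line_zero[OF R _ cl(2)])
      show "((\<lambda>y. w (x, y)) has_real_derivative w' (x, y)) (at y)" for y
        using deriv_along_at[OF d, of "(x, 0)" y] 2 by simp
    qed (use z s in auto)
    then have "(\<integral>x. \<integral>y. w' (x, y) \<partial>lborel \<partial>lborel) = 0" by simp
    then show ?thesis using lborel_pair.integral_fst'[OF int] by (simp add: lborel_prod)
  qed
qed

lemma integration_by_parts:
  assumes i: "i \<in> Basis" and R: "0 < R" and u: "deriv_along i u u'" "continuous_on UNIV u" "continuous_on UNIV u'"
    and v: "deriv_along i v v'" "continuous_on UNIV v" "continuous_on UNIV v'" and s: "bounded_support R v" "bounded_support R v'"
  shows "(\<integral>q. u q * v' q \<partial>lborel) = - (\<integral>q. u' q * v q \<partial>lborel)"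
proof -
  have s1: "bounded_support R (\<lambda>q. u q * v' q)" "bounded_support R (\<lambda>q. u' q * v q)" "bounded_support R (\<lambda>q. u q * v q)"
    using s by (simp_all add: bounded_support_def)
  have s2: "bounded_support R (\<lambda>q. u' q * v q + u q * v' q)" using s by (simp add: bounded_support_def)
  have i1: "integrable lborel (\<lambda>q. u q * v' q)" by (intro integrable_bounded_support[OF _ s1(1)] continuous_intros u v)
  have i2: "integrable lborel (\<lambda>q. u' q * v q)" by (intro integrable_bounded_support[OF _ s1(2)] continuous_intros u v)
  have "deriv_along i (\<lambda>q. u q * v q) (\<lambda>q. u' q * v q + u q * v' q)"
    unfolding deriv_along_def
  proof
    fix q
    have "((\<lambda>t. u (q + t *\<^sub>R i)) has_real_derivative u' q) (at 0)" "((\<lambda>t. v (q + t *\<^sub>R i)) has_real_derivative v' q) (at 0)"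
      using u(1) v(1) unfolding deriv_along_def by blast+
    from DERIV_mult[OF this] show "((\<lambda>t. u (q + t *\<^sub>R i) * v (q + t *\<^sub>R i)) has_real_derivative u' q * v q + u q * v' q) (at 0)"
      by (simp add: algebra_simps)
  qed
  then have "(\<integral>q. u' q * v q + u q * v' q \<partial>lborel) = 0"
    by (intro integral_deriv_along_zero[OF i R _ _ s1(3) s2] continuous_intros u v) 
  then show ?thesis using i1 i2 by simp
qed

lemma weak_partial2_classical:
  assumes ij: "i \<in> Basis" "j \<in> Basis" and F: "continuous_on UNIV F" "continuous_on UNIV F1" "continuous_on UNIV F2"
    and d: "deriv_along i F F1" "deriv_along j F1 F2"
  shows "is_weak_partial2 i j F F2"
  unfolding is_weak_partial2_def
proof
  show "locally_integrable F2" unfolding locally_integrable_def set_integrable_def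
  proof (intro conjI allI impI)
    show "F2 \<in> borel_measurable lborel" using borel_measurable_continuous_onI[OF F(3)] by simp
    show "integrable lborel (\<lambda>x. indicat_real K x *\<^sub>R F2 x)" if "compact K" for K
      by (rule borel_integrable_compact[OF that continuous_on_subset[OF F(3)]]) simp
  qed
  show "\<forall>\<phi>\<in>test_functions. (\<integral>x. F x * partial i (partial j \<phi>) x \<partial>lborel) = (\<integral>x. F2 x * \<phi> x \<partial>lborel)"
  proof
    fix \<phi> assume t: "\<phi> \<in> test_functions"
    obtain R where R: "0 < R" "bounded_support R \<phi>" using test_function_bounded_support[OF t] .
    have sm: "smooth \<phi>" "smooth (partial j \<phi>)" "smooth (partial i (partial j \<phi>))"
      using t ij by (auto simp: test_functions_def intro: smooth_partial)
    have s1: "bounded_support (R + 1) (partial j \<phi>)" by (rule partial_bounded_support[OF R(2)]) simp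
    have s2: "bounded_support (R + 2) (partial i (partial j \<phi>))" by (rule partial_bounded_support[OF s1]) simp
    have s0': "bounded_support (R + 2) \<phi>" "bounded_support (R + 2) (partial j \<phi>)"
      using R(2) s1 unfolding bounded_support_def by force+
    have "(\<integral>x. F x * partial i (partial j \<phi>) x \<partial>lborel) = - (\<integral>x. F1 x * partial j \<phi> x \<partial>lborel)"
      by (rule integration_by_parts[OF ij(1) _ d(1) F(1,2) smooth_deriv_along smooth_continuous smooth_continuous s0'(2) s2]) (use R sm in auto)
    also have "(\<integral>x. F1 x * partial j \<phi> x \<partial>lborel) = - (\<integral>x. F2 x * \<phi> x \<partial>lborel)"
      by (rule integration_by_parts[OF ij(2) _ d(2) F(2,3) smooth_deriv_along smooth_continuous smooth_continuous s0']) (use R sm in auto)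
    finally show "(\<integral>x. F x * partial i (partial j \<phi>) x \<partial>lborel) = (\<integral>x. F2 x * \<phi> x \<partial>lborel)" by simp
  qed
qed

subsection \<open>Smooth interpolation of lattice functions\<close>

text \<open>Radius 3 is a common bound for \<open>ker0\<close>, which lives on [-2, 2], and for the
  shifted kernels that its derivatives lead to.\<close>

definition local_kernel :: "real \<Rightarrow> (real \<Rightarrow> real) \<Rightarrow> bool" where
  "local_kernel \<kappa> a \<longleftrightarrow> continuous_on UNIV a \<and> (\<forall>x. \<bar>a x\<bar> \<le> \<kappa>) \<and> (\<forall>x. 3 < \<bar>x\<bar> \<longrightarrow> a x = 0)"

lemma ex_local_kernel:
  assumes "continuous_on UNIV a" "\<And>x. 3 < \<bar>x\<bar> \<Longrightarrow> a x = 0"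
  shows "\<exists>\<kappa>\<ge>1. local_kernel \<kappa> a"
proof -
  have "compact (a ` {-3..3})" by (intro compact_continuous_image continuous_on_subset[OF assms(1)]) auto
  then have "bounded (a ` {-3..3})" by (rule compact_imp_bounded)
  then obtain C where C: "\<And>x. x \<in> {-3..3} \<Longrightarrow> \<bar>a x\<bar> \<le> C" unfolding bounded_iff by (metis imageI real_norm_def)
  have "\<bar>a x\<bar> \<le> max C 1" for x
  proof (cases "3 < \<bar>x\<bar>")
    case False
    then have "\<bar>a x\<bar> \<le> C" by (intro C) auto
    then show ?thesis by simp
  qed (simp add: assms(2))
  then show ?thesis using assms by (intro exI[of _ "max C 1"]) (auto simp: local_kernel_def)
qed

lemma local_kernel_mono: "local_kernel \<kappa> a \<Longrightarrow> \<kappa> \<le> \<kappa>' \<Longrightarrow> local_kernel \<kappa>' a"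
  unfolding local_kernel_def by (meson order_trans)

definition kern_sum :: "int \<Rightarrow> real \<Rightarrow> lattice_fun \<Rightarrow> (real \<Rightarrow> real) \<Rightarrow> (real \<Rightarrow> real) \<Rightarrow> plane \<Rightarrow> real" where
  "kern_sum M h H a b q = (\<Sum>m\<in>lbox M. H (fst m) (snd m) * (a (fst q / h - real_of_int (fst m)) * b (snd q / h - real_of_int (snd m))))"

lemma continuous_kern_sum:
  assumes a: "continuous_on UNIV a" and b: "continuous_on UNIV b"
  shows "continuous_on UNIV (kern_sum M h H a b)"
proof -
  have "continuous_on UNIV (\<lambda>q :: plane. fst q / h - c)" "continuous_on UNIV (\<lambda>q :: plane. snd q / h - c)" for c
    unfolding divide_inverse by (intro continuous_intros)+
  then have "continuous_on UNIV (\<lambda>q :: plane. a (fst q / h - c))" "continuous_on UNIV (\<lambda>q :: plane. b (snd q / h - c))" for c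
    using continuous_on_compose2[OF a, of UNIV "\<lambda>q :: plane. fst q / h - c"] continuous_on_compose2[OF b, of UNIV "\<lambda>q :: plane. snd q / h - c"] by simp_all
  then show ?thesis unfolding kern_sum_def[abs_def] by (intro continuous_intros)
qed

lemma deriv_along_kern_sum_fst:
  assumes a: "\<And>x. (a has_real_derivative a' x) (at x)"
  shows "deriv_along (1, 0) (kern_sum M h H a b) (\<lambda>q. kern_sum M h H a' b q / h)"
  unfolding deriv_along_def
proof
  fix q :: plane
  have d: "((\<lambda>t. a ((fst q + t) / h - c)) has_real_derivative a' (fst q / h - c) / h) (at 0)" for c
  proof -
    have "((\<lambda>t. (fst q + t) / h - c) has_real_derivative 1 / h) (at 0)"
      unfolding divide_inverse by (auto intro!: derivative_eq_intros)
    from DERIV_chain2[OF a this] show ?thesis by simp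
  qed
  have "((\<lambda>t. \<Sum>m\<in>lbox M. H (fst m) (snd m) * (a ((fst q + t) / h - real_of_int (fst m)) * b (snd q / h - real_of_int (snd m))))
    has_real_derivative (\<Sum>m\<in>lbox M. H (fst m) (snd m) * (a' (fst q / h - real_of_int (fst m)) / h * b (snd q / h - real_of_int (snd m))))) (at 0)"
    by (intro DERIV_sum DERIV_cmult DERIV_cmult_right d)
  then show "((\<lambda>t. kern_sum M h H a b (q + t *\<^sub>R (1, 0))) has_real_derivative kern_sum M h H a' b q / h) (at 0)"
    by (simp add: kern_sum_def sum_divide_distrib)
qed

lemma kern_sum_swap: "kern_sum M h H a b q = kern_sum M h (\<lambda>x y. H y x) b a (snd q, fst q)"
  unfolding kern_sum_def
  by (rule sum.reindex_bij_witness[of _ "\<lambda>(x, y). (y, x)" "\<lambda>(x, y). (y, x)"]) (auto simp: lbox_def)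

lemma deriv_along_kern_sum_snd:
  assumes b: "\<And>x. (b has_real_derivative b' x) (at x)"
  shows "deriv_along (0, 1) (kern_sum M h H a b) (\<lambda>q. kern_sum M h H a b' q / h)"
  using deriv_along_kern_sum_fst[OF b, of M h "\<lambda>x y. H y x" a]
  unfolding deriv_along_def kern_sum_swap[of M h H a] by simp

definition vanishes_off :: "int \<Rightarrow> lattice_fun \<Rightarrow> bool" where
  "vanishes_off K H \<longleftrightarrow> (\<forall>x y. K < \<bar>x\<bar> \<or> K < \<bar>y\<bar> \<longrightarrow> H x y = 0)"

lemma vanishes_off_dx: "vanishes_off K H \<Longrightarrow> vanishes_off (K + 1) (dx H)"
  by (auto simp: vanishes_off_def dx_def)

lemma vanishes_off_dy: "vanishes_off K H \<Longrightarrow> vanishes_off (K + 1) (dy H)"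
  by (auto simp: vanishes_off_def dy_def)

text \<open>c vanishes at the edges of the range, so shifting the index produces no boundary
  terms.\<close>

lemma sum_by_parts:
  fixes c :: "int \<Rightarrow> real"
  assumes c: "\<And>m. K < \<bar>m\<bar> \<Longrightarrow> c m = 0" and K: "K < M"
  shows "(\<Sum>m\<in>{-M..M}. c m * (g (t - real_of_int m) - g (t - real_of_int m - 1))) =
    (\<Sum>m\<in>{-M..M}. (c (m + 1) - c m) * g (t - real_of_int m - 1))"
proof -
  have "(\<Sum>m\<in>{-M..M}. c m * g (t - real_of_int m)) = (\<Sum>m\<in>{-M+1..M+1}. c m * g (t - real_of_int m))"
    using c K by (intro sum.mono_neutral_cong) auto
  also have "\<dots> = (\<Sum>m\<in>{-M..M}. c (m + 1) * g (t - real_of_int m - 1))"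
    by (rule sum.reindex_bij_witness[of _ "\<lambda>m. m + 1" "\<lambda>m. m - 1"]) (auto simp: algebra_simps)
  finally show ?thesis by (simp add: right_diff_distrib left_diff_distrib sum_subtractf)
qed

text \<open>The reason for kernels whose derivative is a difference: the difference is traded for
  one of the lattice function, whose energy is known.\<close>

lemma kern_sum_dx:
  assumes H: "vanishes_off K H" "K < M"
  shows "kern_sum M h H (\<lambda>x. a x - a (x - 1)) b q = kern_sum M h (dx H) (\<lambda>x. a (x - 1)) b q"
proof -
  have e: "kern_sum M h H' a' b q = (\<Sum>y\<in>{-M..M}. (\<Sum>x\<in>{-M..M}. H' x y * a' (fst q / h - real_of_int x)) * b (snd q / h - real_of_int y))" for H' a'
    unfolding kern_sum_def lbox_def sum_distrib_right
    by (subst sum.swap) (simp add: sum.cartesian_product case_prod_unfold mult.assoc)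
  show ?thesis unfolding e dx_def
    using H by (intro sum.cong refl arg_cong2[where f = times] sum_by_parts[where K = K]) (auto simp: vanishes_off_def)
qed

lemma kern_sum_dy:
  assumes H: "vanishes_off K H" "K < M"
  shows "kern_sum M h H a (\<lambda>x. b x - b (x - 1)) q = kern_sum M h (dy H) a (\<lambda>x. b (x - 1)) q"
proof -
  have "vanishes_off K (\<lambda>x y. H y x)" using H(1) by (auto simp: vanishes_off_def)
  then have "kern_sum M h (\<lambda>x y. H y x) (\<lambda>x. b x - b (x - 1)) a (snd q, fst q) = kern_sum M h (dx (\<lambda>x y. H y x)) (\<lambda>x. b (x - 1)) a (snd q, fst q)"
    by (rule kern_sum_dx) (rule H)
  moreover have "dx (\<lambda>x y. H y x) = (\<lambda>x y. dy H y x)" by (simp add: dx_def dy_def)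
  ultimately show ?thesis by (simp only: kern_sum_swap[of M h H] kern_sum_swap[of M h "dy H"])
qed

lemma card_near_le: "card {m \<in> {-M..M}. \<bar>t - real_of_int m\<bar> \<le> 3} \<le> 7"
proof -
  have "{m \<in> {-M..M}. \<bar>t - real_of_int m\<bar> \<le> 3} \<subseteq> {\<lceil>t - 3\<rceil>..\<lfloor>t + 3\<rfloor>}"
  proof
    fix m assume "m \<in> {m \<in> {-M..M}. \<bar>t - real_of_int m\<bar> \<le> 3}"
    then have "\<bar>t - real_of_int m\<bar> \<le> 3" by simp
    then have "t - 3 \<le> real_of_int m" "real_of_int m \<le> t + 3" by linarith+
    then show "m \<in> {\<lceil>t - 3\<rceil>..\<lfloor>t + 3\<rfloor>}" unfolding atLeastAtMost_iff ceiling_le_iff le_floor_iff by simp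
  qed
  then have "card {m \<in> {-M..M}. \<bar>t - real_of_int m\<bar> \<le> 3} \<le> card {\<lceil>t - 3\<rceil>..\<lfloor>t + 3\<rfloor>}" by (intro card_mono) auto
  also have "\<dots> \<le> 7" by simp linarith
  finally show ?thesis .
qed

text \<open>At most 7 * 7 kernels are nonzero at a point. With step 3 h / 2 and shifted base point,
  \<open>sq\<close> becomes the square of half-side 3 h centred at the lattice point.\<close>

lemma kern_sum_powr_le:
  assumes p: "1 < p" "p < 2" and \<kappa>: "1 \<le> \<kappa>" and ab: "local_kernel \<kappa> a" "local_kernel \<kappa> b" and h: "0 < h"
  shows "\<bar>kern_sum M h H a b q\<bar> powr p \<le> 49 * \<kappa> ^ 4 * (\<Sum>m\<in>lbox M. \<bar>H (fst m) (snd m)\<bar> powr p *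
    indicator (sq (h * real_of_int (fst m) - 3 / 2 * h, h * real_of_int (snd m) - 3 / 2 * h) (3 / 2 * h)) q)"
proof -
  define X where "X = fst q / h"
  define Y where "Y = snd q / h"
  define A where "A = {m \<in> {-M..M}. \<bar>X - real_of_int m\<bar> \<le> 3} \<times> {m \<in> {-M..M}. \<bar>Y - real_of_int m\<bar> \<le> 3}"
  define f where "f m = H (fst m) (snd m) * (a (X - real_of_int (fst m)) * b (Y - real_of_int (snd m)))" for m
  have A: "A \<subseteq> lbox M" by (auto simp: A_def lbox_def)
  have fA: "finite A" by (rule finite_subset[OF A finite_lbox])
  have "card A \<le> 7 * 7" unfolding A_def card_cartesian_product by (intro mult_mono card_near_le) auto
  then have cA: "real (card A) powr (p - 1) \<le> 49 powr 1"
    using p by (intro order_trans[OF powr_mono2[of "p - 1" "real (card A)" 49]] powr_mono) auto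
  have "kern_sum M h H a b q = (\<Sum>m\<in>lbox M. f m)" by (simp add: kern_sum_def f_def X_def Y_def)
  also have "\<dots> = (\<Sum>m\<in>A. f m)"
    using ab by (intro sum.mono_neutral_right A finite_lbox) (auto simp: A_def lbox_def f_def local_kernel_def not_le[symmetric])
  finally have "\<bar>kern_sum M h H a b q\<bar> powr p \<le> real (card A) powr (p - 1) * (\<Sum>m\<in>A. \<bar>f m\<bar> powr p)"
    using powr_sum_le[OF fA, of p f] p by simp
  also have "\<dots> \<le> 49 * (\<Sum>m\<in>A. \<bar>f m\<bar> powr p)"
    using cA by (intro mult_right_mono) (auto simp: sum_nonneg)
  also have "\<dots> \<le> 49 * (\<Sum>m\<in>A. \<kappa> ^ 4 * \<bar>H (fst m) (snd m)\<bar> powr p)"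
  proof (intro mult_left_mono sum_mono)
    fix m
    define u where "u = \<bar>a (X - real_of_int (fst m)) * b (Y - real_of_int (snd m))\<bar>"
    have "u \<le> \<kappa> * \<kappa>" unfolding u_def abs_mult using ab \<kappa> by (intro mult_mono) (auto simp: local_kernel_def)
    then have "u powr p \<le> (\<kappa> * \<kappa>) powr p" using p by (intro powr_mono2) (auto simp: u_def)
    also have "\<dots> \<le> (\<kappa> * \<kappa>) powr 2" using p \<kappa> mult_mono[OF \<kappa> \<kappa>] by (intro powr_mono) auto
    also have "\<dots> = \<kappa> ^ 4" using \<kappa> by (simp add: powr_numeral power2_eq_square power4_eq_xxxx mult.assoc)
    finally have "u powr p * \<bar>H (fst m) (snd m)\<bar> powr p \<le> \<kappa> ^ 4 * \<bar>H (fst m) (snd m)\<bar> powr p"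
      by (rule mult_right_mono) simp
    moreover have "\<bar>f m\<bar> = u * \<bar>H (fst m) (snd m)\<bar>" by (simp add: f_def u_def abs_mult)
    ultimately show "\<bar>f m\<bar> powr p \<le> \<kappa> ^ 4 * \<bar>H (fst m) (snd m)\<bar> powr p" by (simp add: powr_mult u_def)
  qed simp
  also have "\<dots> = 49 * \<kappa> ^ 4 * (\<Sum>m\<in>A. \<bar>H (fst m) (snd m)\<bar> powr p)" by (simp add: sum_distrib_left[symmetric] mult.assoc)
  also have "(\<Sum>m\<in>A. \<bar>H (fst m) (snd m)\<bar> powr p) \<le> (\<Sum>m\<in>A. \<bar>H (fst m) (snd m)\<bar> powr p *
    indicator (sq (h * real_of_int (fst m) - 3 / 2 * h, h * real_of_int (snd m) - 3 / 2 * h) (3 / 2 * h)) q)"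
  proof (intro sum_mono)
    fix m assume m: "m \<in> A"
    have "\<bar>X - real_of_int (fst m)\<bar> * h \<le> 3 * h" "\<bar>Y - real_of_int (snd m)\<bar> * h \<le> 3 * h"
      using m h by (auto simp: A_def intro!: mult_right_mono)
    moreover have "\<bar>X - real_of_int (fst m)\<bar> * h = \<bar>fst q - h * real_of_int (fst m)\<bar>" "\<bar>Y - real_of_int (snd m)\<bar> * h = \<bar>snd q - h * real_of_int (snd m)\<bar>"
      using h by (simp_all add: X_def Y_def abs_mult_pos' abs_mult_pos left_diff_distrib mult.commute[of h])
    ultimately have "\<bar>fst q - h * real_of_int (fst m)\<bar> \<le> 3 * h" "\<bar>snd q - h * real_of_int (snd m)\<bar> \<le> 3 * h" by simp_all
    then have "q \<in> sq (h * real_of_int (fst m) - 3 / 2 * h, h * real_of_int (snd m) - 3 / 2 * h) (3 / 2 * h)"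
      unfolding abs_le_iff by (cases q) (simp add: sq_def Basis_plane; linarith)
    then show "\<bar>H (fst m) (snd m)\<bar> powr p \<le> \<bar>H (fst m) (snd m)\<bar> powr p *
      indicator (sq (h * real_of_int (fst m) - 3 / 2 * h, h * real_of_int (snd m) - 3 / 2 * h) (3 / 2 * h)) q" by simp
  qed
  also have "\<dots> \<le> (\<Sum>m\<in>lbox M. \<bar>H (fst m) (snd m)\<bar> powr p *
    indicator (sq (h * real_of_int (fst m) - 3 / 2 * h, h * real_of_int (snd m) - 3 / 2 * h) (3 / 2 * h)) q)"
    by (intro sum_mono2 A finite_lbox) auto
  finally show ?thesis using \<kappa> by (simp add: mult_left_mono)
qed

lemma kern_sum_integral_powr_le:
  assumes p: "1 < p" "p < 2" and \<kappa>: "1 \<le> \<kappa>" and ab: "local_kernel \<kappa> a" "local_kernel \<kappa> b" and h: "0 < h"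
  shows "integrable lborel (\<lambda>q. \<bar>kern_sum M h H a b q\<bar> powr p)"
    and "(\<integral>q. \<bar>kern_sum M h H a b q\<bar> powr p \<partial>lborel) \<le> 1764 * \<kappa> ^ 4 * h\<^sup>2 * (\<Sum>m\<in>lbox M. \<bar>H (fst m) (snd m)\<bar> powr p)"
proof -
  define Q where "Q m = sq (h * real_of_int (fst m) - 3 / 2 * h, h * real_of_int (snd m) - 3 / 2 * h) (3 / 2 * h)" for m :: "int \<times> int"
  define D where "D q = 49 * \<kappa> ^ 4 * (\<Sum>m\<in>lbox M. \<bar>H (fst m) (snd m)\<bar> powr p * indicator (Q m) q)" for q
  have mQ: "measure lborel (Q m) = 36 * h\<^sup>2" for m
    unfolding Q_def using measure_sq[of "3 / 2 * h"] h by (simp add: power_mult_distrib power2_eq_square)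
  have iQ: "integrable lborel (indicator (Q m) :: plane \<Rightarrow> real)" for m
    unfolding Q_def sq_cbox by (simp add: emeasure_lborel_cbox_eq)
  have iD: "integrable lborel D" unfolding D_def[abs_def]
    by (intro Bochner_Integration.integrable_mult_right Bochner_Integration.integrable_sum iQ)
  have [measurable]: "kern_sum M h H a b \<in> borel_measurable borel"
    using ab by (intro borel_measurable_continuous_onI continuous_kern_sum) (auto simp: local_kernel_def)
  have le: "\<bar>kern_sum M h H a b q\<bar> powr p \<le> D q" for q
    unfolding D_def Q_def by (rule kern_sum_powr_le[OF p \<kappa> ab h])
  show i: "integrable lborel (\<lambda>q. \<bar>kern_sum M h H a b q\<bar> powr p)"
  proof (rule Bochner_Integration.integrable_bound[OF iD])
    show "AE q in lborel. norm (\<bar>kern_sum M h H a b q\<bar> powr p) \<le> norm (D q)"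
    proof (intro AE_I2)
      show "norm (\<bar>kern_sum M h H a b q\<bar> powr p) \<le> norm (D q)" for q
        using le[of q] by simp
    qed
  qed simp
  have "(\<integral>q. \<bar>kern_sum M h H a b q\<bar> powr p \<partial>lborel) \<le> (\<integral>q. D q \<partial>lborel)"
    by (intro integral_mono i iD le)
  also have "\<dots> = 49 * \<kappa> ^ 4 * (\<Sum>m\<in>lbox M. \<bar>H (fst m) (snd m)\<bar> powr p * (36 * h\<^sup>2))"
  proof -
    have "(\<integral>q. \<bar>H (fst m) (snd m)\<bar> powr p * indicator (Q m) q \<partial>lborel) = \<bar>H (fst m) (snd m)\<bar> powr p * (36 * h\<^sup>2)" for m
      using iQ[of m] mQ[of m] by simp
    then have "(\<integral>q. (\<Sum>m\<in>lbox M. \<bar>H (fst m) (snd m)\<bar> powr p * indicator (Q m) q) \<partial>lborel) = (\<Sum>m\<in>lbox M. \<bar>H (fst m) (snd m)\<bar> powr p * (36 * h\<^sup>2))"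
      using iQ by (simp only: Bochner_Integration.integral_sum Bochner_Integration.integrable_mult_right)
    then show ?thesis by (simp only: D_def Bochner_Integration.integral_mult_right_zero)
  qed
  finally show "(\<integral>q. \<bar>kern_sum M h H a b q\<bar> powr p \<partial>lborel) \<le> 1764 * \<kappa> ^ 4 * h\<^sup>2 * (\<Sum>m\<in>lbox M. \<bar>H (fst m) (snd m)\<bar> powr p)"
    unfolding sum_distrib_right[symmetric] by (simp add: algebra_simps)
qed

text \<open>The second difference of \<open>lramp\<close> is a compactly supported kernel that takes the value 1 at 0 and vanishes at
  all other integers, and whose second derivative is a second difference: interpolation with it commutes with differences.\<close>

definition lmoll :: "real \<Rightarrow> real" where
  "lmoll x = 4 * moll (2 * x) - moll x"

definition lstep :: "real \<Rightarrow> real" where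
  "lstep x = 2 * step (2 * x) - step x"

text \<open>\<open>ramp\<close> is known to agree with the positive part only at the nonzero
  integers. The difference of the two dilations keeps 2 x - x = x on the right and cancels the value
  at 0, so \<open>lramp\<close> agrees with the positive part at every integer.\<close>

definition lramp :: "real \<Rightarrow> real" where
  "lramp x = ramp (2 * x) - ramp x"

lemma lstep_deriv: "(lstep has_real_derivative lmoll x) (at x)"
  unfolding lstep_def[abs_def] lmoll_def by (auto intro!: derivative_eq_intros DERIV_chain2[OF step_deriv] step_deriv)

lemma lramp_deriv: "(lramp has_real_derivative lstep x) (at x)"
  unfolding lramp_def[abs_def] lstep_def by (auto intro!: derivative_eq_intros DERIV_chain2[OF ramp_deriv] ramp_deriv)

lemma lramp_right: "1 \<le> x \<Longrightarrow> lramp x = x" and lramp_left: "x \<le> -1 \<Longrightarrow> lramp x = 0" and lramp_0: "lramp 0 = 0"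
  by (simp_all add: lramp_def ramp_eq ramp_eq_0)

lemma lstep_right: "1 \<le> x \<Longrightarrow> lstep x = 1" and lstep_left: "x \<le> -1 \<Longrightarrow> lstep x = 0"
  by (simp_all add: lstep_def step_eq_1 step_eq_0)

lemma lmoll_outside: "1 \<le> \<bar>x\<bar> \<Longrightarrow> lmoll x = 0"
  by (simp add: lmoll_def moll_eq_0 abs_mult)

text \<open>The second difference of the positive part is, on the integers, the indicator of 0.
  \<open>ker1\<close> and \<open>ker2\<close> are first differences of the first and second
  derivative of \<open>lramp\<close>.\<close>

definition ker0 :: "real \<Rightarrow> real" where
  "ker0 x = lramp (x + 1) - 2 * lramp x + lramp (x - 1)"

definition ker1 :: "real \<Rightarrow> real" where
  "ker1 x = lstep (x + 1) - lstep x"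

definition ker2 :: "real \<Rightarrow> real" where
  "ker2 x = lmoll (x + 1) - lmoll x"

lemma ker0_deriv: "(ker0 has_real_derivative ker1 x - ker1 (x - 1)) (at x)"
  unfolding ker0_def[abs_def] ker1_def by (auto intro!: derivative_eq_intros DERIV_chain2[OF lramp_deriv] lramp_deriv)

lemma ker1_deriv: "((\<lambda>x. ker1 x - ker1 (x - 1)) has_real_derivative ker2 x - ker2 (x - 1)) (at x)"
  unfolding ker1_def[abs_def] ker2_def by (auto intro!: derivative_eq_intros DERIV_chain2[OF lstep_deriv] lstep_deriv)

lemma ker0_of_int: "ker0 (real_of_int n) = (if n = 0 then 1 else 0)"
proof -
  have l: "lramp (real_of_int k) = real_of_int (max k 0)" for k
    using lramp_right[of "real_of_int k"] lramp_left[of "real_of_int k"] lramp_0 by (cases "k = 0"; cases "0 < k") auto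
  have "ker0 (real_of_int n) = lramp (real_of_int (n + 1)) - 2 * lramp (real_of_int n) + lramp (real_of_int (n - 1))"
    by (simp add: ker0_def)
  also have "\<dots> = (if n = 0 then 1 else 0)" unfolding l by (auto simp: max_def)
  finally show ?thesis .
qed

lemma continuous_lmoll: "continuous_on UNIV lmoll" and continuous_lstep: "continuous_on UNIV lstep" and continuous_lramp: "continuous_on UNIV lramp"
proof -
  have "continuous_on UNIV (\<lambda>x. moll (2 * x))"
    by (rule continuous_on_compose2[OF smooth_real_continuous[OF smooth_moll, of UNIV]]) (auto intro: continuous_intros)
  then show "continuous_on UNIV lmoll" unfolding lmoll_def[abs_def]
    using smooth_real_continuous[OF smooth_moll, of UNIV] by (intro continuous_intros)
  show "continuous_on UNIV lstep" "continuous_on UNIV lramp"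
    using DERIV_continuous_on[OF has_field_derivative_at_within[OF lstep_deriv]] DERIV_continuous_on[OF has_field_derivative_at_within[OF lramp_deriv]] by blast+
qed

lemma continuous_shift: "continuous_on UNIV f \<Longrightarrow> continuous_on UNIV (\<lambda>x. f (x + c))" for f :: "real \<Rightarrow> real"
  by (rule continuous_on_compose2) (auto intro: continuous_intros)

lemma kernels_local: "\<exists>\<kappa>\<ge>1. local_kernel \<kappa> ker0 \<and> local_kernel \<kappa> (\<lambda>x. ker1 (x - 1)) \<and> local_kernel \<kappa> (\<lambda>x. lmoll (x - 1))"
proof -
  have c: "continuous_on UNIV ker0" "continuous_on UNIV (\<lambda>x. ker1 (x - 1))" "continuous_on UNIV (\<lambda>x. lmoll (x - 1))"
    using continuous_shift[OF continuous_lramp, of 1] continuous_shift[OF continuous_lramp, of "-1"] continuous_lramp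
      continuous_shift[OF continuous_lstep, of "-1"] continuous_lstep continuous_shift[OF continuous_lmoll, of "-1"]
    by (auto simp: ker0_def[abs_def] ker1_def intro!: continuous_intros)
  have "ker0 x = 0" if "3 < \<bar>x\<bar>" for x
    using that by (cases "0 < x") (auto simp: ker0_def lramp_right lramp_left)
  moreover have "ker1 (x - 1) = 0" if "3 < \<bar>x\<bar>" for x
    using that by (cases "0 < x") (auto simp: ker1_def lstep_right lstep_left)
  moreover have "lmoll (x - 1) = 0" if "3 < \<bar>x\<bar>" for x
    using that by (intro lmoll_outside) auto
  ultimately obtain k0 k1 k2 where k: "local_kernel k0 ker0" "local_kernel k1 (\<lambda>x. ker1 (x - 1))" "local_kernel k2 (\<lambda>x. lmoll (x - 1))" "1 \<le> k0"
    using ex_local_kernel[OF c(1)] ex_local_kernel[OF c(2)] ex_local_kernel[OF c(3)] by metis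
  then show ?thesis
    by (intro exI[of _ "max k0 (max k1 k2)"]) (auto intro: local_kernel_mono)
qed

definition interp :: "int \<Rightarrow> real \<Rightarrow> lattice_fun \<Rightarrow> plane \<Rightarrow> real" where
  "interp M h H = kern_sum M h H ker0 ker0"

lemma interp_lattice:
  assumes H: "vanishes_off K H" "K \<le> M" and h: "0 < h"
  shows "interp M h H (h * real_of_int x, h * real_of_int y) = H x y"
proof -
  have k: "ker0 (h * real_of_int i / h - real_of_int j) = (if i = j then 1 else 0)" for i j
  proof -
    have "h * real_of_int i / h - real_of_int j = real_of_int (i - j)" using h by simp
    then show ?thesis by (simp only: ker0_of_int) auto
  qed
  have "interp M h H (h * real_of_int x, h * real_of_int y) = (\<Sum>m\<in>lbox M. if m = (x, y) then H x y else 0)"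
    unfolding interp_def kern_sum_def fst_conv snd_conv k by (intro sum.cong refl) (auto split: if_splits)
  also have "\<dots> = (if (x, y) \<in> lbox M then H x y else 0)" by (simp add: sum.delta)
  also have "\<dots> = H x y" using H by (auto simp: lbox_def vanishes_off_def)
  finally show ?thesis .
qed

lemma interp_add: "interp M h (\<lambda>x y. H x y + K x y) q = interp M h H q + interp M h K q"
  by (simp add: interp_def kern_sum_def distrib_right sum.distrib)

lemma interp_cmult: "interp M h (\<lambda>x y. c * H x y) q = c * interp M h H q"
  by (simp add: interp_def kern_sum_def sum_distrib_left mult.assoc)

lemma deriv_along_add: "deriv_along i F F' \<Longrightarrow> deriv_along i G G' \<Longrightarrow> deriv_along i (\<lambda>q. F q + G q) (\<lambda>q. F' q + G' q)"
  unfolding deriv_along_def by (simp add: DERIV_add)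

lemma deriv_along_const_add: "deriv_along i F F' \<Longrightarrow> deriv_along i (\<lambda>q. c + F q) F'"
  unfolding deriv_along_def using DERIV_add[OF DERIV_const] by force

lemma deriv_along_divide: "deriv_along i F F' \<Longrightarrow> deriv_along i (\<lambda>q. F q / h) (\<lambda>q. F' q / h)"
  unfolding deriv_along_def by (simp add: DERIV_cdivide)

text \<open>A sum over a finite box yields a compactly supported function, so the affine part is
  carried along exactly, beside the interpolation.\<close>

definition affine_interp :: "int \<Rightarrow> real \<Rightarrow> real \<Rightarrow> real \<Rightarrow> real \<Rightarrow> lattice_fun \<Rightarrow> plane \<Rightarrow> real" where
  "affine_interp M h \<alpha> \<beta> \<gamma> H q = \<alpha> + \<beta> * (fst q / h) + \<gamma> * (snd q / h) + interp M h H q"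

text \<open>Each derivative falls on a kernel as a difference and is moved to H by
  \<open>kern_sum_dx\<close> or \<open>kern_sum_dy\<close>. The first difference widens the support
  of H by one before the second is taken, hence K + 1 < M.\<close>

lemma interp_weak_partials:
  fixes \<alpha> \<beta> \<gamma> h :: real
  assumes H: "vanishes_off K H" "K + 1 < M"
  defines "F \<equiv> affine_interp M h \<alpha> \<beta> \<gamma> H"
  shows "continuous_on UNIV F"
    and "is_weak_partial2 (1, 0) (1, 0) F (\<lambda>q. kern_sum M h (dx (dx H)) (\<lambda>x. lmoll (x - 1)) ker0 q / h / h)"
    and "is_weak_partial2 (1, 0) (0, 1) F (\<lambda>q. kern_sum M h (dx (dy H)) (\<lambda>x. ker1 (x - 1)) (\<lambda>x. ker1 (x - 1)) q / h / h)"
    and "is_weak_partial2 (0, 1) (1, 0) F (\<lambda>q. kern_sum M h (dx (dy H)) (\<lambda>x. ker1 (x - 1)) (\<lambda>x. ker1 (x - 1)) q / h / h)"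
    and "is_weak_partial2 (0, 1) (0, 1) F (\<lambda>q. kern_sum M h (dy (dy H)) ker0 (\<lambda>x. lmoll (x - 1)) q / h / h)"
proof -
  let ?D = "\<lambda>x. ker1 x - ker1 (x - 1)" and ?E = "\<lambda>x. ker2 x - ker2 (x - 1)"
  have K: "K < M" using H by simp
  have c0: "continuous_on UNIV ker0" using DERIV_continuous_on[OF has_field_derivative_at_within[OF ker0_deriv]] by blast
  have cD: "continuous_on UNIV ?D" using DERIV_continuous_on[OF has_field_derivative_at_within[OF ker1_deriv]] by blast
  have cE: "continuous_on UNIV ?E"
    using continuous_shift[OF continuous_lmoll, of 1] continuous_shift[OF continuous_lmoll, of "-1"] continuous_lmoll
    by (auto simp: ker2_def intro!: continuous_intros)
  note c = c0 cD cE
  show F: "continuous_on UNIV F"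
    unfolding F_def affine_interp_def[abs_def] interp_def divide_inverse by (intro continuous_intros continuous_kern_sum c)
  have E2: "?E = (\<lambda>x. (\<lambda>y. lmoll (y + 1) - lmoll y) x - (\<lambda>y. lmoll (y + 1) - lmoll y) (x - 1))" by (simp add: ker2_def)
  have Fx: "deriv_along (1, 0) F (\<lambda>q. \<beta> / h + kern_sum M h H ?D ker0 q / h)"
  proof -
    have "deriv_along (1, 0) (\<lambda>q. \<alpha> + \<beta> * (fst q / h) + \<gamma> * (snd q / h)) (\<lambda>q. \<beta> / h)"
      unfolding deriv_along_def divide_inverse by (auto intro!: derivative_eq_intros)
    from deriv_along_add[OF this deriv_along_kern_sum_fst[OF ker0_deriv]]
    show ?thesis unfolding F_def affine_interp_def[abs_def] interp_def .
  qed
  have Fy: "deriv_along (0, 1) F (\<lambda>q. \<gamma> / h + kern_sum M h H ker0 ?D q / h)"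
  proof -
    have "deriv_along (0, 1) (\<lambda>q. \<alpha> + \<beta> * (fst q / h) + \<gamma> * (snd q / h)) (\<lambda>q. \<gamma> / h)"
      unfolding deriv_along_def divide_inverse by (auto intro!: derivative_eq_intros)
    from deriv_along_add[OF this deriv_along_kern_sum_snd[OF ker0_deriv]]
    show ?thesis unfolding F_def affine_interp_def[abs_def] interp_def .
  qed
  have Fxx: "deriv_along (1, 0) (\<lambda>q. \<beta> / h + kern_sum M h H ?D ker0 q / h) (\<lambda>q. kern_sum M h H ?E ker0 q / h / h)"
    by (rule deriv_along_const_add[OF deriv_along_divide[OF deriv_along_kern_sum_fst[OF ker1_deriv]]])
  have Fxy: "deriv_along (0, 1) (\<lambda>q. \<beta> / h + kern_sum M h H ?D ker0 q / h) (\<lambda>q. kern_sum M h H ?D ?D q / h / h)"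
    by (rule deriv_along_const_add[OF deriv_along_divide[OF deriv_along_kern_sum_snd[OF ker0_deriv]]])
  have Fyx: "deriv_along (1, 0) (\<lambda>q. \<gamma> / h + kern_sum M h H ker0 ?D q / h) (\<lambda>q. kern_sum M h H ?D ?D q / h / h)"
    by (rule deriv_along_const_add[OF deriv_along_divide[OF deriv_along_kern_sum_fst[OF ker0_deriv]]])
  have Fyy: "deriv_along (0, 1) (\<lambda>q. \<gamma> / h + kern_sum M h H ker0 ?D q / h) (\<lambda>q. kern_sum M h H ker0 ?E q / h / h)"
    by (rule deriv_along_const_add[OF deriv_along_divide[OF deriv_along_kern_sum_snd[OF ker1_deriv]]])
  have cc: "continuous_on UNIV (\<lambda>q. t + kern_sum M h H a b q / h)" "continuous_on UNIV (\<lambda>q. kern_sum M h H a b q / h / h)"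
    if "continuous_on UNIV a" "continuous_on UNIV b" for a b t
    unfolding divide_inverse by (intro continuous_intros continuous_kern_sum that)+
  have B: "(1, 0) \<in> (Basis :: plane set)" "(0, 1) \<in> (Basis :: plane set)" by (auto simp: Basis_plane)
  have k2: "ker2 (x - 1) = lmoll x - lmoll (x - 1)" for x by (simp add: ker2_def)
  have xx: "kern_sum M h H ?E ker0 q = kern_sum M h (dx (dx H)) (\<lambda>x. lmoll (x - 1)) ker0 q" for q
    using kern_sum_dx[OF H(1) K, of h ker2 ker0 q] kern_sum_dx[OF vanishes_off_dx[OF H(1)] H(2), of h lmoll ker0 q] by (simp only: k2)
  have yy: "kern_sum M h H ker0 ?E q = kern_sum M h (dy (dy H)) ker0 (\<lambda>x. lmoll (x - 1)) q" for q
    using kern_sum_dy[OF H(1) K, of h ker0 ker2 q] kern_sum_dy[OF vanishes_off_dy[OF H(1)] H(2), of h ker0 lmoll q] by (simp only: k2)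
  have xy: "kern_sum M h H ?D ?D q = kern_sum M h (dx (dy H)) (\<lambda>x. ker1 (x - 1)) (\<lambda>x. ker1 (x - 1)) q" for q
    by (simp only: kern_sum_dy[OF H(1) K] kern_sum_dx[OF vanishes_off_dy[OF H(1)] H(2)])
  show "is_weak_partial2 (1, 0) (1, 0) F (\<lambda>q. kern_sum M h (dx (dx H)) (\<lambda>x. lmoll (x - 1)) ker0 q / h / h)"
    using weak_partial2_classical[OF B(1) B(1) F cc(1) cc(2) Fx Fxx] c unfolding xx by blast
  show "is_weak_partial2 (1, 0) (0, 1) F (\<lambda>q. kern_sum M h (dx (dy H)) (\<lambda>x. ker1 (x - 1)) (\<lambda>x. ker1 (x - 1)) q / h / h)"
    using weak_partial2_classical[OF B(1) B(2) F cc(1) cc(2) Fx Fxy] c unfolding xy by blast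
  show "is_weak_partial2 (0, 1) (1, 0) F (\<lambda>q. kern_sum M h (dx (dy H)) (\<lambda>x. ker1 (x - 1)) (\<lambda>x. ker1 (x - 1)) q / h / h)"
    using weak_partial2_classical[OF B(2) B(1) F cc(1) cc(2) Fy Fyx] c unfolding xy by blast
  show "is_weak_partial2 (0, 1) (0, 1) F (\<lambda>q. kern_sum M h (dy (dy H)) ker0 (\<lambda>x. lmoll (x - 1)) q / h / h)"
    using weak_partial2_classical[OF B(2) B(2) F cc(1) cc(2) Fy Fyy] c unfolding yy by blast
qed

lemma interp_hess_norm:
  assumes p: "1 < p" "p < 2" and h: "0 < h" and H: "vanishes_off K H" "K + 1 < M"
    and \<kappa>: "1 \<le> \<kappa>" and ker: "local_kernel \<kappa> ker0" "local_kernel \<kappa> (\<lambda>x. ker1 (x - 1))" "local_kernel \<kappa> (\<lambda>x. lmoll (x - 1))"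
  shows "affine_interp M h \<alpha> \<beta> \<gamma> H \<in> L2p p"
    and "(\<integral>x. hess_norm (affine_interp M h \<alpha> \<beta> \<gamma> H) x powr p \<partial>lborel) \<le> 28224 * \<kappa> ^ 4 * h powr (2 - 2 * p) * energy p M H"
proof -
  let ?e = "(1, 0) :: plane" and ?f = "(0, 1) :: plane"
  define F where "F = affine_interp M h \<alpha> \<beta> \<gamma> H"
  define u where "u = kern_sum M h (dx (dx H)) (\<lambda>x. lmoll (x - 1)) ker0"
  define v where "v = kern_sum M h (dx (dy H)) (\<lambda>x. ker1 (x - 1)) (\<lambda>x. ker1 (x - 1))"
  define w where "w = kern_sum M h (dy (dy H)) ker0 (\<lambda>x. lmoll (x - 1))"
  note ip = interp_weak_partials[OF H, of h \<alpha> \<beta> \<gamma>, folded F_def u_def v_def w_def]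
  note ku = kern_sum_integral_powr_le[OF p \<kappa> ker(3,1) h, of M "dx (dx H)", folded u_def]
  note kv = kern_sum_integral_powr_le[OF p \<kappa> ker(2,2) h, of M "dx (dy H)", folded v_def]
  note kw = kern_sum_integral_powr_le[OF p \<kappa> ker(1,3) h, of M "dy (dy H)", folded w_def]
  have hh: "\<bar>t / h / h\<bar> powr p = h powr (- (2 * p)) * \<bar>t\<bar> powr p" for t
  proof -
    have "\<bar>t / h / h\<bar> powr p = (\<bar>t\<bar> / (h * h)) powr p" using h by (simp add: abs_mult)
    also have "\<dots> = \<bar>t\<bar> powr p / (h powr p * h powr p)" using h by (simp add: powr_divide powr_mult)
    also have "h powr p * h powr p = h powr (2 * p)" by (simp add: powr_add[symmetric])
    finally show ?thesis by (simp add: powr_minus divide_inverse)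
  qed
  have lp: "in_Lp p (\<lambda>q. g q / h / h)" if "is_weak_partial2 i j F (\<lambda>q. g q / h / h)" "integrable lborel (\<lambda>q. \<bar>g q\<bar> powr p)" for g i j
    using that unfolding in_Lp_def hh is_weak_partial2_def locally_integrable_def by simp
  have ex: "\<exists>g. is_weak_partial2 i j F g \<and> in_Lp p g" if "i \<in> Basis" "j \<in> Basis" for i j
  proof -
    consider "i = ?e \<and> j = ?e" | "i = ?e \<and> j = ?f" | "i = ?f \<and> j = ?e" | "i = ?f \<and> j = ?f" using \<open>i \<in> Basis\<close> \<open>j \<in> Basis\<close> by (auto simp: Basis_plane)
    then show ?thesis
      by cases (use ip lp[OF ip(2) ku(1)] lp[OF ip(3) kv(1)] lp[OF ip(4) kv(1)] lp[OF ip(5) kw(1)] in blast)+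
  qed
  then have FL: "F \<in> L2p p" using ip(1) by (simp add: L2p_def)
  then show "affine_interp M h \<alpha> \<beta> \<gamma> H \<in> L2p p" by (simp add: F_def)
  have B: "?e \<in> Basis" "?f \<in> Basis" by (auto simp: Basis_plane)
  \<comment> \<open>The Hessian of the seminorm consists of chosen weak derivatives; uniqueness
    identifies them almost everywhere with the explicit kernel sums.\<close>
  have "AE x in lborel. hess_norm F x powr p \<le> 16 * h powr (- (2 * p)) * (\<bar>u x\<bar> powr p + \<bar>v x\<bar> powr p + \<bar>w x\<bar> powr p)"
    using weak_partial_unique[OF weak_partial2_L2p(1)[OF FL B(1) B(1)] ip(2)] weak_partial_unique[OF weak_partial2_L2p(1)[OF FL B(1) B(2)] ip(3)]
      weak_partial_unique[OF weak_partial2_L2p(1)[OF FL B(2) B(1)] ip(4)] weak_partial_unique[OF weak_partial2_L2p(1)[OF FL B(2) B(2)] ip(5)]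
  proof eventually_elim
    case (elim x)
    have "hess_norm F x \<le> \<bar>u x / h / h\<bar> + \<bar>v x / h / h\<bar> + (\<bar>v x / h / h\<bar> + \<bar>w x / h / h\<bar>)"
      using hess_norm_le[of F x] elim by (simp add: Basis_plane)
    also have "\<dots> = \<bar>\<bar>u x / h / h\<bar> + 2 * \<bar>v x / h / h\<bar> + \<bar>w x / h / h\<bar>\<bar>" by simp
    finally have "hess_norm F x powr p \<le> \<bar>\<bar>u x / h / h\<bar> + 2 * \<bar>v x / h / h\<bar> + \<bar>w x / h / h\<bar>\<bar> powr p"
      using p by (intro powr_mono2) auto
    also have "\<dots> \<le> 4 * (\<bar>\<bar>u x / h / h\<bar>\<bar> powr p + \<bar>2 * \<bar>v x / h / h\<bar>\<bar> powr p + \<bar>\<bar>w x / h / h\<bar>\<bar> powr p)"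
      using p by (intro powr_add3_le) auto
    also have "\<bar>2 * \<bar>v x / h / h\<bar>\<bar> powr p = 2 powr p * \<bar>v x / h / h\<bar> powr p"
      by (simp only: abs_mult abs_idempotent abs_numeral powr_mult)
    also have "\<dots> \<le> 4 * \<bar>v x / h / h\<bar> powr p" using powr_two_le_4[of p] p by (intro mult_right_mono) auto
    finally have "hess_norm F x powr p \<le> 4 * (\<bar>u x / h / h\<bar> powr p + 4 * \<bar>v x / h / h\<bar> powr p + \<bar>w x / h / h\<bar> powr p)" by simp
    also have "\<dots> \<le> 16 * (\<bar>u x / h / h\<bar> powr p + \<bar>v x / h / h\<bar> powr p + \<bar>w x / h / h\<bar> powr p)" by simp
    also have "\<dots> = 16 * h powr (- (2 * p)) * (\<bar>u x\<bar> powr p + \<bar>v x\<bar> powr p + \<bar>w x\<bar> powr p)"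
      unfolding hh by (simp add: distrib_left)
    finally show ?case .
  qed
  then have "(\<integral>x. hess_norm F x powr p \<partial>lborel) \<le> (\<integral>x. 16 * h powr (- (2 * p)) * (\<bar>u x\<bar> powr p + \<bar>v x\<bar> powr p + \<bar>w x\<bar> powr p) \<partial>lborel)"
    using hess_norm_integrable(2)[OF FL p(1)] ku(1) kv(1) kw(1) by (intro integral_mono_AE) auto
  also have "\<dots> = 16 * h powr (- (2 * p)) * ((\<integral>x. \<bar>u x\<bar> powr p \<partial>lborel) + (\<integral>x. \<bar>v x\<bar> powr p \<partial>lborel) + (\<integral>x. \<bar>w x\<bar> powr p \<partial>lborel))"
    using ku(1) kv(1) kw(1) by simp
  also have "\<dots> \<le> 16 * h powr (- (2 * p)) * (1764 * \<kappa> ^ 4 * h\<^sup>2 * (\<Sum>m\<in>lbox M. \<bar>dx (dx H) (fst m) (snd m)\<bar> powr p)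
      + 1764 * \<kappa> ^ 4 * h\<^sup>2 * (\<Sum>m\<in>lbox M. \<bar>dx (dy H) (fst m) (snd m)\<bar> powr p) + 1764 * \<kappa> ^ 4 * h\<^sup>2 * (\<Sum>m\<in>lbox M. \<bar>dy (dy H) (fst m) (snd m)\<bar> powr p))"
    by (intro mult_left_mono add_mono ku(2) kv(2) kw(2)) auto
  also have "\<dots> = 28224 * \<kappa> ^ 4 * (h powr (- (2 * p)) * h\<^sup>2) * energy p M H"
    by (simp add: energy_def hess_def sum.distrib algebra_simps)
  also have "h powr (- (2 * p)) * h\<^sup>2 = h powr (2 - 2 * p)"
    using h powr_add[of h "- (2 * p)" 2] by (simp add: powr_numeral)
  finally show "(\<integral>x. hess_norm (affine_interp M h \<alpha> \<beta> \<gamma> H) x powr p \<partial>lborel) \<le> 28224 * \<kappa> ^ 4 * h powr (2 - 2 * p) * energy p M H"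
    by (simp add: F_def)
qed

lemma interp_bound:
  "\<exists>C>0. \<forall>p h K M \<alpha> \<beta> \<gamma> H. 1 < p \<longrightarrow> p < 2 \<longrightarrow> 0 < h \<longrightarrow> vanishes_off K H \<longrightarrow> K + 1 < M \<longrightarrow>
     affine_interp M h \<alpha> \<beta> \<gamma> H \<in> L2p p \<and>
     (\<integral>x. hess_norm (affine_interp M h \<alpha> \<beta> \<gamma> H) x powr p \<partial>lborel) \<le> C * h powr (2 - 2 * p) * energy p M H"
proof -
  obtain \<kappa> where k: "1 \<le> \<kappa>" "local_kernel \<kappa> ker0" "local_kernel \<kappa> (\<lambda>x. ker1 (x - 1))" "local_kernel \<kappa> (\<lambda>x. lmoll (x - 1))"
    using kernels_local by blast
  show ?thesis
    using interp_hess_norm[OF _ _ _ _ _ k] k(1) by (intro exI[of _ "28224 * \<kappa> ^ 4"] conjI allI impI) auto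
qed

lemma L2p_seminorm_eq: "L2p_seminorm p F = (\<integral>x. hess_norm F x powr p \<partial>lborel) powr (1 / p)"
proof -
  have "\<bar>sqrt (\<Sum>i\<in>Basis. \<Sum>j\<in>Basis. (weak_partial2 i j F x)\<^sup>2)\<bar> = hess_norm F x" for x
    by (simp add: hess_norm_def sum_nonneg)
  then show ?thesis by (simp add: L2p_seminorm_def Lp_norm_def)
qed

subsection \<open>The extension operator\<close>

context cantor_tree
begin

definition plane_ext :: "real \<Rightarrow> int \<Rightarrow> real \<Rightarrow> lattice_fun \<Rightarrow> plane \<Rightarrow> real" where
  "plane_ext p N h f = affine_interp (4 * N) h (f 0 0) (slope N (\<lambda>x. f x 0)) (node_vals p N f 0 0) (lattice_rem p N f)"

lemma lattice_rem_vanishes: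
  assumes N: "16 \<le> N" "\<bar>z0\<bar> + 6 * d 1 \<le> N"
  shows "vanishes_off (2 * N) (lattice_rem p N f)"
  unfolding vanishes_off_def using N by (intro allI impI lattice_rem_eq_0) auto

lemma plane_ext_lattice:
  assumes N: "16 \<le> N" "\<bar>z0\<bar> + 6 * d 1 \<le> N" and h: "0 < h"
  shows "plane_ext p N h f (h * real_of_int x, h * real_of_int y) = lattice_ext p N f x y"
  using interp_lattice[OF lattice_rem_vanishes[OF N] _ h, of "4 * N" p f x y] N h
  by (simp add: plane_ext_def affine_interp_def lattice_ext_eq)

lemma plane_ext_add: "plane_ext p N h (\<lambda>x y. f x y + g x y) q = plane_ext p N h f q + plane_ext p N h g q"
proof -
  have "lattice_rem p N (\<lambda>x y. f x y + g x y) = (\<lambda>x y. lattice_rem p N f x y + lattice_rem p N g x y)"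
    by (intro ext lattice_rem_add)
  then show ?thesis
    by (simp add: plane_ext_def affine_interp_def slope_add node_vals_add interp_add distrib_right add_divide_distrib)
qed

lemma plane_ext_cmult: "plane_ext p N h (\<lambda>x y. c * f x y) q = c * plane_ext p N h f q"
proof -
  have "lattice_rem p N (\<lambda>x y. c * f x y) = (\<lambda>x y. c * lattice_rem p N f x y)"
    by (intro ext lattice_rem_cmult)
  then show ?thesis
    by (simp add: plane_ext_def affine_interp_def slope_cmult node_vals_cmult interp_cmult distrib_left mult.assoc)
qed

lemma energy_lattice_ext: "energy p M (lattice_ext p N f) = energy p M (lattice_rem p N f)"
proof -
  have "lattice_ext p N f = (\<lambda>x y. f 0 0 + slope N (\<lambda>x. f x 0) * real_of_int x +
      (node_vals p N f 0 0 * real_of_int y + lattice_rem p N f x y))"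
    by (simp add: lattice_ext_eq[abs_def] add.assoc)
  then show ?thesis by (simp only: energy_def hess_affine_add hess_linear_add)
qed

text \<open>Interpolation scales like h powr (2 - 2 * p) and sampling like h powr (2 * p - 2), so
  the constant does not see the lattice spacing. G is an arbitrary extension of the data.\<close>

lemma plane_ext_bound:
  assumes p: "1 < p" "p < 2" and N: "16 \<le> N" "\<bar>z0\<bar> + 6 * d 1 \<le> N" and h: "0 < h" and C: "0 \<le> C"
    and bound: "(\<integral>x. hess_norm (plane_ext p N h f) x powr p \<partial>lborel) \<le> C * h powr (2 - 2 * p) * energy p (4 * N) (lattice_rem p N f)"
    and G: "G \<in> L2p p" and G0: "\<And>x. \<bar>x\<bar> \<le> N \<Longrightarrow> G (h * real_of_int x, 0) = f x 0"
    and G1: "\<And>m. m < 2 ^ L \<Longrightarrow> G (h * real_of_int (pos L m), h) = f (pos L m) 1"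
  shows "L2p_seminorm p (plane_ext p N h f) \<le> (C * lattice_const p * 19200) powr (1 / p) * L2p_seminorm p G"
proof -
  define I where "I = (\<integral>x. hess_norm G x powr p \<partial>lborel)"
  have I0: "0 \<le> I" unfolding I_def by (intro integral_nonneg_AE AE_I2) auto
  have l0: "0 \<le> lattice_const p" by (rule lattice_const_nonneg[OF p])
  have "(\<integral>x. hess_norm (plane_ext p N h f) x powr p \<partial>lborel) \<le> C * h powr (2 - 2 * p) * energy p (4 * N) (lattice_ext p N f)"
    using bound by (simp add: energy_lattice_ext)
  also have "\<dots> \<le> C * h powr (2 - 2 * p) * (lattice_const p * energy p (4 * N) (\<lambda>x y. G (h * real_of_int x, h * real_of_int y)))"
    using G0 G1 C by (intro mult_left_mono lattice_ext_energy[OF p N]) auto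
  also have "\<dots> \<le> C * h powr (2 - 2 * p) * (lattice_const p * (19200 * h powr (2 * p - 2) * I))"
    unfolding I_def using C l0 by (intro mult_left_mono energy_sample_le[OF G p h]) auto
  also have "\<dots> = (h powr (2 - 2 * p) * h powr (2 * p - 2)) * (C * lattice_const p * 19200 * I)" by simp
  also have "h powr (2 - 2 * p) * h powr (2 * p - 2) = 1" using h by (simp add: powr_add[symmetric])
  finally have "(\<integral>x. hess_norm (plane_ext p N h f) x powr p \<partial>lborel) \<le> C * lattice_const p * 19200 * I" by simp
  then have "(\<integral>x. hess_norm (plane_ext p N h f) x powr p \<partial>lborel) powr (1 / p) \<le> (C * lattice_const p * 19200 * I) powr (1 / p)"
    using p by (intro powr_mono2) (auto intro!: integral_nonneg_AE)
  also have "\<dots> = (C * lattice_const p * 19200) powr (1 / p) * I powr (1 / p)"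
    by (rule powr_mult)
  finally show ?thesis by (simp add: L2p_seminorm_eq I_def)
qed

end

section \<open>The set E in lattice coordinates\<close>

lemma E1_eq:
  assumes "0 < \<epsilon>"
  shows "E1 \<epsilon> L = {(\<epsilon> ^ L * real_of_int x, 0) | x. \<bar>x\<bar> \<le> \<lfloor>1 / \<epsilon> ^ L\<rfloor>}"
proof -
  have "0 < \<epsilon> ^ L" using assms by simp
  then have "-1 \<le> \<epsilon> ^ L * real_of_int k \<and> \<epsilon> ^ L * real_of_int k \<le> 1 \<longleftrightarrow> \<bar>k\<bar> \<le> \<lfloor>1 / \<epsilon> ^ L\<rfloor>" for k
  proof -
    have "\<bar>k\<bar> \<le> \<lfloor>1 / \<epsilon> ^ L\<rfloor> \<longleftrightarrow> \<bar>real_of_int k\<bar> \<le> 1 / \<epsilon> ^ L" by (simp add: le_floor_iff)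
    also have "\<dots> \<longleftrightarrow> \<bar>real_of_int k\<bar> * \<epsilon> ^ L \<le> 1" using \<open>0 < \<epsilon> ^ L\<close> by (simp add: pos_le_divide_eq)
    also have "\<bar>real_of_int k\<bar> * \<epsilon> ^ L = \<bar>\<epsilon> ^ L * real_of_int k\<bar>" using \<open>0 < \<epsilon> ^ L\<close> by (simp add: abs_mult)
    finally show ?thesis by (auto simp: abs_le_iff)
  qed
  then show ?thesis unfolding E1_def by auto
qed

lemma geometric_sum_le:
  fixes \<epsilon> :: real
  assumes "0 < \<epsilon>" "\<epsilon> \<le> 1 / 2" "1 \<le> L"
  shows "(\<Sum>l=1..L. \<epsilon> ^ l) + \<epsilon> ^ L \<le> 2 * \<epsilon>"
  using assms(3)
proof (induction L rule: dec_induct)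
  case (step n)
  have "\<epsilon> * \<epsilon> ^ n \<le> 1 / 2 * \<epsilon> ^ n" using assms by (intro mult_right_mono) auto
  then show ?case using step by simp
qed simp

text \<open>By hypothesis all signed sums lie in the lattice, hence so do their differences \<open>2 * \<epsilon> ^ l\<close>.\<close>

lemma E2_cantor_tree:
  assumes \<epsilon>: "0 < \<epsilon>" "\<epsilon> < 1 / 100" and L: "1 \<le> L"
    and E: "\<And>x. (x, \<epsilon> ^ L) \<in> E2 \<epsilon> L \<Longrightarrow> (x, 0) \<in> E1 \<epsilon> L"
  obtains d z0 where "cantor_tree L d" "\<bar>z0\<bar> + 6 * d 1 \<le> \<lfloor>1 / \<epsilon> ^ L\<rfloor>"
    "E2 \<epsilon> L = {(\<epsilon> ^ L * real_of_int (cantor_tree.pos d z0 L m), \<epsilon> ^ L) | m. m < 2 ^ L}"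
proof -
  define h where "h = \<epsilon> ^ L"
  have h: "0 < h" using \<epsilon> by (simp add: h_def)
  have int: "\<exists>k :: int. (\<Sum>l=1..L. s l * \<epsilon> ^ l) = h * real_of_int k" if "\<And>l. s l \<in> {-1, 1}" for s :: "nat \<Rightarrow> real"
  proof -
    have "((\<Sum>l=1..L. s l * \<epsilon> ^ l), \<epsilon> ^ L) \<in> E2 \<epsilon> L"
      unfolding E2_def by (intro CollectI exI[of _ "\<Sum>l=1..L. s l * \<epsilon> ^ l"] exI[of _ s] conjI refl ballI that)
    from E[OF this] show ?thesis unfolding E1_def h_def by (simp only: mem_Sigma_iff mem_Collect_eq)
  qed
  \<comment> \<open>All signs +1: the rightmost point of \<open>E2\<close>.\<close>
  obtain z0 :: int where z0: "(\<Sum>l=1..L. \<epsilon> ^ l) = h * real_of_int z0" using int[of "\<lambda>_. 1"] by auto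
  have "\<exists>k :: int. 2 * \<epsilon> ^ l = h * real_of_int k" if "l \<in> {1..L}" for l
  proof -
    obtain k :: int where k: "(\<Sum>i=1..L. (if i = l then -1 else 1) * \<epsilon> ^ i) = h * real_of_int k"
    proof -
      have "(if i = l then -1 else 1 :: real) \<in> {-1, 1}" for i by simp
      from int[of "\<lambda>i. if i = l then -1 else 1", OF this] show ?thesis using that by blast
    qed
    have "h * real_of_int (z0 - k) = (\<Sum>i=1..L. \<epsilon> ^ i - (if i = l then -1 else 1) * \<epsilon> ^ i)"
      by (simp only: sum_subtractf z0 k right_diff_distrib of_int_diff)
    also have "\<dots> = (\<Sum>i=1..L. if i = l then 2 * \<epsilon> ^ l else 0)" by (intro sum.cong refl) auto
    also have "\<dots> = 2 * \<epsilon> ^ l" using that by simp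
    finally show ?thesis by metis
  qed
  then obtain d where d: "\<And>l. l \<in> {1..L} \<Longrightarrow> 2 * \<epsilon> ^ l = h * real_of_int (d l)" by metis
  have ct: "cantor_tree L d"
  proof
    show "1 \<le> L" by (rule L)
    show "d L = 2" using d[of L] L h \<epsilon> by (simp add: h_def)
    fix l assume l: "1 \<le> l" "l < L"
    have "h * real_of_int (100 * d (Suc l)) = 200 * \<epsilon> ^ Suc l" using d[of "Suc l"] l by simp
    also have "\<dots> = (100 * \<epsilon>) * (2 * \<epsilon> ^ l)" by simp
    also have "\<dots> \<le> 1 * (2 * \<epsilon> ^ l)" using \<epsilon> by (intro mult_right_mono) auto
    also have "\<dots> = h * real_of_int (d l)" using d[of l] l by simp
    finally show "100 * d (Suc l) \<le> d l" using h by (simp only: mult_le_cancel_left_pos of_int_le_iff)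
  qed
  interpret cantor_tree L d z0 by (rule ct)
  have z00: "0 \<le> z0"
  proof -
    have "0 \<le> h * real_of_int z0" unfolding z0[symmetric] using \<epsilon> by (intro sum_nonneg) auto
    then show ?thesis using h by (simp add: zero_le_mult_iff)
  qed
  have "h * real_of_int z0 \<le> 2 * \<epsilon>" using geometric_sum_le[OF \<epsilon>(1) _ L] \<epsilon> h unfolding z0 h_def by linarith
  moreover have "h * real_of_int (d 1) = 2 * \<epsilon>" using d[of 1] L by simp
  moreover have "h * real_of_int (z0 + 6 * d 1) = h * real_of_int z0 + 6 * (h * real_of_int (d 1))" by (simp add: distrib_left)
  \<comment> \<open>In the unscaled plane z0 lies at most at 2 \<epsilon> and d 1 has length 2
    \<epsilon>, which gives 2 + 6 * 2 = 14; with \<epsilon> below 1/100 the clusters and their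
    cutoffs fit into [-1, 1].\<close>
  ultimately have "h * real_of_int (z0 + 6 * d 1) \<le> 14 * \<epsilon>" by linarith
  then have "h * real_of_int (z0 + 6 * d 1) \<le> 1" using \<epsilon> by linarith
  then have b: "\<bar>z0\<bar> + 6 * d 1 \<le> \<lfloor>1 / \<epsilon> ^ L\<rfloor>"
    using h z00 unfolding h_def[symmetric] le_floor_iff by (simp add: pos_le_divide_eq mult.commute)
  \<comment> \<open>The binary digits of a node index encode the signs: even at a level means sign
    -1 there, odd means +1.\<close>
  have A: "\<exists>m<2 ^ k. h * real_of_int (pos k m) = h * real_of_int z0 - (\<Sum>l=1..k. (1 - s l) * \<epsilon> ^ l)"
    if "k \<le> L" "\<And>l. l \<in> {1..L} \<Longrightarrow> s l \<in> {-1, 1}" for k and s :: "nat \<Rightarrow> real"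
    using that(1)
  proof (induction k)
    case (Suc k)
    then obtain m where m: "m < 2 ^ k" "h * real_of_int (pos k m) = h * real_of_int z0 - (\<Sum>l=1..k. (1 - s l) * \<epsilon> ^ l)" by auto
    have dk: "h * real_of_int (d (Suc k)) = 2 * \<epsilon> ^ Suc k" using d[of "Suc k"] Suc.prems by simp
    have "s (Suc k) = -1 \<or> s (Suc k) = 1" using that(2)[of "Suc k"] Suc.prems by auto
    then show ?case
    proof
      assume "s (Suc k) = -1"
      then show ?thesis using m dk by (intro exI[of _ "2 * m"]) (auto simp: right_diff_distrib)
    next
      assume "s (Suc k) = 1"
      then show ?thesis using m dk by (intro exI[of _ "2 * m + 1"]) auto
    qed
  qed simp
  \<comment> \<open>The converse: signs are read off from a node level by level, changing s only at
    the new level.\<close>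
  have B: "\<exists>s. (\<forall>l. s l \<in> {-1, 1 :: real}) \<and> h * real_of_int (pos k m) = h * real_of_int z0 - (\<Sum>l=1..k. (1 - s l) * \<epsilon> ^ l)"
    if "k \<le> L" for k m
    using that
  proof (induction k arbitrary: m)
    case 0
    then show ?case by (intro exI[of _ "\<lambda>_. 1"]) simp
  next
    case (Suc k)
    then obtain s where s: "\<forall>l. s l \<in> {-1, 1 :: real}" "h * real_of_int (pos k (m div 2)) = h * real_of_int z0 - (\<Sum>l=1..k. (1 - s l) * \<epsilon> ^ l)"
      using Suc.IH[of "m div 2"] by auto
    have dk: "h * real_of_int (d (Suc k)) = 2 * \<epsilon> ^ Suc k" using d[of "Suc k"] Suc.prems by simp
    define s' where "s' = s(Suc k := if even m then -1 else 1)"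
    have "(\<Sum>l=1..k. (1 - s' l) * \<epsilon> ^ l) = (\<Sum>l=1..k. (1 - s l) * \<epsilon> ^ l)" by (intro sum.cong refl) (auto simp: s'_def)
    then have "(\<Sum>l=1..Suc k. (1 - s' l) * \<epsilon> ^ l) = (\<Sum>l=1..k. (1 - s l) * \<epsilon> ^ l) + (if even m then 2 * \<epsilon> ^ Suc k else 0)"
      by (simp add: s'_def)
    then have "h * real_of_int (pos (Suc k) m) = h * real_of_int z0 - (\<Sum>l=1..Suc k. (1 - s' l) * \<epsilon> ^ l)"
      using s(2) dk by (simp add: right_diff_distrib)
    moreover have "\<forall>l. s' l \<in> {-1, 1}" using s(1) by (simp add: s'_def)
    ultimately show ?case by blast
  qed
  have sums: "h * real_of_int z0 - (\<Sum>l=1..L. (1 - s l) * \<epsilon> ^ l) = (\<Sum>l=1..L. s l * \<epsilon> ^ l)" for s :: "nat \<Rightarrow> real"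
    unfolding z0[symmetric] by (simp add: left_diff_distrib sum_subtractf)
  have "E2 \<epsilon> L = {(h * real_of_int (pos L m), h) | m. m < 2 ^ L}"
  proof (intro equalityI subsetI)
    fix q assume "q \<in> E2 \<epsilon> L"
    then obtain s where s: "\<forall>l\<in>{1..L}. s l \<in> {-1, 1 :: real}" "q = (\<Sum>l=1..L. s l * \<epsilon> ^ l, h)"
      unfolding E2_def h_def by blast
    obtain m where "m < 2 ^ L" "h * real_of_int (pos L m) = (\<Sum>l=1..L. s l * \<epsilon> ^ l)" using A[of L s] s(1) unfolding sums by auto
    then have "q = (h * real_of_int (pos L m), h)" "m < 2 ^ L" using s(2) by simp_all
    then show "q \<in> {(h * real_of_int (pos L m), h) | m. m < 2 ^ L}" by blast
  next
    fix q assume "q \<in> {(h * real_of_int (pos L m), h) | m. m < 2 ^ L}"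
    then obtain m where m: "q = (h * real_of_int (pos L m), h)" by blast
    obtain s where s: "\<And>l. s l \<in> {-1, 1 :: real}" "h * real_of_int (pos L m) = (\<Sum>l=1..L. s l * \<epsilon> ^ l)"
      using B[of L m] unfolding sums by auto
    have "((\<Sum>l=1..L. s l * \<epsilon> ^ l), \<epsilon> ^ L) \<in> E2 \<epsilon> L"
      unfolding E2_def by (intro CollectI exI[of _ "\<Sum>l=1..L. s l * \<epsilon> ^ l"] exI[of _ s] conjI refl ballI s)
    then show "q \<in> E2 \<epsilon> L" by (simp only: m s h_def[symmetric])
  qed
  then show ?thesis using that[OF ct b] by (simp add: h_def)
qed

theorem theorem1:
  shows "\<exists>\<epsilon>\<^sub>0::real. 0 < \<epsilon>\<^sub>0 \<and> \<epsilon>\<^sub>0 < 1/2 \<and>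
    (\<forall>p::real. 1 < p \<and> p < 2 \<longrightarrow>
      (\<exists>C::real. C > 0 \<and>
        (\<forall>\<epsilon>::real. \<forall>L::nat.
          0 < \<epsilon> \<and> \<epsilon> < \<epsilon>\<^sub>0 \<and> L \<ge> 1 \<and>
          (\<forall>x. (x, \<epsilon> ^ L) \<in> E2 \<epsilon> L \<longrightarrow> (x, 0) \<in> E1 \<epsilon> L) \<longrightarrow>
          (\<exists>T. linear_map (trace_space p (E1 \<epsilon> L \<union> E2 \<epsilon> L)) (L2p p) T \<and>
            (\<forall>f \<in> trace_space p (E1 \<epsilon> L \<union> E2 \<epsilon> L).
              (\<forall>x \<in> E1 \<epsilon> L \<union> E2 \<epsilon> L. T f x = f x) \<and>
              ennreal (L2p_seminorm p (T f))
                \<le> ennreal C * trace_seminorm p (E1 \<epsilon> L \<union> E2 \<epsilon> L) f)))))"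
proof -
  obtain Ci where Ci: "0 < Ci" and interp: "\<And>p h K M \<alpha> \<beta> \<gamma> H. 1 < p \<Longrightarrow> p < 2 \<Longrightarrow> 0 < h \<Longrightarrow> vanishes_off K H \<Longrightarrow> K + 1 < M \<Longrightarrow>
     affine_interp M h \<alpha> \<beta> \<gamma> H \<in> L2p p \<and>
     (\<integral>x. hess_norm (affine_interp M h \<alpha> \<beta> \<gamma> H) x powr p \<partial>lborel) \<le> Ci * h powr (2 - 2 * p) * energy p M H"
    using interp_bound by blast
  \<comment> \<open>The summand 1 makes the constant positive in every case, so that it may be
    divided by below.\<close>
  define C where "C p = (Ci * lattice_const p * 19200) powr (1 / p) + 1" for p
  have C: "0 < C p" for p by (simp add: C_def add_nonneg_pos)
  have main: "\<exists>T. linear_map (trace_space p (E1 \<epsilon> L \<union> E2 \<epsilon> L)) (L2p p) T \<and>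
      (\<forall>f \<in> trace_space p (E1 \<epsilon> L \<union> E2 \<epsilon> L). (\<forall>x \<in> E1 \<epsilon> L \<union> E2 \<epsilon> L. T f x = f x) \<and>
        ennreal (L2p_seminorm p (T f)) \<le> ennreal (C p) * trace_seminorm p (E1 \<epsilon> L \<union> E2 \<epsilon> L) f)"
    if p: "1 < p" "p < 2" and \<epsilon>: "0 < \<epsilon>" "\<epsilon> < 1 / 100" and L: "1 \<le> L"
      and E: "\<And>x. (x, \<epsilon> ^ L) \<in> E2 \<epsilon> L \<Longrightarrow> (x, 0) \<in> E1 \<epsilon> L" for p \<epsilon> L
  proof -
    obtain d z0 where ct: "cantor_tree L d" and z0: "\<bar>z0\<bar> + 6 * d 1 \<le> \<lfloor>1 / \<epsilon> ^ L\<rfloor>"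
      and E2: "E2 \<epsilon> L = {(\<epsilon> ^ L * real_of_int (cantor_tree.pos d z0 L m), \<epsilon> ^ L) | m. m < 2 ^ L}"
      using E2_cantor_tree[OF \<epsilon> L E] by blast
    interpret cantor_tree L d z0 by (rule ct)
    define h where "h = \<epsilon> ^ L"
    define N where "N = \<lfloor>1 / h\<rfloor>"
    have h: "0 < h" using \<epsilon> by (simp add: h_def)
    have "h \<le> \<epsilon> ^ 1" unfolding h_def using \<epsilon> L by (intro power_decreasing) auto
    then have "h * 16 \<le> 1" using \<epsilon> by simp
    then have "real_of_int 16 \<le> 1 / h" using h by (simp add: field_simps)
    then have N: "16 \<le> N" "\<bar>z0\<bar> + 6 * d 1 \<le> N" using z0 by (simp_all add: N_def h_def le_floor_iff)
    define E where "E = E1 \<epsilon> L \<union> E2 \<epsilon> L"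
    have inE: "(h * real_of_int x, 0) \<in> E" if "\<bar>x\<bar> \<le> N" for x
      using that E1_eq[OF \<epsilon>(1), of L] by (auto simp: E_def N_def h_def)
    have leafE: "(h * real_of_int (pos L m), h) \<in> E" if "m < 2 ^ L" for m
      using that by (auto simp: E_def E2 h_def)
    define smp where "smp f = (\<lambda>x y. f (h * real_of_int x, h * real_of_int y) :: real)" for f :: "plane \<Rightarrow> real"
    \<comment> \<open>Sampling followed by extension is linear in f by construction and defined for
      every f, without a case distinction on the trace space.\<close>
    define T where "T f = plane_ext p N h (smp f)" for f
    have K: "2 * N + 1 < 4 * N" using N by simp
    note ip = interp[OF p h lattice_rem_vanishes[OF N] K]
    have TL: "T f \<in> L2p p" for f using ip unfolding T_def plane_ext_def by blast
    have "T (\<lambda>x. f x + g x) = (\<lambda>x. T f x + T g x)" for f g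
      unfolding T_def smp_def plane_ext_add ..
    moreover have "T (\<lambda>x. c * f x) = (\<lambda>x. c * T f x)" for c f
      unfolding T_def smp_def plane_ext_cmult ..
    ultimately have lin: "linear_map (trace_space p E) (L2p p) T" using TL by (simp add: linear_map_def)
    have row: "T f (h * real_of_int x, 0) = f (h * real_of_int x, 0)" if "\<bar>x\<bar> \<le> N" for f x
      using plane_ext_lattice[OF N h, of p "smp f" x 0] lattice_ext_row[of N x p "smp f"] that N by (simp add: T_def smp_def)
    have leaf: "T f (h * real_of_int (pos L m), h) = f (h * real_of_int (pos L m), h)" if "m < 2 ^ L" for f m
      using plane_ext_lattice[OF N h, of p "smp f" "pos L m" 1] lattice_ext_leaf[OF that, of p N "smp f"] by (simp add: T_def smp_def)
    have ext: "T f x = f x" if "x \<in> E" for f x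
      using that row leaf unfolding E_def E1_eq[OF \<epsilon>(1)] E2 by (auto simp: h_def N_def)
    have "ennreal (L2p_seminorm p (T f)) \<le> ennreal (C p) * trace_seminorm p E f" for f
    proof -
      \<comment> \<open>Each competitor is tested separately; with \<open>C p\<close> moved to the
        left the infimum can be taken on the right, where an empty set of competitors gives
        infinity.\<close>
      have le: "L2p_seminorm p (T f) / C p \<le> L2p_seminorm p G" if G: "G \<in> L2p p" "\<forall>x\<in>E. G x = f x" for G
      proof -
        have "L2p_seminorm p (T f) \<le> (Ci * lattice_const p * 19200) powr (1 / p) * L2p_seminorm p G"
          unfolding T_def
        proof (rule plane_ext_bound[OF p N h _ _ G(1)])
          show "(\<integral>x. hess_norm (plane_ext p N h (smp f)) x powr p \<partial>lborel) \<le> Ci * h powr (2 - 2 * p) * energy p (4 * N) (lattice_rem p N (smp f))"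
            using ip unfolding plane_ext_def by blast
        qed (use Ci G inE leafE in \<open>auto simp: smp_def\<close>)
        also have "\<dots> \<le> C p * L2p_seminorm p G"
          by (intro mult_right_mono) (auto simp: C_def L2p_seminorm_eq)
        finally show ?thesis using C[of p] by (simp add: field_simps)
      qed
      have "ennreal (L2p_seminorm p (T f) / C p) \<le> trace_seminorm p E f"
        unfolding trace_seminorm_def by (intro INF_greatest ennreal_leI le) auto
      then have "ennreal (C p) * ennreal (L2p_seminorm p (T f) / C p) \<le> ennreal (C p) * trace_seminorm p E f"
        by (rule mult_left_mono) simp
      moreover have "ennreal (C p) * ennreal (L2p_seminorm p (T f) / C p) = ennreal (L2p_seminorm p (T f))"
        using C[of p] by (simp add: ennreal_mult'[symmetric] L2p_seminorm_eq)
      ultimately show ?thesis by simp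
    qed
    then show ?thesis using lin ext unfolding E_def by blast
  qed
  show ?thesis
  \<comment> \<open>The reciprocal of the ratio 100 between consecutive scales that
    \<open>cantor_tree\<close> assumes.\<close>
  proof (rule exI[of _ "1 / 100"], intro conjI allI impI)
    fix p :: real assume p: "1 < p \<and> p < 2"
    show "\<exists>C::real. C > 0 \<and>
        (\<forall>\<epsilon>::real. \<forall>L::nat.
          0 < \<epsilon> \<and> \<epsilon> < 1 / 100 \<and> L \<ge> 1 \<and>
          (\<forall>x. (x, \<epsilon> ^ L) \<in> E2 \<epsilon> L \<longrightarrow> (x, 0) \<in> E1 \<epsilon> L) \<longrightarrow>
          (\<exists>T. linear_map (trace_space p (E1 \<epsilon> L \<union> E2 \<epsilon> L)) (L2p p) T \<and>
            (\<forall>f \<in> trace_space p (E1 \<epsilon> L \<union> E2 \<epsilon> L).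
              (\<forall>x \<in> E1 \<epsilon> L \<union> E2 \<epsilon> L. T f x = f x) \<and>
              ennreal (L2p_seminorm p (T f))
                \<le> ennreal C * trace_seminorm p (E1 \<epsilon> L \<union> E2 \<epsilon> L) f)))"
    proof (rule exI[of _ "C p"], intro conjI allI impI C)
      fix \<epsilon> :: real and L :: nat
      assume "0 < \<epsilon> \<and> \<epsilon> < 1 / 100 \<and> L \<ge> 1 \<and> (\<forall>x. (x, \<epsilon> ^ L) \<in> E2 \<epsilon> L \<longrightarrow> (x, 0) \<in> E1 \<epsilon> L)"
      then show "\<exists>T. linear_map (trace_space p (E1 \<epsilon> L \<union> E2 \<epsilon> L)) (L2p p) T \<and>
            (\<forall>f \<in> trace_space p (E1 \<epsilon> L \<union> E2 \<epsilon> L).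
              (\<forall>x \<in> E1 \<epsilon> L \<union> E2 \<epsilon> L. T f x = f x) \<and>
              ennreal (L2p_seminorm p (T f))
                \<le> ennreal (C p) * trace_seminorm p (E1 \<epsilon> L \<union> E2 \<epsilon> L) f)"
        using p by (intro main) auto
    qed
  qed auto
qed

end
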